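(* Let $(I,\cdot)$ be a Cartan datum, $\lambda\in(\mathbb Z_{\ge0}[\bar I])^m$, $\nu\in I^\ell$, and let the scalar parameters of the extended Cartan datum $\tilde I=I\sqcup\bar I$ be $t(\tilde i,\tilde j)=-1$ if $(\tilde i,\tilde j)=(\bar k,k)$ for some $k\in I$ and $t(\tilde i,\tilde j)=1$ otherwise. Let $J$ be the two-sided ideal of the Khovanov-Lauda-Rouquier subalgebra $S_C(\lambda,\nu)$ generated by the elementary symmetric functions in $E_{\lambda_k}$ ($1\le k\le m$) and by the idempotents $e(\mathbf i)$ with $\mathbf i\in\mathrm{Seq}(\lambda,\nu)$ and $\mathbf i_1\in I$. Then the quotient algebra $\overline S_C(\lambda,\nu)=S_C(\lambda,\nu)/J$ is isomorphic to the tensor product algebra $T^{\lambda}_{\nu}$ defined by Webster.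
   Context: $\Bbbk$ is the ground field. A Cartan datum $(I,\cdot)$ is a finite set $I=\{1,\dots,N\}$ with a symmetric bilinear form on $\mathbb Z[I]$ such that $i\cdot i\in2\mathbb Z_{>0}$ for all $i$ and $c(i,j):=2\frac{i\cdot j}{i\cdot i}$ is a non-positive integer for $i\ne j$; $C=(c(i,j))$. Extended datum: $\tilde I=I\sqcup\bar I$ with $\bar I=\{\bar i:i\in I\}$. The form on $\mathbb Z[\tilde I]$ extends that of $I$ by $k\cdot\bar k=\bar k\cdot k=-\frac{k\cdot k}{2}$, $\bar k\cdot\bar k=k\cdot k$, and all other products involving elements of $\bar I$ are $0$; $c(\tilde i,\tilde j)=2\frac{\tilde i\cdot\tilde j}{\tilde i\cdot\tilde i}$. With the scalars $t$ of the claim, $R_n(\overline Q_{\tilde C})$ is the $\Bbbk$-algebra generated by $e(\mathbf i)$ ($\mathbf i\in\tilde I^n$), $x_j$ ($1\le j\le n$), $\psi_j$ ($1\le j\le n-1$), with unit $\sum_{\mathbf i}e(\mathbf i)$, subject to: $e(\mathbf i)e(\mathbf j)=\delta_{\mathbf i,\mathbf j}e(\mathbf i)$; $x_je(\mathbf i)=e(\mathbf i)x_j$; $\psi_je(\mathbf i)=e(\sigma_j\mathbf i)\psi_j$ ($\sigma_j$ swaps entries $j,j+1$); $x_jx_k=x_kx_j$; $\psi_jx_k=x_k\psi_j$ if $k\ne j,j+1$; $\psi_j\psi_k=\psi_k\psi_j$ if $|j-k|>1$; $(x_j\psi_j-\psi_jx_{j+1})e(\mathbf i)=(\psi_jx_j-x_{j+1}\psi_j)e(\mathbf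 i)=\delta_{\mathbf i_j,\mathbf i_{j+1}}e(\mathbf i)$; $\psi_j^2e(\mathbf i)$ equals $0$ if $\mathbf i_j=\mathbf i_{j+1}$, equals $t(\mathbf i_j,\mathbf i_{j+1})e(\mathbf i)$ if $\mathbf i_j\cdot\mathbf i_{j+1}=0$, and equals $\bigl(t(\mathbf i_j,\mathbf i_{j+1})x_j^{-c(\mathbf i_j,\mathbf i_{j+1})}+t(\mathbf i_{j+1},\mathbf i_j)x_{j+1}^{-c(\mathbf i_{j+1},\mathbf i_j)}\bigr)e(\mathbf i)$ if $\mathbf i_j\cdot\mathbf i_{j+1}<0$; and $(\psi_j\psi_{j+1}\psi_j-\psi_{j+1}\psi_j\psi_{j+1})e(\mathbf i)$ equals $t(\mathbf i_j,\mathbf i_{j+1})\sum_{d_1+d_2=-c(\mathbf i_j,\mathbf i_{j+1})-1}x_j^{d_1}x_{j+2}^{d_2}e(\mathbf i)$ if $\mathbf i_j=\mathbf i_{j+2}$ and $\mathbf i_j\cdot\mathbf i_{j+1}<0$, and $0$ otherwise. Let $\lambda=(\lambda_1,\dots,\lambda_m)$, $\lambda_k=\sum_{i\in I}\lambda_k^{(i)}\bar i$ with $\lambda_k^{(i)}\in\mathbb Z_{\ge0}$; $|\lambda_k|=\sum_i\lambda_k^{(i)}$, $|\lambda|=\sum_k|\lambda_k|$; $\nu=(\nu_1,\dots,\nu_\ell)\in I^\ell$. $\mathrm{Seq}(\lambda,\nu)$ is the set of sequences $\mathbf i=(\mathbf i_1,\dots,\mathbf i_{m+\ell})$ in which $\ell$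 entries are the entries of $\nu$, each used exactly once and in any order ("solid" entries), and $m$ entries are $\lambda_1,\dots,\lambda_m$, each used exactly once and in this order ("thick" entries). The thick entry $\lambda_k$ is expanded into the word $\bar1^{\lambda_k^{(1)}}\bar2^{\lambda_k^{(2)}}\cdots\bar N^{\lambda_k^{(N)}}$; thus $\mathbf i$ expands to a word $\hat{\mathbf i}\in\tilde I^{|\lambda|+\ell}$. The following are elements of $R_{|\lambda|+\ell}(\overline Q_{\tilde C})$. - On $n$ consecutive strands with equal label let $e_n=x_1^{n-1}x_2^{n-2}\cdots x_{n-1}\psi_{w_0}$ (indices shifted to these strands; $w_0$ the longest element of $\mathfrak S_n$, $\psi_{w_0}$ the product of $\psi$'s along a reduced word). $e(\mathbf i)$ is the idempotent obtained from $e(\hat{\mathbf i})$ by multiplying by $e_{\lambda_k^{(a)}}$ on the block of strands $\bar a^{\lambda_k^{(a)}}$ of $\lambda_k$, for every $k$ and $a$. - $y_pe(\mathbf i)=x_\alpha e(\mathbf i)$ if $\mathbf i_p\in I$, where $\alpha$ is the position of that strand in $\hat{\mathbf i}$; $y_pe(\mathbf i)=0$ if $\mathbf i_p$ is thick. - $E_{k,d}^{(a)}e(\mathbf i)$ ($1\le d\le\lambda_k^{(a)}$): the $d$-th elementary symmetric polynomial in the $x$'s at the positions in $\hat{\mathbf i}$ of the block $\bar a^{\lambda_k^{(a)}}$ of $\lambda_k$, times $e(\mathbf i)$. $E_{\lambda_k}=\{E_{k,d}^{(a)}: a\in I,\ 1\le d\le\lambda_k^{(a)}\}$. - $\Psi_pe(\mathbf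 i)$: let $q$ be the position in $\hat{\mathbf i}$ of the first strand of entry $\mathbf i_p$. If $\mathbf i_p,\mathbf i_{p+1}\in I$: $\Psi_pe(\mathbf i)=\psi_qe(\mathbf i)$. If $\mathbf i_p=\lambda_k$ thick, $\mathbf i_{p+1}\in I$: $\Psi_pe(\mathbf i)=\psi_q\psi_{q+1}\cdots\psi_{q+|\lambda_k|-1}e(\mathbf i)$. If $\mathbf i_p\in I$, $\mathbf i_{p+1}=\lambda_k$ thick: $\Psi_pe(\mathbf i)=\psi_{q+|\lambda_k|-1}\cdots\psi_{q+1}\psi_qe(\mathbf i)$. If both are thick: $\Psi_pe(\mathbf i)=0$. $S_C(\lambda,\nu)$ is the subalgebra of $R_{|\lambda|+\ell}(\overline Q_{\tilde C})$ generated by $e(\mathbf i)$ ($\mathbf i\in\mathrm{Seq}(\lambda,\nu)$), $y_p$ ($1\le p\le m+\ell$), $E_{k,d}^{(a)}$ ($1\le k\le m$, $a\in I$, $1\le d\le\lambda_k^{(a)}$), and $\Psi_p$ ($1\le p\le m+\ell-1$), where $y_p$, $E_{k,d}^{(a)}$ and $\Psi_p$ denote the sums $\sum_{\mathbf i\in\mathrm{Seq}(\lambda,\nu)}y_pe(\mathbf i)$, $\sum_{\mathbf i\in\mathrm{Seq}(\lambda,\nu)}E_{k,d}^{(a)}e(\mathbf i)$ and $\sum_{\mathbf i\in\mathrm{Seq}(\lambda,\nu)}\Psi_pe(\mathbf i)$ of elements of $R_{|\lambda|+\ell}(\overline Q_{\tilde C})$; its unit is $\sum_{\mathbf i\in\mathrm{Seq}(\lambda,\nu)}e(\mathbf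 i)$. Webster's tensor product algebra $T^\lambda_\nu$. Here $\lambda_k$ is identified with the dominant weight whose pairing with the $i$-th simple coroot is $\lambda_k^{(i)}$, and the black strands carry the multiset of labels of $\nu$. Put $Q_{ab}(u,v)=0$ if $a=b$, $Q_{ab}(u,v)=1$ if $a\cdot b=0$, and $Q_{ab}(u,v)=u^{-c(a,b)}+v^{-c(b,a)}$ if $a\cdot b<0$ ($a,b\in I$). $T^\lambda_\nu$ is the $\Bbbk$-algebra with generators $e(\mathbf i)$ ($\mathbf i\in\mathrm{Seq}(\lambda,\nu)$; solid entries are "black", thick entries "red", red entries being distinguishable by their index $k$), $y_p$ ($1\le p\le m+\ell$), $\psi_p$ ($1\le p\le m+\ell-1$), unit $\sum_{\mathbf i}e(\mathbf i)$, and relations: - $e(\mathbf i)e(\mathbf j)=\delta_{\mathbf i,\mathbf j}e(\mathbf i)$; $y_pe(\mathbf i)=e(\mathbf i)y_p$; $y_py_q=y_qy_p$; $y_pe(\mathbf i)=0$ if $\mathbf i_p$ is red; $\psi_pe(\mathbf i)=0$ if $\mathbf i_p,\mathbf i_{p+1}$ are both red, and otherwise $\psi_pe(\mathbf i)=e(\sigma_p\mathbf i)\psi_p$; $\psi_py_q=y_q\psi_p$ if $q\ne p,p+1$; $\psi_p\psi_q=\psi_q\psi_p$ if $|p-q|>1$. - If $\mathbf i_p,\mathbf i_{p+1}$ are not both red: $(y_p\psi_p-\psi_py_{p+1})e(\mathbf i)=(\psi_py_p-y_{p+1}\psi_p)e(\mathbf i)$, which equals $e(\mathbf i)$ if $\mathbf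 i_p=\mathbf i_{p+1}\in I$ and $0$ otherwise. - $\psi_p^2e(\mathbf i)=Q_{\mathbf i_p\mathbf i_{p+1}}(y_p,y_{p+1})e(\mathbf i)$ if both entries are black; $\psi_p^2e(\mathbf i)=y_p^{\lambda_k^{(a)}}e(\mathbf i)$ if $(\mathbf i_p,\mathbf i_{p+1})=(a,\lambda_k)$; $\psi_p^2e(\mathbf i)=y_{p+1}^{\lambda_k^{(a)}}e(\mathbf i)$ if $(\mathbf i_p,\mathbf i_{p+1})=(\lambda_k,a)$, for $a\in I$. - If at most one of $\mathbf i_p,\mathbf i_{p+1},\mathbf i_{p+2}$ is red, then $(\psi_p\psi_{p+1}\psi_p-\psi_{p+1}\psi_p\psi_{p+1})e(\mathbf i)$ equals $\frac{Q_{ab}(y_p,y_{p+1})-Q_{ab}(y_{p+2},y_{p+1})}{y_p-y_{p+2}}e(\mathbf i)$ if the triple is $(a,b,a)$ with $a,b\in I$; equals $\sum_{d_1+d_2=\lambda_k^{(a)}-1}y_p^{d_1}y_{p+2}^{d_2}e(\mathbf i)$ if the triple is $(a,\lambda_k,a)$ with $a\in I$; and $0$ otherwise. - (Cyclotomic/violating relation) $e(\mathbf i)=0$ if $\mathbf i_1$ is black.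
   Formalization: The formal theorem assumes that ν is empty or every λ_k is nonzero; if some λ_k = 0 and ℓ ≥ 1, distinct sequences give the same idempotent, and the claim fails, e.g. for I = {1}, λ = (1̄, 0), ν = (1). *)

theory Defs
  imports
    "HOL-Library.Poly_Mapping"
    "HOL-Library.Multiset"
    "HOL-Algebra.QuotRing"
    "HOL-Algebra.Module"
begin

section \<open>Algebras over a field given by generators and relations\<close>

text \<open>
  Algebras are records of type \<^type>\<open>module\<close>, which extend \<^type>\<open>ring\<close> by a scalar
  multiplication; they need not be commutative. (The locale \<^locale>\<open>module\<close> is not used.)
  The free algebra is realised as the monoid algebra of the free monoid, so that
  elements of free algebras can be written with the type class operations.
\<close>

datatype 'g freemon = Word (letters: "'g list")

instantiation freemon :: (type) monoid_add
begin
definition "0 = Word []"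
definition "v + w = Word (letters v @ letters w)"
instance
  by standard (simp_all add: zero_freemon_def plus_freemon_def)
end

type_synonym ('g, 'k) free = "'g freemon \<Rightarrow>\<^sub>0 'k"

definition gen :: "'g \<Rightarrow> ('g, 'k::field) free"
  where "gen g = Poly_Mapping.single (Word [g]) 1"

definition scal :: "'k \<Rightarrow> ('g, 'k::field) free"
  where "scal c = Poly_Mapping.single 0 c"

definition free_alg :: "'g set \<Rightarrow> ('k::field, ('g, 'k) free) module"
  where "free_alg G =
    \<lparr>carrier = {f. \<forall>w \<in> Poly_Mapping.keys f. set (letters w) \<subseteq> G},
     mult = (*), one = 1, zero = 0, add = (+), smult = (\<lambda>c f. scal c * f)\<rparr>"

lemma free_alg_ring:
  fixes G :: "'g set"
  shows "ring (free_alg G :: ('k::field, ('g, 'k) free) module)"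
proof (rule ringI)
  show "abelian_group (free_alg G :: ('k, ('g, 'k) free) module)"
  proof (rule abelian_groupI)
    fix f :: "('g, 'k) free" assume f: "f \<in> carrier (free_alg G)"
    then have "- f \<in> carrier (free_alg G)" by (simp add: free_alg_def)
    then show "\<exists>g\<in>carrier (free_alg G). g \<oplus>\<^bsub>free_alg G\<^esub> f = \<zero>\<^bsub>free_alg G\<^esub>"
      by (rule bexI[rotated]) (simp add: free_alg_def)
  next
    fix f g :: "('g, 'k) free" assume "f \<in> carrier (free_alg G)" "g \<in> carrier (free_alg G)"
    then show "f \<oplus>\<^bsub>free_alg G\<^esub> g \<in> carrier (free_alg G)"
      using keys_add[of f g] by (auto simp: free_alg_def)
  qed (auto simp: free_alg_def algebra_simps)
  show "monoid (free_alg G :: ('k, ('g, 'k) free) module)"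
  proof (rule monoidI)
    fix f g :: "('g, 'k) free" assume "f \<in> carrier (free_alg G)" "g \<in> carrier (free_alg G)"
    then show "f \<otimes>\<^bsub>free_alg G\<^esub> g \<in> carrier (free_alg G)"
      using keys_mult[of f g] by (fastforce simp: free_alg_def plus_freemon_def)
  qed (auto simp: free_alg_def zero_freemon_def algebra_simps)
qed (auto simp: free_alg_def algebra_simps)

definition alg_Quot :: "('k, 'a) module \<Rightarrow> 'a set \<Rightarrow> ('k, 'a set) module"
  where "alg_Quot A J =
    \<lparr>carrier = carrier (A Quot J), mult = mult (A Quot J), one = one (A Quot J),
     zero = zero (A Quot J), add = add (A Quot J),
     smult = (\<lambda>c X. \<Union>x\<in>X. J +>\<^bsub>A\<^esub> (c \<odot>\<^bsub>A\<^esub> x))\<rparr>"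

text \<open>\<^const>\<open>genideal\<close> is the generated \<^emph>\<open>two-sided\<close> ideal.\<close>

definition presented_alg :: "'g set \<Rightarrow> ('g, 'k::field) free set \<Rightarrow> ('k, ('g, 'k) free set) module"
  where "presented_alg G Rel = alg_Quot (free_alg G) (Idl\<^bsub>free_alg G\<^esub> Rel)"

definition presented_class :: "'g set \<Rightarrow> ('g, 'k::field) free set \<Rightarrow> ('g, 'k) free \<Rightarrow> ('g, 'k) free set"
  where "presented_class G Rel f = (Idl\<^bsub>free_alg G\<^esub> Rel) +>\<^bsub>free_alg G\<^esub> f"

text \<open>
  The subalgebra generated by \<open>X\<close>, where a subalgebra need not contain the unit of the
  ambient algebra; its own unit is supplied separately in \<open>generated_alg\<close>.
\<close>

inductive_set subalg_span :: "('k, 'a) module \<Rightarrow> 'a set \<Rightarrow> 'a set"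
  for A :: "('k, 'a) module" and X :: "'a set" where
  zero: "\<zero>\<^bsub>A\<^esub> \<in> subalg_span A X"
| incl: "x \<in> X \<Longrightarrow> x \<in> subalg_span A X"
| add: "x \<in> subalg_span A X \<Longrightarrow> y \<in> subalg_span A X \<Longrightarrow> x \<oplus>\<^bsub>A\<^esub> y \<in> subalg_span A X"
| mult: "x \<in> subalg_span A X \<Longrightarrow> y \<in> subalg_span A X \<Longrightarrow> x \<otimes>\<^bsub>A\<^esub> y \<in> subalg_span A X"
| smult: "x \<in> subalg_span A X \<Longrightarrow> c \<odot>\<^bsub>A\<^esub> x \<in> subalg_span A X"

definition generated_alg :: "('k, 'a) module \<Rightarrow> 'a \<Rightarrow> 'a set \<Rightarrow> ('k, 'a) module"
  where "generated_alg A u X = A\<lparr>carrier := subalg_span A X, one := u\<rparr>"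

definition alg_iso :: "('k, 'a) module \<Rightarrow> ('k, 'b) module \<Rightarrow> ('a \<Rightarrow> 'b) set"
  where "alg_iso A B =
    {h \<in> ring_iso A B. \<forall>c. \<forall>x\<in>carrier A. h (c \<odot>\<^bsub>A\<^esub> x) = c \<odot>\<^bsub>B\<^esub> h x}"

definition alg_isomorphic :: "('k, 'a) module \<Rightarrow> ('k, 'b) module \<Rightarrow> bool"
  where "alg_isomorphic A B \<longleftrightarrow> alg_iso A B \<noteq> {}"


section \<open>Cartan data\<close>

text \<open>
  The index set is \<open>I = {1..N}\<close>; the bilinear form on \<open>\<int>[I]\<close> is given by its values on the
  basis \<open>I\<close>. The division in \<open>cartan_int\<close> is exact for (extended) Cartan data.
\<close>

definition cartan_int :: "('l \<Rightarrow> 'l \<Rightarrow> int) \<Rightarrow> 'l \<Rightarrow> 'l \<Rightarrow> int"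
  where "cartan_int B i j = (2 * B i j) div (B i i)"

definition cartan_datum :: "nat \<Rightarrow> (nat \<Rightarrow> nat \<Rightarrow> int) \<Rightarrow> bool"
  where "cartan_datum N B \<longleftrightarrow>
    (\<forall>i\<in>{1..N}. \<forall>j\<in>{1..N}. B i j = B j i) \<and>
    (\<forall>i\<in>{1..N}. even (B i i) \<and> B i i > 0) \<and>
    (\<forall>i\<in>{1..N}. \<forall>j\<in>{1..N}. i \<noteq> j \<longrightarrow> B i i dvd 2 * B i j \<and> cartan_int B i j \<le> 0)"

datatype lab = Orig nat | Bar nat

definition ext_index :: "nat \<Rightarrow> lab set"
  where "ext_index N = Orig ` {1..N} \<union> Bar ` {1..N}"

fun ext_form :: "(nat \<Rightarrow> nat \<Rightarrow> int) \<Rightarrow> lab \<Rightarrow> lab \<Rightarrow> int" where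
  "ext_form B (Orig i) (Orig j) = B i j"
| "ext_form B (Orig i) (Bar j) = (if i = j then - (B i i div 2) else 0)"
| "ext_form B (Bar i) (Orig j) = (if i = j then - (B i i div 2) else 0)"
| "ext_form B (Bar i) (Bar j) = (if i = j then B i i else 0)"


section \<open>Khovanov-Lauda-Rouquier algebras\<close>

text \<open>
  Strands, entries of sequences and the thick entries \<open>\<lambda>\<^sub>k\<close> are numbered from \<open>0\<close>.
  The same generators (idempotents, dots, crossings) serve for both presentations.
\<close>

datatype 'l gens = Idemp "'l list" | Dot nat | Cross nat

abbreviation "\<e> i \<equiv> gen (Idemp i)"
abbreviation "\<x> p \<equiv> gen (Dot p)"
abbreviation "\<psi> p \<equiv> gen (Cross p)"

definition gens_over :: "'l list set \<Rightarrow> nat \<Rightarrow> 'l gens set"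
  where "gens_over W n = Idemp ` W \<union> Dot ` {p. p < n} \<union> Cross ` {p. Suc p < n}"

definition words :: "'l set \<Rightarrow> nat \<Rightarrow> 'l list set"
  where "words L n = {i. set i \<subseteq> L \<and> length i = n}"

definition swap :: "nat \<Rightarrow> 'l list \<Rightarrow> 'l list"
  where "swap p i = i[p := i ! Suc p, Suc p := i ! p]"

text \<open>The sum of \<open>u^d\<^sub>1 w^d\<^sub>2\<close> over \<open>d\<^sub>1 + d\<^sub>2 = n - 1\<close>, which is empty for \<open>n = 0\<close>.\<close>

definition hsum :: "nat \<Rightarrow> 'r::ring_1 \<Rightarrow> 'r \<Rightarrow> 'r"
  where "hsum n u w = (\<Sum>d<n. u ^ d * w ^ (n - Suc d))"

text \<open>A relation \<open>a = b\<close> is recorded as the element \<open>a - b\<close> of the free algebra.\<close>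

inductive_set klr_rels ::
    "'l set \<Rightarrow> ('l \<Rightarrow> 'l \<Rightarrow> int) \<Rightarrow> ('l \<Rightarrow> 'l \<Rightarrow> 'k) \<Rightarrow> nat \<Rightarrow> ('l gens, 'k::field) free set"
  for L :: "'l set" and B :: "'l \<Rightarrow> 'l \<Rightarrow> int" and t :: "'l \<Rightarrow> 'l \<Rightarrow> 'k" and n :: nat where
  unit: "(\<Sum>i\<in>words L n. \<e> i) - 1 \<in> klr_rels L B t n"
| idem: "i \<in> words L n \<Longrightarrow> j \<in> words L n \<Longrightarrow>
    \<e> i * \<e> j - (if i = j then \<e> i else 0) \<in> klr_rels L B t n"
| dot_idem: "i \<in> words L n \<Longrightarrow> p < n \<Longrightarrow>
    \<x> p * \<e> i - \<e> i * \<x> p \<in> klr_rels L B t n"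
| cross_idem: "i \<in> words L n \<Longrightarrow> Suc p < n \<Longrightarrow>
    \<psi> p * \<e> i - \<e> (swap p i) * \<psi> p \<in> klr_rels L B t n"
| dot_dot: "p < n \<Longrightarrow> q < n \<Longrightarrow>
    \<x> p * \<x> q - \<x> q * \<x> p \<in> klr_rels L B t n"
| cross_dot_far: "Suc p < n \<Longrightarrow> q < n \<Longrightarrow> q \<noteq> p \<Longrightarrow> q \<noteq> Suc p \<Longrightarrow>
    \<psi> p * \<x> q - \<x> q * \<psi> p \<in> klr_rels L B t n"
| cross_cross_far: "Suc p < n \<Longrightarrow> Suc q < n \<Longrightarrow> Suc p < q \<or> Suc q < p \<Longrightarrow>
    \<psi> p * \<psi> q - \<psi> q * \<psi> p \<in> klr_rels L B t n"
| slide_left: "i \<in> words L n \<Longrightarrow> Suc p < n \<Longrightarrow>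
    (\<x> p * \<psi> p - \<psi> p * \<x> (Suc p)) * \<e> i
      - (if i ! p = i ! Suc p then \<e> i else 0) \<in> klr_rels L B t n"
| slide_right: "i \<in> words L n \<Longrightarrow> Suc p < n \<Longrightarrow>
    (\<psi> p * \<x> p - \<x> (Suc p) * \<psi> p) * \<e> i
      - (if i ! p = i ! Suc p then \<e> i else 0) \<in> klr_rels L B t n"
| square_same: "i \<in> words L n \<Longrightarrow> Suc p < n \<Longrightarrow> i ! p = i ! Suc p \<Longrightarrow>
    \<psi> p ^ 2 * \<e> i \<in> klr_rels L B t n"
| square_orth: "i \<in> words L n \<Longrightarrow> Suc p < n \<Longrightarrow> a = i ! p \<Longrightarrow> b = i ! Suc p \<Longrightarrow>
    a \<noteq> b \<Longrightarrow> B a b = 0 \<Longrightarrow>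
    \<psi> p ^ 2 * \<e> i - scal (t a b) * \<e> i \<in> klr_rels L B t n"
| square_adj: "i \<in> words L n \<Longrightarrow> Suc p < n \<Longrightarrow> a = i ! p \<Longrightarrow> b = i ! Suc p \<Longrightarrow>
    a \<noteq> b \<Longrightarrow> B a b < 0 \<Longrightarrow>
    \<psi> p ^ 2 * \<e> i
      - (scal (t a b) * \<x> p ^ nat (- cartan_int B a b)
         + scal (t b a) * \<x> (Suc p) ^ nat (- cartan_int B b a)) * \<e> i \<in> klr_rels L B t n"
| braid: "i \<in> words L n \<Longrightarrow> Suc (Suc p) < n \<Longrightarrow> a = i ! p \<Longrightarrow> b = i ! Suc p \<Longrightarrow>
    (\<psi> p * \<psi> (Suc p) * \<psi> p - \<psi> (Suc p) * \<psi> p * \<psi> (Suc p)) * \<e> i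
      - (if i ! Suc (Suc p) = a \<and> B a b < 0
         then scal (t a b) * hsum (nat (- cartan_int B a b)) (\<x> p) (\<x> (Suc (Suc p))) * \<e> i
         else 0) \<in> klr_rels L B t n"

definition klr_alg ::
    "'l set \<Rightarrow> ('l \<Rightarrow> 'l \<Rightarrow> int) \<Rightarrow> ('l \<Rightarrow> 'l \<Rightarrow> 'k) \<Rightarrow> nat \<Rightarrow> ('k::field, ('l gens, 'k) free set) module"
  where "klr_alg L B t n = presented_alg (gens_over (words L n) n) (klr_rels L B t n)"

definition klr_class ::
    "'l set \<Rightarrow> ('l \<Rightarrow> 'l \<Rightarrow> int) \<Rightarrow> ('l \<Rightarrow> 'l \<Rightarrow> 'k) \<Rightarrow> nat \<Rightarrow> ('l gens, 'k::field) free \<Rightarrow> ('l gens, 'k) free set"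
  where "klr_class L B t n = presented_class (gens_over (words L n) n) (klr_rels L B t n)"


section \<open>Sequences of solid and thick entries\<close>

text \<open>
  The list \<open>lam\<close> consists of the \<open>\<lambda>\<^sub>k\<close>, with \<open>(lam ! k) a\<close> the coefficient of the barred
  element of \<open>a \<in> {1..N}\<close> in \<open>\<lambda>\<^sub>k\<close>. The entry \<open>\<lambda>\<^sub>k\<close> of a sequence is recorded by its index
  \<open>k\<close>.
\<close>

datatype entry = Solid nat | Thick nat

fun is_solid :: "entry \<Rightarrow> bool" where
  "is_solid (Solid a) = True"
| "is_solid (Thick k) = False"

definition Seq :: "(nat \<Rightarrow> nat) list \<Rightarrow> nat list \<Rightarrow> entry list set"
  where "Seq lam nu =
    (\<Union>nu'\<in>{nu'. mset nu' = mset nu}. shuffles (map Solid nu') (map Thick [0..<length lam]))"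

definition weight_size :: "nat \<Rightarrow> (nat \<Rightarrow> nat) \<Rightarrow> nat"
  where "weight_size N l = (\<Sum>a\<in>{1..N}. l a)"

definition strands :: "nat \<Rightarrow> (nat \<Rightarrow> nat) list \<Rightarrow> nat list \<Rightarrow> nat"
  where "strands N lam nu = (\<Sum>l\<leftarrow>lam. weight_size N l) + length nu"

fun expand_entry :: "nat \<Rightarrow> (nat \<Rightarrow> nat) list \<Rightarrow> entry \<Rightarrow> lab list" where
  "expand_entry N lam (Solid a) = [Orig a]"
| "expand_entry N lam (Thick k) = concat (map (\<lambda>a. replicate ((lam ! k) a) (Bar a)) [1..<Suc N])"

text \<open>
  If some \<open>\<lambda>\<^sub>k\<close> is zero and there is a solid entry, distinct sequences have the same
  expansion; then the idempotents attached to sequences below are not orthogonal.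
\<close>

definition expand :: "nat \<Rightarrow> (nat \<Rightarrow> nat) list \<Rightarrow> entry list \<Rightarrow> lab list"
  where "expand N lam i = concat (map (expand_entry N lam) i)"

definition first_strand :: "nat \<Rightarrow> (nat \<Rightarrow> nat) list \<Rightarrow> entry list \<Rightarrow> nat \<Rightarrow> nat"
  where "first_strand N lam i p = length (expand N lam (take p i))"

definition thick_pos :: "entry list \<Rightarrow> nat \<Rightarrow> nat"
  where "thick_pos i k = (THE p. p < length i \<and> i ! p = Thick k)"

definition block_start :: "nat \<Rightarrow> (nat \<Rightarrow> nat) list \<Rightarrow> entry list \<Rightarrow> nat \<Rightarrow> nat \<Rightarrow> nat"
  where "block_start N lam i k a =
    first_strand N lam i (thick_pos i k) + (\<Sum>b\<in>{1..<a}. (lam ! k) b)"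


section \<open>The subalgebra \<open>S\<^sub>C(\<lambda>, \<nu>)\<close> and its quotient\<close>

text \<open>
  The elements below are given by representatives in the free algebra. Since that algebra is
  not commutative, an order of the factors has to be chosen; it does not matter in the
  Khovanov-Lauda-Rouquier algebra.
\<close>

text \<open>
  The product of crossings along the reduced word \<open>(s\<^sub>1)(s\<^sub>2s\<^sub>1)(s\<^sub>3s\<^sub>2s\<^sub>1)\<dots>\<close> of the longest
  element, on the \<open>n\<close> strands starting at \<open>s\<close>.
\<close>

definition psi_longest :: "nat \<Rightarrow> nat \<Rightarrow> ('l gens, 'k::field) free"
  where "psi_longest s n = prod_list (map \<psi> (concat (map (\<lambda>j. rev [s..<s + j]) [1..<n])))"

definition nil_idem :: "nat \<Rightarrow> nat \<Rightarrow> ('l gens, 'k::field) free"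
  where "nil_idem s n = (\<Prod>j\<leftarrow>[0..<n]. \<x> (s + j) ^ (n - Suc j)) * psi_longest s n"

definition elem_sym :: "nat \<Rightarrow> nat set \<Rightarrow> ('l gens, 'k::field) free"
  where "elem_sym d P = (\<Sum>A | A \<subseteq> P \<and> card A = d. prod_list (map \<x> (sorted_list_of_set A)))"

definition S_e :: "nat \<Rightarrow> (nat \<Rightarrow> nat) list \<Rightarrow> entry list \<Rightarrow> (lab gens, 'k::field) free"
  where "S_e N lam i =
    (\<Prod>k\<leftarrow>[0..<length lam]. \<Prod>a\<leftarrow>[1..<Suc N]. nil_idem (block_start N lam i k a) ((lam ! k) a))
    * \<e> (expand N lam i)"

definition S_y :: "nat \<Rightarrow> (nat \<Rightarrow> nat) list \<Rightarrow> nat \<Rightarrow> entry list \<Rightarrow> (lab gens, 'k::field) free"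
  where "S_y N lam p i =
    (if is_solid (i ! p) then \<x> (first_strand N lam i p) * S_e N lam i else 0)"

definition S_E :: "nat \<Rightarrow> (nat \<Rightarrow> nat) list \<Rightarrow> nat \<Rightarrow> nat \<Rightarrow> nat \<Rightarrow> entry list \<Rightarrow> (lab gens, 'k::field) free"
  where "S_E N lam k a d i =
    elem_sym d {block_start N lam i k a ..< block_start N lam i k a + (lam ! k) a} * S_e N lam i"

definition S_Psi :: "nat \<Rightarrow> (nat \<Rightarrow> nat) list \<Rightarrow> nat \<Rightarrow> entry list \<Rightarrow> (lab gens, 'k::field) free"
  where "S_Psi N lam p i =
    (let q = first_strand N lam i p in
     case (i ! p, i ! Suc p) of
       (Solid a, Solid b) \<Rightarrow> \<psi> q * S_e N lam i
     | (Thick k, Solid b) \<Rightarrow>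
         prod_list (map \<psi> [q..<q + weight_size N (lam ! k)]) * S_e N lam i
     | (Solid a, Thick k) \<Rightarrow>
         prod_list (map \<psi> (rev [q..<q + weight_size N (lam ! k)])) * S_e N lam i
     | (Thick k, Thick l) \<Rightarrow> 0)"

definition tilde_R :: "nat \<Rightarrow> (nat \<Rightarrow> nat \<Rightarrow> int) \<Rightarrow> (lab \<Rightarrow> lab \<Rightarrow> 'k) \<Rightarrow> nat
    \<Rightarrow> ('k::field, (lab gens, 'k) free set) module"
  where "tilde_R N B t n = klr_alg (ext_index N) (ext_form B) t n"

definition R_class :: "nat \<Rightarrow> (nat \<Rightarrow> nat \<Rightarrow> int) \<Rightarrow> (lab \<Rightarrow> lab \<Rightarrow> 'k) \<Rightarrow> nat
    \<Rightarrow> (lab gens, 'k::field) free \<Rightarrow> (lab gens, 'k) free set"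
  where "R_class N B t n = klr_class (ext_index N) (ext_form B) t n"

definition S_alg :: "nat \<Rightarrow> (nat \<Rightarrow> nat \<Rightarrow> int) \<Rightarrow> (lab \<Rightarrow> lab \<Rightarrow> 'k) \<Rightarrow> (nat \<Rightarrow> nat) list \<Rightarrow> nat list
    \<Rightarrow> ('k::field, (lab gens, 'k) free set) module"
  where "S_alg N B t lam nu =
    (let n = strands N lam nu; r = length lam + length nu; cls = R_class N B t n in
     generated_alg (tilde_R N B t n)
       (cls (\<Sum>i\<in>Seq lam nu. S_e N lam i))
       ({cls (S_e N lam i) | i. i \<in> Seq lam nu}
        \<union> {cls (\<Sum>i\<in>Seq lam nu. S_y N lam p i) | p. p < r}
        \<union> {cls (\<Sum>i\<in>Seq lam nu. S_E N lam k a d i) | k a d.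
             k < length lam \<and> a \<in> {1..N} \<and> d \<in> {1..(lam ! k) a}}
        \<union> {cls (\<Sum>i\<in>Seq lam nu. S_Psi N lam p i) | p. Suc p < r}))"

definition S_ideal :: "nat \<Rightarrow> (nat \<Rightarrow> nat \<Rightarrow> int) \<Rightarrow> (lab \<Rightarrow> lab \<Rightarrow> 'k) \<Rightarrow> (nat \<Rightarrow> nat) list \<Rightarrow> nat list
    \<Rightarrow> (lab gens, 'k::field) free set set"
  where "S_ideal N B t lam nu =
    (let cls = R_class N B t (strands N lam nu) in
     Idl\<^bsub>S_alg N B t lam nu\<^esub>
       ({cls (\<Sum>i\<in>Seq lam nu. S_E N lam k a d i) | k a d.
           k < length lam \<and> a \<in> {1..N} \<and> d \<in> {1..(lam ! k) a}}
        \<union> {cls (S_e N lam i) | i. i \<in> Seq lam nu \<and> i \<noteq> [] \<and> is_solid (i ! 0)}))"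

definition S_bar :: "nat \<Rightarrow> (nat \<Rightarrow> nat \<Rightarrow> int) \<Rightarrow> (lab \<Rightarrow> lab \<Rightarrow> 'k) \<Rightarrow> (nat \<Rightarrow> nat) list \<Rightarrow> nat list
    \<Rightarrow> ('k::field, (lab gens, 'k) free set set) module"
  where "S_bar N B t lam nu = alg_Quot (S_alg N B t lam nu) (S_ideal N B t lam nu)"


section \<open>Webster's tensor product algebra\<close>

definition Q_poly :: "(nat \<Rightarrow> nat \<Rightarrow> int) \<Rightarrow> nat \<Rightarrow> nat \<Rightarrow> 'r::ring_1 \<Rightarrow> 'r \<Rightarrow> 'r"
  where "Q_poly B a b u v =
    (if a = b then 0 else if B a b = 0 then 1
     else u ^ nat (- cartan_int B a b) + v ^ nat (- cartan_int B b a))"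

text \<open>
  The polynomial \<open>(Q\<^sub>a\<^sub>b(u, v) - Q\<^sub>a\<^sub>b(w, v)) / (u - w)\<close>, which does not involve \<open>v\<close>.
\<close>

definition Q_quot :: "(nat \<Rightarrow> nat \<Rightarrow> int) \<Rightarrow> nat \<Rightarrow> nat \<Rightarrow> 'r::ring_1 \<Rightarrow> 'r \<Rightarrow> 'r"
  where "Q_quot B a b u w =
    (if a = b \<or> B a b = 0 then 0 else hsum (nat (- cartan_int B a b)) u w)"

lemma Q_quot_eq:
  fixes u v w :: "'r::comm_ring_1"
  shows "(u - w) * Q_quot B a b u w = Q_poly B a b u v - Q_poly B a b w v"
  by (simp add: Q_quot_def Q_poly_def hsum_def power_diff_sumr2 mult.commute)

inductive_set T_rels ::
    "(nat \<Rightarrow> nat \<Rightarrow> int) \<Rightarrow> (nat \<Rightarrow> nat) list \<Rightarrow> nat list \<Rightarrow> (entry gens, 'k::field) free set"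
  for B :: "nat \<Rightarrow> nat \<Rightarrow> int" and lam :: "(nat \<Rightarrow> nat) list" and nu :: "nat list" where
  unit: "(\<Sum>i\<in>Seq lam nu. \<e> i) - 1 \<in> T_rels B lam nu"
| idem: "i \<in> Seq lam nu \<Longrightarrow> j \<in> Seq lam nu \<Longrightarrow>
    \<e> i * \<e> j - (if i = j then \<e> i else 0) \<in> T_rels B lam nu"
| dot_idem: "i \<in> Seq lam nu \<Longrightarrow> p < length i \<Longrightarrow>
    \<x> p * \<e> i - \<e> i * \<x> p \<in> T_rels B lam nu"
| dot_dot: "p < length lam + length nu \<Longrightarrow> q < length lam + length nu \<Longrightarrow>
    \<x> p * \<x> q - \<x> q * \<x> p \<in> T_rels B lam nu"
| dot_red: "i \<in> Seq lam nu \<Longrightarrow> p < length i \<Longrightarrow> \<not> is_solid (i ! p) \<Longrightarrow>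
    \<x> p * \<e> i \<in> T_rels B lam nu"
| cross_red: "i \<in> Seq lam nu \<Longrightarrow> Suc p < length i \<Longrightarrow>
    \<not> is_solid (i ! p) \<Longrightarrow> \<not> is_solid (i ! Suc p) \<Longrightarrow>
    \<psi> p * \<e> i \<in> T_rels B lam nu"
| cross_idem: "i \<in> Seq lam nu \<Longrightarrow> Suc p < length i \<Longrightarrow>
    is_solid (i ! p) \<or> is_solid (i ! Suc p) \<Longrightarrow>
    \<psi> p * \<e> i - \<e> (swap p i) * \<psi> p \<in> T_rels B lam nu"
| cross_dot_far: "Suc p < length lam + length nu \<Longrightarrow> q < length lam + length nu \<Longrightarrow>
    q \<noteq> p \<Longrightarrow> q \<noteq> Suc p \<Longrightarrow>
    \<psi> p * \<x> q - \<x> q * \<psi> p \<in> T_rels B lam nu"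
| cross_cross_far: "Suc p < length lam + length nu \<Longrightarrow> Suc q < length lam + length nu \<Longrightarrow>
    Suc p < q \<or> Suc q < p \<Longrightarrow>
    \<psi> p * \<psi> q - \<psi> q * \<psi> p \<in> T_rels B lam nu"
| slide_left: "i \<in> Seq lam nu \<Longrightarrow> Suc p < length i \<Longrightarrow>
    is_solid (i ! p) \<or> is_solid (i ! Suc p) \<Longrightarrow>
    (\<x> p * \<psi> p - \<psi> p * \<x> (Suc p)) * \<e> i
      - (if i ! p = i ! Suc p then \<e> i else 0) \<in> T_rels B lam nu"
| slide_right: "i \<in> Seq lam nu \<Longrightarrow> Suc p < length i \<Longrightarrow>
    is_solid (i ! p) \<or> is_solid (i ! Suc p) \<Longrightarrow>
    (\<psi> p * \<x> p - \<x> (Suc p) * \<psi> p) * \<e> i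
      - (if i ! p = i ! Suc p then \<e> i else 0) \<in> T_rels B lam nu"
| square_black: "i \<in> Seq lam nu \<Longrightarrow> Suc p < length i \<Longrightarrow>
    i ! p = Solid a \<Longrightarrow> i ! Suc p = Solid b \<Longrightarrow>
    \<psi> p ^ 2 * \<e> i - Q_poly B a b (\<x> p) (\<x> (Suc p)) * \<e> i \<in> T_rels B lam nu"
| square_black_red: "i \<in> Seq lam nu \<Longrightarrow> Suc p < length i \<Longrightarrow>
    i ! p = Solid a \<Longrightarrow> i ! Suc p = Thick k \<Longrightarrow>
    \<psi> p ^ 2 * \<e> i - \<x> p ^ ((lam ! k) a) * \<e> i \<in> T_rels B lam nu"
| square_red_black: "i \<in> Seq lam nu \<Longrightarrow> Suc p < length i \<Longrightarrow>
    i ! p = Thick k \<Longrightarrow> i ! Suc p = Solid a \<Longrightarrow>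
    \<psi> p ^ 2 * \<e> i - \<x> (Suc p) ^ ((lam ! k) a) * \<e> i \<in> T_rels B lam nu"
| braid_black: "i \<in> Seq lam nu \<Longrightarrow> Suc (Suc p) < length i \<Longrightarrow>
    i ! p = Solid a \<Longrightarrow> i ! Suc p = Solid b \<Longrightarrow> i ! Suc (Suc p) = Solid a \<Longrightarrow>
    (\<psi> p * \<psi> (Suc p) * \<psi> p - \<psi> (Suc p) * \<psi> p * \<psi> (Suc p)) * \<e> i
      - Q_quot B a b (\<x> p) (\<x> (Suc (Suc p))) * \<e> i \<in> T_rels B lam nu"
| braid_red: "i \<in> Seq lam nu \<Longrightarrow> Suc (Suc p) < length i \<Longrightarrow>
    i ! p = Solid a \<Longrightarrow> i ! Suc p = Thick k \<Longrightarrow> i ! Suc (Suc p) = Solid a \<Longrightarrow>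
    (\<psi> p * \<psi> (Suc p) * \<psi> p - \<psi> (Suc p) * \<psi> p * \<psi> (Suc p)) * \<e> i
      - hsum ((lam ! k) a) (\<x> p) (\<x> (Suc (Suc p))) * \<e> i \<in> T_rels B lam nu"
| braid_plain: "i \<in> Seq lam nu \<Longrightarrow> Suc (Suc p) < length i \<Longrightarrow>
    card {q \<in> {p, Suc p, Suc (Suc p)}. \<not> is_solid (i ! q)} \<le> 1 \<Longrightarrow>
    i ! p \<noteq> i ! Suc (Suc p) \<Longrightarrow>
    (\<psi> p * \<psi> (Suc p) * \<psi> p - \<psi> (Suc p) * \<psi> p * \<psi> (Suc p)) * \<e> i \<in> T_rels B lam nu"
| cyclotomic: "i \<in> Seq lam nu \<Longrightarrow> i \<noteq> [] \<Longrightarrow> is_solid (i ! 0) \<Longrightarrow>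
    \<e> i \<in> T_rels B lam nu"

definition T_alg :: "(nat \<Rightarrow> nat \<Rightarrow> int) \<Rightarrow> (nat \<Rightarrow> nat) list \<Rightarrow> nat list
    \<Rightarrow> ('k::field, (entry gens, 'k) free set) module"
  where "T_alg B lam nu =
    presented_alg (gens_over (Seq lam nu) (length lam + length nu)) (T_rels B lam nu)"

end

theory Submission
  imports
    Defs
    "HOL-Library.Product_Plus"
    "HOL-Library.Function_Algebras"
    "HOL-Computational_Algebra.Fraction_Field"
    "HOL-Computational_Algebra.Polynomial"
    "HOL-Library.Nat_Bijection"
    "HOL.Vector_Spaces"
begin

text \<open>
  The crossings, dots and elementary symmetric polynomials of \<open>S\<close> satisfy Webster's relations with
  \<open>y\<^sup>m\<close> deformed to \<open>\<Sum>\<^sub>d (-1)\<^sup>d E\<^sub>d y\<^bsup>m-d\<^esup>\<close>, so modulo \<open>J\<close> Webster's relations hold and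
  \<open>S/J\<close> is a quotient of \<open>T\<close>. Conversely, call representatives of elements of \<open>S\<close> and \<open>T\<close> matched if they
  are built in the same way from corresponding generators. The deformed relations suffice to write
  any matched pair, simultaneously in both algebras, as a combination of normal words in the crossings
  with coefficients built from idempotents, dots and the \<open>E\<^sub>d\<close>. In a polynomial representation of the
  Khovanov-Lauda-Rouquier algebra the normal words are independent, because their leading terms
  permute generic configurations of points in different ways. Hence, if the element of \<open>S\<close> vanishes,
  the coefficients vanish; specialising the variables of the thick strands to zero, their counterparts
  in \<open>T\<close> vanish as well.
\<close>

section \<open>Rings of additive endomorphisms and products of rings\<close>

text \<open>\<open>S\<close> comes without a presentation and \<open>T\<close> without a basis, so
  neither direction of the isomorphism can be read off from generators alone: a map out of
  \<open>S\<close> must be shown to be independent of representatives. Linear independence is proved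
  on the side of \<open>S\<close> only. \<open>T\<close> enters merely as a ring satisfying the
  relations with all \<open>E k a d\<close> equal to 0, so the argument is not disturbed by the
  violating relation. Working in the product of the two rings keeps the coefficients matched. The
  thick strands cannot be specialised to zero from the start, since configurations need pairwise
  distinct values for the denominators of divided differences. They therefore carry multiples of an
  indeterminate, which is set to 0 only in the final coefficients. The nondegeneracy hypothesis
  makes distinct sequences expand to distinct words; the orthogonality of the idempotents of
  \<open>S\<close> rests on it.\<close>

typedef (overloaded) 'v endo = "{f :: 'v::ab_group_add => 'v. \<forall>x y. f (x + y) = f x + f y}"
  morphisms app Endo
  by (rule exI[of _ id]) simp

setup_lifting type_definition_endo

lemma app_add [simp]: "app f (x + y) = app f x + app f y"
  using app[of f] by simp

lemma app_zero [simp]: "app f 0 = 0"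
  using app_add[of f 0 0] by simp

lemma app_minus [simp]: "app f (- x) = - app f x"
  by (metis add.right_inverse app_add app_zero add_eq_0_iff)

lemma app_diff [simp]: "app f (x - y) = app f x - app f y"
  by (metis app_add app_minus diff_conv_add_uminus)

lemma app_sum [simp]: "app f (sum g A) = (\<Sum>a\<in>A. app f (g a))"
  by (induction A rule: infinite_finite_induct) auto

lemma endo_eqI: "(\<And>x. app f x = app g x) ==> f = g"
  by (metis app_inject ext)

instantiation endo :: ("{ab_group_add, zero_neq_one}") ring_1
begin
lift_definition zero_endo :: "'a endo" is "\<lambda>x. 0" by simp
lift_definition one_endo :: "'a endo" is "\<lambda>x. x" by simp
lift_definition plus_endo :: "'a endo => 'a endo => 'a endo" is "\<lambda>f g x. f x + g x"
  by (simp add: algebra_simps)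
lift_definition uminus_endo :: "'a endo => 'a endo" is "\<lambda>f x. - f x" by simp
lift_definition minus_endo :: "'a endo => 'a endo => 'a endo" is "\<lambda>f g x. f x - g x"
  by (simp add: algebra_simps)
lift_definition times_endo :: "'a endo => 'a endo => 'a endo" is "\<lambda>f g x. f (g x)" by simp
instance
proof
  show "(0 :: 'a endo) \<noteq> 1"
    by transfer (metis zero_neq_one)
qed (transfer; simp add: algebra_simps fun_eq_iff)+
end

lemma app_simps [simp]:
  "app 0 x = 0" "app 1 x = x" "app (f + g) x = app f x + app g x"
  "app (- f) x = - app f x" "app (f - g) x = app f x - app g x"
  "app (f * g) x = app f (app g x)"
  by (transfer; simp)+

lemma app_of_sum [simp]: "app (sum g A) x = (\<Sum>a\<in>A. app (g a) x)"
  by (induction A rule: infinite_finite_induct) auto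

text \<open>Componentwise multiplication: an identity in the product ring is an identity in each
  factor, which is how one reduction to normal form serves both algebras.\<close>

instantiation prod :: (times, times) times
begin
definition "a * b = (fst a * fst b, snd a * snd b)"
instance ..
end

instantiation prod :: (one, one) one
begin
definition "1 = (1, 1)"
instance ..
end

lemma fst_times [simp]: "fst (a * b) = fst a * fst b"
  and snd_times [simp]: "snd (a * b) = snd a * snd b"
  and fst_one [simp]: "fst 1 = 1" and snd_one [simp]: "snd 1 = 1"
  by (simp_all add: times_prod_def one_prod_def)

instance prod :: (ring_1, ring_1) ring_1
proof
  show "(0 :: 'a \<times> 'b) \<noteq> 1"
    by (simp add: zero_prod_def one_prod_def)
qed (simp_all add: prod_eq_iff algebra_simps)

lemma fst_power [simp]: "fst (a ^ n) = fst a ^ n"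
  and snd_power [simp]: "snd (a ^ n) = snd a ^ n"
  for a :: "'a::ring_1 \<times> 'b::ring_1"
  by (induction n) auto

section \<open>Homomorphisms from free algebras\<close>

text \<open>\<open>h\<close> takes the word together with its coefficient, so that scalars may act
  through an arbitrary map \<kappa>.\<close>

definition pm_extend :: "('w => 'k => 'r) => ('w \<Rightarrow>\<^sub>0 'k::zero) => 'r::comm_monoid_add"
  where "pm_extend h f = (\<Sum>w\<in>Poly_Mapping.keys f. h w (Poly_Mapping.lookup f w))"

lemma pm_extend_superset:
  assumes "\<And>w. h w 0 = 0" "finite A" "Poly_Mapping.keys f \<subseteq> A"
  shows "pm_extend h f = (\<Sum>w\<in>A. h w (Poly_Mapping.lookup f w))"
  unfolding pm_extend_def using assms
  by (intro sum.mono_neutral_left) (auto simp: in_keys_iff)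

lemma pm_extend_add:
  fixes h :: "'w => 'k::comm_monoid_add => 'r::comm_monoid_add"
  assumes "\<And>w. h w 0 = 0" "\<And>w a b. h w (a + b) = h w a + h w b"
  shows "pm_extend h (f + g) = pm_extend h f + pm_extend h g"
proof -
  let ?A = "Poly_Mapping.keys f \<union> Poly_Mapping.keys g"
  have "Poly_Mapping.keys (f + g) \<subseteq> ?A" by (rule keys_add)
  then have "pm_extend h (f + g) = (\<Sum>w\<in>?A. h w (Poly_Mapping.lookup (f + g) w))"
    by (intro pm_extend_superset) (auto simp: assms)
  also have "\<dots> = (\<Sum>w\<in>?A. h w (Poly_Mapping.lookup f w)) + (\<Sum>w\<in>?A. h w (Poly_Mapping.lookup g w))"
    by (simp add: lookup_add assms sum.distrib)
  also have "\<dots> = pm_extend h f + pm_extend h g"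
    using pm_extend_superset[of h ?A f] pm_extend_superset[of h ?A g] by (simp add: assms)
  finally show ?thesis .
qed

lemma pm_extend_single:
  "h w 0 = 0 ==> pm_extend h (Poly_Mapping.single w c) = h w c"
  by (simp add: pm_extend_def)

lemma pm_extend_zero [simp]: "pm_extend h 0 = 0"
  by (simp add: pm_extend_def)

lemma poly_mapping_additive_induct [case_names zero single_add]:
  fixes f :: "'w \<Rightarrow>\<^sub>0 'k::comm_monoid_add"
  assumes "P 0" "\<And>w c f. P f ==> P (Poly_Mapping.single w c + f)"
  shows "P f"
proof (induction "card (Poly_Mapping.keys f)" arbitrary: f rule: less_induct)
  case less
  show ?case
  proof (cases "f = 0")
    case False
    then obtain w where w: "w \<in> Poly_Mapping.keys f" by (meson ex_in_conv keys_eq_empty)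
    define g where "g = Poly_Mapping.update w 0 f"
    have f: "f = Poly_Mapping.single w (Poly_Mapping.lookup f w) + g"
      by (rule poly_mapping_eqI) (simp add: g_def lookup_add lookup_single lookup_update when_def)
    have "Poly_Mapping.keys g = Poly_Mapping.keys f - {w}"
      by (simp add: g_def keys_update)
    then have "card (Poly_Mapping.keys g) < card (Poly_Mapping.keys f)"
      using w by (simp add: card_Diff1_less del: card_Diff_insert)
    then have "P g" by (rule less)
    then show ?thesis using assms(2) f by metis
  qed (simp add: assms)
qed

lemma pm_extend_mult:
  fixes h :: "'w::monoid_add => 'k::semiring_0 => 'r::semiring_0"
  assumes "\<And>w. h w 0 = 0" "\<And>w a b. h w (a + b) = h w a + h w b"
    and "\<And>v w a b. h (v + w) (a * b) = h v a * h w b"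
  shows "pm_extend h (f * g) = pm_extend h f * pm_extend h g"
proof (induction f rule: poly_mapping_additive_induct)
  case (single_add w c f)
  have "pm_extend h (Poly_Mapping.single w c * g) = h w c * pm_extend h g"
  proof (induction g rule: poly_mapping_additive_induct)
    case (single_add v d g)
    then show ?case
      by (simp add: distrib_left pm_extend_add assms mult_single pm_extend_single)
  qed simp
  then show ?case
    using single_add by (simp add: distrib_right pm_extend_add assms pm_extend_single)
qed simp

text \<open>\<open>\<rho> 1\<close> is only an idempotent acting as a unit on the image, not the
  unit of the target: operators on valid configurations and the later \<open>\<eta>\<close>, whose
  unit is that of \<open>S\<close>, are of this kind. \<open>\<kappa>\<close> gives the scalars as
  elements commuting with the image.\<close>

locale alg_hom =
  fixes \<rho> :: "('g, 'k::field) free => 'r::ring_1" and \<kappa> :: "'k => 'r"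
  assumes add: "\<rho> (f + g) = \<rho> f + \<rho> g"
    and mult: "\<rho> (f * g) = \<rho> f * \<rho> g"
    and scal: "\<rho> (scal c * f) = \<kappa> c * \<rho> f"
    and kappa_comm: "\<kappa> c * \<rho> f = \<rho> f * \<kappa> c"
    and kappa_one: "\<kappa> 1 = 1"
    and kappa_add: "\<kappa> (c + d) = \<kappa> c + \<kappa> d"
    and kappa_mult: "\<kappa> (c * d) = \<kappa> c * \<kappa> d"
begin

lemma zero [simp]: "\<rho> 0 = 0"
  using add[of 0 0] by simp

lemma minus [simp]: "\<rho> (- f) = - \<rho> f"
  by (metis add add.right_inverse zero add_eq_0_iff)

lemma diff [simp]: "\<rho> (f - g) = \<rho> f - \<rho> g"
  by (metis add minus diff_conv_add_uminus)

lemma sum [simp]: "\<rho> (sum g A) = (\<Sum>a\<in>A. \<rho> (g a))"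
  by (induction A rule: infinite_finite_induct) (auto simp: add)

lemma one_left [simp]: "\<rho> 1 * \<rho> f = \<rho> f"
  by (metis mult mult_1)

lemma one_right [simp]: "\<rho> f * \<rho> 1 = \<rho> f"
  by (metis mult mult_1_right)

lemma one_left_assoc [simp]: "\<rho> 1 * (\<rho> f * z) = \<rho> f * z"
  by (metis one_left mult.assoc)

lemma prod_list_mult: "\<rho> (prod_list fs * g) = prod_list (map \<rho> fs) * \<rho> g"
  by (induction fs) (auto simp: mult mult.assoc)

lemma power_mult: "\<rho> (f ^ n * g) = \<rho> f ^ n * \<rho> g"
  by (induction n) (auto simp: mult mult.assoc)

lemma kappa_zero [simp]: "\<kappa> 0 = 0"
  using kappa_add[of 0 0] by simp

lemma kappa_uminus: "\<kappa> (- c) = - \<kappa> c"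
  by (metis kappa_add add.right_inverse kappa_zero add_eq_0_iff)

end

text \<open>\<open>p\<close> is the prescribed image of \<open>1\<close>. It stands in front of
  every word; nonempty words absorb it because the images of the generators do.\<close>

definition free_eval :: "('k => 'r) => 'r => ('g => 'r) => ('g, 'k::field) free => 'r::ring_1"
  where "free_eval \<kappa> p \<gamma> = pm_extend (\<lambda>w c. \<kappa> c * (p * prod_list (map \<gamma> (letters w))))"

lemma free_eval_alg_hom:
  fixes \<kappa> :: "'k::field => 'r::ring_1"
  assumes k: "\<kappa> 1 = 1" "\<And>c d. \<kappa> (c + d) = \<kappa> c + \<kappa> d" "\<And>c d. \<kappa> (c * d) = \<kappa> c * \<kappa> d"
    and kp: "\<And>c. \<kappa> c * p = p * \<kappa> c" and kg: "\<And>c g. \<kappa> c * \<gamma> g = \<gamma> g * \<kappa> c"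
    and pp: "p * p = p" and pg: "\<And>g. p * \<gamma> g = \<gamma> g" and gp: "\<And>g. \<gamma> g * p = \<gamma> g"
  shows "alg_hom (free_eval \<kappa> p \<gamma>) \<kappa>" (is "alg_hom ?ev _")
    and "free_eval \<kappa> p \<gamma> (gen g) = \<gamma> g"
    and "free_eval \<kappa> p \<gamma> 1 = p"
proof -
  define h where "h = (\<lambda>w c. \<kappa> c * (p * prod_list (map \<gamma> (letters w))))"
  have h: "?ev = pm_extend h" by (simp add: free_eval_def h_def)
  have k0: "\<kappa> 0 = 0" using k(2)[of 0 0] by simp
  have h0: "h w 0 = 0" for w by (simp add: h_def k0)
  have ha: "h w (a + b) = h w a + h w b" for w a b by (simp add: h_def k algebra_simps)
  have kl: "\<kappa> c * prod_list (map \<gamma> l) = prod_list (map \<gamma> l) * \<kappa> c" for c l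
    by (induction l) (simp_all, metis kg mult.assoc)
  have pl: "p * prod_list (map \<gamma> l) = prod_list (map \<gamma> l) * p" for l
    by (induction l) (simp_all, metis pg gp mult.assoc)
  have hm: "h (v + w) (a * b) = h v a * h w b" for v w a b
  proof -
    let ?V = "prod_list (map \<gamma> (letters v))" and ?W = "prod_list (map \<gamma> (letters w))"
    have "h v a * h w b = \<kappa> a * (p * ?V * \<kappa> b) * (p * ?W)" by (simp add: h_def mult.assoc)
    also have "p * ?V * \<kappa> b = \<kappa> b * (p * ?V)" by (metis kl kp mult.assoc)
    also have "\<kappa> a * (\<kappa> b * (p * ?V)) * (p * ?W) = \<kappa> a * \<kappa> b * (p * (?V * p) * ?W)" by (simp add: mult.assoc)
    also have "p * (?V * p) = p * ?V" by (metis pl pp mult.assoc)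
    finally show ?thesis by (simp add: h_def k plus_freemon_def mult.assoc)
  qed
  have s: "pm_extend h (scal c * f) = \<kappa> c * pm_extend h f" for c f
  proof (induction f rule: poly_mapping_additive_induct)
    case (single_add w d f)
    then show ?case
      by (simp add: distrib_left pm_extend_add h0 ha scal_def mult_single pm_extend_single)
        (simp add: h_def k mult.assoc)
  qed simp
  have c: "\<kappa> c * pm_extend h f = pm_extend h f * \<kappa> c" for c f
  proof (induction f rule: poly_mapping_additive_induct)
    case (single_add w d f)
    have "\<kappa> c * h w d = h w d * \<kappa> c"
      unfolding h_def by (metis k(3) kl kp mult.assoc mult.commute)
    with single_add show ?case
      by (simp add: pm_extend_add h0 ha pm_extend_single distrib_left distrib_right)
  qed simp
  show "alg_hom ?ev \<kappa>"
    unfolding h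
    by standard (simp_all add: pm_extend_add h0 ha s c k pm_extend_mult hm)
  show "?ev (gen g) = \<gamma> g"
    unfolding h by (simp add: gen_def pm_extend_single h0) (simp add: h_def k pg)
  show "?ev 1 = p"
    unfolding h using pm_extend_single[of h 0 1] by (simp add: h0) (simp add: h_def k zero_freemon_def)
qed


section \<open>Typed models of presented algebras\<close>

abbreviation Rideal :: "'g set => ('g, 'k::field) free set => ('g, 'k) free set"
  where "Rideal G Rel \<equiv> Idl\<^bsub>free_alg G\<^esub> Rel"

lemma free_alg_simps [simp]:
  "carrier (free_alg G) = {f. \<forall>w \<in> Poly_Mapping.keys f. set (letters w) \<subseteq> G}"
  "mult (free_alg G) = (*)" "one (free_alg G) = 1" "zero (free_alg G) = 0"
  "add (free_alg G) = (+)" "module.smult (free_alg G) = (\<lambda>c f. scal c * f)"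
  by (simp_all add: free_alg_def)

lemma free_alg_uminus:
  assumes "f \<in> carrier (free_alg G)"
  shows "\<ominus>\<^bsub>free_alg G\<^esub> f = - f"
proof -
  interpret ring "free_alg G" by (rule free_alg_ring)
  show ?thesis
    by (rule minus_equality) (use assms in auto)
qed

lemma scal_carrier [simp]: "scal c \<in> carrier (free_alg G)"
  by (auto simp: scal_def zero_freemon_def)

lemma scal_mult: "scal (c * d) = scal c * scal d"
  by (simp add: scal_def mult_single)

lemma scal_add: "scal (c + d) = scal c + scal d"
  by (simp add: scal_def single_add)

lemma scal_one [simp]: "scal 1 = 1"
  by (simp add: scal_def)

lemma scal_uminus [simp]: "scal (- c) = - scal c"
  by (simp add: scal_def single_uminus)

lemma scal_zero [simp]: "scal 0 = 0"
  by (simp add: scal_def)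

lemma scal_comm: "scal c * f = f * (scal c :: ('g, 'k::field) free)"
proof (induction f rule: poly_mapping_additive_induct)
  case (single_add w d f)
  then show ?case
    by (simp add: distrib_left distrib_right scal_def mult_single mult.commute)
qed simp

lemma gen_carrier [simp]: "gen g \<in> carrier (free_alg G) \<longleftrightarrow> g \<in> G"
  by (auto simp: gen_def)

lemma carrier_closed:
  fixes G :: "'g set"
  defines "C \<equiv> carrier (free_alg G :: ('k::field, ('g, 'k) free) module)"
  shows "0 \<in> C" "1 \<in> C" "f \<in> C ==> g \<in> C ==> f + g \<in> C" "f \<in> C ==> g \<in> C ==> f * g \<in> C"
    "f \<in> C ==> - f \<in> C" "f \<in> C ==> g \<in> C ==> f - g \<in> C"
proof -
  interpret ring "free_alg G :: ('k, ('g, 'k) free) module" by (rule free_alg_ring)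
  show "0 \<in> C" "1 \<in> C" "f \<in> C ==> g \<in> C ==> f + g \<in> C" "f \<in> C ==> g \<in> C ==> f * g \<in> C"
    using zero_closed one_closed a_closed m_closed unfolding C_def free_alg_simps(2-) by blast+
  show m: "f \<in> C ==> - f \<in> C" for f
    unfolding C_def by simp
  show "f \<in> C ==> g \<in> C ==> f - g \<in> C"
    using a_closed[of f "- g"] m[of g] unfolding C_def free_alg_simps(2-) by simp
qed

lemma carrier_sum:
  assumes "\<And>a. a \<in> A ==> g a \<in> carrier (free_alg G)"
  shows "sum g A \<in> carrier (free_alg G)"
  using assms by (induction A rule: infinite_finite_induct) (auto intro: carrier_closed simp del: free_alg_simps(1))

lemma carrier_prod_list:
  assumes "\<And>f. f \<in> set fs ==> f \<in> carrier (free_alg G)"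
  shows "prod_list fs \<in> carrier (free_alg G)"
  using assms by (induction fs) (auto intro: carrier_closed simp del: free_alg_simps(1))

lemma carrier_power:
  assumes "f \<in> carrier (free_alg G)"
  shows "f ^ n \<in> carrier (free_alg G)"
  using assms by (induction n) (auto intro: carrier_closed simp del: free_alg_simps(1))

text \<open>Projects onto the span of the words in \<open>G\<close>; this turns an ideal of \<open>free_alg G\<close> into an
  ideal of the whole type.\<close>

definition restrict_words :: "'g set => ('g, 'k::field) free => ('g, 'k) free"
  where "restrict_words G = pm_extend (\<lambda>w c. if set (letters w) \<subseteq> G then Poly_Mapping.single w c else 0)"

lemma restrict_words:
  shows "restrict_words G (f + g) = restrict_words G f + restrict_words G g"
    and "restrict_words G (f * g) = restrict_words G f * restrict_words G g"
    and "restrict_words G f \<in> carrier (free_alg G)"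
    and "f \<in> carrier (free_alg G) ==> restrict_words G f = f"
    and "restrict_words G 0 = 0"
proof -
  show "restrict_words G (f + g) = restrict_words G f + restrict_words G g"
    unfolding restrict_words_def by (rule pm_extend_add) (auto simp: single_add)
  show "restrict_words G (f * g) = restrict_words G f * restrict_words G g"
    unfolding restrict_words_def
    by (rule pm_extend_mult) (auto simp: single_add mult_single plus_freemon_def)
  show "restrict_words G f \<in> carrier (free_alg G)"
    unfolding restrict_words_def pm_extend_def by (rule carrier_sum) auto
  show "restrict_words G f = f" if "f \<in> carrier (free_alg G)"
  proof -
    have "restrict_words G f = pm_extend Poly_Mapping.single f"
      unfolding restrict_words_def pm_extend_def using that by (intro sum.cong) auto
    also have "\<dots> = f"
      by (induction f rule: poly_mapping_additive_induct)
        (simp_all add: pm_extend_add pm_extend_single single_add)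
    finally show ?thesis .
  qed
  show "restrict_words G 0 = 0" by (simp add: restrict_words_def)
qed

interpretation free_vs: vector_space "\<lambda>c f. scal c * (f :: ('g, 'k::field) free)"
  by standard (simp_all add: scal_add scal_mult algebra_simps)

text \<open>A basis of \<open>Z\<close> is extended to one of the whole space, and the projection
  kills the first part. Its image is a copy of the quotient by \<open>Z\<close> inside the same
  type.\<close>

lemma subspace_projection:
  assumes "free_vs.subspace Z"
  obtains \<pi> :: "('g, 'k::field) free => ('g, 'k) free"
  where "\<And>f g. \<pi> (f + g) = \<pi> f + \<pi> g" "\<And>c f. \<pi> (scal c * f) = scal c * \<pi> f"
    "\<And>f. f - \<pi> f \<in> Z" "\<And>f. \<pi> f = 0 \<longleftrightarrow> f \<in> Z"
proof -
  obtain b where b: "b \<subseteq> Z" "free_vs.independent b" "Z \<subseteq> free_vs.span b"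
    using free_vs.maximal_independent_subset by blast
  have bZ: "free_vs.span b = Z"
    using b(3) free_vs.span_minimal[OF b(1) assms] by (rule subset_antisym[rotated])
  interpret vector_space_pair "\<lambda>c f. scal c * (f :: ('g, 'k) free)" "\<lambda>c f. scal c * (f :: ('g, 'k) free)"
    by unfold_locales
  define B where "B = free_vs.extend_basis b"
  have B: "free_vs.independent B" "b \<subseteq> B" "free_vs.span B = UNIV"
    unfolding B_def using b(2)
    by (auto simp: free_vs.independent_extend_basis free_vs.extend_basis_superset)
  define \<pi> where "\<pi> = construct B (\<lambda>x. if x \<in> b then 0 else x)"
  have lin: "Vector_Spaces.linear (\<lambda>c f. scal c * (f :: ('g, 'k) free)) (\<lambda>c f. scal c * f) \<pi>"
    unfolding \<pi>_def by (rule linear_construct) (fact B)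
  interpret l: Vector_Spaces.linear "\<lambda>c f. scal c * (f :: ('g, 'k) free)" "\<lambda>c f. scal c * f" \<pi>
    by (fact lin)
  have base: "\<pi> x = (if x \<in> b then 0 else x)" if "x \<in> B" for x
    unfolding \<pi>_def using construct_basis[OF B(1) that] by simp
  have diff: "f - \<pi> f \<in> Z" for f
  proof -
    have "f \<in> free_vs.span B" using B by simp
    then show ?thesis
    proof (induction f rule: free_vs.span_induct_alt)
      case base
      then show ?case using assms by (simp add: free_vs.subspace_0)
    next
      case (step c x y)
      have "x - \<pi> x \<in> Z" using base[OF step(1)] b(1) assms by (auto simp: free_vs.subspace_0)
      then have "scal c * (x - \<pi> x) + (y - \<pi> y) \<in> Z"
        using step assms by (intro free_vs.subspace_add free_vs.subspace_scale) auto
      then show ?case by (simp add: l.add l.scale algebra_simps)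
    qed
  qed
  have "\<pi> f = 0" if "f \<in> Z" for f
  proof -
    have "f \<in> free_vs.span b" using that bZ by simp
    then show ?thesis
      by (induction f rule: free_vs.span_induct_alt) (use base B(2) in \<open>auto simp: l.add l.scale l.zero\<close>)
  qed
  then show thesis
    using that[of \<pi>] l.add l.scale diff by (metis diff_zero)
qed

lemma Rideal_ideal:
  assumes "Rel \<subseteq> carrier (free_alg G)"
  shows "ideal (Rideal G Rel) (free_alg G)"
proof -
  interpret ring "free_alg G" by (rule free_alg_ring)
  show ?thesis by (rule genideal_ideal) (fact assms)
qed

lemma Rideal_closed:
  fixes Rel :: "('g, 'k::field) free set"
  assumes Rel: "Rel \<subseteq> carrier (free_alg G)"
  defines "Z \<equiv> Rideal G Rel"
  shows "Z \<subseteq> carrier (free_alg G)" "0 \<in> Z" "f \<in> Z ==> g \<in> Z ==> f + g \<in> Z"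
    "f \<in> Z ==> g \<in> carrier (free_alg G) ==> f * g \<in> Z" "f \<in> Z ==> g \<in> carrier (free_alg G) ==> g * f \<in> Z"
    "f \<in> Z ==> - f \<in> Z" "f \<in> Z ==> g \<in> Z ==> f - g \<in> Z" "Rel \<subseteq> Z"
proof -
  interpret ideal Z "free_alg G" unfolding Z_def by (rule Rideal_ideal[OF Rel])
  show c: "Z \<subseteq> carrier (free_alg G)" using a_Hcarr by blast
  show z: "0 \<in> Z" and a: "\<And>f g. f \<in> Z ==> g \<in> Z ==> f + g \<in> Z"
    using zero_closed a_closed additive_subgroup.zero_closed[OF is_additive_subgroup]
      additive_subgroup.a_closed[OF is_additive_subgroup] by simp_all
  show "f \<in> Z ==> g \<in> carrier (free_alg G) ==> f * g \<in> Z" "f \<in> Z ==> g \<in> carrier (free_alg G) ==> g * f \<in> Z"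
    using I_r_closed I_l_closed by simp_all
  show m: "\<And>f. f \<in> Z ==> - f \<in> Z"
  proof -
    fix f assume "f \<in> Z"
    have "- 1 \<in> carrier (free_alg G :: ('k, ('g, 'k) free) module)"
      by (intro carrier_closed)
    from I_l_closed[OF \<open>f \<in> Z\<close> this] have "- 1 * f \<in> Z"
      unfolding free_alg_simps(2) .
    then show "- f \<in> Z" by simp
  qed
  show "f \<in> Z ==> g \<in> Z ==> f - g \<in> Z"
    using a[of f "- g"] m by simp
  show "Rel \<subseteq> Z" unfolding Z_def using genideal_self[OF Rel] .
qed

text \<open>A presented algebra depends on term parameters and so is not itself a type of class
  \<open>ring_1\<close>. Instead it acts faithfully by left multiplication on a complement of the
  ideal. Additive endomorphisms of a fixed type form such a ring, and computations can be done
  there.\<close>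

proposition presented_alg_model:
  fixes G :: "'g set" and Rel :: "('g, 'k::field) free set"
  assumes Rel: "Rel \<subseteq> carrier (free_alg G)"
  obtains \<rho> :: "('g, 'k) free => ('g, 'k) free endo" and \<kappa>
  where "alg_hom \<rho> \<kappa>" "\<And>f. f \<in> carrier (free_alg G) ==> \<rho> f = 0 \<longleftrightarrow> f \<in> Rideal G Rel"
proof -
  note Z = Rideal_closed[OF Rel]
  define Z' where "Z' = {f. restrict_words G f \<in> Rideal G Rel}"
  have sub: "free_vs.subspace Z'"
  proof (rule free_vs.subspaceI)
    show "0 \<in> Z'" by (simp add: Z'_def restrict_words(5) Z(2))
    show "f + g \<in> Z'" if "f \<in> Z'" "g \<in> Z'" for f g
      using that by (simp add: Z'_def restrict_words(1) Z(3))
    show "scal c * f \<in> Z'" if "f \<in> Z'" for c f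
      using that unfolding Z'_def mem_Collect_eq restrict_words(2)
      by (rule Z(5)[OF _ restrict_words(3)])
  qed
  have Z'l: "g * f \<in> Z'" if "f \<in> Z'" for f g
    using that unfolding Z'_def mem_Collect_eq restrict_words(2)
    by (rule Z(5)[OF _ restrict_words(3)])
  have Z'r: "f * g \<in> Z'" if "f \<in> Z'" for f g
    using that unfolding Z'_def mem_Collect_eq restrict_words(2)
    by (rule Z(4)[OF _ restrict_words(3)])
  obtain \<pi> :: "('g, 'k) free => ('g, 'k) free" where \<pi>:
    "\<And>f g. \<pi> (f + g) = \<pi> f + \<pi> g" "\<And>c f. \<pi> (scal c * f) = scal c * \<pi> f"
    "\<And>f. f - \<pi> f \<in> Z'" "\<And>f. \<pi> f = 0 \<longleftrightarrow> f \<in> Z'"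
    using subspace_projection[OF sub] by metis
  have \<pi>m: "\<pi> (f - g) = \<pi> f - \<pi> g" for f g
    using \<pi>(1)[of "f - g" g] by simp
  \<comment> \<open>The left ideal property: changing the argument by an element of
    \<open>Z'\<close> before multiplying does not affect the projection. This makes \<rho>
    multiplicative.\<close>
  have pi_eq: "\<pi> (f * \<pi> g) = \<pi> (f * g)" for f g
  proof -
    have "f * (g - \<pi> g) \<in> Z'" using \<pi>(3) Z'l by blast
    then have "\<pi> (f * g - f * \<pi> g) = 0" by (simp add: \<pi>(4) algebra_simps)
    then show ?thesis by (simp add: \<pi>m)
  qed
  define \<rho> where "\<rho> f = Endo (\<lambda>v. \<pi> (f * v))" for f
  define \<kappa> where "\<kappa> c = Endo (\<lambda>v. scal c * v :: ('g, 'k) free)" for c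
  have app_rho: "app (\<rho> f) v = \<pi> (f * v)" for f v
    unfolding \<rho>_def by (subst Endo_inverse) (auto simp: \<pi> algebra_simps)
  have app_kappa: "app (\<kappa> c) v = scal c * v" for c v
    unfolding \<kappa>_def by (subst Endo_inverse) (auto simp: algebra_simps)
  have hom: "alg_hom \<rho> \<kappa>"
  proof
    fix f g :: "('g, 'k) free" and c d :: 'k
    show "\<rho> (f + g) = \<rho> f + \<rho> g"
      by (rule endo_eqI) (simp add: app_rho \<pi>(1) distrib_right)
    show "\<rho> (f * g) = \<rho> f * \<rho> g"
      by (rule endo_eqI) (simp add: app_rho pi_eq mult.assoc)
    show "\<rho> (scal c * f) = \<kappa> c * \<rho> f"
      by (rule endo_eqI) (simp add: app_rho app_kappa \<pi>(2) mult.assoc)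
    show "\<kappa> c * \<rho> f = \<rho> f * \<kappa> c"
    proof (rule endo_eqI)
      fix v
      have "f * (scal c * v) = scal c * (f * v)" by (metis scal_comm mult.assoc)
      then show "app (\<kappa> c * \<rho> f) v = app (\<rho> f * \<kappa> c) v"
        by (simp add: app_rho app_kappa \<pi>(2))
    qed
    show "\<kappa> 1 = 1"
      by (rule endo_eqI) (simp add: app_kappa)
    show "\<kappa> (c + d) = \<kappa> c + \<kappa> d"
      by (rule endo_eqI) (simp only: app_kappa app_simps scal_add distrib_right)
    show "\<kappa> (c * d) = \<kappa> c * \<kappa> d"
      by (rule endo_eqI) (simp only: app_kappa app_simps scal_mult mult.assoc)
  qed
  have kernel: "\<rho> f = 0 \<longleftrightarrow> f \<in> Rideal G Rel" if f: "f \<in> carrier (free_alg G)" for f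
  proof -
    have "\<rho> f = 0 \<longleftrightarrow> f \<in> Z'"
    proof
      assume "\<rho> f = 0"
      \<comment> \<open>Evaluation at \<open>1\<close> recovers the projection of \<open>f\<close>
        itself; the converse below uses that \<open>Z'\<close> is a right ideal.\<close>
      then have "app (\<rho> f) 1 = 0" by simp
      then show "f \<in> Z'" by (simp add: app_rho \<pi>(4))
    next
      assume "f \<in> Z'"
      then show "\<rho> f = 0" by (intro endo_eqI) (simp add: app_rho \<pi>(4) Z'r)
    qed
    then show ?thesis using restrict_words(4)[OF f] by (simp add: Z'_def)
  qed
  show thesis by (rule that[OF hom kernel])
qed

section \<open>Sequences and their expansions\<close>

lemma length_swap [simp]: "length (swap p i) = length i"
  by (simp add: swap_def)

lemma swap_append2 [simp]: "length u = p ==> swap p (u @ a # b # v) = u @ b # a # v"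
  by (auto simp: swap_def list_update_append nth_append)

lemma swap_nth [simp]:
  assumes "Suc p < length i"
  shows "swap p i ! p = i ! Suc p" "swap p i ! Suc p = i ! p"
    "q \<noteq> p ==> q \<noteq> Suc p ==> swap p i ! q = i ! q"
  using assms by (auto simp: swap_def nth_list_update)

lemma swap_swap [simp]: "Suc p < length i ==> swap p (swap p i) = i"
  by (rule nth_equalityI) (auto simp: swap_def nth_list_update)

lemma mset_swap [simp]: "Suc p < length i ==> mset (swap p i) = mset i"
  unfolding swap_def by (rule mset_swap) auto

lemma set_swap [simp]: "Suc p < length i ==> set (swap p i) = set i"
  by (metis mset_swap set_mset_mset)

lemma distinct_swap [simp]: "Suc p < length i ==> distinct (swap p i) = distinct i"
  by (rule mset_eq_imp_distinct_iff) simp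

lemma map_swap: "Suc p < length i ==> map f (swap p i) = swap p (map f i)"
  by (simp add: swap_def map_update)

lemma swap_same: "Suc p < length i ==> i ! p = i ! Suc p ==> swap p i = i"
  by (rule nth_equalityI) (auto simp: swap_def nth_list_update)

lemma swap_words: "w \<in> words L n ==> Suc p < n ==> swap p w \<in> words L n"
  by (auto simp: words_def)

lemma split_two:
  assumes "Suc p < length i"
  obtains u v where "i = u @ i ! p # i ! Suc p # v" "length u = p"
  using assms that[of "take p i" "drop (Suc (Suc p)) i"]
  by (simp add: Cons_nth_drop_Suc id_take_nth_drop)

lemma split_three:
  assumes "Suc (Suc p) < length i"
  obtains u v where "i = u @ i ! p # i ! Suc p # i ! Suc (Suc p) # v" "length u = p"
  using assms that[of "take p i" "drop (Suc (Suc (Suc p))) i"]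
  by (simp add: Cons_nth_drop_Suc id_take_nth_drop)

abbreviation thicks :: "entry list => entry list" where "thicks \<equiv> filter (\<lambda>x. \<not> is_solid x)"
abbreviation solids :: "entry list => entry list" where "solids \<equiv> filter is_solid"

lemma is_solid_iff: "is_solid x \<longleftrightarrow> (\<exists>a. x = Solid a)"
  by (cases x) auto

lemma not_is_solid_iff: "\<not> is_solid x \<longleftrightarrow> (\<exists>k. x = Thick k)"
  by (cases x) auto

text \<open>Membership in a shuffle becomes a condition on the sublists of solid and of thick
  entries, which a swap of neighbours changes in a controlled way.\<close>

lemma Seq_iff:
  "i \<in> Seq lam nu \<longleftrightarrow> thicks i = map Thick [0..<length lam] \<and> mset (solids i) = mset (map Solid nu)"
proof
  assume "i \<in> Seq lam nu"
  then obtain nu' where nu': "mset nu' = mset nu" "i \<in> shuffles (map Solid nu') (map Thick [0..<length lam])"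
    by (auto simp: Seq_def)
  have "solids i = map Solid nu'"
    using filter_shuffles_disjoint1(1)[OF _ nu'(2)] filter_shuffles[of is_solid "map Solid nu'" "map Thick [0..<length lam]"] nu'(2)
    by (auto simp: filter_map o_def)
  moreover have "thicks i = map Thick [0..<length lam]"
    using filter_shuffles[of "\<lambda>x. \<not> is_solid x" "map Solid nu'" "map Thick [0..<length lam]"] nu'(2)
    by (auto simp: filter_map o_def)
  ultimately show "thicks i = map Thick [0..<length lam] \<and> mset (solids i) = mset (map Solid nu)"
    using nu'(1) by (metis mset_map)
next
  assume i: "thicks i = map Thick [0..<length lam] \<and> mset (solids i) = mset (map Solid nu)"
  define nu' where "nu' = map (\<lambda>x. case x of Solid a => a | Thick k => k) (solids i)"
  have s: "solids i = map Solid nu'"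
    unfolding nu'_def map_map by (rule map_idI[symmetric]) (auto simp: is_solid_iff)
  then have "mset nu' = mset nu"
    using i inj_eq[OF multiset.inj_map[of Solid], of "mset nu'" "mset nu"] by (simp add: inj_def)
  moreover have "i \<in> shuffles (map Solid nu') (map Thick [0..<length lam])"
    using partition_in_shuffles[of i is_solid] i s by metis
  ultimately show "i \<in> Seq lam nu" by (auto simp: Seq_def)
qed

lemma Seq_length: "i \<in> Seq lam nu ==> length i = length lam + length nu"
  using sum_length_filter_compl[of is_solid i] unfolding Seq_iff
  by (metis add.commute length_map length_upt minus_nat.diff_0 size_mset)

lemma Seq_set: "i \<in> Seq lam nu ==> set i = Solid ` set nu \<union> Thick ` {..<length lam}"
proof -
  assume i: "i \<in> Seq lam nu"
  have "set i = set (solids i) \<union> set (thicks i)" by auto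
  also have "set (solids i) = Solid ` set nu"
    using i unfolding Seq_iff by (metis set_mset_mset list.set_map)
  also have "set (thicks i) = Thick ` {..<length lam}"
    using i unfolding Seq_iff by (simp add: atLeast_upt)
  finally show ?thesis .
qed

lemma finite_Seq [simp]: "finite (Seq lam nu)"
proof (rule finite_subset)
  show "Seq lam nu \<subseteq> {i. set i \<subseteq> Solid ` set nu \<union> Thick ` {..<length lam} \<and> length i = length lam + length nu}"
    using Seq_set Seq_length by blast
  show "finite \<dots>" by (rule finite_lists_length_eq) simp
qed

lemma Seq_swap:
  assumes "i \<in> Seq lam nu" "Suc p < length i" "is_solid (i ! p) \<or> is_solid (i ! Suc p)"
  shows "swap p i \<in> Seq lam nu"
proof -
  obtain u v where i: "i = u @ i ! p # i ! Suc p # v" "length u = p"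
    using split_two[OF assms(2)] .
  then have s: "swap p i = u @ i ! Suc p # i ! p # v"
    by (metis swap_append2)
  have "thicks (swap p i) = thicks i" "mset (solids (swap p i)) = mset (solids i)"
    using assms(3) by (subst (2) i(1); auto simp: s)+
  then show ?thesis using assms(1) by (simp add: Seq_iff)
qed

lemma thick_order:
  assumes "i \<in> Seq lam nu" "p < p'" "p' < length i" "i ! p = Thick k" "i ! p' = Thick k'"
  shows "k < k'"
proof -
  define u where "u = drop (Suc p) i"
  have "i = take p i @ Thick k # u"
    using id_take_nth_drop[of p i] assms by (simp add: u_def)
  moreover have "u = take (p' - Suc p) u @ Thick k' # drop (Suc (p' - Suc p)) u"
    using id_take_nth_drop[of "p' - Suc p" u] assms by (simp add: u_def)
  ultimately have "thicks i = thicks (take p i) @ Thick k # thicks (take (p' - Suc p) u) @ Thick k' # thicks (drop (Suc (p' - Suc p)) u)"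
    by (metis filter.simps(2) filter_append is_solid.simps(2))
  moreover have "sorted_wrt (\<lambda>a b. case (a, b) of (Thick k, Thick l) => k < l | _ => True) (thicks i)"
    using assms(1) by (simp add: Seq_iff sorted_wrt_map)
  ultimately show ?thesis by (simp add: sorted_wrt_append)
qed

lemma thick_pos:
  assumes "i \<in> Seq lam nu" "k < length lam"
  shows "thick_pos i k < length i" "i ! thick_pos i k = Thick k"
proof -
  have "Thick k \<in> set i" using assms by (auto simp: Seq_set)
  then obtain p where p: "p < length i" "i ! p = Thick k" by (metis in_set_conv_nth)
  have "thick_pos i k = p" unfolding thick_pos_def
  proof (rule the_equality)
    fix q assume "q < length i \<and> i ! q = Thick k"
    then show "q = p" using thick_order[OF assms(1), of p q] thick_order[OF assms(1), of q p] p
      by (metis less_irrefl linorder_neqE_nat)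
  qed (use p in auto)
  with p show "thick_pos i k < length i" "i ! thick_pos i k = Thick k" by auto
qed

lemma thick_pos_eq:
  assumes "i \<in> Seq lam nu" "p < length i" "i ! p = Thick k"
  shows "thick_pos i k = p" "k < length lam"
proof -
  show k: "k < length lam"
    using assms Seq_set[OF assms(1)] nth_mem[OF assms(2)] by auto
  show "thick_pos i k = p"
    using thick_pos[OF assms(1) k] thick_order[OF assms(1), of p "thick_pos i k"]
      thick_order[OF assms(1), of "thick_pos i k" p] assms
    by (metis less_irrefl linorder_neqE_nat)
qed

lemma thick_pos_mono:
  assumes "i \<in> Seq lam nu" "k < k'" "k' < length lam"
  shows "thick_pos i k < thick_pos i k'"
  using thick_order[OF assms(1), of "thick_pos i k'" "thick_pos i k" k' k] thick_pos[OF assms(1)] assms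
  by (metis entry.inject(2) less_asym linorder_neqE_nat order.strict_trans)

lemma length_expand_thick [simp]:
  "length (concat (map (\<lambda>a. replicate (f a) (Bar a)) [1..<Suc N])) = weight_size N f"
proof -
  have "length (concat (map (\<lambda>a. replicate (f a) (Bar a)) [1..<Suc N])) = sum_list (map f [1..<Suc N])"
    by (simp add: length_concat o_def)
  also have "\<dots> = weight_size N f"
    unfolding weight_size_def by (metis atLeastLessThanSuc_atLeastAtMost interv_sum_list_conv_sum_set_nat set_upt)
  finally show ?thesis .
qed

lemma length_expand_Thick [simp]:
  "length (expand_entry N lam (Thick k)) = weight_size N (lam ! k)"
  using length_expand_thick[of "lam ! k" N] by (simp del: upt_Suc length_expand_thick)

declare expand_entry.simps(2) [simp del]

lemma expand_append [simp]: "expand N lam (i @ j) = expand N lam i @ expand N lam j"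
  and expand_Cons [simp]: "expand N lam (x # i) = expand_entry N lam x @ expand N lam i"
  and expand_Nil [simp]: "expand N lam [] = []"
  by (simp_all add: expand_def)

lemma first_strand_Suc:
  "p < length i ==> first_strand N lam i (Suc p) = first_strand N lam i p + length (expand_entry N lam (i ! p))"
  by (simp add: first_strand_def take_Suc_conv_app_nth)

lemma first_strand_mono: "p \<le> q ==> first_strand N lam i p \<le> first_strand N lam i q"
  unfolding first_strand_def
  by (metis (no_types, lifting) append_take_drop_id expand_append le_add1 length_append min.absorb1 take_take)

lemma first_strand_le: "first_strand N lam i p \<le> length (expand N lam i)"
  unfolding first_strand_def by (metis append_take_drop_id expand_append le_add1 length_append)

lemma first_strand_swap:
  assumes "Suc p < length i" "r \<noteq> Suc p"
  shows "first_strand N lam (swap p i) r = first_strand N lam i r"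
proof -
  obtain u v where i: "i = u @ i ! p # i ! Suc p # v" "length u = p"
    using split_two[OF assms(1)] .
  then have s: "swap p i = u @ i ! Suc p # i ! p # v" by (metis swap_append2)
  show ?thesis
  proof (cases "r \<le> p")
    case True
    then have "take r (swap p i) = take r i"
      by (subst i(1), subst s) (simp add: i(2))
    then show ?thesis by (simp add: first_strand_def)
  next
    case False
    then obtain r' where r: "r = p + 2 + r'" using assms(2)
      by (metis add_2_eq_Suc' le_Suc_ex not_less_eq_eq le_antisym le_SucE add_Suc_right add.commute)
    then show ?thesis unfolding first_strand_def
      by (subst (2) i(1), subst s) (simp add: i(2))
  qed
qed

lemma first_strand_swap_Suc:
  assumes "Suc p < length i"
  shows "first_strand N lam (swap p i) (Suc p) = first_strand N lam i p + length (expand_entry N lam (i ! Suc p))"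
  using first_strand_Suc[of p "swap p i" N lam] first_strand_swap[OF assms, of p N lam] assms by simp

lemma expand_split:
  assumes "Suc p < length i"
  obtains u z where "expand N lam i = u @ expand_entry N lam (i ! p) @ expand_entry N lam (i ! Suc p) @ z"
    "expand N lam (swap p i) = u @ expand_entry N lam (i ! Suc p) @ expand_entry N lam (i ! p) @ z"
    "length u = first_strand N lam i p"
proof -
  obtain u v where i: "i = u @ i ! p # i ! Suc p # v" "length u = p"
    using split_two[OF assms(1)] .
  then have s: "swap p i = u @ i ! Suc p # i ! p # v" by (metis swap_append2)
  show thesis
  proof (rule that[of "expand N lam u" "expand N lam v"])
    show "expand N lam i = expand N lam u @ expand_entry N lam (i ! p) @ expand_entry N lam (i ! Suc p) @ expand N lam v"
      by (subst i(1)) simp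
    show "expand N lam (swap p i) = expand N lam u @ expand_entry N lam (i ! Suc p) @ expand_entry N lam (i ! p) @ expand N lam v"
      by (subst s) simp
    have "u = take p i" by (subst i(1)) (simp add: i(2))
    then show "length (expand N lam u) = first_strand N lam i p" by (simp add: first_strand_def)
  qed
qed

lemma expand_nth:
  assumes "p < length i" "j < length (expand_entry N lam (i ! p))"
  shows "expand N lam i ! (first_strand N lam i p + j) = expand_entry N lam (i ! p) ! j"
proof -
  have "i = take p i @ i ! p # drop (Suc p) i" using assms by (simp add: id_take_nth_drop)
  then have "expand N lam i = expand N lam (take p i) @ expand_entry N lam (i ! p) @ expand N lam (drop (Suc p) i)"
    by (metis expand_Cons expand_append)
  then show ?thesis using assms by (simp add: first_strand_def nth_append)
qed

lemma thick_word_nth: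
  assumes "a \<in> {1..N}" "j < (lam ! k) a"
  shows "expand_entry N lam (Thick k) ! ((\<Sum>b\<in>{1..<a}. (lam ! k) b) + j) = Bar a"
proof -
  have u: "[1..<Suc N] = [1..<a] @ a # [Suc a..<Suc N]"
  proof -
    have "[1..<Suc N] = [1..<a] @ [a..<Suc N]"
      using assms upt_add_eq_append[of 1 a "Suc N - a"] by simp
    then show ?thesis using assms by (simp add: upt_conv_Cons del: upt_Suc)
  qed
  have "length (concat (map (\<lambda>a. replicate ((lam ! k) a) (Bar a)) [1..<a])) = (\<Sum>b\<in>{1..<a}. (lam ! k) b)"
    by (simp add: length_concat o_def interv_sum_list_conv_sum_set_nat)
  then show ?thesis using assms unfolding expand_entry.simps u by (simp add: nth_append)
qed

lemma block_sum_le: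
  assumes "a \<in> {1..N}"
  shows "(\<Sum>b\<in>{1..<a}. f b) + f a \<le> weight_size N (f :: nat => nat)"
proof -
  have "(\<Sum>b\<in>{1..<a}. f b) + f a = (\<Sum>b\<in>{1..a}. f b)"
    using assms by (metis atLeastAtMost_iff atLeastLessThanSuc_atLeastAtMost sum.atLeastLessThan_Suc)
  also have "\<dots> \<le> weight_size N f"
    unfolding weight_size_def using assms by (intro sum_mono2) auto
  finally show ?thesis .
qed

lemma block_bounds:
  assumes "i \<in> Seq lam nu" "k < length lam" "a \<in> {1..N}"
  shows "first_strand N lam i (thick_pos i k) \<le> block_start N lam i k a"
    "block_start N lam i k a + (lam ! k) a \<le> first_strand N lam i (Suc (thick_pos i k))"
    "j < (lam ! k) a ==> expand N lam i ! (block_start N lam i k a + j) = Bar a"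
proof -
  note tp = thick_pos[OF assms(1,2)]
  show "first_strand N lam i (thick_pos i k) \<le> block_start N lam i k a"
    by (simp add: block_start_def)
  show "block_start N lam i k a + (lam ! k) a \<le> first_strand N lam i (Suc (thick_pos i k))"
    using block_sum_le[OF assms(3), of "lam ! k"] by (simp add: block_start_def first_strand_Suc tp del: upt_Suc)
  show "j < (lam ! k) a ==> expand N lam i ! (block_start N lam i k a + j) = Bar a"
    using expand_nth[OF tp(1), of "(\<Sum>b\<in>{1..<a}. (lam ! k) b) + j" N lam] thick_word_nth[OF assms(3), of j lam k]
      block_sum_le[OF assms(3), of "lam ! k"]
    by (simp add: block_start_def tp add.assoc del: upt_Suc)
qed

lemma block_order:
  assumes i: "i \<in> Seq lam nu" and k: "k < length lam" "k' < length lam" and a: "a \<in> {1..N}" "a' \<in> {1..N}"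
    and lt: "k < k' \<or> k = k' \<and> a < a'"
  shows "block_start N lam i k a + (lam ! k) a \<le> block_start N lam i k' a'"
proof (cases "k < k'")
  case True
  have "first_strand N lam i (Suc (thick_pos i k)) \<le> first_strand N lam i (thick_pos i k')"
    using thick_pos_mono[OF i True k(2)] by (intro first_strand_mono) simp
  then show ?thesis
    using block_bounds(2)[OF i k(1) a(1)] block_bounds(1)[OF i k(2) a(2)] by linarith
next
  case False
  then have lt: "k = k'" "a < a'" using lt by auto
  have "(\<Sum>b\<in>{1..<a}. (lam ! k) b) + (lam ! k) a \<le> (\<Sum>b\<in>{1..<a'}. (lam ! k) b)"
  proof -
    have "(\<Sum>b\<in>{1..<a}. (lam ! k) b) + (lam ! k) a = (\<Sum>b\<in>{1..<Suc a}. (lam ! k) b)"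
      using a by simp
    also have "\<dots> \<le> (\<Sum>b\<in>{1..<a'}. (lam ! k) b)"
      using lt by (intro sum_mono2) auto
    finally show ?thesis .
  qed
  then show ?thesis by (simp add: block_start_def lt)
qed

lemma block_start_swap:
  assumes i: "i \<in> Seq lam nu" and p: "Suc p < length i" and s: "is_solid (i ! p) \<or> is_solid (i ! Suc p)"
    and k: "k < length lam"
  shows "i ! p \<noteq> Thick k ==> i ! Suc p \<noteq> Thick k ==> block_start N lam (swap p i) k a = block_start N lam i k a"
    and "i ! p = Thick k ==> block_start N lam (swap p i) k a = Suc (block_start N lam i k a)"
    and "i ! Suc p = Thick k ==> Suc (block_start N lam (swap p i) k a) = block_start N lam i k a"
proof -
  have i': "swap p i \<in> Seq lam nu" using Seq_swap[OF i p s] .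
  note tp = thick_pos[OF i k]
  show "block_start N lam (swap p i) k a = block_start N lam i k a" if "i ! p \<noteq> Thick k" "i ! Suc p \<noteq> Thick k"
  proof -
    have "thick_pos i k \<noteq> p" "thick_pos i k \<noteq> Suc p" using that tp by auto
    then have "thick_pos (swap p i) k = thick_pos i k"
      using p tp by (intro thick_pos_eq(1)[OF i']) auto
    then show ?thesis using first_strand_swap[OF p] \<open>thick_pos i k \<noteq> Suc p\<close> by (simp add: block_start_def)
  qed
  show "block_start N lam (swap p i) k a = Suc (block_start N lam i k a)" if ip: "i ! p = Thick k"
  proof -
    have "thick_pos i k = p" using ip p by (intro thick_pos_eq(1)[OF i]) auto
    moreover have "thick_pos (swap p i) k = Suc p"
      using p ip by (intro thick_pos_eq(1)[OF i']) auto
    moreover obtain b where "i ! Suc p = Solid b" using s ip by (auto simp: is_solid_iff)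
    ultimately show ?thesis using first_strand_swap_Suc[OF p] by (simp add: block_start_def)
  qed
  show "Suc (block_start N lam (swap p i) k a) = block_start N lam i k a" if ip: "i ! Suc p = Thick k"
  proof -
    have "thick_pos i k = Suc p" using ip p by (intro thick_pos_eq(1)[OF i]) auto
    moreover have "thick_pos (swap p i) k = p"
      using p ip by (intro thick_pos_eq(1)[OF i']) auto
    moreover obtain b where "i ! p = Solid b" using s ip by (auto simp: is_solid_iff)
    ultimately show ?thesis using first_strand_swap[OF p, of p] first_strand_Suc[of p i] p by (simp add: block_start_def)
  qed
qed

lemma expand_length:
  assumes "i \<in> Seq lam nu"
  shows "length (expand N lam i) = strands N lam nu"
proof -
  have "length (expand N lam j) = sum_list (map (\<lambda>x. length (expand_entry N lam x)) (thicks j)) + length (solids j)" for j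
    by (induction j) (auto simp: is_solid_iff)
  moreover have "map (\<lambda>x. length (expand_entry N lam x)) (thicks i) = map (weight_size N) lam"
    using assms unfolding Seq_iff by (auto intro: nth_equalityI)
  moreover have "length (solids i) = length nu"
    using assms unfolding Seq_iff by (metis length_map size_mset)
  ultimately show ?thesis by (simp add: strands_def)
qed

lemma expand_words:
  assumes "i \<in> Seq lam nu" "set nu \<subseteq> {1..N}"
  shows "expand N lam i \<in> words (ext_index N) (strands N lam nu)"
proof -
  have "set (expand_entry N lam x) \<subseteq> ext_index N" if "x \<in> set i" for x
  proof (cases x)
    case (Solid a)
    then have "a \<in> set nu" using that Seq_set[OF assms(1)] by auto
    then show ?thesis using Solid assms(2) by (auto simp: ext_index_def)
  qed (auto simp: ext_index_def expand_entry.simps simp del: upt_Suc)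
  then have "set (expand N lam i) \<subseteq> ext_index N" by (auto simp: expand_def)
  then show ?thesis using expand_length[OF assms(1)] by (simp add: words_def)
qed

lemma expand_entry_Thick_eq_Nil:
  assumes "expand_entry N lam (Thick k) = []" "a \<in> {1..N}"
  shows "(lam ! k) a = 0"
  using assms by (auto simp: expand_entry.simps simp del: upt_Suc)

text \<open>Reading from the left, the first letter tells whether the next entry is solid or thick,
  and the common list of thick entries then tells which thick entry it is. An empty expansion would
  have no first letter.\<close>

lemma expand_inj_aux:
  assumes "thicks i = thicks j" "expand N lam i = expand N lam j"
    "\<And>x. x \<in> set (thicks i) ==> expand_entry N lam x \<noteq> []"
  shows "i = j"
  using assms
proof (induction i arbitrary: j)
  case Nil
  show ?case
  proof (cases j)
    case (Cons y j')
    then show ?thesis using Nil by (cases y) auto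
  qed simp
next
  case (Cons x i)
  have ne: "expand_entry N lam x \<noteq> []"
    using Cons.prems(3)[of x] by (cases x) auto
  then obtain y j' where j: "j = y # j'"
    using Cons.prems(2) by (cases j) auto
  have hd_thick: "\<exists>a. hd (expand_entry N lam (Thick k)) = Bar a" if "expand_entry N lam (Thick k) \<noteq> []" for k
  proof -
    have "hd (expand_entry N lam (Thick k)) \<in> set (expand_entry N lam (Thick k))"
      using that by (rule hd_in_set)
    then show ?thesis by (auto simp: expand_entry.simps)
  qed
  have ney: "expand_entry N lam y \<noteq> []"
  proof (cases y)
    case (Thick k)
    then have "y \<in> set (thicks (x # i))" using Cons.prems(1) j by simp
    then show ?thesis by (rule Cons.prems(3))
  qed simp
  have "hd (expand_entry N lam x) = hd (expand_entry N lam y)"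
    using Cons.prems(2) ne ney j by (metis expand_Cons hd_append2)
  then have "x = y"
    using Cons.prems(1) j hd_thick ne ney
    by (cases x; cases y) (auto, (metis lab.distinct(1))+)
  moreover have "i = j'"
    using Cons j \<open>x = y\<close> by (intro Cons.IH) (auto split: if_splits)
  ultimately show ?case using j by simp
qed

text \<open>Without solid entries a sequence equals its list of thick entries, so empty expansions
  do no harm in that case.\<close>

lemma expand_inj:
  assumes "nu = [] \<or> (\<forall>k<length lam. \<exists>a\<in>{1..N}. (lam ! k) a \<noteq> 0)"
    and i: "i \<in> Seq lam nu" and j: "j \<in> Seq lam nu" and e: "expand N lam i = expand N lam j"
  shows "i = j"
proof (cases "nu = []")
  case True
  then have "solids i = []" "solids j = []" using i j unfolding Seq_iff by auto
  then have "i = thicks i" "j = thicks j" by (auto simp: filter_empty_conv filter_id_conv)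
  then show ?thesis using i j unfolding Seq_iff by metis
next
  case False
  show ?thesis
  proof (rule expand_inj_aux)
    show "thicks i = thicks j" using i j by (simp add: Seq_iff)
    fix x assume "x \<in> set (thicks i)"
    then have "x \<in> set (map Thick [0..<length lam])" using i by (metis Seq_iff)
    then obtain k where "x = Thick k" "k < length lam" by auto
    then show "expand_entry N lam x \<noteq> []"
      using assms(1) False expand_entry_Thick_eq_Nil by metis
  qed (fact e)
qed

section \<open>Moving elements through crossings\<close>

text \<open>The crossing \<open>C\<close> applied to the idempotent \<open>E\<close> carries \<open>g\<close> to \<open>h\<close>.\<close>

definition transports :: "'r::ring_1 => 'r => 'r => 'r => bool"
  where "transports C E g h \<longleftrightarrow> g * E = E * g \<and> C * g * E = h * C * E"

lemma transportsI: "g * E = E * g ==> C * g * E = h * C * E ==> transports C E g h"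
  by (simp add: transports_def)

lemma transports_comm: "g * E = E * g ==> C * g = g * C ==> transports C E g g"
  by (simp add: transports_def)

lemma transports_mult:
  assumes "transports C E g h" "transports C E g' h'"
  shows "transports C E (g * g') (h * h')"
proof (rule transportsI)
  show "g * g' * E = E * (g * g')" using assms unfolding transports_def by (metis mult.assoc)
  have "C * (g * g') * E = C * g * E * g'" using assms unfolding transports_def by (metis mult.assoc)
  also have "\<dots> = h * C * E * g'" using assms by (simp add: transports_def)
  also have "\<dots> = h * (C * g' * E)" using assms unfolding transports_def by (metis mult.assoc)
  also have "\<dots> = h * h' * C * E" using assms unfolding transports_def by (metis mult.assoc)
  finally show "C * (g * g') * E = h * h' * C * E" .
qed

lemma transports_one: "transports C E 1 1" and transports_zero: "transports C E 0 0"
  by (auto simp: transports_def)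

lemma transports_add: "transports C E g h ==> transports C E g' h' ==> transports C E (g + g') (h + h')"
  by (simp add: transports_def distrib_left distrib_right left_diff_distrib right_diff_distrib)

lemma transports_diff: "transports C E g h ==> transports C E g' h' ==> transports C E (g - g') (h - h')"
  by (simp add: transports_def distrib_left distrib_right left_diff_distrib right_diff_distrib)

lemma transports_minus: "transports C E g h ==> transports C E (- g) (- h)"
  by (simp add: transports_def)

lemma transports_power: "transports C E g h ==> transports C E (g ^ k) (h ^ k)"
  by (induction k) (auto intro: transports_one transports_mult)

lemma transports_sum: "(\<And>a. a \<in> A ==> transports C E (g a) (h a)) ==> transports C E (sum g A) (sum h A)"
  by (induction A rule: infinite_finite_induct) (auto intro: transports_zero transports_add)

lemma transports_prod_list:
  "(\<And>a. a \<in> set l ==> transports C E (g a) (h a)) ==> transports C E (prod_list (map g l)) (prod_list (map h l))"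
  by (induction l) (auto intro: transports_one transports_mult)

lemma transports_trans:
  assumes "transports C E g h" "transports D E' h k" "C * E = E' * C"
  shows "transports (D * C) E g k"
proof (rule transportsI)
  show "g * E = E * g" using assms by (simp add: transports_def)
  have "D * C * g * E = D * h * E' * C" using assms unfolding transports_def by (metis mult.assoc)
  also have "\<dots> = k * D * (E' * C)" using assms unfolding transports_def by (metis mult.assoc)
  also have "\<dots> = k * (D * C) * E" using assms by (simp add: mult.assoc)
  finally show "D * C * g * E = k * (D * C) * E" .
qed

lemma transportsD: "transports C E g h ==> C * (g * E) = h * (C * E)"
  by (metis transports_def mult.assoc)

lemma transports_idem: "transports C E g h ==> g * E = E * g"
  by (simp add: transports_def)

lemma comm_prod_list:
  fixes c :: "'r::ring_1"
  shows "(\<And>f. f \<in> set l ==> c * f = f * c) ==> c * prod_list l = prod_list l * c"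
proof (induction l)
  case (Cons f l)
  then have "c * f = f * c" "c * prod_list l = prod_list l * c" by auto
  then show ?case by (simp, metis mult.assoc)
qed simp

lemma comm_power:
  fixes c :: "'r::ring_1"
  shows "c * f = f * c ==> c * f ^ k = f ^ k * c"
  by (metis power_commuting_commutes)

section \<open>The nilCoxeter relations\<close>

context
  fixes a :: "nat => 'r::ring_1" and m :: nat
  assumes sq: "\<And>j. j < m ==> a j * a j = 0"
    and braid: "\<And>j. Suc j < m ==> a j * a (Suc j) * a j = a (Suc j) * a j * a (Suc j)"
    and far: "\<And>j k. j < m ==> k < m ==> Suc j < k \<or> Suc k < j ==> a j * a k = a k * a j"
begin

text \<open>The largest letter of the second copy commutes back to the two largest letters of the
  first; a braid relation then exposes the square of the shorter descending run.\<close>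

lemma nilcox_desc_sq:
  "0 < k ==> k \<le> m ==> prod_list (map a (rev [0..<k])) * prod_list (map a (rev [0..<k])) = 0"
proof (induction k)
  case (Suc k)
  let ?D = "\<lambda>k. prod_list (map a (rev [0..<k]))"
  show ?case
  proof (cases k)
    case 0
    then show ?thesis using Suc sq by simp
  next
    case (Suc l)
    have DS: "?D (Suc k) = a k * ?D k" for k by simp
    have c: "a (Suc l) * ?D l = ?D l * a (Suc l)"
      using Suc.prems Suc by (intro comm_prod_list) (auto intro!: far)
    have "?D (Suc k) * ?D (Suc k) = a (Suc l) * a l * (?D l * a (Suc l)) * a l * ?D l"
      by (simp only: DS Suc mult.assoc)
    also have "\<dots> = a (Suc l) * a l * a (Suc l) * ?D l * a l * ?D l"
      by (simp only: c[symmetric] mult.assoc)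
    also have "\<dots> = a l * a (Suc l) * a l * ?D l * a l * ?D l"
      using braid[of l] Suc.prems Suc by simp
    also have "\<dots> = a l * a (Suc l) * (?D k * ?D k)"
      by (simp only: DS Suc mult.assoc)
    also have "\<dots> = 0" using Suc.IH Suc.prems Suc by simp
    finally show ?thesis .
  qed
qed simp

text \<open>A letter in front of a reduced word of the longest element makes it nonreduced. For the
  last letter this is explicit: it commutes up to the last but one descending run and extends it to
  a copy of the last run, whose square vanishes.\<close>

lemma nilcox_longest:
  "j < k ==> k \<le> m ==>
    a j * prod_list (map (\<lambda>j. prod_list (map a (rev [0..<j]))) [1..<Suc k]) = 0"
proof (induction k)
  case (Suc k)
  let ?D = "\<lambda>k. prod_list (map a (rev [0..<k]))"
  let ?P = "\<lambda>k. prod_list (map ?D [1..<Suc k])"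
  have PS: "?P (Suc k) = ?P k * ?D (Suc k)" for k by simp
  show ?case
  proof (cases "j < k")
    case True
    then have "a j * ?P k = 0" using Suc by simp
    then show ?thesis unfolding PS by (metis mult.assoc mult_zero_left)
  next
    case False
    then have j: "j = k" using Suc by simp
    show ?thesis
    proof (cases k)
      case 0
      then show ?thesis using j sq Suc by simp
    next
      case (Suc l)
      have c: "a k * ?P l = ?P l * a k"
        using Suc.prems Suc by (intro comm_prod_list) (auto intro!: comm_prod_list far simp del: upt_Suc)
      have "a j * ?P (Suc k) = (a k * ?P l) * ?D (Suc l) * ?D (Suc k)"
        unfolding PS j unfolding Suc PS by (simp only: mult.assoc)
      also have "\<dots> = ?P l * (a k * ?D k) * ?D (Suc k)"
        unfolding c unfolding Suc by (simp only: mult.assoc)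
      also have "a k * ?D k = ?D (Suc k)" by simp
      also have "?P l * ?D (Suc k) * ?D (Suc k) = ?P l * (?D (Suc k) * ?D (Suc k))"
        by (simp only: mult.assoc)
      also have "\<dots> = 0" using nilcox_desc_sq[of "Suc k"] Suc.prems by simp
      finally show ?thesis .
    qed
  qed
qed simp

end

section \<open>Relations in a Khovanov-Lauda-Rouquier algebra\<close>

locale klr = alg_hom \<rho> \<kappa> for \<rho> :: "(lab gens, 'k::field) free => 'r::ring_1" and \<kappa> +
  fixes N :: nat and B :: "nat => nat => int" and t :: "lab => lab => 'k" and n :: nat
  assumes cartan: "cartan_datum N B"
    and scalars: "\<And>i j. i \<in> ext_index N ==> j \<in> ext_index N ==>
      t i j = (if \<exists>k\<in>{1..N}. i = Bar k \<and> j = Orig k then - 1 else 1)"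
    and kills: "r \<in> klr_rels (ext_index N) (ext_form B) t n ==> \<rho> r = 0"
begin

abbreviation "W \<equiv> words (ext_index N) n"
abbreviation "ee w \<equiv> \<rho> (\<e> w)"
abbreviation "xx p \<equiv> \<rho> (\<x> p)"
abbreviation "ps p \<equiv> \<rho> (\<psi> p)"

lemma ee_ee: "w \<in> W ==> v \<in> W ==> ee w * ee v = (if w = v then ee w else 0)"
  using kills[OF klr_rels.idem, of w v] by (auto simp: mult split: if_splits)

lemma xx_ee: "w \<in> W ==> p < n ==> xx p * ee w = ee w * xx p"
  using kills[OF klr_rels.dot_idem, of w p] by (auto simp: mult)

lemma ps_ee: "w \<in> W ==> Suc p < n ==> ps p * ee w = ee (swap p w) * ps p"
  using kills[OF klr_rels.cross_idem, of w p] by (auto simp: mult)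

lemma xx_xx: "p < n ==> q < n ==> xx p * xx q = xx q * xx p"
  using kills[OF klr_rels.dot_dot, of p q] by (auto simp: mult)

lemma ps_xx: "Suc p < n ==> q < n ==> q \<noteq> p ==> q \<noteq> Suc p ==> ps p * xx q = xx q * ps p"
  using kills[OF klr_rels.cross_dot_far, of p q] by (auto simp: mult)

lemma ps_ps: "Suc p < n ==> Suc q < n ==> Suc p < q \<or> Suc q < p ==> ps p * ps q = ps q * ps p"
  using kills[OF klr_rels.cross_cross_far, of p q] by (auto simp: mult)

lemma slide_left: "w \<in> W ==> Suc p < n ==>
    xx p * ps p * ee w = ps p * xx (Suc p) * ee w + (if w ! p = w ! Suc p then ee w else 0)"
  using kills[OF klr_rels.slide_left, of w p] by (auto simp: mult algebra_simps add split: if_splits)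

lemma slide_right: "w \<in> W ==> Suc p < n ==>
    ps p * xx p * ee w = xx (Suc p) * ps p * ee w + (if w ! p = w ! Suc p then ee w else 0)"
  using kills[OF klr_rels.slide_right, of w p] by (auto simp: mult algebra_simps add split: if_splits)

lemma words_nth: "w \<in> W ==> p < n ==> w ! p \<in> ext_index N"
  by (auto simp: words_def)

lemma square_same: "w \<in> W ==> Suc p < n ==> w ! p = w ! Suc p ==> ps p * ps p * ee w = 0"
  using kills[OF klr_rels.square_same, of w p] by (simp add: mult power2_eq_square)

lemma rho_power: "\<rho> (f ^ k) * \<rho> h = \<rho> f ^ k * \<rho> h"
  using power_mult[of f k h] by (simp add: mult)

lemma rho_hsum: "\<rho> (hsum m f g) * \<rho> h = hsum m (\<rho> f) (\<rho> g) * \<rho> h"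
proof -
  have "\<rho> (hsum m f g * h) = hsum m (\<rho> f) (\<rho> g) * \<rho> h"
    by (simp add: hsum_def sum_distrib_right mult.assoc power_mult)
  then show ?thesis by (simp add: mult)
qed

lemma form_neg:
  assumes "a \<in> {1..N}" "b \<in> {1..N}" "a \<noteq> b" "B a b \<noteq> 0"
  shows "B a b < 0"
proof -
  have B: "B a a > 0" "B a a dvd 2 * B a b" "(2 * B a b) div B a a \<le> 0"
    using cartan assms by (auto simp: cartan_datum_def cartan_int_def)
  then have "2 * B a b \<le> 0"
    by (metis dvd_div_mult_self mult_nonpos_nonneg order_less_imp_le)
  then show ?thesis using assms by simp
qed

lemma form_diag: "a \<in> {1..N} ==> B a a > 0 \<and> even (B a a)"
  using cartan by (auto simp: cartan_datum_def)

lemma Orig_ext [simp]: "Orig a \<in> ext_index N \<longleftrightarrow> a \<in> {1..N}"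
  and Bar_ext [simp]: "Bar a \<in> ext_index N \<longleftrightarrow> a \<in> {1..N}"
  by (auto simp: ext_index_def)

text \<open>The value \<open>-1\<close> in both orders makes double crossings of \<open>k\<close>
  with its barred copy linear in the dots.\<close>

lemma cartan_int_ext:
  "cartan_int (ext_form B) (Orig a) (Orig b) = cartan_int B a b"
  "a \<in> {1..N} ==> cartan_int (ext_form B) (Orig a) (Bar a) = - 1"
  "a \<in> {1..N} ==> cartan_int (ext_form B) (Bar a) (Orig a) = - 1"
proof -
  show "cartan_int (ext_form B) (Orig a) (Orig b) = cartan_int B a b"
    by (simp add: cartan_int_def)
  assume "a \<in> {1..N}"
  then obtain c where "B a a = 2 * c" "c > 0" using form_diag[of a] by (auto elim!: evenE)
  then show "cartan_int (ext_form B) (Orig a) (Bar a) = - 1" "cartan_int (ext_form B) (Bar a) (Orig a) = - 1"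
    by (auto simp: cartan_int_def zdiv_zminus1_eq_if)
qed

lemma square_solid:
  assumes "w \<in> W" "Suc p < n" "w ! p = Orig a" "w ! Suc p = Orig b"
  shows "ps p * ps p * ee w = Q_poly B a b (xx p) (xx (Suc p)) * ee w"
proof -
  have ab: "a \<in> {1..N}" "b \<in> {1..N}"
    using words_nth[OF assms(1), of p] words_nth[OF assms(1), of "Suc p"] assms by auto
  then have t: "t (Orig a) (Orig b) = 1" "t (Orig b) (Orig a) = 1" by (auto simp: scalars)
  consider "a = b" | "a \<noteq> b" "B a b = 0" | "a \<noteq> b" "B a b < 0"
    using form_neg[OF ab] by blast
  then show ?thesis
  proof cases
    case 1
    then show ?thesis using square_same[OF assms(1,2)] assms by (simp add: Q_poly_def)
  next
    case 2
    then show ?thesis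
      using kills[OF klr_rels.square_orth[OF assms(1,2) refl refl]] assms t
      by (simp add: mult power2_eq_square Q_poly_def)
  next
    case 3
    then show ?thesis
      using kills[OF klr_rels.square_adj[OF assms(1,2) refl refl]] assms t
      by (simp add: mult power2_eq_square Q_poly_def cartan_int_ext distrib_right rho_power add)
  qed
qed

text \<open>Here the sign \<open>t (Bar k) (Orig k) = - 1\<close> matters: in either order of the
  strands the square is the dot on the solid strand minus the dot on the barred one. The product of
  such factors over a block has the elementary symmetric polynomials as coefficients, up to
  sign.\<close>

lemma square_orig_bar:
  assumes "w \<in> W" "Suc p < n" "w ! p = Orig a" "w ! Suc p = Bar c"
  shows "ps p * ps p * ee w = (if c = a then xx p - xx (Suc p) else 1) * ee w"
proof -
  have ab: "a \<in> {1..N}" "c \<in> {1..N}"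
    using words_nth[OF assms(1), of p] words_nth[OF assms(1), of "Suc p"] assms by auto
  then have t: "t (Orig a) (Bar c) = 1" "c = a ==> t (Bar c) (Orig a) = - 1" by (auto simp: scalars)
  show ?thesis
  proof (cases "c = a")
    case True
    then have "ext_form B (w ! p) (w ! Suc p) < 0" using assms form_diag[OF ab(1)] by (auto elim!: evenE)
    then show ?thesis
      using kills[OF klr_rels.square_adj[OF assms(1,2) refl refl]] assms t True ab
      by (simp add: mult power2_eq_square cartan_int_ext algebra_simps add add)
  next
    case False
    then show ?thesis
      using kills[OF klr_rels.square_orth[OF assms(1,2) refl refl]] assms t
      by (simp add: mult power2_eq_square)
  qed
qed

lemma square_bar_orig:
  assumes "w \<in> W" "Suc p < n" "w ! p = Bar c" "w ! Suc p = Orig a"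
  shows "ps p * ps p * ee w = (if c = a then xx (Suc p) - xx p else 1) * ee w"
proof -
  have ab: "a \<in> {1..N}" "c \<in> {1..N}"
    using words_nth[OF assms(1), of p] words_nth[OF assms(1), of "Suc p"] assms by auto
  then have t: "t (Orig a) (Bar c) = 1" "c = a ==> t (Bar c) (Orig a) = - 1"
    "c \<noteq> a ==> t (Bar c) (Orig a) = 1" by (auto simp: scalars)
  show ?thesis
  proof (cases "c = a")
    case True
    then have "ext_form B (w ! p) (w ! Suc p) < 0" using assms form_diag[OF ab(1)] by (auto elim!: evenE)
    then show ?thesis
      using kills[OF klr_rels.square_adj[OF assms(1,2) refl refl]] assms t True ab
      by (simp add: mult power2_eq_square cartan_int_ext algebra_simps add add)
  next
    case False
    then show ?thesis
      using kills[OF klr_rels.square_orth[OF assms(1,2) refl refl]] assms t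
      by (simp add: mult power2_eq_square)
  qed
qed

text \<open>An error term requires equal outer labels and a negative value of the form at the first
  two labels, while the form is positive on equal labels.\<close>

lemma braid_plain:
  assumes "w \<in> W" "Suc (Suc p) < n" "w ! p \<noteq> w ! Suc (Suc p) \<or> w ! p = w ! Suc p"
  shows "ps p * ps (Suc p) * ps p * ee w = ps (Suc p) * ps p * ps (Suc p) * ee w"
proof -
  have "\<not> (w ! p = w ! Suc p \<and> ext_form B (w ! p) (w ! Suc p) < 0)"
    using words_nth[OF assms(1), of p] assms(2) form_diag
    by (cases "w ! p") (auto dest!: sym[of _ "w ! Suc p"], (metis less_asym)+)
  then have no: "\<not> (w ! Suc (Suc p) = w ! p \<and> ext_form B (w ! p) (w ! Suc p) < 0)" using assms(3) by metis
  then show ?thesis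
    using kills[OF klr_rels.braid[OF assms(1,2) refl refl]] unfolding if_not_P[OF no]
    by (simp add: mult algebra_simps add)
qed

lemma braid_solid:
  assumes "w \<in> W" "Suc (Suc p) < n" "w ! p = Orig a" "w ! Suc p = Orig b" "w ! Suc (Suc p) = Orig a"
  shows "ps p * ps (Suc p) * ps p * ee w = ps (Suc p) * ps p * ps (Suc p) * ee w
    + Q_quot B a b (xx p) (xx (Suc (Suc p))) * ee w"
proof -
  have ab: "a \<in> {1..N}" "b \<in> {1..N}"
    using words_nth[OF assms(1), of p] words_nth[OF assms(1), of "Suc p"] assms by auto
  then have t: "t (Orig a) (Orig b) = 1" by (auto simp: scalars)
  consider "a = b" | "a \<noteq> b" "B a b = 0" | "a \<noteq> b" "B a b < 0"
    using form_neg[OF ab] by blast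
  then show ?thesis
  proof cases
    case 1
    then show ?thesis using braid_plain[OF assms(1,2)] assms by (simp add: Q_quot_def)
  next
    case 2
    then show ?thesis
      using kills[OF klr_rels.braid[OF assms(1,2) refl refl]] assms
      by (simp add: mult Q_quot_def algebra_simps add)
  next
    case 3
    then show ?thesis
      using kills[OF klr_rels.braid[OF assms(1,2) refl refl]] assms t
      by (simp add: mult Q_quot_def algebra_simps add rho_hsum cartan_int_ext)
  qed
qed

text \<open>The error is the divided difference of the linear polynomial of the square, hence the
  constant 1.\<close>

lemma braid_orig_bar:
  assumes "w \<in> W" "Suc (Suc p) < n" "w ! p = Orig a" "w ! Suc p = Bar c" "w ! Suc (Suc p) = Orig a"
  shows "ps p * ps (Suc p) * ps p * ee w = ps (Suc p) * ps p * ps (Suc p) * ee w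
    + (if c = a then ee w else 0)"
proof -
  have ab: "a \<in> {1..N}" "c \<in> {1..N}"
    using words_nth[OF assms(1), of p] words_nth[OF assms(1), of "Suc p"] assms by auto
  then have t: "t (Orig a) (Bar c) = 1" by (auto simp: scalars)
  show ?thesis
  proof (cases "c = a")
    case True
    then have "ext_form B (w ! p) (w ! Suc p) < 0" using assms form_diag[OF ab(1)] by (auto elim!: evenE)
    then show ?thesis
      using kills[OF klr_rels.braid[OF assms(1,2) refl refl]] assms t True ab(1)
      by (simp add: mult algebra_simps add cartan_int_ext hsum_def)
  next
    case False
    then show ?thesis
      using kills[OF klr_rels.braid[OF assms(1,2) refl refl]] assms
      by (simp add: mult algebra_simps add)
  qed
qed

end

section \<open>Moving a strand across a run of strands\<close>

lemma assoc_eq: "a * b = c ==> a * (b * z) = c * (z :: 'r::semigroup_mult)"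
  by (metis mult.assoc)

lemma assoc_comm: "a * b = b * a ==> a * (b * z) = b * (a * (z :: 'r::semigroup_mult))"
  by (metis mult.assoc)

lemma comp_comm:
  assumes "A * E = E' * A" "D * E' = E'' * D"
  shows "D * A * E = E'' * (D * (A :: 'r::semigroup_mult))"
  using assms by (metis mult.assoc)

lemma nth_append2:
  "(u @ v @ y) ! (length u + length v + j) = y ! j"
  "(u @ v @ y) ! (length u + length v) = y ! 0"
  "(u @ v @ y) ! (Suc (length u + length v)) = y ! 1"
  "(u @ v @ y) ! (Suc (Suc (length u + length v))) = y ! 2"
  using nth_append_length_plus[of "u @ v" y] nth_append_length_plus[of "u @ v" y 0]
    nth_append_length_plus[of "u @ v" y 1] nth_append_length_plus[of "u @ v" y 2]
  by (simp_all add: numeral_2_eq_2)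

lemma nth_append1:
  "(u @ y) ! Suc (length u) = y ! 1"
  "(u @ y) ! Suc (Suc (length u)) = y ! 2"
  using nth_append_length_plus[of u y 1] nth_append_length_plus[of u y 2]
  by (simp_all add: numeral_2_eq_2)

context klr
begin

text \<open>Products act from the right, so \<open>RR q m\<close> takes strand \<open>q\<close>
  rightwards over the next \<open>m\<close> strands, and \<open>LL q m\<close> takes strand
  \<open>q + m\<close> leftwards over the \<open>m\<close> strands before it.\<close>

definition "RR q m = prod_list (map ps (rev [q..<q + m]))"
definition "LL q m = prod_list (map ps [q..<q + m])"

lemma RR_0 [simp]: "RR q 0 = 1" and LL_0 [simp]: "LL q 0 = 1"
  by (simp_all add: RR_def LL_def)

lemma RR_Suc: "RR q (Suc m) = RR (Suc q) m * ps q"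
proof -
  have "[q..<q + Suc m] = q # [Suc q..<Suc q + m]" by (simp add: upt_conv_Cons del: upt_Suc)
  then show ?thesis by (simp add: RR_def del: upt_Suc)
qed

lemma RR_Suc': "RR q (Suc m) = ps (q + m) * RR q m"
  by (simp add: RR_def)

lemma LL_Suc: "LL q (Suc m) = LL q m * ps (q + m)"
  by (simp add: LL_def)

lemma LL_Suc': "LL q (Suc m) = ps q * LL (Suc q) m"
proof -
  have "[q..<q + Suc m] = q # [Suc q..<Suc q + m]" by (simp add: upt_conv_Cons del: upt_Suc)
  then show ?thesis by (simp add: LL_def del: upt_Suc)
qed

lemma comm_RR: "(\<And>r. q \<le> r ==> r < q + m ==> f * ps r = ps r * f) ==> f * RR q m = RR q m * f"
  unfolding RR_def by (rule comm_prod_list) auto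

lemma comm_LL: "(\<And>r. q \<le> r ==> r < q + m ==> f * ps r = ps r * f) ==> f * LL q m = LL q m * f"
  unfolding LL_def by (rule comm_prod_list) auto

lemma words_length: "w \<in> W ==> length w = n"
  by (simp add: words_def)

lemma words_perm: "w \<in> W ==> mset v = mset w ==> v \<in> W"
  unfolding words_def by (metis (mono_tags, lifting) mem_Collect_eq set_mset_mset size_mset)

lemma ps_ee_same: "w \<in> W ==> Suc p < n ==> w ! p = w ! Suc p ==> ps p * ee w = ee w * ps p"
  using ps_ee[of w p] swap_same[of p w] words_length[of w] by simp

lemma ps_ee_append: "u @ c # d # z \<in> W ==>
    ps (length u) * ee (u @ c # d # z) = ee (u @ d # c # z) * ps (length u)"
  using ps_ee[of "u @ c # d # z" "length u"] words_length[of "u @ c # d # z"] by simp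

lemma ps_ee_append2: "u @ v @ c # d # z \<in> W ==>
    ps (length u + length v) * ee (u @ v @ c # d # z) = ee (u @ v @ d # c # z) * ps (length u + length v)"
  using ps_ee_append[of "u @ v" c d z] by simp

lemma ps_transports_x:
  assumes "w \<in> W" "Suc p < n" "w ! p \<noteq> w ! Suc p"
  shows "transports (ps p) (ee w) (xx p) (xx (Suc p))"
    "transports (ps p) (ee w) (xx (Suc p)) (xx p)"
    "r < n ==> r \<noteq> p ==> r \<noteq> Suc p ==> transports (ps p) (ee w) (xx r) (xx r)"
  using slide_right[OF assms(1,2)] slide_left[OF assms(1,2)] assms
  by (auto intro!: transportsI xx_ee simp: ps_xx)

lemma RR_ee:
  "u @ c # v @ z \<in> W ==>
    RR (length u) (length v) * ee (u @ c # v @ z) = ee (u @ v @ c # z) * RR (length u) (length v)"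
proof (induction v arbitrary: u)
  case (Cons d v)
  have w: "(u @ [d]) @ c # v @ z \<in> W" by (rule words_perm[OF Cons.prems]) simp
  show ?case
    using comp_comm[OF ps_ee_append[of u c d "v @ z"] Cons.IH[OF w, simplified]] Cons.prems
    by (simp add: RR_Suc)
qed simp

lemma LL_ee:
  "u @ v @ c # z \<in> W ==>
    LL (length u) (length v) * ee (u @ v @ c # z) = ee (u @ c # v @ z) * LL (length u) (length v)"
proof (induction v arbitrary: z rule: rev_induct)
  case (snoc d v)
  have w: "u @ v @ c # d # z \<in> W" by (rule words_perm[OF snoc.prems]) simp
  show ?case
    using comp_comm[OF ps_ee_append2[of u v d c z] snoc.IH[OF w, simplified]] snoc.prems
    by (simp add: LL_Suc)
qed simp

text \<open>No corrections arise since the moving strand has a label different from those of the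
  run; each strand of the run is displaced by one.\<close>

lemma RR_transports_x:
  assumes "u @ c # v @ z \<in> W" "c \<notin> set v"
  shows "transports (RR (length u) (length v)) (ee (u @ c # v @ z)) (xx (length u)) (xx (length u + length v))"
    and "j < length v ==>
      transports (RR (length u) (length v)) (ee (u @ c # v @ z)) (xx (Suc (length u + j))) (xx (length u + j))"
    and "r < n ==> r < length u \<or> length u + length v < r ==>
      transports (RR (length u) (length v)) (ee (u @ c # v @ z)) (xx r) (xx r)"
proof -
  show "transports (RR (length u) (length v)) (ee (u @ c # v @ z)) (xx (length u)) (xx (length u + length v))"
    using assms
  proof (induction v arbitrary: u)
    case Nil
    then show ?case using words_length[of "u @ c # z"] by (auto intro!: transportsI xx_ee)
  next
    case (Cons d v)
    have w: "(u @ [d]) @ c # v @ z \<in> W" by (rule words_perm[OF Cons.prems(1)]) simp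
    have W: "u @ c # d # v @ z \<in> W" using Cons.prems by simp
    note len = words_length[OF W]
    have "transports (ps (length u)) (ee (u @ c # d # v @ z)) (xx (length u)) (xx (Suc (length u)))"
      using Cons.prems len by (intro ps_transports_x W) (auto simp: nth_append1)
    from transports_trans[OF this _ ps_ee_append[OF W], OF Cons.IH[OF w, simplified]]
    show ?case using Cons.prems by (simp add: RR_Suc)
  qed
  show "transports (RR (length u) (length v)) (ee (u @ c # v @ z)) (xx (Suc (length u + j))) (xx (length u + j))"
    if "j < length v"
    using assms that
  proof (induction v arbitrary: u j)
    case (Cons d v)
    have w: "(u @ [d]) @ c # v @ z \<in> W" by (rule words_perm[OF Cons.prems(1)]) simp
    have W: "u @ c # d # v @ z \<in> W" using Cons.prems by simp
    note len = words_length[OF W]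
    let ?w = "u @ d # c # v @ z"
    show ?case
    proof (cases j)
      case 0
      have 1: "transports (ps (length u)) (ee (u @ c # d # v @ z)) (xx (Suc (length u))) (xx (length u))"
        using Cons.prems len by (intro ps_transports_x W) (auto simp: nth_append1)
      have 2: "transports (RR (Suc (length u)) (length v)) (ee ?w) (xx (length u)) (xx (length u))"
        using w len by (intro transports_comm comm_RR[symmetric] xx_ee) (auto simp: ps_xx)
      show ?thesis using transports_trans[OF 1 2 ps_ee_append[OF W]] 0 by (simp add: RR_Suc)
    next
      case (Suc i)
      have "transports (ps (length u)) (ee (u @ c # d # v @ z)) (xx (Suc (length u + j))) (xx (Suc (length u + j)))"
        using Cons.prems len Suc by (intro ps_transports_x W) (auto simp: nth_append1)
      from transports_trans[OF this _ ps_ee_append[OF W], of "RR (Suc (length u)) (length v)" "xx (length u + j)"]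
      show ?thesis using Cons.IH[OF w, of i] Cons.prems Suc by (simp add: RR_Suc)
    qed
  qed simp
  show "transports (RR (length u) (length v)) (ee (u @ c # v @ z)) (xx r) (xx r)"
    if "r < n" "r < length u \<or> length u + length v < r"
    using assms that words_length[OF assms(1)]
    by (intro transports_comm xx_ee comm_RR[symmetric]) (auto simp: ps_xx)
qed

lemma LL_transports_x:
  assumes "u @ v @ c # z \<in> W" "c \<notin> set v"
  shows "transports (LL (length u) (length v)) (ee (u @ v @ c # z)) (xx (length u + length v)) (xx (length u))"
    and "j < length v ==>
      transports (LL (length u) (length v)) (ee (u @ v @ c # z)) (xx (length u + j)) (xx (Suc (length u + j)))"
    and "r < n ==> r < length u \<or> length u + length v < r ==>
      transports (LL (length u) (length v)) (ee (u @ v @ c # z)) (xx r) (xx r)"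
proof -
  show "transports (LL (length u) (length v)) (ee (u @ v @ c # z)) (xx (length u + length v)) (xx (length u))"
    using assms
  proof (induction v arbitrary: z rule: rev_induct)
    case Nil
    then show ?case using words_length[of "u @ c # z"] by (auto intro!: transportsI xx_ee)
  next
    case (snoc d v)
    have w: "u @ v @ c # d # z \<in> W" by (rule words_perm[OF snoc.prems(1)]) simp
    have W: "u @ v @ d # c # z \<in> W" using snoc.prems by simp
    note len = words_length[OF W]
    let ?p = "length u + length v"
    have "transports (ps ?p) (ee (u @ v @ d # c # z)) (xx (Suc ?p)) (xx ?p)"
      using snoc.prems len by (intro ps_transports_x W) (auto simp: nth_append2)
    from transports_trans[OF this _ ps_ee_append2[OF W], OF snoc.IH[OF w]]
    show ?case using snoc.prems by (simp add: LL_Suc)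
  qed
  show "transports (LL (length u) (length v)) (ee (u @ v @ c # z)) (xx (length u + j)) (xx (Suc (length u + j)))"
    if "j < length v"
    using assms that
  proof (induction v arbitrary: z j rule: rev_induct)
    case (snoc d v)
    have w: "u @ v @ c # d # z \<in> W" by (rule words_perm[OF snoc.prems(1)]) simp
    have W: "u @ v @ d # c # z \<in> W" using snoc.prems by simp
    note len = words_length[OF W]
    let ?p = "length u + length v"
    show ?case
    proof (cases "j = length v")
      case True
      have 1: "transports (ps ?p) (ee (u @ v @ d # c # z)) (xx ?p) (xx (Suc ?p))"
        using snoc.prems len by (intro ps_transports_x W) (auto simp: nth_append2)
      have 2: "transports (LL (length u) (length v)) (ee (u @ v @ c # d # z)) (xx (Suc ?p)) (xx (Suc ?p))"
        using w len by (intro transports_comm comm_LL[symmetric] xx_ee) (auto simp: ps_xx)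
      show ?thesis using transports_trans[OF 1 2 ps_ee_append2[OF W]] True by (simp add: LL_Suc)
    next
      case False
      then have j: "j < length v" using snoc.prems by simp
      have "transports (ps ?p) (ee (u @ v @ d # c # z)) (xx (length u + j)) (xx (length u + j))"
        using snoc.prems len j by (intro ps_transports_x W) (auto simp: nth_append2)
      from transports_trans[OF this _ ps_ee_append2[OF W], OF snoc.IH[OF w]]
      show ?thesis using snoc.prems j by (simp add: LL_Suc)
    qed
  qed simp
  show "transports (LL (length u) (length v)) (ee (u @ v @ c # z)) (xx r) (xx r)"
    if "r < n" "r < length u \<or> length u + length v < r"
    using assms that words_length[OF assms(1)]
    by (intro transports_comm xx_ee comm_LL[symmetric]) (auto simp: ps_xx)
qed

text \<open>Equal neighbours in the run remain neighbours when the strand passes. At the moment when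
  these two are passed a braid relation applies, without error because its outer labels
  differ.\<close>

lemma RR_transports_ps:
  assumes "u @ c # v @ z \<in> W" "c \<notin> set v" "Suc j < length v" "v ! j = v ! Suc j"
  shows "transports (RR (length u) (length v)) (ee (u @ c # v @ z)) (ps (Suc (length u + j))) (ps (length u + j))"
  using assms
proof (induction v arbitrary: u j)
  case (Cons d v)
  have w: "(u @ [d]) @ c # v @ z \<in> W" by (rule words_perm[OF Cons.prems(1)]) simp
  let ?q = "length u" and ?w = "u @ c # d # v @ z"
  have W: "?w \<in> W" using Cons.prems by simp
  note len = words_length[OF W]
  show ?case
  proof (cases j)
    case 0
    then obtain v' where v: "v = d # v'" using Cons.prems by (cases v) auto
    have nth: "?w ! ?q = c" "?w ! Suc ?q = d" "?w ! Suc (Suc ?q) = d" by (simp_all add: v nth_append1)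
    have cd: "c \<noteq> d" using Cons.prems by simp
    have "ps ?q * ps (Suc ?q) * ps ?q * ee ?w = ps (Suc ?q) * ps ?q * ps (Suc ?q) * ee ?w"
      by (rule braid_plain[OF W]) (use len nth cd v in auto)
    moreover have "ps (Suc ?q) * ee ?w = ee ?w * ps (Suc ?q)"
      using len nth v by (intro ps_ee_same W) auto
    ultimately have 1: "transports (ps (Suc ?q) * ps ?q) (ee ?w) (ps (Suc ?q)) (ps ?q)"
      by (intro transportsI) (auto simp: mult.assoc)
    have w2: "u @ d # d # c # v' @ z \<in> W" by (rule words_perm[OF W]) (simp add: v)
    have 2: "transports (RR (Suc (Suc ?q)) (length v')) (ee (u @ d # d # c # v' @ z)) (ps ?q) (ps ?q)"
      using len w2 ps_ee_same[OF w2, of ?q]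
      by (intro transports_comm comm_RR[symmetric]) (auto simp: v nth_append1 intro!: ps_ps)
    have 3: "ps (Suc ?q) * ps ?q * ee ?w = ee (u @ d # d # c # v' @ z) * (ps (Suc ?q) * ps ?q)"
    proof (rule comp_comm)
      show "ps ?q * ee ?w = ee (u @ d # c # d # v' @ z) * ps ?q" using ps_ee_append[OF W] v by simp
      show "ps (Suc ?q) * ee (u @ d # c # d # v' @ z) = ee (u @ d # d # c # v' @ z) * ps (Suc ?q)"
        using ps_ee_append[of "u @ [d]" c d "v' @ z"] w v by simp
    qed
    show ?thesis using transports_trans[OF 1 2 3] 0 by (simp add: RR_Suc v mult.assoc)
  next
    case (Suc i)
    have "?w ! Suc (?q + j) = ?w ! Suc (Suc (?q + j))"
      using Cons.prems Suc nth_append_length_plus[of u "c # d # v @ z" "Suc j"]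
        nth_append_length_plus[of u "c # d # v @ z" "Suc (Suc j)"] by (simp add: nth_append)
    then have 1: "transports (ps ?q) (ee ?w) (ps (Suc (?q + j))) (ps (Suc (?q + j)))"
      using Cons.prems len Suc by (intro transports_comm ps_ps ps_ee_same W) auto
    from transports_trans[OF this _ ps_ee_append[OF W], of "RR (Suc (length u)) (length v)" "ps (length u + j)"]
    show ?thesis using Cons.IH[OF w, of i] Cons.prems Suc by (simp add: RR_Suc)
  qed
qed simp

lemma LL_transports_ps:
  assumes "u @ v @ c # z \<in> W" "c \<notin> set v" "Suc j < length v" "v ! j = v ! Suc j"
  shows "transports (LL (length u) (length v)) (ee (u @ v @ c # z)) (ps (length u + j)) (ps (Suc (length u + j)))"
  using assms
proof (induction v arbitrary: z j rule: rev_induct)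
  case (snoc d v)
  have w: "u @ v @ c # d # z \<in> W" by (rule words_perm[OF snoc.prems(1)]) simp
  let ?p = "length u + length v" and ?w = "u @ v @ d # c # z"
  have W: "?w \<in> W" using snoc.prems by simp
  note len = words_length[OF W]
  show ?case
  proof (cases "Suc j = length v")
    case True
    then obtain v' where v: "v = v' @ [d]"
      using snoc.prems by (cases v rule: rev_cases) (auto simp: nth_append)
    let ?q = "length u + length v'" and ?w = "u @ v' @ d # d # c # z"
    have W: "?w \<in> W" using snoc.prems v by simp
    have j: "j = length v'" using True v by simp
    have nth: "?w ! ?q = d" "?w ! Suc ?q = d" "?w ! Suc (Suc ?q) = c"
      by (simp_all add: nth_append2)
    have cd: "c \<noteq> d" using snoc.prems by simp
    have "ps ?q * ps (Suc ?q) * ps ?q * ee ?w = ps (Suc ?q) * ps ?q * ps (Suc ?q) * ee ?w"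
      by (rule braid_plain[OF W]) (use len nth cd v in auto)
    moreover have "ps ?q * ee ?w = ee ?w * ps ?q"
      using len nth v by (intro ps_ee_same W) auto
    ultimately have 1: "transports (ps ?q * ps (Suc ?q)) (ee ?w) (ps ?q) (ps (Suc ?q))"
      by (intro transportsI) (auto simp: mult.assoc)
    have w2: "u @ v' @ c # d # d # z \<in> W" by (rule words_perm[OF W]) simp
    have 2: "transports (LL (length u) (length v')) (ee (u @ v' @ c # d # d # z)) (ps (Suc ?q)) (ps (Suc ?q))"
      using len ps_ee_same[OF w2, of "Suc ?q"]
      by (intro transports_comm comm_LL[symmetric]) (auto simp: v nth_append2 intro!: ps_ps)
    have 3: "ps ?q * ps (Suc ?q) * ee ?w = ee (u @ v' @ c # d # d # z) * (ps ?q * ps (Suc ?q))"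
      using comp_comm[OF ps_ee_append2[of u "v' @ [d]" d c z, simplified] ps_ee_append2[of u v' d c "d # z"]] W w v
      by simp
    show ?thesis using transports_trans[OF 1 2 3] j by (simp add: LL_Suc v mult.assoc)
  next
    case False
    then have j: "Suc j < length v" using snoc.prems by simp
    have nth: "?w ! (length u + j) = v ! j" "?w ! Suc (length u + j) = v ! Suc j"
      using j nth_append_length_plus[of u "v @ d # c # z" j]
        nth_append_length_plus[of u "v @ d # c # z" "Suc j"] by (simp_all add: nth_append)
    have vj: "v ! j = v ! Suc j" using snoc.prems j by (simp add: nth_append)
    have "transports (ps ?p) (ee ?w) (ps (length u + j)) (ps (length u + j))"
      using snoc.prems len j nth vj by (intro transports_comm ps_ps ps_ee_same W) auto
    from transports_trans[OF this _ ps_ee_append2[OF W], OF snoc.IH[OF w _ j vj]]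
    show ?thesis using snoc.prems by (simp add: LL_Suc)
  qed
qed simp

end

section \<open>Squares and braids of strands crossing runs\<close>

context klr
begin

text \<open>The contribution of a double crossing of a solid strand labelled \<open>a\<close> with a
  barred strand labelled \<open>l\<close>: \<open>y\<close> is the dot on the solid strand and
  \<open>z\<close> the dot on the barred one.\<close>

definition bfac :: "nat => lab => 'r => 'r => 'r"
  where "bfac a l y z = (if l = Bar a then y - z else 1)"

definition bprod :: "nat => 'r => nat => lab list => 'r"
  where "bprod a y r v = prod_list (map (\<lambda>j. bfac a (v ! j) y (xx (r + j))) [0..<length v])"

lemma bprod_Nil [simp]: "bprod a y r [] = 1"
  by (simp add: bprod_def)

lemma bprod_Cons: "bprod a y r (d # v) = bfac a d y (xx r) * bprod a y (Suc r) v"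
proof -
  have "[0..<length (d # v)] = 0 # map Suc [0..<length v]"
    by (simp add: map_Suc_upt upt_conv_Cons del: upt_Suc)
  then show ?thesis by (simp add: bprod_def o_def del: upt_Suc)
qed

lemma bprod_snoc: "bprod a y r (v @ [d]) = bprod a y r v * bfac a d y (xx (r + length v))"
proof -
  have "map (\<lambda>j. bfac a ((v @ [d]) ! j) y (xx (r + j))) [0..<length v] = map (\<lambda>j. bfac a (v ! j) y (xx (r + j))) [0..<length v]"
    by (auto simp: nth_append)
  from arg_cong[OF this, of prod_list] show ?thesis by (simp add: bprod_def del: map_eq_conv)
qed

lemma bfac_transports:
  assumes "transports C E y y'" "transports C E z z'"
  shows "transports C E (bfac a l y z) (bfac a l y' z')"
  using assms by (auto simp: bfac_def intro: transports_one transports_diff)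

lemma bprod_transports:
  assumes "transports C E y y'" "\<And>j. j < length v ==> transports C E (xx (r + j)) (xx (r' + j))"
  shows "transports C E (bprod a y r v) (bprod a y' r' v)"
  unfolding bprod_def using assms by (intro transports_prod_list bfac_transports) auto

lemma bfac_comm: "f * y = y * f ==> f * z = z * f ==> f * bfac a l y z = bfac a l y z * f"
  by (simp add: bfac_def algebra_simps)

lemma bprod_comm:
  assumes "f * y = y * f" "\<And>j. j < length v ==> f * xx (r + j) = xx (r + j) * f"
  shows "f * bprod a y r v = bprod a y r v * f"
  unfolding bprod_def using assms by (intro comm_prod_list) (auto intro!: bfac_comm)

text \<open>The crossing with the first strand of the run is outermost in both passes. Inside it the
  induction hypothesis leaves a polynomial, which slides through one of the two outer crossings;
  these then meet and give the factor of that strand.\<close>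

lemma square_pass_right:
  assumes "u @ Orig a # v @ z \<in> W" "Orig a \<notin> set v" "\<And>l. l \<in> set v ==> \<exists>c. l = Bar c"
  shows "LL (length u) (length v) * RR (length u) (length v) * ee (u @ Orig a # v @ z)
    = bprod a (xx (length u)) (Suc (length u)) v * ee (u @ Orig a # v @ z)"
  using assms
proof (induction v arbitrary: u)
  case (Cons d v)
  have w: "(u @ [d]) @ Orig a # v @ z \<in> W" by (rule words_perm[OF Cons.prems(1)]) simp
  let ?q = "length u" and ?w = "u @ Orig a # d # v @ z" and ?w' = "u @ d # Orig a # v @ z"
  have W: "?w \<in> W" using Cons.prems by simp
  note len = words_length[OF W]
  obtain c where c: "d = Bar c" using Cons.prems(3)[of d] by auto
  have IH: "LL (Suc ?q) (length v) * RR (Suc ?q) (length v) * ee ?w'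
      = bprod a (xx (Suc ?q)) (Suc (Suc ?q)) v * ee ?w'"
    using Cons.IH[OF w] Cons.prems by simp
  have psw: "ps ?q * ee ?w = ee ?w' * ps ?q" using ps_ee_append[OF W] .
  have W': "?w' \<in> W" using w by simp
  have tr: "transports (ps ?q) (ee ?w') (bprod a (xx (Suc ?q)) (Suc (Suc ?q)) v) (bprod a (xx ?q) (Suc (Suc ?q)) v)"
    using W' len c by (intro bprod_transports ps_transports_x) (auto simp: nth_append1)
  have "LL ?q (Suc (length v)) * RR ?q (Suc (length v)) * ee ?w
      = ps ?q * (LL (Suc ?q) (length v) * RR (Suc ?q) (length v) * (ps ?q * ee ?w))"
    by (simp only: LL_Suc' RR_Suc mult.assoc)
  also have "\<dots> = ps ?q * (LL (Suc ?q) (length v) * RR (Suc ?q) (length v) * ee ?w') * ps ?q"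
    by (simp only: psw mult.assoc)
  also have "\<dots> = ps ?q * bprod a (xx (Suc ?q)) (Suc (Suc ?q)) v * ee ?w' * ps ?q"
    unfolding IH by (simp only: mult.assoc)
  also have "\<dots> = bprod a (xx ?q) (Suc (Suc ?q)) v * ps ?q * (ee ?w' * ps ?q)"
    using arg_cong[OF transportsD[OF tr], of "\<lambda>f. f * ps ?q"] by (simp only: mult.assoc)
  also have "\<dots> = bprod a (xx ?q) (Suc (Suc ?q)) v * (ps ?q * ps ?q * ee ?w)"
    by (simp only: psw[symmetric] mult.assoc)
  also have "ps ?q * ps ?q * ee ?w = bfac a d (xx ?q) (xx (Suc ?q)) * ee ?w"
    using square_orig_bar[OF W, of ?q a c] len c by (simp add: bfac_def nth_append1)
  also have "bprod a (xx ?q) (Suc (Suc ?q)) v * (bfac a d (xx ?q) (xx (Suc ?q)) * ee ?w)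
      = bfac a d (xx ?q) (xx (Suc ?q)) * bprod a (xx ?q) (Suc (Suc ?q)) v * ee ?w"
    using len by (subst bprod_comm) (auto intro!: bfac_comm[symmetric] xx_xx simp: mult.assoc)
  finally show ?case by (simp add: bprod_Cons)
qed simp

lemma square_pass_left:
  assumes "u @ v @ Orig a # z \<in> W" "Orig a \<notin> set v" "\<And>l. l \<in> set v ==> \<exists>c. l = Bar c"
  shows "RR (length u) (length v) * LL (length u) (length v) * ee (u @ v @ Orig a # z)
    = bprod a (xx (length u + length v)) (length u) v * ee (u @ v @ Orig a # z)"
  using assms
proof (induction v arbitrary: z rule: rev_induct)
  case (snoc d v)
  let ?q = "length u" and ?p = "length u + length v"
    and ?w = "u @ v @ d # Orig a # z" and ?w' = "u @ v @ Orig a # d # z"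
  have W: "?w \<in> W" using snoc.prems by simp
  have W': "?w' \<in> W" by (rule words_perm[OF W]) simp
  note len = words_length[OF W]
  obtain c where c: "d = Bar c" using snoc.prems(3)[of d] by auto
  have IH: "RR ?q (length v) * LL ?q (length v) * ee ?w' = bprod a (xx ?p) ?q v * ee ?w'"
    using snoc.IH[OF W'] snoc.prems by simp
  have psw: "ps ?p * ee ?w = ee ?w' * ps ?p" using ps_ee_append2[OF W] .
  have tr: "transports (ps ?p) (ee ?w') (bprod a (xx ?p) ?q v) (bprod a (xx (Suc ?p)) ?q v)"
    using W' len c by (intro bprod_transports ps_transports_x) (auto simp: nth_append2)
  have "RR ?q (Suc (length v)) * LL ?q (Suc (length v)) * ee ?w
      = ps ?p * (RR ?q (length v) * LL ?q (length v) * (ps ?p * ee ?w))"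
    by (simp only: LL_Suc RR_Suc' mult.assoc)
  also have "\<dots> = ps ?p * (RR ?q (length v) * LL ?q (length v) * ee ?w') * ps ?p"
    by (simp only: psw mult.assoc)
  also have "\<dots> = ps ?p * bprod a (xx ?p) ?q v * ee ?w' * ps ?p"
    unfolding IH by (simp only: mult.assoc)
  also have "\<dots> = bprod a (xx (Suc ?p)) ?q v * ps ?p * (ee ?w' * ps ?p)"
    using arg_cong[OF transportsD[OF tr], of "\<lambda>f. f * ps ?p"] by (simp only: mult.assoc)
  also have "\<dots> = bprod a (xx (Suc ?p)) ?q v * (ps ?p * ps ?p * ee ?w)"
    by (simp only: psw[symmetric] mult.assoc)
  also have "ps ?p * ps ?p * ee ?w = bfac a d (xx (Suc ?p)) (xx ?p) * ee ?w"
    using square_bar_orig[OF W, of ?p c a] len c by (simp add: bfac_def nth_append2)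
  finally show ?case by (simp add: bprod_snoc mult.assoc)
qed simp

text \<open>The divided difference of \<open>bprod\<close> at \<open>y\<close> and
  \<open>y'\<close>, by the Leibniz rule: a factor \<open>y - z\<close> has divided difference 1, a
  constant factor 0.\<close>

fun bdiff :: "nat => 'r => 'r => nat => lab list => 'r" where
  "bdiff a y y' r [] = 0"
| "bdiff a y y' r (d # v) = bfac a d y (xx r) * bdiff a y y' (Suc r) v
     + (if d = Bar a then bprod a y' (Suc r) v else 0)"

lemma bdiff_transports:
  assumes "transports C E y z" "transports C E y' z'"
    "\<And>j. j < length v ==> transports C E (xx (r + j)) (xx (r' + j))"
  shows "transports C E (bdiff a y y' r v) (bdiff a z z' r' v)"
  using assms
proof (induction v arbitrary: r r')
  case (Cons d v)
  have "transports C E (xx r) (xx r')" using Cons.prems(3)[of 0] by simp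
  moreover have "transports C E (xx (Suc r + j)) (xx (Suc r' + j))" if "j < length v" for j
    using Cons.prems(3)[of "Suc j"] that by simp
  ultimately show ?case using Cons.prems(1,2) Cons.IH
    by (auto intro!: transports_add transports_mult bfac_transports bprod_transports transports_zero)
qed (simp add: transports_zero)

lemma bdiff_comm:
  assumes "f * y = y * f" "f * y' = y' * f" "\<And>j. j < length v ==> f * xx (r + j) = xx (r + j) * f"
  shows "f * bdiff a y y' r v = bdiff a y y' r v * f"
  using bdiff_transports[of f 1 y y y' y' v r r a] assms by (auto simp: transports_def)

text \<open>Induction on the run, peeling off its first strand. Two errors arise, one from the braid
  relation with that strand and one from the induction hypothesis; they are the two summands of the
  Leibniz rule in \<open>bdiff\<close>.\<close>

lemma braid_pass_orig:
  assumes "u @ Orig a # v @ Orig a # z \<in> W" "\<And>l. l \<in> set v ==> \<exists>c. l = Bar c"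
  shows "LL (length u) (length v) * ps (length u + length v) * RR (length u) (length v) * ee (u @ Orig a # v @ Orig a # z)
    = RR (Suc (length u)) (length v) * ps (length u) * LL (Suc (length u)) (length v) * ee (u @ Orig a # v @ Orig a # z)
      + bdiff a (xx (length u)) (xx (Suc (length u + length v))) (Suc (length u)) v * ee (u @ Orig a # v @ Orig a # z)"
  using assms
proof (induction v arbitrary: u)
  case (Cons d v)
  let ?q = "length u" and ?m = "length v" and ?w = "u @ Orig a # d # v @ Orig a # z"
    and ?w' = "u @ d # Orig a # v @ Orig a # z" and ?w2 = "u @ Orig a # d # Orig a # v @ z"
  have W: "?w \<in> W" using Cons.prems by simp
  have W': "?w' \<in> W" by (rule words_perm[OF W]) simp
  have W2: "?w2 \<in> W" by (rule words_perm[OF W]) simp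
  note len = words_length[OF W]
  obtain c where c: "d = Bar c" using Cons.prems(2)[of d] by auto
  let ?D = "bdiff a (xx (Suc ?q)) (xx (Suc (Suc (?q + ?m)))) (Suc (Suc ?q)) v"
  let ?D' = "bdiff a (xx ?q) (xx (Suc (Suc (?q + ?m)))) (Suc (Suc ?q)) v"
  let ?R2 = "RR (Suc (Suc ?q)) ?m" and ?L2 = "LL (Suc (Suc ?q)) ?m"
  have IH: "LL (Suc ?q) ?m * ps (Suc (?q + ?m)) * RR (Suc ?q) ?m * ee ?w'
      = ?R2 * ps (Suc ?q) * ?L2 * ee ?w' + ?D * ee ?w'"
    using Cons.IH[of "u @ [d]"] W' Cons.prems by simp
  have psw: "ps ?q * ee ?w = ee ?w' * ps ?q" using ps_ee_append[OF W] .
  have cR: "ps ?q * ?R2 = ?R2 * ps ?q" using len by (intro comm_RR ps_ps) auto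
  have cL: "ps ?q * ?L2 = ?L2 * ps ?q" using len by (intro comm_LL ps_ps) auto
  have Lw: "?L2 * ee ?w = ee ?w2 * ?L2"
    using LL_ee[of "u @ [Orig a, d]" v "Orig a" z] W by simp
  have br: "ps ?q * ps (Suc ?q) * ps ?q * ee ?w2 = ps (Suc ?q) * ps ?q * ps (Suc ?q) * ee ?w2
      + (if c = a then 1 else 0) * ee ?w2"
    using braid_orig_bar[OF W2, of ?q a c] len c by (simp add: nth_append1)
  \<comment> \<open>In the error of the new braid relation three crossings have disappeared, and the
    second solid strand is left crossing the remaining run and coming back.\<close>
  have sq: "?R2 * ?L2 * ee ?w = bprod a (xx (Suc (Suc (?q + ?m)))) (Suc (Suc ?q)) v * ee ?w"
    using square_pass_left[of "u @ [Orig a, d]" v a z] W Cons.prems c by auto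
  have tr: "transports (ps ?q) (ee ?w') ?D ?D'"
    using W' len c by (intro bdiff_transports ps_transports_x) (auto simp: nth_append1)
  have D: "ps ?q * ?D * ee ?w' * ps ?q = bfac a d (xx ?q) (xx (Suc ?q)) * ?D' * ee ?w"
  proof -
    have "ps ?q * ?D * ee ?w' * ps ?q = ?D' * ps ?q * (ee ?w' * ps ?q)"
      using arg_cong[OF transportsD[OF tr], of "\<lambda>f. f * ps ?q"] by (simp only: mult.assoc)
    also have "\<dots> = ?D' * (ps ?q * ps ?q * ee ?w)" by (simp only: psw[symmetric] mult.assoc)
    also have "ps ?q * ps ?q * ee ?w = bfac a d (xx ?q) (xx (Suc ?q)) * ee ?w"
      using square_orig_bar[OF W, of ?q a c] len c by (simp add: bfac_def nth_append1)
    also have "?D' * (bfac a d (xx ?q) (xx (Suc ?q)) * ee ?w) = bfac a d (xx ?q) (xx (Suc ?q)) * ?D' * ee ?w"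
      using len by (subst bdiff_comm) (auto intro!: bfac_comm[symmetric] xx_xx simp: mult.assoc)
    finally show ?thesis .
  qed
  have "LL ?q (Suc ?m) * ps (?q + Suc ?m) * RR ?q (Suc ?m) * ee ?w
      = ps ?q * (LL (Suc ?q) ?m * ps (Suc (?q + ?m)) * RR (Suc ?q) ?m * (ps ?q * ee ?w))"
    by (simp add: LL_Suc' RR_Suc mult.assoc)
  also have "\<dots> = ps ?q * (LL (Suc ?q) ?m * ps (Suc (?q + ?m)) * RR (Suc ?q) ?m * ee ?w') * ps ?q"
    by (simp only: psw mult.assoc)
  also have "\<dots> = (ps ?q * ?R2) * ps (Suc ?q) * ?L2 * (ee ?w' * ps ?q) + ps ?q * ?D * ee ?w' * ps ?q"
    unfolding IH by (simp only: distrib_left distrib_right mult.assoc)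
  also have "\<dots> = ?R2 * (ps ?q * ps (Suc ?q) * (?L2 * ps ?q) * ee ?w) + ps ?q * ?D * ee ?w' * ps ?q"
    unfolding psw[symmetric] cR by (simp only: mult.assoc)
  also have "ps ?q * ps (Suc ?q) * (?L2 * ps ?q) * ee ?w = ps ?q * ps (Suc ?q) * ps ?q * ee ?w2 * ?L2"
    unfolding cL[symmetric] using Lw by (simp only: mult.assoc)
  also have "\<dots> = ps (Suc ?q) * ps ?q * ps (Suc ?q) * (ee ?w2 * ?L2) + (if c = a then 1 else 0) * (ee ?w2 * ?L2)"
    unfolding br by (simp only: distrib_right mult.assoc)
  also have "?R2 * \<dots> = (?R2 * ps (Suc ?q)) * ps ?q * (ps (Suc ?q) * ?L2) * ee ?w
      + (if c = a then 1 else 0) * (?R2 * ?L2 * ee ?w)"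
    unfolding Lw[symmetric] by (simp add: distrib_left mult.assoc)
  also have "\<dots> + ps ?q * ?D * ee ?w' * ps ?q = RR (Suc ?q) (Suc ?m) * ps ?q * LL (Suc ?q) (Suc ?m) * ee ?w
      + bdiff a (xx ?q) (xx (Suc (?q + Suc ?m))) (Suc ?q) (d # v) * ee ?w"
    unfolding D sq by (simp add: c RR_Suc LL_Suc' distrib_right mult.assoc)
  finally show ?case by simp
qed simp

lemma braid_pass_diff:
  assumes "u @ c # v @ d # z \<in> W" "c \<noteq> d"
  shows "LL (length u) (length v) * ps (length u + length v) * RR (length u) (length v) * ee (u @ c # v @ d # z)
    = RR (Suc (length u)) (length v) * ps (length u) * LL (Suc (length u)) (length v) * ee (u @ c # v @ d # z)"
  using assms
proof (induction v arbitrary: u)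
  case (Cons f v)
  let ?q = "length u" and ?m = "length v" and ?w = "u @ c # f # v @ d # z"
    and ?w' = "u @ f # c # v @ d # z" and ?w2 = "u @ c # f # d # v @ z"
  have W: "?w \<in> W" using Cons.prems by simp
  have W': "?w' \<in> W" by (rule words_perm[OF W]) simp
  have W2: "?w2 \<in> W" by (rule words_perm[OF W]) simp
  note len = words_length[OF W]
  let ?R2 = "RR (Suc (Suc ?q)) ?m" and ?L2 = "LL (Suc (Suc ?q)) ?m"
  have IH: "LL (Suc ?q) ?m * ps (Suc (?q + ?m)) * RR (Suc ?q) ?m * ee ?w' = ?R2 * ps (Suc ?q) * ?L2 * ee ?w'"
    using Cons.IH[of "u @ [f]"] W' Cons.prems by simp
  have psw: "ps ?q * ee ?w = ee ?w' * ps ?q" using ps_ee_append[OF W] .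
  have cR: "ps ?q * ?R2 = ?R2 * ps ?q" using len by (intro comm_RR ps_ps) auto
  have cL: "ps ?q * ?L2 = ?L2 * ps ?q" using len by (intro comm_LL ps_ps) auto
  have Lw: "?L2 * ee ?w = ee ?w2 * ?L2"
    using LL_ee[of "u @ [c, f]" v d z] W by simp
  have br: "ps ?q * ps (Suc ?q) * ps ?q * ee ?w2 = ps (Suc ?q) * ps ?q * ps (Suc ?q) * ee ?w2"
    using braid_plain[OF W2, of ?q] len Cons.prems by (simp add: nth_append1)
  have "LL ?q (Suc ?m) * ps (?q + Suc ?m) * RR ?q (Suc ?m) * ee ?w
      = ps ?q * (LL (Suc ?q) ?m * ps (Suc (?q + ?m)) * RR (Suc ?q) ?m * (ps ?q * ee ?w))"
    by (simp add: LL_Suc' RR_Suc mult.assoc)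
  also have "\<dots> = ps ?q * (LL (Suc ?q) ?m * ps (Suc (?q + ?m)) * RR (Suc ?q) ?m * ee ?w') * ps ?q"
    by (simp only: psw mult.assoc)
  also have "\<dots> = (ps ?q * ?R2) * ps (Suc ?q) * ?L2 * (ee ?w' * ps ?q)"
    unfolding IH by (simp only: mult.assoc)
  also have "\<dots> = ?R2 * (ps ?q * ps (Suc ?q) * (?L2 * ps ?q) * ee ?w)"
    unfolding psw[symmetric] cR by (simp only: mult.assoc)
  also have "ps ?q * ps (Suc ?q) * (?L2 * ps ?q) * ee ?w = ps ?q * ps (Suc ?q) * ps ?q * ee ?w2 * ?L2"
    unfolding cL[symmetric] using Lw by (simp only: mult.assoc)
  also have "\<dots> = ps (Suc ?q) * ps ?q * ps (Suc ?q) * (ee ?w2 * ?L2)"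
    unfolding br by (simp only: mult.assoc)
  also have "?R2 * \<dots> = RR (Suc ?q) (Suc ?m) * ps ?q * LL (Suc ?q) (Suc ?m) * ee ?w"
    unfolding Lw[symmetric] by (simp only: RR_Suc LL_Suc' mult.assoc)
  finally show ?case by simp
qed simp

text \<open>In every braid relation used here the outer labels are \<open>c\<close> and a letter of
  the run, so there is no error.\<close>

lemma braid_two_right:
  assumes "u @ c # d # v @ z \<in> W" "c \<notin> set v"
  shows "RR (length u) (length v) * RR (Suc (length u)) (length v) * ps (length u) * ee (u @ c # d # v @ z)
    = ps (length u + length v) * RR (length u) (length v) * RR (Suc (length u)) (length v) * ee (u @ c # d # v @ z)"
  using assms
proof (induction v arbitrary: u)
  case (Cons f v)
  let ?q = "length u" and ?m = "length v" and ?w = "u @ c # d # f # v @ z" and ?w' = "u @ f # c # d # v @ z"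
  have W: "?w \<in> W" using Cons.prems by simp
  have W1: "u @ c # f # d # v @ z \<in> W" by (rule words_perm[OF W]) simp
  have W': "?w' \<in> W" by (rule words_perm[OF W]) simp
  note len = words_length[OF W]
  let ?R1 = "RR (Suc ?q) ?m" and ?R2 = "RR (Suc (Suc ?q)) ?m"
  have IH: "?R1 * ?R2 * ps (Suc ?q) * ee ?w' = ps (Suc (?q + ?m)) * ?R1 * ?R2 * ee ?w'"
    using Cons.IH[of "u @ [f]"] W' Cons.prems by simp
  have cR: "ps ?q * ?R2 = ?R2 * ps ?q" using len by (intro comm_RR ps_ps) auto
  have br: "ps ?q * ps (Suc ?q) * ps ?q * ee ?w = ps (Suc ?q) * ps ?q * ps (Suc ?q) * ee ?w"
    using braid_plain[OF W, of ?q] len Cons.prems by (simp add: nth_append1)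
  have mv: "ps ?q * ps (Suc ?q) * ee ?w = ee ?w' * (ps ?q * ps (Suc ?q))"
    using comp_comm[OF ps_ee_append[of "u @ [c]" d f "v @ z", simplified] ps_ee_append[of u c f "d # v @ z"]] W W1
    by simp
  have "RR ?q (Suc ?m) * RR (Suc ?q) (Suc ?m) * ps ?q * ee ?w
      = ?R1 * (ps ?q * ?R2) * ps (Suc ?q) * ps ?q * ee ?w"
    by (simp only: RR_Suc mult.assoc)
  also have "\<dots> = ?R1 * ?R2 * (ps ?q * ps (Suc ?q) * ps ?q * ee ?w)"
    unfolding cR by (simp only: mult.assoc)
  also have "\<dots> = ?R1 * ?R2 * ps (Suc ?q) * (ps ?q * ps (Suc ?q) * ee ?w)"
    unfolding br by (simp only: mult.assoc)
  also have "\<dots> = (?R1 * ?R2 * ps (Suc ?q) * ee ?w') * (ps ?q * ps (Suc ?q))"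
    unfolding mv by (simp only: mult.assoc)
  also have "\<dots> = ps (Suc (?q + ?m)) * ?R1 * ?R2 * (ee ?w' * (ps ?q * ps (Suc ?q)))"
    unfolding IH by (simp only: mult.assoc)
  also have "\<dots> = ps (Suc (?q + ?m)) * ?R1 * (?R2 * ps ?q) * ps (Suc ?q) * ee ?w"
    unfolding mv[symmetric] by (simp only: mult.assoc)
  also have "\<dots> = ps (?q + Suc ?m) * RR ?q (Suc ?m) * RR (Suc ?q) (Suc ?m) * ee ?w"
    unfolding cR[symmetric] by (simp add: RR_Suc mult.assoc)
  finally show ?case by simp
qed simp

lemma braid_two_left:
  assumes "u @ v @ c # d # z \<in> W" "d \<notin> set v"
  shows "LL (Suc (length u)) (length v) * LL (length u) (length v) * ps (length u + length v) * ee (u @ v @ c # d # z)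
    = ps (length u) * LL (Suc (length u)) (length v) * LL (length u) (length v) * ee (u @ v @ c # d # z)"
  using assms
proof (induction v arbitrary: z rule: rev_induct)
  case (snoc f v)
  let ?q = "length u" and ?m = "length v" and ?w = "u @ v @ f # c # d # z" and ?w' = "u @ v @ c # d # f # z"
  let ?p = "?q + ?m"
  have W: "?w \<in> W" using snoc.prems by simp
  have W1: "u @ v @ c # f # d # z \<in> W" by (rule words_perm[OF W]) simp
  have W': "?w' \<in> W" by (rule words_perm[OF W]) simp
  note len = words_length[OF W]
  let ?L0 = "LL ?q ?m" and ?L1 = "LL (Suc ?q) ?m"
  have IH: "?L1 * ?L0 * ps ?p * ee ?w' = ps ?q * ?L1 * ?L0 * ee ?w'"
    using snoc.IH[OF W'] snoc.prems by simp
  have cL: "ps (Suc ?p) * ?L0 = ?L0 * ps (Suc ?p)" using len by (intro comm_LL ps_ps) auto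
  have br: "ps ?p * ps (Suc ?p) * ps ?p * ee ?w = ps (Suc ?p) * ps ?p * ps (Suc ?p) * ee ?w"
    by (rule braid_plain[OF W]) (use len snoc.prems in \<open>auto simp: nth_append2\<close>)
  have mv: "ps (Suc ?p) * ps ?p * ee ?w = ee ?w' * (ps (Suc ?p) * ps ?p)"
    using comp_comm[OF ps_ee_append2[of u v f c "d # z"] ps_ee_append2[of u "v @ [c]" f d z, simplified]] W W1
    by simp
  have "LL (Suc ?q) (Suc ?m) * LL ?q (Suc ?m) * ps (?q + Suc ?m) * ee ?w
      = ?L1 * (ps (Suc ?p) * ?L0) * ps ?p * ps (Suc ?p) * ee ?w"
    by (simp add: LL_Suc mult.assoc)
  also have "\<dots> = ?L1 * ?L0 * (ps (Suc ?p) * ps ?p * ps (Suc ?p) * ee ?w)"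
    unfolding cL by (simp only: mult.assoc)
  also have "\<dots> = ?L1 * ?L0 * ps ?p * (ps (Suc ?p) * ps ?p * ee ?w)"
    unfolding br[symmetric] by (simp only: mult.assoc)
  also have "\<dots> = (?L1 * ?L0 * ps ?p * ee ?w') * (ps (Suc ?p) * ps ?p)"
    unfolding mv by (simp only: mult.assoc)
  also have "\<dots> = ps ?q * ?L1 * ?L0 * (ee ?w' * (ps (Suc ?p) * ps ?p))"
    unfolding IH by (simp only: mult.assoc)
  also have "\<dots> = ps ?q * ?L1 * (?L0 * ps (Suc ?p)) * ps ?p * ee ?w"
    unfolding mv[symmetric] by (simp only: mult.assoc)
  also have "\<dots> = ps ?q * LL (Suc ?q) (Suc ?m) * LL ?q (Suc ?m) * ee ?w"
    unfolding cL[symmetric] by (simp add: LL_Suc mult.assoc)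
  finally show ?case by simp
qed simp

end

lemma commuting_power_mult:
  fixes a :: "'r::ring_1"
  assumes "a * b = b * a"
  shows "(a * b) ^ k = a ^ k * b ^ k"
proof (induction k)
  case (Suc k)
  have b: "b * a ^ k = a ^ k * b" using assms by (rule comm_power[OF sym])
  have "(a * b) ^ Suc k = a * (b * a ^ k) * b ^ k" by (simp only: Suc power_Suc mult.assoc)
  also have "\<dots> = a ^ Suc k * b ^ Suc k" by (simp only: b power_Suc mult.assoc)
  finally show ?case .
qed simp

section \<open>Elementary symmetric polynomials and nilHecke idempotents\<close>

lemma hsum_Suc: "hsum (Suc m) u w = u * hsum m u w + w ^ m"
  by (simp add: hsum_def sum.lessThan_Suc_shift sum_distrib_left mult.assoc del: sum.lessThan_Suc)

lemma hsum_0 [simp]: "hsum 0 u w = 0"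
  by (simp add: hsum_def)

text \<open>The factors stand in the order of positions, as in \<open>elem_sym\<close>, because the
  ring is not commutative.\<close>

definition esym :: "(nat => 'r::ring_1) => nat => nat set => 'r"
  where "esym x d P = (\<Sum>A | A \<subseteq> P \<and> card A = d. prod_list (map x (sorted_list_of_set A)))"

lemma esym_0 [simp]: "finite P ==> esym x 0 P = 1"
proof -
  assume "finite P"
  then have "{A. A \<subseteq> P \<and> card A = 0} = {{}}" by (auto dest: finite_subset)
  then show ?thesis by (simp add: esym_def)
qed

lemma esym_big: "finite P ==> card P < d ==> esym x d P = 0"
proof -
  assume "finite P" "card P < d"
  then have "\<not> (A \<subseteq> P \<and> card A = d)" for A
    using card_mono[of P A] by auto
  then have none: "{A. A \<subseteq> P \<and> card A = d} = {}" by blast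
  show ?thesis by (simp only: esym_def none sum.empty)
qed

text \<open>Subsets are split by whether they contain \<open>b\<close>. Below, the hypothesis
  \<open>factor\<close> is supplied once by minimality of \<open>b\<close> and once by
  commutation.\<close>

lemma esym_insert_aux:
  assumes "finite P" and bP: "b \<notin> P"
    and factor: "\<And>A. A \<subseteq> P ==> prod_list (map x (sorted_list_of_set (insert b A))) = x b * prod_list (map x (sorted_list_of_set A))"
  shows "esym x (Suc d) (insert b P) = x b * esym x d P + esym x (Suc d) P"
proof -
  have sets: "{A. A \<subseteq> insert b P \<and> card A = Suc d} = insert b ` {A. A \<subseteq> P \<and> card A = d} \<union> {A. A \<subseteq> P \<and> card A = Suc d}"
    (is "?L = ?R")
  proof (intro equalityI subsetI)
    fix A assume A: "A \<in> ?L"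
    then have fin: "finite A" using assms(1) by (auto intro: finite_subset)
    show "A \<in> ?R"
    proof (cases "b \<in> A")
      case True
      have "A = insert b (A - {b})" using True by auto
      moreover have "A - {b} \<in> {A. A \<subseteq> P \<and> card A = d}"
        using A True fin by auto
      ultimately have "A \<in> insert b ` {A. A \<subseteq> P \<and> card A = d}" by (rule image_eqI)
      then show ?thesis by (rule UnI1)
    qed (use A in auto)
  next
    fix A assume "A \<in> ?R"
    then show "A \<in> ?L"
    proof
      assume "A \<in> insert b ` {A. A \<subseteq> P \<and> card A = d}"
      then obtain A' where A': "A = insert b A'" "A' \<subseteq> P" "card A' = d" by auto
      then have "card A = Suc d"
        using bP assms(1) finite_subset[of A' P] card_insert_disjoint[of A' b] by blast
      then show ?thesis using A' by auto
    qed auto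
  qed
  have "esym x (Suc d) (insert b P)
    = (\<Sum>A\<in>insert b ` {A. A \<subseteq> P \<and> card A = d}. prod_list (map x (sorted_list_of_set A))) + esym x (Suc d) P"
  proof -
    have "finite (insert b ` {A. A \<subseteq> P \<and> card A = d})" "finite {A. A \<subseteq> P \<and> card A = Suc d}"
      "insert b ` {A. A \<subseteq> P \<and> card A = d} \<inter> {A. A \<subseteq> P \<and> card A = Suc d} = {}"
      using assms(1) bP by auto
    from sum.union_disjoint[OF this] show ?thesis unfolding esym_def sets .
  qed
  also have "(\<Sum>A\<in>insert b ` {A. A \<subseteq> P \<and> card A = d}. prod_list (map x (sorted_list_of_set A)))
     = (\<Sum>A | A \<subseteq> P \<and> card A = d. prod_list (map x (sorted_list_of_set (insert b A))))"
  proof (subst sum.reindex)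
    show "inj_on (insert b) {A. A \<subseteq> P \<and> card A = d}"
    proof (rule inj_onI)
      fix A A' assume "A \<in> {A. A \<subseteq> P \<and> card A = d}" "A' \<in> {A. A \<subseteq> P \<and> card A = d}" "insert b A = insert b A'"
      then have "b \<notin> A" "b \<notin> A'" "insert b A = insert b A'" using bP by auto
      then show "A = A'" by (simp add: insert_ident)
    qed
  qed (simp add: o_def)
  also have "\<dots> = (\<Sum>A | A \<subseteq> P \<and> card A = d. x b * prod_list (map x (sorted_list_of_set A)))"
    using factor by (intro sum.cong) auto
  also have "\<dots> = x b * esym x d P" by (simp add: esym_def sum_distrib_left)
  finally show ?thesis .
qed

lemma esym_insert_min:
  assumes "finite P" "\<And>q. q \<in> P ==> b < q"
  shows "esym x (Suc d) (insert b P) = x b * esym x d P + esym x (Suc d) P"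
proof (rule esym_insert_aux[OF assms(1)])
  show bP: "b \<notin> P" using assms(2) by blast
  fix A assume A: "A \<subseteq> P"
  then have fin: "finite A" using assms(1) by (rule finite_subset)
  have "Min (insert b A) = b" using A fin assms(2) by (intro Min_eqI) (auto intro: less_imp_le)
  moreover have "insert b A - {b} = A" using A bP by auto
  ultimately have "sorted_list_of_set (insert b A) = b # sorted_list_of_set A"
    using sorted_list_of_set_nonempty[of "insert b A"] fin by simp
  then show "prod_list (map x (sorted_list_of_set (insert b A))) = x b * prod_list (map x (sorted_list_of_set A))"
    by simp
qed

lemma prod_list_insort:
  fixes x :: "nat => 'r::ring_1"
  shows "(\<And>q. q \<in> set l ==> x b * x q = x q * x b) ==> prod_list (map x (insort b l)) = x b * prod_list (map x l)"
proof (induction l)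
  case (Cons c l)
  then have "prod_list (map x (insort b l)) = x b * prod_list (map x l)" "x b * x c = x c * x b" by auto
  then show ?case by (simp add: assoc_comm)
qed simp

lemma esym_insert:
  assumes "finite P" "b \<notin> P" "\<And>q. q \<in> P ==> x b * x q = x q * x b"
  shows "esym x (Suc d) (insert b P) = x b * esym x d P + esym x (Suc d) P"
proof (rule esym_insert_aux[OF assms(1,2)])
  fix A assume A: "A \<subseteq> P"
  then have "finite A" "b \<notin> A" using assms by (auto intro: finite_subset)
  then have "prod_list (map x (sorted_list_of_set (insert b A))) = prod_list (map x (insort b (sorted_list_of_set A)))"
    by simp
  also have "\<dots> = x b * prod_list (map x (sorted_list_of_set A))"
    using A \<open>finite A\<close> assms(3) by (intro prod_list_insort) auto
  finally show "prod_list (map x (sorted_list_of_set (insert b A))) = x b * prod_list (map x (sorted_list_of_set A))" .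
qed

text \<open>With \<open>c 0 = 1\<close> and \<open>c d\<close> the elementary symmetric polynomials of \<open>z\<^sub>1, \<dots>, z\<^sub>m\<close>, this is
  the product of the \<open>y - z\<^sub>j\<close>; \<open>dgam\<close> is its divided difference.\<close>

definition gam :: "(nat => 'r::ring_1) => nat => 'r => 'r"
  where "gam c m y = (\<Sum>d\<le>m. (- 1) ^ d * c d * y ^ (m - d))"

definition dgam :: "(nat => 'r::ring_1) => nat => 'r => 'r => 'r"
  where "dgam c m y y' = (\<Sum>d\<le>m. (- 1) ^ d * c d * hsum (m - d) y y')"

abbreviation block_esym :: "(nat => 'r::ring_1) => nat => nat => nat => 'r"
  where "block_esym x b m d \<equiv> esym x d {b..<b + m}"

lemma block_esym_Suc:
  "esym x (Suc d) {b..<Suc (b + m)} = x b * esym x d {Suc b..<Suc (b + m)} + esym x (Suc d) {Suc b..<Suc (b + m)}"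
proof -
  have "{b..<Suc (b + m)} = insert b {Suc b..<Suc b + m}" by auto
  then show ?thesis using esym_insert_min[of "{Suc b..<Suc b + m}" b x d] by simp
qed

lemma esym_comm:
  assumes "\<And>q. q \<in> P ==> f * x q = x q * f"
  shows "f * esym x d P = esym x d P * f"
proof (cases "finite P")
  case True
  have "f * prod_list (map x (sorted_list_of_set A)) = prod_list (map x (sorted_list_of_set A)) * f"
    if "A \<subseteq> P" for A
    using assms that finite_subset[OF that True] by (intro comm_prod_list) auto
  then show ?thesis
    unfolding esym_def sum_distrib_left sum_distrib_right by (intro sum.cong) auto
next
  case False
  have "f * prod_list (map x (sorted_list_of_set A)) = prod_list (map x (sorted_list_of_set A)) * f"
    if "A \<subseteq> P" for A
  proof (cases "finite A")
    case True
    then show ?thesis using that assms by (intro comm_prod_list) auto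
  qed simp
  then show ?thesis
    unfolding esym_def sum_distrib_left sum_distrib_right by (intro sum.cong) auto
qed

lemma neg_one_power_comm: "(- 1) ^ d * z = z * (- 1) ^ d" for z :: "'r::ring_1"
  by (induction d) simp_all

text \<open>Splits off the root \<open>x b\<close> of the product of the \<open>y - z\<close>; for
  the coefficients this is the Pascal recursion of elementary symmetric polynomials. The second part
  is the Leibniz rule, matching the recursion of \<open>bdiff\<close>.\<close>

lemma gam_rec:
  fixes x :: "nat => 'r::ring_1"
  assumes y: "\<And>j. j < m ==> y * x (Suc b + j) = x (Suc b + j) * y"
  shows "gam (block_esym x b (Suc m)) (Suc m) y = (y - x b) * gam (block_esym x (Suc b) m) m y" (is ?g)
    and "dgam (block_esym x b (Suc m)) (Suc m) y y' = (y - x b) * dgam (block_esym x (Suc b) m) m y y'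
      + gam (block_esym x (Suc b) m) m y'" (is ?d)
proof -
  let ?e = "block_esym x (Suc b) m"
  have ye: "y * ((- 1) ^ d * ?e d * h) = (- 1) ^ d * ?e d * (y * h)" for d h
  proof -
    have "y * ?e d = ?e d * y"
    proof (rule esym_comm)
      fix q assume "q \<in> {Suc b..<Suc b + m}"
      then obtain j where "q = Suc b + j" "j < m" by (auto dest: le_Suc_ex)
      then show "y * x q = x q * y" using y[of j] by simp
    qed
    moreover have "y * ((- 1) ^ d * ?e d * h) = (y * (- 1) ^ d) * ?e d * h" by (simp only: mult.assoc)
    moreover have "y * (- 1) ^ d = (- 1) ^ d * y" by (rule neg_one_power_comm[symmetric])
    moreover have "(- 1) ^ d * y * ?e d * h = (- 1) ^ d * (y * ?e d) * h" by (simp only: mult.assoc)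
    ultimately show ?thesis by (simp only: mult.assoc)
  qed
  \<comment> \<open>The recursion of the coefficients against an arbitrary sequence
    \<open>H\<close>: powers of \<open>y\<close> give \<open>gam\<close>, and \<open>hsum\<close>
    gives \<open>dgam\<close>.\<close>
  have main: "(\<Sum>d\<le>Suc m. (- 1) ^ d * block_esym x b (Suc m) d * H (Suc m - d))
     = (\<Sum>d\<le>m. (- 1) ^ d * ?e d * H (Suc m - d)) - x b * (\<Sum>d\<le>m. (- 1) ^ d * ?e d * H (m - d))"
    for H :: "nat => 'r"
  proof -
    have "(\<Sum>d\<le>Suc m. (- 1) ^ d * block_esym x b (Suc m) d * H (Suc m - d))
      = H (Suc m) - (\<Sum>d\<le>m. (- 1) ^ d * (x b * ?e d + ?e (Suc d)) * H (m - d))"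
      by (simp add: sum.atMost_Suc_shift block_esym_Suc sum_negf del: sum.atMost_Suc)
    also have "(\<Sum>d\<le>m. (- 1) ^ d * (x b * ?e d + ?e (Suc d)) * H (m - d))
      = x b * (\<Sum>d\<le>m. (- 1) ^ d * ?e d * H (m - d)) + (\<Sum>d\<le>m. (- 1) ^ d * ?e (Suc d) * H (m - d))"
      unfolding sum_distrib_left sum.distrib[symmetric]
      by (intro sum.cong refl)
        (simp add: distrib_left distrib_right mult.assoc assoc_comm[OF neg_one_power_comm[of _ "x b"]])
    also have "(\<Sum>d\<le>m. (- 1) ^ d * ?e (Suc d) * H (m - d)) = H (Suc m) - (\<Sum>d\<le>Suc m. (- 1) ^ d * ?e d * H (Suc m - d))"
      by (simp add: sum.atMost_Suc_shift sum_negf del: sum.atMost_Suc)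
    also have "(\<Sum>d\<le>Suc m. (- 1) ^ d * ?e d * H (Suc m - d)) = (\<Sum>d\<le>m. (- 1) ^ d * ?e d * H (Suc m - d))"
      by (simp add: esym_big)
    finally show ?thesis by (simp add: algebra_simps)
  qed
  have ysum: "y * (\<Sum>d\<le>m. (- 1) ^ d * ?e d * H d) = (\<Sum>d\<le>m. (- 1) ^ d * ?e d * (y * H d))" for H :: "nat => 'r"
    by (simp only: sum_distrib_left ye)
  show ?g
    unfolding gam_def main left_diff_distrib ysum by (simp add: Suc_diff_le)
  have "(\<Sum>d\<le>m. (- 1) ^ d * ?e d * hsum (Suc m - d) y y')
    = (\<Sum>d\<le>m. (- 1) ^ d * ?e d * (y * hsum (m - d) y y')) + (\<Sum>d\<le>m. (- 1) ^ d * ?e d * y' ^ (m - d))"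
    unfolding sum.distrib[symmetric] by (intro sum.cong refl) (simp add: Suc_diff_le hsum_Suc distrib_left)
  then show ?d
    unfolding dgam_def gam_def main[of "\<lambda>j. hsum j y y'"] left_diff_distrib ysum by simp
qed

lemma esym_transports:
  assumes "\<And>j. j < m ==> transports C E (x (b + j)) (x (b' + j))"
  shows "transports C E (block_esym x b m d) (block_esym x b' m d)"
  using assms
proof (induction m arbitrary: b b' d)
  case 0
  show ?case by (cases d) (auto simp: esym_big intro: transports_zero transports_one)
next
  case (Suc m)
  have h: "transports C E (x b) (x b')" using Suc.prems[of 0] by simp
  have t: "transports C E (x (Suc b + j)) (x (Suc b' + j))" if "j < m" for j
    using Suc.prems[of "Suc j"] that by simp
  show ?case
  proof (cases d)
    case 0
    then show ?thesis by (simp add: transports_one)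
  next
    case (Suc d')
    then show ?thesis
      using Suc.IH[OF t] h by (simp add: block_esym_Suc) (intro transports_add transports_mult; simp)
  qed
qed

lemma gam_0 [simp]: "gam c 0 y = c 0" and dgam_0 [simp]: "dgam c 0 y y' = 0"
  by (simp_all add: gam_def dgam_def)

text \<open>The word of \<open>psi_longest\<close>, with positions relative to the first strand of
  the block.\<close>

definition nil_word :: "nat => nat list"
  where "nil_word m = concat (map (\<lambda>j. rev [0..<j]) [1..<m])"

lemma nil_word_less: "x \<in> set (nil_word m) ==> Suc x < m"
  by (auto simp: nil_word_def)

lemma prod_list_concat: "prod_list (concat xss) = prod_list (map prod_list xss)" for xss :: "'r::monoid_mult list list"
  by (induction xss) auto

section \<open>Double crossings with thick entries, and nilHecke relations on strands with equal
  labels\<close>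

context klr
begin

lemma bprod_append: "bprod a y r (v @ v') = bprod a y r v * bprod a y (r + length v) v'"
  by (induction v arbitrary: r) (auto simp: bprod_Cons mult.assoc)

lemma bprod_trivial: "Bar a \<notin> set v ==> bprod a y r v = 1"
  by (induction v arbitrary: r) (auto simp: bprod_Cons bfac_def)

lemma bprod_replicate:
  "(\<And>j. j < m ==> y * xx (r + j) = xx (r + j) * y) ==>
    bprod a y r (replicate m (Bar a)) = gam (block_esym xx r m) m y"
proof (induction m arbitrary: r)
  case (Suc m)
  have "y * xx (Suc r + j) = xx (Suc r + j) * y" if "j < m" for j
    using Suc.prems[of "Suc j"] that by simp
  then show ?case using Suc.IH[of "Suc r"] gam_rec(1)[of m y xx r] by (simp add: bprod_Cons bfac_def)
qed simp

lemma bdiff_append_left: "Bar a \<notin> set v ==> bdiff a y y' r (v @ v') = bdiff a y y' (r + length v) v'"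
  by (induction v arbitrary: r) (auto simp: bfac_def)

lemma bdiff_trivial: "Bar a \<notin> set v ==> bdiff a y y' r v = 0"
  by (induction v arbitrary: r) auto

lemma bdiff_replicate:
  assumes "Bar a \<notin> set v" "\<And>j. j < m ==> y * xx (r + j) = xx (r + j) * y"
    "\<And>j. j < m ==> y' * xx (r + j) = xx (r + j) * y'"
  shows "bdiff a y y' r (replicate m (Bar a) @ v) = dgam (block_esym xx r m) m y y'"
  using assms(2,3)
proof (induction m arbitrary: r)
  case 0
  then show ?case by (simp add: bdiff_trivial assms)
next
  case (Suc m)
  have "y * xx (Suc r + j) = xx (Suc r + j) * y" "y' * xx (Suc r + j) = xx (Suc r + j) * y'" if "j < m" for j
    using Suc.prems[of "Suc j"] that by simp_all
  then show ?case using Suc.IH[of "Suc r"] gam_rec(2)[of m y xx r y'] bprod_replicate[of m y' "Suc r" a]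
    by (simp add: bfac_def bprod_append bprod_trivial assms)
qed

lemma thick_word_split:
  assumes "a \<in> {1..N}"
  obtains v1 v2 where "expand_entry N lam (Thick k) = v1 @ replicate ((lam ! k) a) (Bar a) @ v2"
    "Bar a \<notin> set v1" "Bar a \<notin> set v2" "length v1 = (\<Sum>b\<in>{1..<a}. (lam ! k) b)"
proof -
  have u: "[1..<Suc N] = [1..<a] @ a # [Suc a..<Suc N]"
  proof -
    have "[1..<Suc N] = [1..<a] @ [a..<Suc N]"
      using assms upt_add_eq_append[of 1 a "Suc N - a"] by simp
    then show ?thesis using assms by (simp add: upt_conv_Cons del: upt_Suc)
  qed
  show thesis
    by (rule that[of "concat (map (\<lambda>a. replicate ((lam ! k) a) (Bar a)) [1..<a])"
          "concat (map (\<lambda>a. replicate ((lam ! k) a) (Bar a)) [Suc a..<Suc N])"])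
      (unfold expand_entry.simps u, auto simp: length_concat o_def interv_sum_list_conv_sum_set_nat simp del: upt_Suc)
qed

text \<open>Only the block labelled \<open>Bar a\<close> of the thick entry contributes; its factors
  multiply to the deformed power of \<open>y\<close>.\<close>

lemma bprod_thick:
  assumes "a \<in> {1..N}" "\<And>j. j < weight_size N (lam ! k) ==> y * xx (r + j) = xx (r + j) * y"
  shows "bprod a y r (expand_entry N lam (Thick k))
    = gam (block_esym xx (r + (\<Sum>b\<in>{1..<a}. (lam ! k) b)) ((lam ! k) a)) ((lam ! k) a) y"
proof -
  obtain v1 v2 where v: "expand_entry N lam (Thick k) = v1 @ replicate ((lam ! k) a) (Bar a) @ v2"
    "Bar a \<notin> set v1" "Bar a \<notin> set v2" "length v1 = (\<Sum>b\<in>{1..<a}. (lam ! k) b)"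
    using thick_word_split[OF assms(1)] .
  have "y * xx (r + length v1 + j) = xx (r + length v1 + j) * y" if "j < (lam ! k) a" for j
    using assms(2)[of "length v1 + j"] block_sum_le[OF assms(1), of "lam ! k"] that v(4) by (simp add: add.assoc)
  then show ?thesis using v by (simp add: bprod_append bprod_trivial bprod_replicate)
qed

lemma bdiff_thick:
  assumes "a \<in> {1..N}" "\<And>j. j < weight_size N (lam ! k) ==> y * xx (r + j) = xx (r + j) * y"
    "\<And>j. j < weight_size N (lam ! k) ==> y' * xx (r + j) = xx (r + j) * y'"
  shows "bdiff a y y' r (expand_entry N lam (Thick k))
    = dgam (block_esym xx (r + (\<Sum>b\<in>{1..<a}. (lam ! k) b)) ((lam ! k) a)) ((lam ! k) a) y y'"
proof -
  obtain v1 v2 where v: "expand_entry N lam (Thick k) = v1 @ replicate ((lam ! k) a) (Bar a) @ v2"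
    "Bar a \<notin> set v1" "Bar a \<notin> set v2" "length v1 = (\<Sum>b\<in>{1..<a}. (lam ! k) b)"
    using thick_word_split[OF assms(1)] .
  have "y * xx (r + length v1 + j) = xx (r + length v1 + j) * y"
    "y' * xx (r + length v1 + j) = xx (r + length v1 + j) * y'" if "j < (lam ! k) a" for j
    using assms(2,3)[of "length v1 + j"] block_sum_le[OF assms(1), of "lam ! k"] that v(4) by (simp_all add: add.assoc)
  then show ?thesis using v by (simp add: bdiff_append_left bdiff_replicate)
qed

definition "nilx b m = prod_list (map (\<lambda>j. xx (b + j) ^ (m - Suc j)) [0..<m])"
definition "nilps b m = prod_list (map (\<lambda>j. ps (b + j)) (nil_word m))"

lemma rho_nil_idem: "\<rho> (nil_idem b m * f) = nilx b m * nilps b m * \<rho> f"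
proof -
  have "[b..<b + j] = map (\<lambda>x. b + x) [0..<j]" for j
    by (simp add: map_add_upt add.commute)
  then have "concat (map (\<lambda>j. rev [b..<b + j]) [1..<m]) = map (\<lambda>x. b + x) (nil_word m)"
    unfolding nil_word_def by (simp add: map_concat rev_map o_def)
  then have p: "\<rho> (psi_longest b m * f) = nilps b m * \<rho> f" for f
    by (simp add: psi_longest_def prod_list_mult nilps_def o_def)
  have "\<rho> (prod_list (map (\<lambda>j. \<x> (b + j) ^ (m - Suc j)) l) * f)
      = prod_list (map (\<lambda>j. xx (b + j) ^ (m - Suc j)) l) * \<rho> f" for l f
    by (induction l) (auto simp: mult.assoc power_mult)
  then show ?thesis by (simp add: nil_idem_def nilx_def p mult.assoc)
qed

definition same_run :: "lab list => nat => nat => bool"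
  where "same_run w b m \<longleftrightarrow> b + m \<le> n \<and> (\<forall>j. Suc j < m \<longrightarrow> w ! (b + j) = w ! Suc (b + j))"

text \<open>The nilCoxeter relations hold only next to the idempotent of a word with equal labels in
  the block. The letters \<open>a j\<close> carry that idempotent, so that
  \<open>nilcox_longest\<close> applies to them.\<close>

lemma nilps_kill:
  assumes "w \<in> W" "same_run w b m" "Suc j < m"
  shows "ps (b + j) * nilps b m * ee w = 0"
proof -
  define a where "a j = ps (b + j) * ee w" for j
  have run: "w ! (b + j) = w ! Suc (b + j)" "Suc (b + j) < n" if "j < m - 1" for j
    using that assms(2) unfolding same_run_def by auto
  have com: "ps (b + j) * ee w = ee w * ps (b + j)" if "j < m - 1" for j
    using ps_ee_same[OF assms(1)] run[OF that] by simp
  have ww: "ee w * ee w = ee w" using ee_ee assms(1) by simp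
  have aa: "a j * a k = ps (b + j) * ps (b + k) * ee w" if "j < m - 1" "k < m - 1" for j k
  proof -
    have "a j * a k = ps (b + j) * (ee w * ps (b + k)) * ee w" by (simp only: a_def mult.assoc)
    also have "\<dots> = ps (b + j) * ps (b + k) * (ee w * ee w)"
      unfolding com[OF that(2), symmetric] by (simp only: mult.assoc)
    finally show ?thesis by (simp only: ww)
  qed
  have aaa: "a j * a k * a l = ps (b + j) * ps (b + k) * ps (b + l) * ee w" if "j < m - 1" "k < m - 1" "l < m - 1" for j k l
  proof -
    have "a j * a k * a l = ps (b + j) * ps (b + k) * (ee w * ps (b + l)) * ee w"
      unfolding aa[OF that(1,2)] by (simp only: a_def mult.assoc)
    also have "\<dots> = ps (b + j) * ps (b + k) * ps (b + l) * (ee w * ee w)"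
      unfolding com[OF that(3), symmetric] by (simp only: mult.assoc)
    finally show ?thesis by (simp only: ww)
  qed
  have eq: "prod_list (map (\<lambda>j. ps (b + j)) l) * ee w = ee w * prod_list (map a l)"
    if "\<And>j. j \<in> set l ==> j < m - 1" for l
    using that
  proof (induction l)
    case (Cons j l)
    then have IH: "prod_list (map (\<lambda>j. ps (b + j)) l) * ee w = ee w * prod_list (map a l)" and j: "j < m - 1" by auto
    have "prod_list (map (\<lambda>j. ps (b + j)) (j # l)) * ee w = ps (b + j) * (prod_list (map (\<lambda>j. ps (b + j)) l) * ee w)"
      by (simp add: mult.assoc)
    also have "\<dots> = ps (b + j) * (ee w * ee w) * prod_list (map a l)" unfolding IH ww by (simp only: mult.assoc)
    also have "\<dots> = ee w * a j * prod_list (map a l)" by (simp only: a_def com[OF j, symmetric] mult.assoc[symmetric])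
    finally show ?case by (simp add: mult.assoc)
  qed simp
  have "ps (b + j) * nilps b m * ee w = ps (b + j) * (ee w * prod_list (map a (nil_word m)))"
    unfolding nilps_def mult.assoc by (subst eq) (auto dest: nil_word_less)
  also have "\<dots> = a j * prod_list (map a (nil_word m))" by (simp add: a_def mult.assoc)
  also have "prod_list (map a (nil_word m)) = prod_list (map (\<lambda>j. prod_list (map a (rev [0..<j]))) [1..<m])"
    by (simp add: nil_word_def map_concat prod_list_concat o_def)
  also have "a j * \<dots> = 0"
  proof -
    have "a j * prod_list (map (\<lambda>j. prod_list (map a (rev [0..<j]))) [1..<Suc (m - 1)]) = 0"
    proof (rule nilcox_longest[where m = "m - 1"])
      fix j assume j: "j < m - 1"
      then show "a j * a j = 0" using square_same[OF assms(1)] run[OF j] aa by simp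
    next
      fix j assume j: "Suc j < m - 1"
      then show "a j * a (Suc j) * a j = a (Suc j) * a j * a (Suc j)"
        using braid_plain[OF assms(1), of "b + j"] run[of j] run[of "Suc j"] by (simp add: aaa)
    next
      fix j k assume "j < m - 1" "k < m - 1" "Suc j < k \<or> Suc k < j"
      then show "a j * a k = a k * a j" using ps_ps[of "b + j" "b + k"] run[of j] run[of k] by (auto simp: aa)
    qed (use assms(3) in auto)
    then show ?thesis using assms(3) by simp
  qed
  finally show ?thesis .
qed

lemma nilps_Suc: "nilps b (Suc m) = nilps b m * RR b m"
proof -
  have "RR b m = prod_list (map (\<lambda>j. ps (b + j)) (rev [0..<m]))"
  proof -
    have "[b..<b + m] = map (\<lambda>x. b + x) [0..<m]" by (simp add: map_add_upt add.commute)
    then show ?thesis by (simp add: RR_def rev_map o_def)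
  qed
  then show ?thesis by (cases m) (auto simp: nilps_def nil_word_def)
qed

text \<open>The corrections from sliding the two dots cancel in symmetric polynomials, which are
  generated by these two.\<close>

lemma ps_transports_product:
  assumes w: "w \<in> W" and run: "w ! p = w ! Suc p" "Suc p < n"
  shows "transports (ps p) (ee w) (xx p * xx (Suc p)) (xx p * xx (Suc p))"
    and "transports (ps p) (ee w) (xx p + xx (Suc p)) (xx p + xx (Suc p))"
proof -
  have xc: "xx p * xx (Suc p) = xx (Suc p) * xx p" using run by (intro xx_xx) auto
  have r: "ps p * xx p * ee w = xx (Suc p) * ps p * ee w + ee w"
    and l: "ps p * xx (Suc p) * ee w = xx p * ps p * ee w - ee w"
    using slide_right[OF w run(2)] slide_left[OF w run(2)] run by (auto simp: algebra_simps)
  have xe: "xx p * ee w = ee w * xx p" "xx (Suc p) * ee w = ee w * xx (Suc p)"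
    using w run by (auto intro!: xx_ee)
  show "transports (ps p) (ee w) (xx p * xx (Suc p)) (xx p * xx (Suc p))"
  proof (rule transportsI)
    show "xx p * xx (Suc p) * ee w = ee w * (xx p * xx (Suc p))" by (simp only: mult.assoc xe assoc_comm[OF xe(1)])
    have "ps p * (xx p * xx (Suc p)) * ee w = (ps p * xx p * ee w) * xx (Suc p)"
      by (simp only: mult.assoc xe(2))
    also have "\<dots> = xx (Suc p) * (ps p * xx (Suc p) * ee w) + ee w * xx (Suc p)"
      unfolding r by (simp only: distrib_right mult.assoc xe(2))
    also have "\<dots> = xx (Suc p) * xx p * ps p * ee w"
      unfolding l by (simp add: right_diff_distrib xe mult.assoc)
    finally show "ps p * (xx p * xx (Suc p)) * ee w = xx p * xx (Suc p) * ps p * ee w" by (simp only: xc)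
  qed
  show "transports (ps p) (ee w) (xx p + xx (Suc p)) (xx p + xx (Suc p))"
    by (rule transportsI) (simp_all add: distrib_left distrib_right xe r l)
qed

text \<open>A divided difference: apart from one factor \<open>xx p\<close> the monomial commutes
  with the crossing, and the crossing kills \<open>Y\<close>.\<close>

lemma nil_step:
  assumes w: "w \<in> W" and run: "w ! p = w ! Suc p" "Suc p < n"
    and Y: "ps p * Y = 0" "ee w * Y = Y" and G: "ps p * G = G * ps p" "G * ee w = ee w * G"
  shows "ps p * (xx p ^ Suc c * xx (Suc p) ^ c * G * Y) = xx p ^ c * xx (Suc p) ^ c * G * Y"
proof -
  let ?H = "(xx p * xx (Suc p)) ^ c * G"
  have xc: "xx p * xx (Suc p) = xx (Suc p) * xx p" using run by (intro xx_xx) auto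
  have split: "xx p ^ c * xx (Suc p) ^ c = (xx p * xx (Suc p)) ^ c"
    using xc by (rule commuting_power_mult[symmetric])
  have r: "ps p * xx p * ee w = xx (Suc p) * ps p * ee w + ee w"
    using slide_right[OF w run(2)] run by simp
  have pe: "ps p * ee w = ee w * ps p" using ps_ee_same[OF w run(2,1)] .
  note t1 = ps_transports_product(1)[OF w run]
  have tG: "transports (ps p) (ee w) G G" using G by (intro transports_comm) auto
  have tH: "transports (ps p) (ee w) ?H ?H"
    by (intro transports_mult transports_power t1 tG)
  have HY: "ee w * (?H * Y) = ?H * Y" using transports_idem[OF tH] Y(2) by (metis mult.assoc)
  have pH: "ps p * (?H * Y) = 0"
  proof -
    have "ps p * (?H * (ee w * Y)) = ps p * (?H * ee w) * Y" by (simp only: mult.assoc)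
    also have "\<dots> = ?H * (ps p * ee w) * Y" using transportsD[OF tH] by (simp add: mult.assoc)
    also have "\<dots> = ?H * (ps p * (ee w * Y))" by (simp only: mult.assoc)
    finally show ?thesis using Y by simp
  qed
  have "ps p * (xx p ^ Suc c * xx (Suc p) ^ c * G * Y) = ps p * (xx p * (?H * Y))"
    unfolding split[symmetric] by (simp add: mult.assoc)
  also have "\<dots> = ps p * (xx p * (ee w * (?H * Y)))" by (simp only: HY)
  also have "\<dots> = (xx (Suc p) * ps p * ee w + ee w) * (?H * Y)" unfolding r[symmetric] by (simp only: mult.assoc)
  also have "\<dots> = xx (Suc p) * (ps p * (ee w * (?H * Y))) + ee w * (?H * Y)" by (simp only: distrib_right mult.assoc)
  also have "\<dots> = ?H * Y" by (simp only: HY pH mult_zero_right add_0)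
  finally show ?thesis unfolding split .
qed

end

section \<open>The idempotents attached to sequences\<close>

lemma comm_mult:
  fixes a :: "'r::semigroup_mult"
  assumes "a * b = b * a" "a * c = c * a"
  shows "a * (b * c) = b * c * a"
proof -
  have "a * (b * c) = (a * b) * c" by (simp only: mult.assoc)
  also have "\<dots> = b * (a * c)" by (simp only: assms(1) mult.assoc)
  finally show ?thesis by (simp only: assms(2) mult.assoc)
qed

context klr
begin

definition "nilid b m = nilx b m * nilps b m"

lemma xx_power_ee: "w \<in> W ==> p < n ==> xx p ^ c * ee w = ee w * xx p ^ c"
  using comm_power[OF xx_ee[symmetric]] by metis

lemma nilx_ee: "w \<in> W ==> b + m \<le> n ==> nilx b m * ee w = ee w * nilx b m"
  unfolding nilx_def by (rule comm_prod_list[symmetric]) (auto simp: xx_power_ee)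

lemma nilps_ee: "w \<in> W ==> same_run w b m ==> nilps b m * ee w = ee w * nilps b m"
  unfolding nilps_def same_run_def
  by (rule comm_prod_list[symmetric]) (auto dest!: nil_word_less intro!: ps_ee_same[symmetric])

lemma nilx_Suc: "nilx b (Suc m) = prod_list (map (\<lambda>j. xx (b + j) ^ (m - j)) [0..<m])"
  by (simp add: nilx_def)

text \<open>Each letter of \<open>RR\<close> lowers one exponent of the staircase monomial by one,
  so a full run turns the staircase of \<open>m + 1\<close> strands into that of \<open>m\<close>
  strands.\<close>

lemma nil_reduce:
  assumes w: "w \<in> W" and run: "same_run w b (Suc m)" and Y: "ee w * Y = Y"
    "\<And>j. j < m ==> ps (b + j) * Y = 0"
  shows "k \<le> m ==> RR b k * nilx b (Suc m) * Y
    = prod_list (map (\<lambda>j. xx (b + j) ^ (m - Suc j)) [0..<k]) * prod_list (map (\<lambda>j. xx (b + j) ^ (m - j)) [k..<m]) * Y"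
proof (induction k)
  case 0
  then show ?case by (simp add: nilx_Suc)
next
  case (Suc k)
  have bn: "b + Suc m \<le> n" and eq: "\<And>j. j < m ==> w ! (b + j) = w ! Suc (b + j)"
    using run by (auto simp: same_run_def)
  let ?A = "\<lambda>k. prod_list (map (\<lambda>j. xx (b + j) ^ (m - Suc j)) [0..<k])"
  let ?S = "\<lambda>k. prod_list (map (\<lambda>j. xx (b + j) ^ (m - j)) [k..<m])"
  define c where "c = m - Suc k"
  have cA: "ps (b + k) * ?A k = ?A k * ps (b + k)"
    using bn Suc.prems by (intro comm_prod_list) (auto intro!: comm_power ps_xx)
  have cS: "ps (b + k) * ?S (Suc (Suc k)) = ?S (Suc (Suc k)) * ps (b + k)"
    using bn Suc.prems by (intro comm_prod_list) (auto intro!: comm_power ps_xx)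
  have Se: "?S (Suc (Suc k)) * ee w = ee w * ?S (Suc (Suc k))"
    using bn w by (intro comm_prod_list[symmetric]) (auto intro!: xx_power_ee[symmetric])
  have S: "?S k = xx (b + k) ^ Suc c * ?S (Suc k)"
    using Suc.prems unfolding c_def by (subst upt_conv_Cons) (auto simp: Suc_diff_Suc simp del: power_Suc)
  have S': "?S (Suc k) = xx (Suc (b + k)) ^ c * ?S (Suc (Suc k))"
  proof (cases "Suc k < m")
    case True
    then show ?thesis unfolding c_def by (subst upt_conv_Cons) auto
  next
    case False
    then show ?thesis using Suc.prems by (simp add: c_def)
  qed
  have cc: "xx (b + k) ^ c * xx (Suc (b + k)) ^ c * ?S (Suc (Suc k)) = xx (b + k) ^ c * ?S (Suc k)"
    by (simp add: S' mult.assoc)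
  have "RR b (Suc k) * nilx b (Suc m) * Y = ps (b + k) * (?A k * ?S k * Y)"
    using Suc by (simp add: RR_Suc' mult.assoc)
  also have "\<dots> = ?A k * (ps (b + k) * (xx (b + k) ^ Suc c * xx (Suc (b + k)) ^ c * ?S (Suc (Suc k)) * Y))"
    unfolding S S' by (simp only: mult.assoc assoc_comm[OF cA])
  also have "ps (b + k) * (xx (b + k) ^ Suc c * xx (Suc (b + k)) ^ c * ?S (Suc (Suc k)) * Y)
      = xx (b + k) ^ c * xx (Suc (b + k)) ^ c * ?S (Suc (Suc k)) * Y"
    using bn Suc.prems eq[of k] cS Se by (intro nil_step[OF w] Y) auto
  also have "?A k * (xx (b + k) ^ c * xx (Suc (b + k)) ^ c * ?S (Suc (Suc k)) * Y) = ?A (Suc k) * ?S (Suc k) * Y"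
    unfolding cc by (simp add: c_def mult.assoc)
  finally show ?case .
qed

text \<open>The longest divided difference of the staircase monomial is 1, which is the reason why
  the nilHecke element is idempotent.\<close>

lemma nilps_nilx:
  assumes "w \<in> W" "same_run w b m" "ee w * Y = Y" "\<And>j. Suc j < m ==> ps (b + j) * Y = 0"
  shows "nilps b m * nilx b m * Y = Y"
  using assms(2,4)
proof (induction m)
  case 0
  then show ?case by (simp add: nilps_def nilx_def nil_word_def)
next
  case (Suc m)
  have "nilps b (Suc m) * nilx b (Suc m) * Y = nilps b m * (RR b m * nilx b (Suc m) * Y)"
    by (simp only: nilps_Suc mult.assoc)
  also have "RR b m * nilx b (Suc m) * Y = nilx b m * Y"
    using nil_reduce[OF assms(1) Suc.prems(1) assms(3), of m] Suc.prems(2) by (simp add: nilx_def)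
  also have "nilps b m * (nilx b m * Y) = Y"
    using Suc.IH Suc.prems by (simp add: same_run_def mult.assoc)
  finally show ?case .
qed

lemma nilid_nilx:
  assumes "w \<in> W" "same_run w b m" "ee w * Y = Y" "\<And>j. Suc j < m ==> ps (b + j) * Y = 0"
  shows "nilid b m * nilx b m * Y = nilx b m * Y"
proof -
  have "nilid b m * nilx b m * Y = nilx b m * (nilps b m * nilx b m * Y)"
    by (simp only: nilid_def mult.assoc)
  then show ?thesis using nilps_nilx[OF assms] by simp
qed

lemma ps_nilx_far:
  "\<lbrakk>Suc p < b \<or> b + m \<le> p; Suc p < n; b + m \<le> n\<rbrakk> \<Longrightarrow> ps p * nilx b m = nilx b m * ps p"
  unfolding nilx_def by (rule comm_prod_list) (auto intro!: comm_power ps_xx)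

lemma ps_nilps_far:
  "\<lbrakk>Suc p < b \<or> b + m \<le> p; Suc p < n; b + m \<le> n\<rbrakk> \<Longrightarrow> ps p * nilps b m = nilps b m * ps p"
  unfolding nilps_def by (rule comm_prod_list) (auto dest!: nil_word_less intro!: ps_ps)

lemma xx_nilx: "p < n ==> b + m \<le> n ==> xx p * nilx b m = nilx b m * xx p"
  unfolding nilx_def by (rule comm_prod_list) (auto intro!: comm_power xx_xx)

lemma xx_nilps_far: "\<lbrakk>p < b \<or> b + m \<le> p; p < n; b + m \<le> n\<rbrakk> \<Longrightarrow> xx p * nilps b m = nilps b m * xx p"
  unfolding nilps_def by (rule comm_prod_list) (auto dest!: nil_word_less intro!: ps_xx[symmetric])

definition run_list :: "lab list => (nat \<times> nat) list => bool"
  where "run_list w bl \<longleftrightarrow> (\<forall>(b, m)\<in>set bl. same_run w b m)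
    \<and> sorted_wrt (\<lambda>(b, m) (b', m'). b + m \<le> b') bl"

abbreviation "nus bl \<equiv> prod_list (map (\<lambda>(b, m). nilid b m) bl)"
abbreviation "nilxs bl \<equiv> prod_list (map (\<lambda>(b, m). nilx b m) bl)"
abbreviation "nilpss bl \<equiv> prod_list (map (\<lambda>(b, m). nilps b m) bl)"

lemma nilxs_ee: "w \<in> W ==> run_list w bl ==> nilxs bl * ee w = ee w * nilxs bl"
  unfolding run_list_def by (rule comm_prod_list[symmetric]) (auto simp: same_run_def nilx_ee)

lemma nilpss_ee: "w \<in> W ==> run_list w bl ==> nilpss bl * ee w = ee w * nilpss bl"
  unfolding run_list_def by (rule comm_prod_list[symmetric]) (auto simp: nilps_ee)

lemma nilx_nilps_far:
  assumes "b + m \<le> b' \<or> b' + m' \<le> b" "b + m \<le> n" "b' + m' \<le> n"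
  shows "nilx b m * nilps b' m' = nilps b' m' * nilx b m"
  unfolding nilx_def using assms
  by (intro comm_prod_list[symmetric]) (auto intro!: comm_power xx_nilps_far[symmetric])

lemma nilx_nilx:
  assumes "b + m \<le> n" "b' + m' \<le> n"
  shows "nilx b m * nilx b' m' = nilx b' m' * nilx b m"
  unfolding nilx_def[of b'] using assms
  by (intro comm_prod_list) (auto intro!: comm_power xx_nilx[symmetric])

text \<open>Whatever is killed by all crossings inside the blocks becomes fixed by the nilHecke
  idempotents once it is multiplied by the staircase monomials. This yields idempotency in
  \<open>nus_idem\<close>, and later functions on which the unit of \<open>S\<close> acts as the
  identity.\<close>

lemma nus_nilxs:
  assumes "w \<in> W" "run_list w bl" "ee w * Y = Y"
    "\<And>b m j. (b, m) \<in> set bl ==> Suc j < m ==> ps (b + j) * Y = 0"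
  shows "nus bl * (nilxs bl * Y) = nilxs bl * Y"
  using assms(2,4)
proof (induction bl)
  case (Cons bm bl)
  obtain b m where bm: "bm = (b, m)" by force
  have run: "same_run w b m" "b + m \<le> n" "run_list w bl"
    "\<And>b' m'. (b', m') \<in> set bl ==> b + m \<le> b' \<and> b' + m' \<le> n"
    using Cons.prems(1) unfolding run_list_def bm same_run_def by auto
  have c: "nus bl * nilx b m = nilx b m * nus bl"
  proof (rule comm_prod_list[symmetric])
    fix f assume "f \<in> set (map (\<lambda>(b, m). nilid b m) bl)"
    then obtain b' m' where f: "f = nilid b' m'" "(b', m') \<in> set bl" by auto
    then have b': "b + m \<le> b'" "b' + m' \<le> n" using run(4) by blast+
    have "nilx b m * nilx b' m' = nilx b' m' * nilx b m" "nilx b m * nilps b' m' = nilps b' m' * nilx b m"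
      using b' run(2) by (auto intro!: nilx_nilx nilx_nilps_far)
    then show "nilx b m * f = f * nilx b m" unfolding f nilid_def
      by (rule comm_mult)
  qed
  have IH: "nus bl * (nilxs bl * Y) = nilxs bl * Y"
    using Cons.IH[OF run(3)] Cons.prems(2) by auto
  have Y': "ee w * (nilxs bl * Y) = nilxs bl * Y"
    using assoc_comm[OF nilxs_ee[OF assms(1) run(3), symmetric], of Y] assms(3) by simp
  have kill: "ps (b + j) * (nilxs bl * Y) = 0" if "Suc j < m" for j
  proof -
    have "ps (b + j) * nilxs bl = nilxs bl * ps (b + j)"
    proof (rule comm_prod_list)
      fix f assume "f \<in> set (map (\<lambda>(b, m). nilx b m) bl)"
      then obtain b' m' where f: "f = nilx b' m'" "(b', m') \<in> set bl" by auto
      then show "ps (b + j) * f = f * ps (b + j)"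
        using that run(2) run(4)[OF f(2)] by (auto intro!: ps_nilx_far)
    qed
    then have "ps (b + j) * (nilxs bl * Y) = nilxs bl * (ps (b + j) * Y)" by (rule assoc_comm)
    also have "ps (b + j) * Y = 0" using Cons.prems(2)[of b m j] that bm by simp
    finally show ?thesis by simp
  qed
  have "nus (bm # bl) * (nilxs (bm # bl) * Y) = nilid b m * (nus bl * nilx b m) * (nilxs bl * Y)"
    by (simp add: bm mult.assoc)
  also have "\<dots> = nilid b m * nilx b m * (nus bl * (nilxs bl * Y))" unfolding c by (simp only: mult.assoc)
  also have "\<dots> = nilx b m * (nilxs bl * Y)" unfolding IH by (rule nilid_nilx[OF assms(1) run(1) Y' kill])
  finally show ?case by (simp add: bm mult.assoc)
qed simp

lemma nus_split:
  assumes "run_list w bl"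
  shows "nus bl = nilxs bl * nilpss bl"
  using assms
proof (induction bl)
  case (Cons bm bl)
  obtain b m where bm: "bm = (b, m)" by force
  have run: "run_list w bl" "b + m \<le> n" "\<And>b' m'. (b', m') \<in> set bl ==> b + m \<le> b' \<and> b' + m' \<le> n"
    using Cons.prems unfolding run_list_def bm same_run_def by auto
  have c: "nilps b m * nilxs bl = nilxs bl * nilps b m"
  proof (rule comm_prod_list)
    fix f assume "f \<in> set (map (\<lambda>(b, m). nilx b m) bl)"
    then obtain b' m' where f: "f = nilx b' m'" "(b', m') \<in> set bl" by auto
    then show "nilps b m * f = f * nilps b m" using run(2) run(3)[OF f(2)] by (auto intro!: nilx_nilps_far[symmetric])
  qed
  have "nus (bm # bl) = nilx b m * (nilps b m * nilxs bl) * nilpss bl"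
    using Cons.IH[OF run(1)] by (simp add: bm nilid_def mult.assoc)
  then show ?case unfolding c by (simp add: bm mult.assoc)
qed simp

lemma nilpss_kill:
  assumes "w \<in> W" "run_list w bl" "(b, m) \<in> set bl" "Suc j < m"
  shows "ps (b + j) * (nilpss bl * ee w) = 0"
  using assms(2,3)
proof (induction bl)
  case (Cons bm bl)
  obtain b' m' where bm: "bm = (b', m')" by force
  have run: "run_list w bl" "same_run w b' m'" "b' + m' \<le> n"
    "\<And>b m. (b, m) \<in> set bl ==> b' + m' \<le> b \<and> b + m \<le> n"
    using Cons.prems unfolding run_list_def bm same_run_def by auto
  show ?case
  proof (cases "(b, m) = (b', m')")
    case True
    have "ps (b + j) * (nilpss (bm # bl) * ee w) = ps (b + j) * (nilps b m * ee w) * nilpss bl"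
      using True nilpss_ee[OF assms(1) run(1)] by (simp add: bm mult.assoc)
    also have "ps (b + j) * (nilps b m * ee w) = 0"
      using nilps_kill[OF assms(1), of b m j] run(2) True assms(4) by (simp add: mult.assoc)
    finally show ?thesis by simp
  next
    case False
    then have bl: "(b, m) \<in> set bl" using Cons.prems(2) unfolding bm by auto
    have "ps (b + j) * nilps b' m' = nilps b' m' * ps (b + j)"
      using run(3) run(4)[OF bl] assms(4) by (intro ps_nilps_far) auto
    then have "ps (b + j) * (nilpss (bm # bl) * ee w) = nilps b' m' * (ps (b + j) * (nilpss bl * ee w))"
      by (simp add: bm mult.assoc assoc_comm)
    then show ?thesis using Cons.IH[OF run(1) bl] by simp
  qed
qed simp

lemma nus_idem:
  assumes "w \<in> W" "run_list w bl"
  shows "nus bl * ee w = ee w * nus bl" and "nus bl * nus bl * ee w = nus bl * ee w"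
proof -
  have s: "nus bl = nilxs bl * nilpss bl" using nus_split[OF assms(2)] .
  show c: "nus bl * ee w = ee w * nus bl"
    unfolding s by (rule comm_mult[symmetric]) (simp_all only: nilxs_ee[OF assms] nilpss_ee[OF assms])
  have e: "ee w * (nilpss bl * ee w) = nilpss bl * ee w"
    unfolding nilpss_ee[OF assms] using assoc_eq[of "ee w" "ee w" "ee w"] ee_ee[OF assms(1) assms(1)] by simp
  have "nus bl * nus bl * ee w = nus bl * (nilxs bl * (nilpss bl * ee w))"
    by (subst (2) s) (simp only: mult.assoc)
  also have "\<dots> = nilxs bl * (nilpss bl * ee w)"
    by (rule nus_nilxs[OF assms e]) (rule nilpss_kill[OF assms])
  also have "\<dots> = nus bl * ee w" unfolding s by (simp only: mult.assoc)
  finally show "nus bl * nus bl * ee w = nus bl * ee w" .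
qed

end

definition block_list :: "nat => (nat => nat) list => entry list => (nat \<times> nat) list"
  where "block_list N lam i =
    map (\<lambda>(k, a). (block_start N lam i k a, (lam ! k) a)) (List.product [0..<length lam] [1..<Suc N])"

lemma sorted_wrt_product:
  assumes "sorted_wrt R xs" "sorted_wrt S ys"
  shows "sorted_wrt (\<lambda>(x, y) (x', y'). R x x' \<or> (x = x' \<and> S y y')) (List.product xs ys)"
  using assms(1)
proof (induction xs)
  case (Cons a xs)
  have "sorted_wrt (\<lambda>y y'. R a a \<or> S y y') ys"
    by (rule sorted_wrt_mono_rel[OF _ assms(2)]) auto
  then show ?case using Cons by (auto simp: sorted_wrt_append sorted_wrt_map)
qed simp

lemma rho_prod_list_factor:
  assumes "alg_hom \<rho> \<kappa>" "\<And>a h. a \<in> set l ==> \<rho> (F a * h) = G a * \<rho> h"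
  shows "\<rho> (prod_list (map F l) * f) = prod_list (map G l) * \<rho> f"
  using assms(2) by (induction l) (auto simp: mult.assoc)

locale klr_seq = klr \<rho> \<kappa> N B t n
  for \<rho> :: "(lab gens, 'k::field) free => 'r::ring_1" and \<kappa> N B t n +
  fixes lam :: "(nat => nat) list" and nu :: "nat list"
  assumes n_eq: "n = strands N lam nu"
    and nu_set: "set nu \<subseteq> {1..N}"
    and nondegenerate: "nu = [] \<or> (\<forall>k<length lam. \<exists>a\<in>{1..N}. (lam ! k) a \<noteq> 0)"
begin

abbreviation "Sq \<equiv> Seq lam nu"
abbreviation "wd i \<equiv> expand N lam i"
abbreviation "fs i p \<equiv> first_strand N lam i p"

definition "se i = nus (block_list N lam i) * ee (wd i)"

lemma wd_W: "i \<in> Sq ==> wd i \<in> W"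
  using expand_words[OF _ nu_set] by (simp add: n_eq)

lemma wd_inj: "i \<in> Sq ==> j \<in> Sq ==> wd i = wd j \<longleftrightarrow> i = j"
  using expand_inj[OF nondegenerate] by blast

lemma fs_le: "i \<in> Sq ==> fs i p \<le> n"
  using first_strand_le[of N lam i p] expand_length[of i lam nu N] n_eq by simp

lemma run_list_block_list:
  assumes i: "i \<in> Sq"
  shows "run_list (wd i) (block_list N lam i)"
proof -
  \<comment> \<open>The lexicographic order of the pairs \<open>(k, a)\<close> is the order of the
    blocks from left to right.\<close>
  have "sorted_wrt (\<lambda>(k, a) (k', a'). k < k' \<or> (k = k' \<and> a < a')) (List.product [0..<length lam] [1..<Suc N])"
    by (rule sorted_wrt_product) (auto simp del: upt_Suc)
  then have "sorted_wrt (\<lambda>ka ka'. block_start N lam i (fst ka) (snd ka) + (lam ! fst ka) (snd ka) \<le> block_start N lam i (fst ka') (snd ka'))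
      (List.product [0..<length lam] [1..<Suc N])"
    by (rule sorted_wrt_mono_rel[rotated]) (auto intro!: block_order[OF i])
  then have "sorted_wrt (\<lambda>(b, m) (b', m'). b + m \<le> b') (block_list N lam i)"
    by (simp add: block_list_def sorted_wrt_map case_prod_beta)
  moreover have "same_run (wd i) b m" if bm: "(b, m) \<in> set (block_list N lam i)" for b m
  proof -
    obtain k a where ka: "k < length lam" "a \<in> {1..N}" "b = block_start N lam i k a" "m = (lam ! k) a"
      using bm by (auto simp: block_list_def less_Suc_eq_le simp del: upt_Suc)
    show ?thesis
      using block_bounds[OF i ka(1,2)] fs_le[OF i, of "Suc (thick_pos i k)"]
        block_bounds(3)[OF i ka(1,2), of "Suc _"]
      unfolding same_run_def ka(3,4) by auto
  qed
  ultimately show ?thesis by (auto simp: run_list_def)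
qed

lemma rho_S_e: "\<rho> (S_e N lam i) = se i"
proof -
  let ?F = "\<lambda>(k, a). nil_idem (block_start N lam i k a) ((lam ! k) a) :: (lab gens, 'k) free"
  have "(\<Prod>k\<leftarrow>ks. \<Prod>a\<leftarrow>as. ?F (k, a)) = prod_list (map ?F (List.product ks as))" for ks as
    by (induction ks) (auto simp: o_def)
  then have "S_e N lam i = prod_list (map ?F (List.product [0..<length lam] [1..<Suc N])) * \<e> (wd i)"
    by (simp add: S_e_def del: upt_Suc)
  also have "\<rho> \<dots> = prod_list (map (\<lambda>(k, a). nilid (block_start N lam i k a) ((lam ! k) a))
      (List.product [0..<length lam] [1..<Suc N])) * ee (wd i)"
    by (rule rho_prod_list_factor[OF alg_hom_axioms]) (auto simp: rho_nil_idem nilid_def)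
  also have "\<dots> = se i"
    by (simp add: se_def block_list_def o_def split_def del: upt_Suc)
  finally show ?thesis .
qed

lemma se_se: "i \<in> Sq ==> j \<in> Sq ==> se i * se j = (if i = j then se i else 0)"
proof -
  assume i: "i \<in> Sq" and j: "j \<in> Sq"
  note c = nus_idem[OF wd_W run_list_block_list]
  have "se i * se j = nus (block_list N lam i) * (ee (wd i) * ee (wd j)) * nus (block_list N lam j)"
    using c(1)[OF j j] by (simp add: se_def mult.assoc)
  also have "\<dots> = (if i = j then se i else 0)"
  proof (cases "i = j")
    case True
    have "nus (block_list N lam i) * ee (wd i) * nus (block_list N lam i) = nus (block_list N lam i) * nus (block_list N lam i) * ee (wd i)"
      by (simp only: mult.assoc c(1)[OF i i, symmetric])
    then show ?thesis using True ee_ee[OF wd_W wd_W, OF i i] c(2)[OF i i] by (simp add: se_def)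
  qed (simp add: ee_ee[OF wd_W wd_W, OF i j] wd_inj i j)
  finally show ?thesis .
qed

lemma se_ee:
  assumes "i \<in> Sq"
  shows "se i * ee (wd i) = se i" "ee (wd i) * se i = se i"
proof -
  have e: "ee (wd i) * ee (wd i) = ee (wd i)" using ee_ee[OF wd_W wd_W, OF assms assms] by simp
  note c = nus_idem(1)[OF wd_W run_list_block_list, OF assms assms]
  show "se i * ee (wd i) = se i" by (simp only: se_def mult.assoc e)
  show "ee (wd i) * se i = se i" unfolding se_def c by (simp only: mult.assoc[symmetric] e)
qed

end

section \<open>The deformed tensor product algebra\<close>

text \<open>
  Webster's relations without the cyclotomic one, in which the powers \<open>y\<^sup>m\<close> with \<open>m\<close> the
  multiplicity of \<open>a\<close> in \<open>\<lambda>\<^sub>k\<close> are deformed to polynomials with central coefficients \<open>E k a d\<close>.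
\<close>

locale tensor_relations =
  fixes N :: nat and B :: "nat => nat => int" and lam :: "(nat => nat) list" and nu :: "nat list"
    and e :: "entry list => 'r::ring_1" and y :: "nat => 'r" and E :: "nat => nat => nat => 'r" and P :: "nat => 'r"
  assumes e_e: "i \<in> Seq lam nu ==> j \<in> Seq lam nu ==> e i * e j = (if i = j then e i else 0)"
    and y_sum: "p < length lam + length nu ==> (\<Sum>i\<in>Seq lam nu. y p * e i) = y p"
    and E_sum: "k < length lam ==> a \<in> {1..N} ==> d \<in> {1..(lam ! k) a} ==> (\<Sum>i\<in>Seq lam nu. E k a d * e i) = E k a d"
    and P_sum: "Suc p < length lam + length nu ==> (\<Sum>i\<in>Seq lam nu. P p * e i) = P p"
    and y_e: "i \<in> Seq lam nu ==> p < length i ==> y p * e i = e i * y p"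
    and E_e: "i \<in> Seq lam nu ==> k < length lam ==> a \<in> {1..N} ==> d \<in> {1..(lam ! k) a} ==> E k a d * e i = e i * E k a d"
    and y_y: "p < length lam + length nu ==> q < length lam + length nu ==> y p * y q = y q * y p"
    and E_y: "k < length lam ==> a \<in> {1..N} ==> d \<in> {1..(lam ! k) a} ==> p < length lam + length nu ==>
      E k a d * y p = y p * E k a d"
    and E_P: "k < length lam ==> a \<in> {1..N} ==> d \<in> {1..(lam ! k) a} ==> Suc p < length lam + length nu ==>
      E k a d * P p = P p * E k a d"
    and y_red: "i \<in> Seq lam nu ==> p < length i ==> \<not> is_solid (i ! p) ==> y p * e i = 0"
    and P_red: "i \<in> Seq lam nu ==> Suc p < length i ==> \<not> is_solid (i ! p) ==> \<not> is_solid (i ! Suc p) ==> P p * e i = 0"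
    and P_e: "i \<in> Seq lam nu ==> Suc p < length i ==> is_solid (i ! p) \<or> is_solid (i ! Suc p) ==>
      P p * e i = e (swap p i) * P p"
    and P_y: "Suc p < length lam + length nu ==> q < length lam + length nu ==> q \<noteq> p ==> q \<noteq> Suc p ==>
      P p * y q = y q * P p"
    and P_P: "Suc p < length lam + length nu ==> Suc q < length lam + length nu ==> Suc p < q ==>
      P p * P q = P q * P p"
    and slide_left: "i \<in> Seq lam nu ==> Suc p < length i ==> is_solid (i ! p) \<or> is_solid (i ! Suc p) ==>
      y p * P p * e i = P p * y (Suc p) * e i + (if i ! p = i ! Suc p then e i else 0)"
    and slide_right: "i \<in> Seq lam nu ==> Suc p < length i ==> is_solid (i ! p) \<or> is_solid (i ! Suc p) ==>
      P p * y p * e i = y (Suc p) * P p * e i + (if i ! p = i ! Suc p then e i else 0)"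
    and square_black: "i \<in> Seq lam nu ==> Suc p < length i ==> i ! p = Solid a ==> i ! Suc p = Solid b ==>
      P p * P p * e i = Q_poly B a b (y p) (y (Suc p)) * e i"
    and square_black_red: "i \<in> Seq lam nu ==> Suc p < length i ==> i ! p = Solid a ==> i ! Suc p = Thick k ==>
      P p * P p * e i = gam (\<lambda>d. if d = 0 then 1 else E k a d) ((lam ! k) a) (y p) * e i"
    and square_red_black: "i \<in> Seq lam nu ==> Suc p < length i ==> i ! p = Thick k ==> i ! Suc p = Solid a ==>
      P p * P p * e i = gam (\<lambda>d. if d = 0 then 1 else E k a d) ((lam ! k) a) (y (Suc p)) * e i"
    and braid_black: "i \<in> Seq lam nu ==> Suc (Suc p) < length i ==>
      i ! p = Solid a ==> i ! Suc p = Solid b ==> i ! Suc (Suc p) = Solid a ==>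
      P p * P (Suc p) * P p * e i = P (Suc p) * P p * P (Suc p) * e i + Q_quot B a b (y p) (y (Suc (Suc p))) * e i"
    and braid_red: "i \<in> Seq lam nu ==> Suc (Suc p) < length i ==>
      i ! p = Solid a ==> i ! Suc p = Thick k ==> i ! Suc (Suc p) = Solid a ==>
      P p * P (Suc p) * P p * e i = P (Suc p) * P p * P (Suc p) * e i
        + dgam (\<lambda>d. if d = 0 then 1 else E k a d) ((lam ! k) a) (y p) (y (Suc (Suc p))) * e i"
    and braid_plain: "i \<in> Seq lam nu ==> Suc (Suc p) < length i ==>
      card {q \<in> {p, Suc p, Suc (Suc p)}. \<not> is_solid (i ! q)} \<le> 1 ==> i ! p \<noteq> i ! Suc (Suc p) ==>
      P p * P (Suc p) * P p * e i = P (Suc p) * P p * P (Suc p) * e i"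

section \<open>Crossings of entries and the generators of the subalgebra\<close>

context klr_seq
begin

lemma nilid_transports:
  assumes "\<And>j. j < m ==> transports C E (xx (b + j)) (xx (b' + j))"
    "\<And>j. Suc j < m ==> transports C E (ps (b + j)) (ps (b' + j))"
  shows "transports C E (nilid b m) (nilid b' m)"
  unfolding nilid_def nilx_def nilps_def using assms
  by (intro transports_mult transports_prod_list transports_power) (auto dest: nil_word_less)

text \<open>The image of \<open>S_Psi\<close> stripped of its idempotent, so that relations can be
  proved next to a word idempotent before they are multiplied by \<open>se i\<close>.\<close>

definition cr :: "entry list => nat => 'r"
  where "cr i p = (case (i ! p, i ! Suc p) of
      (Solid a, Solid b) => ps (fs i p)
    | (Thick k, Solid b) => LL (fs i p) (weight_size N (lam ! k))
    | (Solid a, Thick k) => RR (fs i p) (weight_size N (lam ! k))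
    | (Thick k, Thick l) => 0)"

lemma cr_cases:
  assumes "Suc p < length i" "is_solid (i ! p) \<or> is_solid (i ! Suc p)"
  obtains (SS) a b where "i ! p = Solid a" "i ! Suc p = Solid b" "cr i p = ps (fs i p)"
      "fs i (Suc p) = Suc (fs i p)" "fs i (Suc (Suc p)) = Suc (Suc (fs i p))"
  | (ST) a k where "i ! p = Solid a" "i ! Suc p = Thick k" "cr i p = RR (fs i p) (weight_size N (lam ! k))"
      "fs i (Suc p) = Suc (fs i p)" "fs i (Suc (Suc p)) = Suc (fs i p + weight_size N (lam ! k))"
  | (TS) a k where "i ! p = Thick k" "i ! Suc p = Solid a" "cr i p = LL (fs i p) (weight_size N (lam ! k))"
      "fs i (Suc p) = fs i p + weight_size N (lam ! k)" "fs i (Suc (Suc p)) = Suc (fs i p + weight_size N (lam ! k))"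
  using assms first_strand_Suc[of p i N lam] first_strand_Suc[of "Suc p" i N lam]
  by (cases "i ! p"; cases "i ! Suc p") (auto simp: cr_def)

lemma cr_comm:
  assumes "Suc p < length i" "is_solid (i ! p) \<or> is_solid (i ! Suc p)"
    "\<And>r. fs i p \<le> r ==> Suc r < fs i (Suc (Suc p)) ==> f * ps r = ps r * f"
  shows "f * cr i p = cr i p * f"
  using assms(1,2)
  by (cases rule: cr_cases) (use assms(3) in \<open>auto intro!: comm_RR comm_LL\<close>)

lemma split_word:
  assumes "i \<in> Sq" "Suc p < length i"
  obtains u z where "wd i = u @ expand_entry N lam (i ! p) @ expand_entry N lam (i ! Suc p) @ z"
    "wd (swap p i) = u @ expand_entry N lam (i ! Suc p) @ expand_entry N lam (i ! p) @ z"
    "length u = fs i p"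
  using expand_split[OF assms(2)] by metis

lemma Orig_notin_thick: "Orig a \<notin> set (expand_entry N lam (Thick k))"
  and thick_Bar: "l \<in> set (expand_entry N lam (Thick k)) ==> \<exists>c. l = Bar c"
  by (auto simp: expand_entry.simps)

lemma cr_ee:
  assumes i: "i \<in> Sq" and p: "Suc p < length i" and s: "is_solid (i ! p) \<or> is_solid (i ! Suc p)"
  shows "cr i p * ee (wd i) = ee (wd (swap p i)) * cr i p"
proof -
  obtain u z where w: "wd i = u @ expand_entry N lam (i ! p) @ expand_entry N lam (i ! Suc p) @ z"
    "wd (swap p i) = u @ expand_entry N lam (i ! Suc p) @ expand_entry N lam (i ! p) @ z"
    "length u = fs i p" using split_word[OF i p] .
  note W = wd_W[OF i]
  from p s show ?thesis
  proof (cases rule: cr_cases)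
    case (SS a b)
    then show ?thesis using ps_ee_append[of u "Orig a" "Orig b" z] W w by simp
  next
    case (ST a k)
    then show ?thesis using RR_ee[of u "Orig a" "expand_entry N lam (Thick k)" z] W w by simp
  next
    case (TS a k)
    then show ?thesis using LL_ee[of u "expand_entry N lam (Thick k)" "Orig a" z] W w by simp
  qed
qed

lemma block_far:
  assumes i: "i \<in> Sq" and p: "Suc p < length i" and k: "k < length lam" "a \<in> {1..N}"
    and ne: "i ! p \<noteq> Thick k" "i ! Suc p \<noteq> Thick k"
  shows "block_start N lam i k a + (lam ! k) a \<le> fs i p \<or> fs i (Suc (Suc p)) \<le> block_start N lam i k a"
proof -
  note tp = thick_pos[OF i k(1)]
  have "thick_pos i k \<noteq> p" "thick_pos i k \<noteq> Suc p" using ne tp by auto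
  then consider "Suc (thick_pos i k) \<le> p" | "Suc (Suc p) \<le> thick_pos i k" by linarith
  then show ?thesis
  proof cases
    case 1
    then show ?thesis using first_strand_mono[OF 1, of N lam i] block_bounds(2)[OF i k] by linarith
  next
    case 2
    then show ?thesis using first_strand_mono[OF 2, of N lam i] block_bounds(1)[OF i k] by linarith
  qed
qed

text \<open>Everything built from the dots and inner crossings of a block moves along with them:
  nilHecke idempotents in \<open>cr_se\<close>, elementary symmetric polynomials in
  \<open>cr_esym\<close>.\<close>

lemma cr_transports_letters:
  assumes i: "i \<in> Sq" and p: "Suc p < length i" and s: "is_solid (i ! p) \<or> is_solid (i ! Suc p)"
    and k: "k < length lam" "a \<in> {1..N}"
  defines "b \<equiv> block_start N lam i k a" and "b' \<equiv> block_start N lam (swap p i) k a" and "m \<equiv> (lam ! k) a"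
  shows "j < m ==> transports (cr i p) (ee (wd i)) (xx (b + j)) (xx (b' + j))"
    and "Suc j < m ==> transports (cr i p) (ee (wd i)) (ps (b + j)) (ps (b' + j))"
proof -
  obtain u z where w: "wd i = u @ expand_entry N lam (i ! p) @ expand_entry N lam (i ! Suc p) @ z"
    "wd (swap p i) = u @ expand_entry N lam (i ! Suc p) @ expand_entry N lam (i ! p) @ z"
    "length u = fs i p" using split_word[OF i p] .
  note W = wd_W[OF i]
  have bn: "b + m \<le> n"
    using block_bounds(2)[OF i k] fs_le[OF i, of "Suc (thick_pos i k)"] by (simp add: b_def m_def)
  have fn: "fs i (Suc (Suc p)) \<le> n" using fs_le[OF i] .
  have run: "wd i ! (b + j) = wd i ! Suc (b + j)" if "Suc j < m" for j
    using block_bounds(3)[OF i k, of j] block_bounds(3)[OF i k, of "Suc j"] that by (simp add: b_def m_def)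
  have bb: "(\<Sum>b\<in>{1..<a}. (lam ! k) b) + m \<le> weight_size N (lam ! k)"
    unfolding m_def by (rule block_sum_le[OF k(2)])
  consider "i ! p \<noteq> Thick k" "i ! Suc p \<noteq> Thick k" | "i ! p = Thick k" | "i ! Suc p = Thick k" by blast
  then have "(j < m \<longrightarrow> transports (cr i p) (ee (wd i)) (xx (b + j)) (xx (b' + j)))
    \<and> (Suc j < m \<longrightarrow> transports (cr i p) (ee (wd i)) (ps (b + j)) (ps (b' + j)))"
  proof cases
    case 1
    have b': "b' = b" using block_start_swap(1)[OF i p s k(1) 1] by (simp add: b_def b'_def)
    have far: "b + m \<le> fs i p \<or> fs i (Suc (Suc p)) \<le> b"
      using block_far[OF i p k 1] by (simp add: b_def m_def)
    show ?thesis unfolding b'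
    proof (intro conjI impI)
      assume "j < m"
      then show "transports (cr i p) (ee (wd i)) (xx (b + j)) (xx (b + j))"
        using far bn fn by (intro transports_comm xx_ee[OF W] cr_comm[OF p s, symmetric] ps_xx[symmetric]) auto
    next
      assume "Suc j < m"
      then show "transports (cr i p) (ee (wd i)) (ps (b + j)) (ps (b + j))"
        using far bn fn run[of j] by (intro transports_comm ps_ee_same[OF W] cr_comm[OF p s, symmetric] ps_ps) auto
    qed
  next
    case 2
    then obtain a' where sol: "i ! Suc p = Solid a'" using s by (auto simp: is_solid_iff)
    have b': "b' = Suc b" using block_start_swap(2)[OF i p s k(1) 2] by (simp add: b_def b'_def)
    have tp: "thick_pos i k = p" using thick_pos_eq(1)[OF i _ 2] p by simp
    have b: "b = length u + (\<Sum>b\<in>{1..<a}. (lam ! k) b)" using tp w(3) by (simp add: b_def block_start_def)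
    let ?v = "expand_entry N lam (Thick k)"
    have w': "wd i = u @ ?v @ Orig a' # z" using w(1) 2 sol by simp
    have cr: "cr i p = LL (length u) (length ?v)" using 2 sol w(3) by (simp add: cr_def)
    show ?thesis
    proof (intro conjI impI)
      assume "j < m"
      then show "transports (cr i p) (ee (wd i)) (xx (b + j)) (xx (b' + j))"
        using LL_transports_x(2)[of u ?v "Orig a'" z "b + j - length u"] W w' bb Orig_notin_thick
        unfolding cr b' w' b by (simp add: add.assoc)
    next
      assume j: "Suc j < m"
      have nth: "wd i ! (length u + r) = ?v ! r" if "r < length ?v" for r
        using that unfolding w' by (simp add: nth_append)
      have "?v ! (b + j - length u) = ?v ! Suc (b + j - length u)"
        using nth[of "b + j - length u"] nth[of "Suc (b + j - length u)"] run[OF j] j bb b by (simp add: add.assoc)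
      then show "transports (cr i p) (ee (wd i)) (ps (b + j)) (ps (b' + j))"
        using LL_transports_ps[of u ?v "Orig a'" z "b + j - length u"] W w' bb Orig_notin_thick j
        unfolding cr b' w' b by (simp add: add.assoc)
    qed
  next
    case 3
    then obtain a' where sol: "i ! p = Solid a'" using s by (auto simp: is_solid_iff)
    have b': "b = Suc b'" using block_start_swap(3)[OF i p s k(1) 3] by (simp add: b_def b'_def)
    have tp: "thick_pos i k = Suc p" using thick_pos_eq(1)[OF i p 3] .
    have b: "b' = length u + (\<Sum>b\<in>{1..<a}. (lam ! k) b)"
      using tp w(3) first_strand_Suc[of p i N lam] p sol b' by (simp add: b_def block_start_def)
    let ?v = "expand_entry N lam (Thick k)"
    have w': "wd i = u @ Orig a' # ?v @ z" using w(1) 3 sol by simp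
    have cr: "cr i p = RR (length u) (length ?v)" using 3 sol w(3) by (simp add: cr_def)
    show ?thesis
    proof (intro conjI impI)
      assume "j < m"
      then show "transports (cr i p) (ee (wd i)) (xx (b + j)) (xx (b' + j))"
        using RR_transports_x(2)[of u "Orig a'" ?v z "b' + j - length u"] W w' bb Orig_notin_thick
        unfolding cr b' w' b by (simp add: add.assoc)
    next
      assume j: "Suc j < m"
      have nth: "wd i ! Suc (length u + r) = ?v ! r" if "r < length ?v" for r
        using that nth_append_length_plus[of u "Orig a' # ?v @ z" "Suc r"] unfolding w' by (simp add: nth_append)
      have "?v ! (b' + j - length u) = ?v ! Suc (b' + j - length u)"
        using nth[of "b' + j - length u"] nth[of "Suc (b' + j - length u)"] run[OF j] j bb b b' by (simp add: add.assoc)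
      then show "transports (cr i p) (ee (wd i)) (ps (b + j)) (ps (b' + j))"
        using RR_transports_ps[of u "Orig a'" ?v z "b' + j - length u"] W w' bb Orig_notin_thick j
        unfolding cr b' w' b by (simp add: add.assoc)
    qed
  qed
  then show "j < m ==> transports (cr i p) (ee (wd i)) (xx (b + j)) (xx (b' + j))"
    and "Suc j < m ==> transports (cr i p) (ee (wd i)) (ps (b + j)) (ps (b' + j))" by blast+
qed

lemma cr_se:
  assumes i: "i \<in> Sq" and p: "Suc p < length i" and s: "is_solid (i ! p) \<or> is_solid (i ! Suc p)"
  shows "cr i p * se i = se (swap p i) * cr i p"
proof -
  have t: "transports (cr i p) (ee (wd i)) (nus (block_list N lam i)) (nus (block_list N lam (swap p i)))"
    unfolding block_list_def map_map
    by (intro transports_prod_list)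
      (auto simp del: upt_Suc simp: less_Suc_eq_le intro!: nilid_transports cr_transports_letters[OF i p s])
  have "cr i p * se i = nus (block_list N lam (swap p i)) * (cr i p * ee (wd i))"
    unfolding se_def using transportsD[OF t] by simp
  also have "\<dots> = se (swap p i) * cr i p"
    unfolding se_def cr_ee[OF i p s] by (simp only: mult.assoc)
  finally show ?thesis .
qed

lemma cr_red: "\<not> is_solid (i ! p) ==> \<not> is_solid (i ! Suc p) ==> cr i p = 0"
  by (auto simp: cr_def not_is_solid_iff)

definition "sy p i = (if is_solid (i ! p) then xx (fs i p) else 0)"
definition "sE k a d i = block_esym xx (block_start N lam i k a) ((lam ! k) a) d"
definition "yy p = (\<Sum>i\<in>Sq. sy p i * se i)"
definition "EE k a d = (\<Sum>i\<in>Sq. sE k a d i * se i)"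
definition "PP p = (\<Sum>i\<in>Sq. cr i p * se i)"

lemma sum_se: "i \<in> Sq ==> (\<Sum>j\<in>Sq. f j * se j) * se i = f i * se i"
proof -
  assume i: "i \<in> Sq"
  have "(\<Sum>j\<in>Sq. f j * se j) * se i = (\<Sum>j\<in>Sq. if j = i then f i * se i else 0)"
    unfolding sum_distrib_right using i by (intro sum.cong) (auto simp: mult.assoc se_se)
  then show ?thesis using i by simp
qed

lemma yy_se: "i \<in> Sq ==> yy p * se i = sy p i * se i"
  and EE_se: "i \<in> Sq ==> EE k a d * se i = sE k a d i * se i"
  and PP_se: "i \<in> Sq ==> PP p * se i = cr i p * se i"
  by (simp_all add: yy_def EE_def PP_def sum_se)

lemma comm_se:
  assumes i: "i \<in> Sq" and f: "f * ee (wd i) = ee (wd i) * f"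
    and nil: "\<And>k a. k < length lam ==> a \<in> {1..N} ==>
      transports f (ee (wd i)) (nilid (block_start N lam i k a) ((lam ! k) a)) (nilid (block_start N lam i k a) ((lam ! k) a))"
  shows "f * se i = se i * f"
proof -
  have "transports f (ee (wd i)) (nus (block_list N lam i)) (nus (block_list N lam i))"
    unfolding block_list_def map_map
    by (intro transports_prod_list) (auto simp del: upt_Suc simp: less_Suc_eq_le nil)
  then have "f * se i = nus (block_list N lam i) * (f * ee (wd i))"
    unfolding se_def using transportsD by blast
  then show ?thesis unfolding se_def f by (simp only: mult.assoc)
qed

lemma block_le_n: "i \<in> Sq ==> k < length lam ==> a \<in> {1..N} ==> block_start N lam i k a + (lam ! k) a \<le> n"
  using block_bounds(2)[of i lam nu k a N] fs_le[of i "Suc (thick_pos i k)"] by (metis le_trans)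

lemma nilid_ee:
  assumes "i \<in> Sq" "k < length lam" "a \<in> {1..N}"
  shows "nilid (block_start N lam i k a) ((lam ! k) a) * ee (wd i) = ee (wd i) * nilid (block_start N lam i k a) ((lam ! k) a)"
proof -
  have "same_run (wd i) (block_start N lam i k a) ((lam ! k) a)"
    using block_le_n[OF assms] block_bounds(3)[OF assms] block_bounds(3)[OF assms, of "Suc _"]
    unfolding same_run_def by simp
  then show ?thesis
    unfolding nilid_def
    by (intro comm_mult[symmetric] nilx_ee[symmetric] nilps_ee[symmetric] wd_W assms block_le_n)
qed

lemma solid_strand:
  assumes "i \<in> Sq" "p < length i" "is_solid (i ! p)"
  shows "fs i p < n" "fs i (Suc p) = Suc (fs i p)"
proof -
  show "fs i (Suc p) = Suc (fs i p)" using assms by (auto simp: first_strand_Suc is_solid_iff)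
  then show "fs i p < n" using fs_le[OF assms(1), of "Suc p"] by simp
qed

lemma sy_se:
  assumes i: "i \<in> Sq" and p: "p < length i"
  shows "sy p i * se i = se i * sy p i"
proof (cases "is_solid (i ! p)")
  case True
  note sol = solid_strand[OF i p True]
  show ?thesis
  proof (rule comm_se[OF i])
    show "sy p i * ee (wd i) = ee (wd i) * sy p i" using True sol by (simp add: sy_def xx_ee wd_W i)
    fix k a assume k: "k < length lam" "a \<in> {1..N}"
    let ?b = "block_start N lam i k a" and ?m = "(lam ! k) a"
    note tp = thick_pos[OF i k(1)]
    have "thick_pos i k \<noteq> p" using True tp by auto
    then have "?b + ?m \<le> fs i p \<or> fs i (Suc p) \<le> ?b"
      using first_strand_mono[of "Suc (thick_pos i k)" p N lam i] first_strand_mono[of "Suc p" "thick_pos i k" N lam i]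
        block_bounds(1,2)[OF i k] by linarith
    then have "xx (fs i p) * nilid ?b ?m = nilid ?b ?m * xx (fs i p)"
      unfolding nilid_def using sol block_le_n[OF i k]
      by (intro comm_mult xx_nilx xx_nilps_far) auto
    then show "transports (sy p i) (ee (wd i)) (nilid ?b ?m) (nilid ?b ?m)"
      using True nilid_ee[OF i k] by (intro transports_comm) (auto simp: sy_def)
  qed
qed (simp add: sy_def)

text \<open>Splitting off the two crossed positions expresses \<open>esym\<close> through the sum
  and the product of their dots, with coefficients in the other dots.\<close>

lemma ps_esym:
  assumes w: "w \<in> W" and p: "p \<in> Q" "Suc p \<in> Q" "w ! p = w ! Suc p" and Q: "Q \<subseteq> {..<n}"
  shows "transports (ps p) (ee w) (esym xx d Q) (esym xx d Q)"
proof -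
  define Q' where "Q' = Q - {p, Suc p}"
  have Q': "Q = insert p (insert (Suc p) Q')" "finite Q'" "p \<notin> insert (Suc p) Q'" "Suc p \<notin> Q'"
    using p Q finite_subset[OF Q] by (auto simp: Q'_def)
  have pn: "Suc p < n" using p Q by auto
  have c: "xx r * xx q = xx q * xx r" if "r \<in> Q" "q \<in> Q" for r q
    using that Q by (intro xx_xx) auto
  have e1: "esym xx (Suc c) Q = xx p * esym xx c (insert (Suc p) Q') + esym xx (Suc c) (insert (Suc p) Q')" for c
    unfolding Q'(1) using c Q' by (intro esym_insert) auto
  have e2: "esym xx (Suc c) (insert (Suc p) Q') = xx (Suc p) * esym xx c Q' + esym xx (Suc c) Q'" for c
    using c Q' by (intro esym_insert) auto
  note t = ps_transports_product[OF w p(3) pn]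
  have t': "transports (ps p) (ee w) (esym xx c Q') (esym xx c Q')" for c
  proof (rule transports_comm)
    show "esym xx c Q' * ee w = ee w * esym xx c Q'"
      using w Q Q' by (intro esym_comm[symmetric] xx_ee[symmetric]) auto
    show "ps p * esym xx c Q' = esym xx c Q' * ps p"
      using pn Q Q' by (intro esym_comm ps_xx) auto
  qed
  have fin: "finite Q" "finite (insert (Suc p) Q')" using Q' by auto
  consider "d = 0" | "d = Suc 0" | c where "d = Suc (Suc c)" by (metis not0_implies_Suc)
  then show ?thesis
  proof cases
    case 1
    then show ?thesis using fin by (simp add: transports_one)
  next
    case 2
    have "esym xx d Q = (xx p + xx (Suc p)) * esym xx 0 Q' + esym xx (Suc 0) Q'"
      unfolding 2 e1 e2 using fin Q' by (simp add: add.assoc)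
    then show ?thesis using t t' by (auto intro!: transports_add transports_mult)
  next
    case 3
    have "esym xx d Q = xx p * xx (Suc p) * esym xx c Q' + (xx p + xx (Suc p)) * esym xx (Suc c) Q' + esym xx (Suc (Suc c)) Q'"
      unfolding 3 e1 e2 by (simp add: algebra_simps)
    then show ?thesis using t t' by (auto intro!: transports_add transports_mult)
  qed
qed

lemma sE_se:
  assumes i: "i \<in> Sq" and k: "k < length lam" "a \<in> {1..N}"
  shows "sE k a d i * se i = se i * sE k a d i"
proof (rule comm_se[OF i])
  let ?b = "block_start N lam i k a" and ?m = "(lam ! k) a"
  note bn = block_le_n[OF i k]
  show ee: "sE k a d i * ee (wd i) = ee (wd i) * sE k a d i"
    unfolding sE_def using bn by (intro esym_comm[symmetric] xx_ee[symmetric] wd_W i) auto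
  fix k' a' assume k': "k' < length lam" "a' \<in> {1..N}"
  let ?b' = "block_start N lam i k' a'" and ?m' = "(lam ! k') a'"
  have tx: "transports (sE k a d i) (ee (wd i)) (xx (?b' + j)) (xx (?b' + j))" if "j < ?m'" for j
    unfolding sE_def using that block_le_n[OF i k'] bn
    by (intro transports_comm esym_comm[symmetric] xx_ee xx_xx wd_W i) auto
  have tp: "transports (sE k a d i) (ee (wd i)) (ps (?b' + j)) (ps (?b' + j))" if j: "Suc j < ?m'" for j
  proof -
    have run: "wd i ! (?b' + j) = wd i ! Suc (?b' + j)"
      using block_bounds(3)[OF i k', of j] block_bounds(3)[OF i k', of "Suc j"] j by simp
    have pe: "ps (?b' + j) * ee (wd i) = ee (wd i) * ps (?b' + j)"
      using run block_le_n[OF i k'] j by (intro ps_ee_same wd_W i) auto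
    have "transports (ps (?b' + j)) (ee (wd i)) (sE k a d i) (sE k a d i)"
    proof (cases "k = k' \<and> a = a'")
      case True
      then show ?thesis unfolding sE_def using j bn run by (intro ps_esym wd_W i) auto
    next
      case False
      then consider "k < k' \<or> k = k' \<and> a < a'" | "k' < k \<or> k' = k \<and> a' < a" by linarith
      then have "?b + ?m \<le> ?b' \<or> ?b' + ?m' \<le> ?b"
        using block_order[OF i k(1) k'(1) k(2) k'(2)] block_order[OF i k'(1) k(1) k'(2) k(2)] by cases auto
      then show ?thesis
        unfolding sE_def using j bn block_le_n[OF i k']
        by (intro transports_comm ee[unfolded sE_def] esym_comm ps_xx) auto
    qed
    then have "ps (?b' + j) * sE k a d i * ee (wd i) = sE k a d i * ps (?b' + j) * ee (wd i)"
      by (simp add: transports_def)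
    then show ?thesis using pe by (intro transportsI) simp_all
  qed
  show "transports (sE k a d i) (ee (wd i)) (nilid ?b' ?m') (nilid ?b' ?m')"
    by (rule nilid_transports) (fact tx tp)+
qed

end

lemma transports_hsum:
  "transports C E g h ==> transports C E g' h' ==> transports C E (hsum m g g') (hsum m h h')"
  unfolding hsum_def by (intro transports_sum transports_mult transports_power)

lemma transports_neg_one_power: "transports C E ((- 1) ^ d) ((- 1) ^ d)"
  by (intro transports_power transports_minus transports_one)

lemma transports_gam:
  "(\<And>d. d \<le> m ==> transports C E (c d) (c' d)) ==> transports C E g h ==> transports C E (gam c m g) (gam c' m h)"
  unfolding gam_def by (intro transports_sum transports_mult transports_power transports_neg_one_power) auto

lemma transports_dgam:
  "(\<And>d. d \<le> m ==> transports C E (c d) (c' d)) ==> transports C E g h ==> transports C E g' h' ==>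
    transports C E (dgam c m g g') (dgam c' m h h')"
  unfolding dgam_def by (intro transports_sum transports_mult transports_hsum transports_neg_one_power) auto

lemma transports_Q_poly:
  "transports C E g h ==> transports C E g' h' ==> transports C E (Q_poly B a b g g') (Q_poly B a b h h')"
  unfolding Q_poly_def by (auto intro: transports_zero transports_one transports_add transports_power)

lemma transports_Q_quot:
  "transports C E g h ==> transports C E g' h' ==> transports C E (Q_quot B a b g g') (Q_quot B a b h h')"
  unfolding Q_quot_def by (auto intro: transports_zero transports_hsum)

section \<open>The deformed relations hold in the subalgebra\<close>

context klr_seq
begin

abbreviation "rr \<equiv> length lam + length nu"

lemma se_sum:
  assumes "i \<in> Sq" "\<And>j. j \<in> Sq ==> f j * se j = se j * f j"
  shows "se i * (\<Sum>j\<in>Sq. f j * se j) = f i * se i"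
proof -
  have "se i * (\<Sum>j\<in>Sq. f j * se j) = (\<Sum>j\<in>Sq. if j = i then f i * se i else 0)"
    unfolding sum_distrib_left using assms
    by (intro sum.cong) (auto simp: mult.assoc[symmetric] se_se)
  then show ?thesis using assms by simp
qed

lemma eq_by_se:
  assumes "(\<Sum>i\<in>Sq. a * se i) = a" "(\<Sum>i\<in>Sq. b * se i) = b" "\<And>i. i \<in> Sq ==> a * se i = b * se i"
  shows "a = b"
  using assms by (metis (no_types, lifting) sum.cong)

lemma unit_sums:
  "(\<Sum>i\<in>Sq. yy p * se i) = yy p" "(\<Sum>i\<in>Sq. EE k a d * se i) = EE k a d" "(\<Sum>i\<in>Sq. PP p * se i) = PP p"
  by (simp_all add: yy_se EE_se PP_se) (simp_all add: yy_def EE_def PP_def)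

lemma unit_sums_mult:
  assumes "(\<Sum>i\<in>Sq. b * se i) = b"
  shows "(\<Sum>i\<in>Sq. a * b * se i) = a * b"
  using assms by (simp only: mult.assoc sum_distrib_left[symmetric])

text \<open>With \<open>1\<close> as the crossing, \<open>transports\<close> says that
  \<open>sy p i\<close> commutes with \<open>se i\<close> and agrees there with \<open>yy p\<close>.
  The closure lemmas for \<open>transports\<close> then replace the one by the other inside
  polynomials.\<close>

lemma yy_tr: "i \<in> Sq ==> p < length i ==> transports 1 (se i) (sy p i) (yy p)"
  by (rule transportsI) (simp_all add: sy_se yy_se)

lemma EE_tr: "i \<in> Sq ==> k < length lam ==> a \<in> {1..N} ==> transports 1 (se i) (sE k a d i) (EE k a d)"
  by (rule transportsI) (simp_all add: sE_se EE_se)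

lemma tr_eq: "transports 1 E g h ==> h * E = g * E"
  by (drule transportsD) simp

lemma lift_ee:
  assumes "i \<in> Sq" "f * ee (wd i) = g * ee (wd i)"
  shows "f * se i = g * se i"
  using arg_cong[OF assms(2), of "\<lambda>h. h * se i"] by (simp only: mult.assoc se_ee(2)[OF assms(1)])

lemma PP_cr:
  assumes "i \<in> Sq" "Suc q < length i" "is_solid (i ! q) \<or> is_solid (i ! Suc q)"
  shows "PP p * (cr i q * se i) = cr (swap q i) p * (cr i q * se i)"
  using assms PP_se[OF Seq_swap[OF assms]] by (simp add: cr_se mult.assoc[symmetric])

lemma yy_cr:
  assumes "i \<in> Sq" "Suc q < length i" "is_solid (i ! q) \<or> is_solid (i ! Suc q)"
  shows "yy p * (cr i q * se i) = sy p (swap q i) * (cr i q * se i)"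
  using assms yy_se[OF Seq_swap[OF assms]] by (simp add: cr_se mult.assoc[symmetric])

lemma EE_cr:
  assumes "i \<in> Sq" "Suc q < length i" "is_solid (i ! q) \<or> is_solid (i ! Suc q)"
  shows "EE k a d * (cr i q * se i) = sE k a d (swap q i) * (cr i q * se i)"
  using assms EE_se[OF Seq_swap[OF assms]] by (simp add: cr_se mult.assoc[symmetric])

lemma PP_comm:
  assumes "i \<in> Sq" "f * se i = se i * f"
  shows "PP p * (f * se i) = cr i p * (f * se i)"
  using PP_se[OF assms(1), of p] by (simp add: assms(2) mult.assoc[symmetric])

lemma cr_esym:
  assumes "i \<in> Sq" "Suc p < length i" "is_solid (i ! p) \<or> is_solid (i ! Suc p)" "k < length lam" "a \<in> {1..N}"
  shows "transports (cr i p) (ee (wd i)) (sE k a d i) (sE k a d (swap p i))"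
  unfolding sE_def using assms by (intro esym_transports cr_transports_letters)

lemma split_word3:
  assumes "i \<in> Sq" "Suc (Suc p) < length i"
  obtains u z where "wd i = u @ expand_entry N lam (i ! p) @ expand_entry N lam (i ! Suc p)
      @ expand_entry N lam (i ! Suc (Suc p)) @ z" "length u = fs i p"
proof -
  obtain u v where i: "i = u @ i ! p # i ! Suc p # i ! Suc (Suc p) # v" "length u = p"
    using split_three[OF assms(2)] .
  have "fs i p = length (expand N lam u)"
    unfolding first_strand_def by (subst i(1)) (simp add: i(2))
  moreover have "wd i = expand N lam u @ expand_entry N lam (i ! p) @ expand_entry N lam (i ! Suc p)
      @ expand_entry N lam (i ! Suc (Suc p)) @ expand N lam v"
    by (subst i(1)) simp
  ultimately show thesis using that by metis
qed

lemma gam_tr: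
  assumes "i \<in> Sq" "k < length lam" "a \<in> {1..N}"
  shows "transports 1 (se i) (block_esym xx (block_start N lam i k a) ((lam ! k) a) d) (if d = 0 then 1 else EE k a d)"
  using EE_tr[OF assms, of d] by (auto simp: sE_def intro: transports_one)

lemma sy_slide:
  assumes i: "i \<in> Sq" and p: "Suc p < length i" and s: "is_solid (i ! p) \<or> is_solid (i ! Suc p)"
  shows "sy p (swap p i) * cr i p * ee (wd i) = cr i p * sy (Suc p) i * ee (wd i) + (if i ! p = i ! Suc p then ee (wd i) else 0)"
    and "cr i p * sy p i * ee (wd i) = sy (Suc p) (swap p i) * cr i p * ee (wd i) + (if i ! p = i ! Suc p then ee (wd i) else 0)"
proof -
  obtain u z where w: "wd i = u @ expand_entry N lam (i ! p) @ expand_entry N lam (i ! Suc p) @ z"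
    "wd (swap p i) = u @ expand_entry N lam (i ! Suc p) @ expand_entry N lam (i ! p) @ z"
    "length u = fs i p" using split_word[OF i p] .
  note W = wd_W[OF i]
  have f: "fs (swap p i) p = fs i p" "fs (swap p i) (Suc p) = fs i p + length (expand_entry N lam (i ! Suc p))"
    using first_strand_swap[OF p, of p] first_strand_swap_Suc[OF p] by auto
  from p s have "sy p (swap p i) * cr i p * ee (wd i) = cr i p * sy (Suc p) i * ee (wd i) + (if i ! p = i ! Suc p then ee (wd i) else 0)
    \<and> cr i p * sy p i * ee (wd i) = sy (Suc p) (swap p i) * cr i p * ee (wd i) + (if i ! p = i ! Suc p then ee (wd i) else 0)"
  proof (cases rule: cr_cases)
    case (SS a b)
    have nth: "wd i ! fs i p = Orig a" "wd i ! Suc (fs i p) = Orig b" "Suc (fs i p) < n"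
      using SS w(1) fs_le[OF i, of "Suc (Suc p)"] by (simp_all add: w(3)[symmetric] nth_append1)
    show ?thesis
      using slide_left[OF W nth(3)] slide_right[OF W nth(3)] SS p f nth by (simp add: sy_def)
  next
    case (ST a k)
    have "transports (cr i p) (ee (wd i)) (xx (fs i p)) (xx (fs i p + weight_size N (lam ! k)))"
      using RR_transports_x(1)[of u "Orig a" "expand_entry N lam (Thick k)" z] ST w W Orig_notin_thick by simp
    then show ?thesis using ST p f by (simp add: sy_def transports_def)
  next
    case (TS a k)
    have "transports (cr i p) (ee (wd i)) (xx (fs i p + weight_size N (lam ! k))) (xx (fs i p))"
      using LL_transports_x(1)[of u "expand_entry N lam (Thick k)" "Orig a" z] TS w W Orig_notin_thick by simp
    then show ?thesis using TS p f by (simp add: sy_def transports_def)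
  qed
  then show "sy p (swap p i) * cr i p * ee (wd i) = cr i p * sy (Suc p) i * ee (wd i) + (if i ! p = i ! Suc p then ee (wd i) else 0)"
    and "cr i p * sy p i * ee (wd i) = sy (Suc p) (swap p i) * cr i p * ee (wd i) + (if i ! p = i ! Suc p then ee (wd i) else 0)"
    by blast+
qed

lemma cr_square:
  assumes i: "i \<in> Sq" and p: "Suc p < length i"
  shows "i ! p = Solid a ==> i ! Suc p = Solid b ==>
      cr (swap p i) p * cr i p * ee (wd i) = Q_poly B a b (sy p i) (sy (Suc p) i) * ee (wd i)"
    and "i ! p = Solid a ==> i ! Suc p = Thick k ==>
      cr (swap p i) p * cr i p * ee (wd i)
        = gam (block_esym xx (block_start N lam i k a) ((lam ! k) a)) ((lam ! k) a) (sy p i) * ee (wd i)"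
    and "i ! p = Thick k ==> i ! Suc p = Solid a ==>
      cr (swap p i) p * cr i p * ee (wd i)
        = gam (block_esym xx (block_start N lam i k a) ((lam ! k) a)) ((lam ! k) a) (sy (Suc p) i) * ee (wd i)"
proof -
  obtain u z where w: "wd i = u @ expand_entry N lam (i ! p) @ expand_entry N lam (i ! Suc p) @ z"
    "wd (swap p i) = u @ expand_entry N lam (i ! Suc p) @ expand_entry N lam (i ! p) @ z"
    "length u = fs i p" using split_word[OF i p] .
  note W = wd_W[OF i]
  have f: "fs (swap p i) p = fs i p" using first_strand_swap[OF p, of p] by auto
  have len: "fs i (Suc (Suc p)) \<le> n" using fs_le[OF i] .
  have fS: "fs i (Suc p) = fs i p + length (expand_entry N lam (i ! p))"
    "fs i (Suc (Suc p)) = fs i (Suc p) + length (expand_entry N lam (i ! Suc p))"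
    using first_strand_Suc[of p i] first_strand_Suc[of "Suc p" i] p by auto
  have aN: "a \<in> {1..N}" if "Solid a \<in> set i" for a
    using that Seq_set[OF i] nu_set by auto
  show "cr (swap p i) p * cr i p * ee (wd i) = Q_poly B a b (sy p i) (sy (Suc p) i) * ee (wd i)"
    if "i ! p = Solid a" "i ! Suc p = Solid b"
  proof -
    have nth: "wd i ! fs i p = Orig a" "wd i ! Suc (fs i p) = Orig b" "Suc (fs i p) < n"
      using that w(1) fS len by (simp_all add: w(3)[symmetric] nth_append1)
    show ?thesis using square_solid[OF W nth(3,1,2)] that p f fS by (simp add: cr_def sy_def)
  qed
  show "cr (swap p i) p * cr i p * ee (wd i)
        = gam (block_esym xx (block_start N lam i k a) ((lam ! k) a)) ((lam ! k) a) (sy p i) * ee (wd i)"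
    if sol: "i ! p = Solid a" "i ! Suc p = Thick k"
  proof -
    have tp: "thick_pos i k = Suc p" using thick_pos_eq(1)[OF i p sol(2)] .
    have a: "a \<in> {1..N}" using aN sol p by (metis Suc_lessD nth_mem)
    have "LL (length u) (length (expand_entry N lam (Thick k))) * RR (length u) (length (expand_entry N lam (Thick k))) * ee (wd i)
       = bprod a (xx (length u)) (Suc (length u)) (expand_entry N lam (Thick k)) * ee (wd i)"
      using square_pass_right[of u a "expand_entry N lam (Thick k)" z] W w sol Orig_notin_thick thick_Bar by simp
    also have "bprod a (xx (length u)) (Suc (length u)) (expand_entry N lam (Thick k))
      = gam (block_esym xx (block_start N lam i k a) ((lam ! k) a)) ((lam ! k) a) (xx (fs i p))"
      using bprod_thick[OF a, of lam k "xx (length u)" "Suc (length u)"] xx_xx len fS w(3) sol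
      by (simp add: block_start_def tp)
    finally show ?thesis using sol p f w(3) by (simp add: cr_def sy_def)
  qed
  show "cr (swap p i) p * cr i p * ee (wd i)
        = gam (block_esym xx (block_start N lam i k a) ((lam ! k) a)) ((lam ! k) a) (sy (Suc p) i) * ee (wd i)"
    if sol: "i ! p = Thick k" "i ! Suc p = Solid a"
  proof -
    have tp: "thick_pos i k = p" using thick_pos_eq(1)[OF i _ sol(1)] p by simp
    have a: "a \<in> {1..N}" using aN sol p by (metis nth_mem)
    have "RR (length u) (length (expand_entry N lam (Thick k))) * LL (length u) (length (expand_entry N lam (Thick k))) * ee (wd i)
       = bprod a (xx (length u + length (expand_entry N lam (Thick k)))) (length u) (expand_entry N lam (Thick k)) * ee (wd i)"
      using square_pass_left[of u "expand_entry N lam (Thick k)" a z] W w sol Orig_notin_thick thick_Bar by simp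
    also have "bprod a (xx (length u + length (expand_entry N lam (Thick k)))) (length u) (expand_entry N lam (Thick k))
      = gam (block_esym xx (block_start N lam i k a) ((lam ! k) a)) ((lam ! k) a) (xx (fs i (Suc p)))"
      using bprod_thick[OF a, of lam k "xx (fs i (Suc p))" "length u"] xx_xx len fS w(3) sol
      by (simp add: block_start_def tp)
    finally show ?thesis using sol p f w(3) by (simp add: cr_def sy_def)
  qed
qed

text \<open>Without thick entries this is a braid relation of single strands. A thick entry in the
  middle is a run between two solid strands; one at the side is a run that both solid strands
  pass.\<close>

lemma cr_braid:
  assumes i: "i \<in> Sq" and p: "Suc (Suc p) < length i"
  defines "l \<equiv> cr (swap (Suc p) (swap p i)) p * cr (swap p i) (Suc p) * cr i p * ee (wd i)"
    and "r \<equiv> cr (swap p (swap (Suc p) i)) (Suc p) * cr (swap (Suc p) i) p * cr i (Suc p) * ee (wd i)"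
  shows "i ! p = Solid a ==> i ! Suc p = Solid b ==> i ! Suc (Suc p) = Solid a ==>
      l = r + Q_quot B a b (sy p i) (sy (Suc (Suc p)) i) * ee (wd i)"
    and "i ! p = Solid a ==> i ! Suc p = Thick k ==> i ! Suc (Suc p) = Solid a ==>
      l = r + dgam (block_esym xx (block_start N lam i k a) ((lam ! k) a)) ((lam ! k) a)
        (sy p i) (sy (Suc (Suc p)) i) * ee (wd i)"
    and "card {q \<in> {p, Suc p, Suc (Suc p)}. \<not> is_solid (i ! q)} \<le> 1 ==> i ! p \<noteq> i ! Suc (Suc p) ==> l = r"
proof -
  obtain u z where w: "wd i = u @ expand_entry N lam (i ! p) @ expand_entry N lam (i ! Suc p)
      @ expand_entry N lam (i ! Suc (Suc p)) @ z" "length u = fs i p" using split_word3[OF i p] .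
  note W = wd_W[OF i]
  have fs0: "fs (swap p i) p = fs i p" "fs (swap (Suc p) i) p = fs i p"
      "fs (swap (Suc p) (swap p i)) p = fs i p" "fs (swap p (swap (Suc p) i)) p = fs i p"
    and fs1: "fs i (Suc p) = fs i p + length (expand_entry N lam (i ! p))"
      "fs i (Suc (Suc p)) = fs i p + length (expand_entry N lam (i ! p)) + length (expand_entry N lam (i ! Suc p))"
      "fs i (Suc (Suc (Suc p))) = fs i p + length (expand_entry N lam (i ! p)) + length (expand_entry N lam (i ! Suc p))
        + length (expand_entry N lam (i ! Suc (Suc p)))"
      "fs (swap p i) (Suc p) = fs i p + length (expand_entry N lam (i ! Suc p))"
      "fs (swap p (swap (Suc p) i)) (Suc p) = fs i p + length (expand_entry N lam (i ! Suc (Suc p)))"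
    using p first_strand_swap[of p i p] first_strand_swap[of "Suc p" i p]
      first_strand_swap[of "Suc p" "swap p i" p] first_strand_swap[of p "swap (Suc p) i" p]
      first_strand_Suc[of p i] first_strand_Suc[of "Suc p" i] first_strand_Suc[of "Suc (Suc p)" i]
      first_strand_swap_Suc[of p i] first_strand_swap_Suc[of p "swap (Suc p) i"] by auto
  have len: "fs i (Suc (Suc (Suc p))) \<le> n" using fs_le[OF i] .
  have nth: "swap p i ! Suc p = i ! p" "swap p i ! Suc (Suc p) = i ! Suc (Suc p)"
    "swap (Suc p) (swap p i) ! p = i ! Suc p" "swap (Suc p) (swap p i) ! Suc p = i ! Suc (Suc p)"
    "swap (Suc p) i ! p = i ! p" "swap (Suc p) i ! Suc p = i ! Suc (Suc p)"
    "swap p (swap (Suc p) i) ! Suc p = i ! p" "swap p (swap (Suc p) i) ! Suc (Suc p) = i ! Suc p"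
    using p by simp_all
  note crs = cr_def nth fs0 fs1
  have aN: "a \<in> {1..N}" if "Solid a \<in> set i" for a
    using that Seq_set[OF i] nu_set by auto
  let ?q = "fs i p"
  show "l = r + Q_quot B a b (sy p i) (sy (Suc (Suc p)) i) * ee (wd i)"
    if sol: "i ! p = Solid a" "i ! Suc p = Solid b" "i ! Suc (Suc p) = Solid a"
  proof -
    have "wd i ! ?q = Orig a" "wd i ! Suc ?q = Orig b" "wd i ! Suc (Suc ?q) = Orig a" "Suc (Suc ?q) < n"
      using w(1) fs1 len sol by (simp_all add: w(2)[symmetric] nth_append1)
    from braid_solid[OF W this(4,1,2,3)] show ?thesis
      unfolding l_def r_def using sol by (simp add: crs sy_def)
  qed
  show "l = r + dgam (block_esym xx (block_start N lam i k a) ((lam ! k) a)) ((lam ! k) a)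
        (sy p i) (sy (Suc (Suc p)) i) * ee (wd i)"
    if sol: "i ! p = Solid a" "i ! Suc p = Thick k" "i ! Suc (Suc p) = Solid a"
  proof -
    have tp: "thick_pos i k = Suc p" using thick_pos_eq(1)[OF i _ sol(2)] p by simp
    have a: "a \<in> {1..N}" using aN sol p by (metis nth_mem)
    have "bdiff a (xx ?q) (xx (Suc (?q + weight_size N (lam ! k)))) (Suc ?q) (expand_entry N lam (Thick k))
      = dgam (block_esym xx (block_start N lam i k a) ((lam ! k) a)) ((lam ! k) a) (xx ?q) (xx (Suc (?q + weight_size N (lam ! k))))"
      using bdiff_thick[OF a, of lam k "xx ?q" "Suc ?q" "xx (Suc (?q + weight_size N (lam ! k)))"] xx_xx len fs1 sol
      by (simp add: block_start_def tp)
    then show ?thesis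
      using braid_pass_orig[of u a "expand_entry N lam (Thick k)" z] W w sol thick_Bar
      unfolding l_def r_def by (simp add: crs sy_def)
  qed
  show "l = r" if c: "card {q \<in> {p, Suc p, Suc (Suc p)}. \<not> is_solid (i ! q)} \<le> 1" and ne: "i ! p \<noteq> i ! Suc (Suc p)"
  proof -
    have two: "is_solid (i ! q) \<or> is_solid (i ! q')"
      if "q \<in> {p, Suc p, Suc (Suc p)}" "q' \<in> {p, Suc p, Suc (Suc p)}" "q \<noteq> q'" for q q'
    proof (rule ccontr)
      assume "\<not> ?thesis"
      then have "card {q, q'} \<le> card {q \<in> {p, Suc p, Suc (Suc p)}. \<not> is_solid (i ! q)}"
        using that by (intro card_mono) auto
      then show False using c that by simp
    qed
    have t: "is_solid (i ! p) \<or> is_solid (i ! Suc p)" "is_solid (i ! p) \<or> is_solid (i ! Suc (Suc p))"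
      "is_solid (i ! Suc p) \<or> is_solid (i ! Suc (Suc p))"
      by (rule two; simp)+
    consider (SSS) a b c where "i ! p = Solid a" "i ! Suc p = Solid b" "i ! Suc (Suc p) = Solid c"
      | (TSS) k b c where "i ! p = Thick k" "i ! Suc p = Solid b" "i ! Suc (Suc p) = Solid c"
      | (STS) a k c where "i ! p = Solid a" "i ! Suc p = Thick k" "i ! Suc (Suc p) = Solid c"
      | (SST) a b k where "i ! p = Solid a" "i ! Suc p = Solid b" "i ! Suc (Suc p) = Thick k"
      using t by (cases "i ! p"; cases "i ! Suc p"; cases "i ! Suc (Suc p)") auto
    then show ?thesis
    proof cases
      case SSS
      have "wd i ! ?q = Orig a" "wd i ! Suc ?q = Orig b" "wd i ! Suc (Suc ?q) = Orig c" "Suc (Suc ?q) < n"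
        using w(1) fs1 len SSS by (simp_all add: w(2)[symmetric] nth_append1)
      then show ?thesis
        using braid_plain[OF W, of ?q] SSS ne unfolding l_def r_def by (simp add: crs)
    next
      case TSS
      then show ?thesis
        using braid_two_left[of u "expand_entry N lam (Thick k)" "Orig b" "Orig c" z] W w Orig_notin_thick
        unfolding l_def r_def by (simp add: crs)
    next
      case STS
      then show ?thesis
        using braid_pass_diff[of u "Orig a" "expand_entry N lam (Thick k)" "Orig c" z] W w ne
        unfolding l_def r_def by (simp add: crs)
    next
      case SST
      then show ?thesis
        using braid_two_right[of u "Orig a" "Orig b" "expand_entry N lam (Thick k)" z] W w Orig_notin_thick
        unfolding l_def r_def by (simp add: crs)
    qed
  qed
qed


text \<open>After the right factor has acted, only the idempotent of the swapped sequence survives,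
  so the sums in \<open>PP\<close> collapse to local crossings.\<close>

lemma PP_PP_se:
  assumes "i \<in> Sq" "Suc q < length i" "is_solid (i ! q) \<or> is_solid (i ! Suc q)"
  shows "PP p * PP q * se i = cr (swap q i) p * cr i q * se i"
  using PP_cr[OF assms, of p] by (simp add: mult.assoc PP_se assms)

lemma PP_PP_PP_se:
  assumes "i \<in> Sq" "Suc q < length i" "is_solid (i ! q) \<or> is_solid (i ! Suc q)"
    "Suc p < length i" "is_solid (swap q i ! p) \<or> is_solid (swap q i ! Suc p)"
  shows "PP s * PP p * PP q * se i = cr (swap p (swap q i)) s * cr (swap q i) p * cr i q * se i"
proof -
  note i' = Seq_swap[OF assms(1-3)]
  have "PP s * PP p * PP q * se i = PP s * PP p * se (swap q i) * cr i q"
    using assms by (simp add: mult.assoc PP_se cr_se)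
  also have "\<dots> = cr (swap p (swap q i)) s * cr (swap q i) p * (se (swap q i) * cr i q)"
    using PP_PP_se[OF i', of p s] assms by (simp add: mult.assoc)
  finally show ?thesis using assms by (simp add: cr_se[symmetric] mult.assoc)
qed

lemma far_swap_solid:
  "Suc p < q ==> Suc q < length i ==> swap p i ! q = i ! q \<and> swap p i ! Suc q = i ! Suc q"
  "Suc p < q ==> Suc q < length i ==> swap q i ! p = i ! p \<and> swap q i ! Suc p = i ! Suc p"
  by auto

lemma cr_far:
  assumes "i \<in> Sq" "Suc p < q" "Suc q < length i"
  shows "cr (swap p i) q = cr i q" "cr (swap q i) p = cr i p"
  using assms first_strand_swap[of p i q N lam] first_strand_swap[of q i p N lam]
  by (simp_all add: cr_def far_swap_solid split: entry.split)

lemma cr_cr_far: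
  assumes i: "i \<in> Sq" and p: "Suc p < q" and q: "Suc q < length i"
    and s: "is_solid (i ! p) \<or> is_solid (i ! Suc p)" "is_solid (i ! q) \<or> is_solid (i ! Suc q)"
  shows "cr i p * cr i q = cr i q * cr i p"
proof (rule cr_comm[OF q s(2)])
  fix r assume r: "fs i q \<le> r" "Suc r < fs i (Suc (Suc q))"
  have "fs i (Suc (Suc p)) \<le> fs i q" using p by (intro first_strand_mono) simp
  then have "ps r * cr i p = cr i p * ps r"
    using r p q fs_le[OF i, of "Suc (Suc q)"] by (intro cr_comm s(1) ps_ps) auto
  then show "cr i p * ps r = ps r * cr i p" by simp
qed

text \<open>Relations are tested against \<open>se i\<close>, where the sums over sequences reduce
  to one term; what remains follows from an identity next to the word idempotent
  \<open>ee (wd i)\<close>.\<close>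

theorem tensor_relations: "tensor_relations N B lam nu se yy EE PP"
proof
  show "se i * se j = (if i = j then se i else 0)" if "i \<in> Sq" "j \<in> Sq" for i j
    using se_se that .
  show "(\<Sum>i\<in>Sq. yy p * se i) = yy p" for p by (rule unit_sums)
  show "(\<Sum>i\<in>Sq. EE k a d * se i) = EE k a d" for k a d by (rule unit_sums)
  show "(\<Sum>i\<in>Sq. PP p * se i) = PP p" for p by (rule unit_sums)
  show ye: "yy p * se i = se i * yy p" if "i \<in> Sq" "p < length i" for p i
    using that se_sum[OF that(1), of "sy p"] by (simp add: yy_se) (simp add: yy_def sy_se Seq_length)
  show Ee: "EE k a d * se i = se i * EE k a d" if "i \<in> Sq" "k < length lam" "a \<in> {1..N}" for k a d i
    using that se_sum[OF that(1), of "sE k a d"] by (simp add: EE_se) (simp add: EE_def sE_se)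
  have len: "length i = rr" if "i \<in> Sq" for i using Seq_length[OF that] .
  have syy: "sy p i * sy q i = sy q i * sy p i" if "i \<in> Sq" "p < rr" "q < rr" for p q i
    using that solid_strand[OF that(1)] len by (auto simp: sy_def xx_xx)
  show "yy p * yy q = yy q * yy p" if "p < rr" "q < rr" for p q
  proof (rule eq_by_se)
    fix i assume i: "i \<in> Sq"
    have "yy p * yy q * se i = sy p i * sy q i * se i" "yy q * yy p * se i = sy q i * sy p i * se i"
      using that len[OF i] i by (auto intro!: tr_eq transports_mult yy_tr)
    then show "yy p * yy q * se i = yy q * yy p * se i" using syy[OF i that] by simp
  qed (intro unit_sums_mult unit_sums)+
  show "EE k a d * yy p = yy p * EE k a d" if k: "k < length lam" "a \<in> {1..N}" and p: "p < rr" for k a d p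
  proof (rule eq_by_se)
    fix i assume i: "i \<in> Sq"
    have "EE k a d * yy p * se i = sE k a d i * sy p i * se i" "yy p * EE k a d * se i = sy p i * sE k a d i * se i"
      using k p len[OF i] i by (auto intro!: tr_eq transports_mult yy_tr EE_tr)
    moreover have "sy p i * sE k a d i = sE k a d i * sy p i"
      using solid_strand[OF i, of p] p len[OF i] block_le_n[OF i k]
      by (cases "is_solid (i ! p)") (auto simp: sy_def sE_def intro!: esym_comm xx_xx)
    ultimately show "EE k a d * yy p * se i = yy p * EE k a d * se i" by simp
  qed (intro unit_sums_mult unit_sums)+
  show "EE k a d * PP p = PP p * EE k a d" if k: "k < length lam" "a \<in> {1..N}" and p: "Suc p < rr" for k a d p
  proof (rule eq_by_se)
    fix i assume i: "i \<in> Sq"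
    show "EE k a d * PP p * se i = PP p * EE k a d * se i"
    proof (cases "is_solid (i ! p) \<or> is_solid (i ! Suc p)")
      case True
      have p': "Suc p < length i" using p len[OF i] by simp
      have "sE k a d (swap p i) * cr i p * ee (wd i) = cr i p * sE k a d i * ee (wd i)"
        using cr_esym[OF i p' True k] by (simp add: transports_def)
      from lift_ee[OF i this] show ?thesis
        using EE_cr[OF i p' True] PP_comm[OF i sE_se[OF i k]] by (simp add: mult.assoc PP_se EE_se i)
    next
      case False
      then show ?thesis using PP_comm[OF i sE_se[OF i k]] by (simp add: mult.assoc PP_se EE_se i cr_red)
    qed
  qed (intro unit_sums_mult unit_sums)+
  show "yy p * se i = 0" if "i \<in> Sq" "\<not> is_solid (i ! p)" for i p
    using that by (simp add: yy_se sy_def)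
  show "PP p * se i = 0" if "i \<in> Sq" "\<not> is_solid (i ! p)" "\<not> is_solid (i ! Suc p)" for i p
    using that by (simp add: PP_se cr_red)
  show "PP p * se i = se (swap p i) * PP p"
    if i: "i \<in> Sq" and p: "Suc p < length i" and s: "is_solid (i ! p) \<or> is_solid (i ! Suc p)" for i p
  proof -
    note i' = Seq_swap[OF i p s]
    have "se (swap p i) * (cr j p * se j) = (if j = i then cr i p * se i else 0)" if j: "j \<in> Sq" for j
    proof (cases "is_solid (j ! p) \<or> is_solid (j ! Suc p)")
      case True
      have pj: "Suc p < length j" using p len[OF i] len[OF j] by simp
      have "se (swap p i) * (cr j p * se j) = se (swap p i) * se (swap p j) * cr j p"
        by (simp add: cr_se[OF j pj True] mult.assoc)
      moreover have "swap p i = swap p j \<longleftrightarrow> i = j" using swap_swap[OF p] swap_swap[OF pj] by metis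
      ultimately show ?thesis using se_se[OF i' Seq_swap[OF j pj True]] cr_se[OF i p s] by auto
    next
      case False
      then show ?thesis using s by (auto simp: cr_red)
    qed
    then have "se (swap p i) * PP p = (\<Sum>j\<in>Sq. if j = i then cr i p * se i else 0)"
      unfolding PP_def sum_distrib_left by (intro sum.cong) auto
    then show ?thesis using i by (simp add: PP_se)
  qed
  show "PP p * yy q = yy q * PP p" if p: "Suc p < rr" and q: "q < rr" "q \<noteq> p" "q \<noteq> Suc p" for p q
  proof (rule eq_by_se)
    fix i assume i: "i \<in> Sq"
    have len': "Suc p < length i" "q < length i" using p q len[OF i] by auto
    show "PP p * yy q * se i = yy q * PP p * se i"
    proof (cases "is_solid (i ! p) \<or> is_solid (i ! Suc p)")
      case True
      have sy': "sy q (swap p i) = sy q i"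
        using len' q first_strand_swap[of p i q N lam] by (simp add: sy_def)
      have "sy q i * cr i p = cr i p * sy q i"
      proof (cases "is_solid (i ! q)")
        case solid: True
        note sol = solid_strand[OF i len'(2) solid]
        have "fs i (Suc q) \<le> fs i p \<or> fs i (Suc (Suc p)) \<le> fs i q"
          using q first_strand_mono[of "Suc q" p N lam i] first_strand_mono[of "Suc (Suc p)" q N lam i] by linarith
        then have "xx (fs i q) * cr i p = cr i p * xx (fs i q)"
          using sol fs_le[OF i, of "Suc (Suc p)"] by (intro cr_comm len' True ps_xx[symmetric]) auto
        then show ?thesis using solid by (simp add: sy_def)
      qed (simp add: sy_def)
      then show ?thesis
        using yy_cr[OF i len'(1) True] PP_comm[OF i sy_se[OF i len'(2)]] sy'
        by (simp add: mult.assoc PP_se yy_se i) (simp add: mult.assoc[symmetric])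
    next
      case False
      then show ?thesis using PP_comm[OF i sy_se[OF i len'(2)]] by (simp add: mult.assoc PP_se yy_se i cr_red)
    qed
  qed (intro unit_sums_mult unit_sums)+
  show "PP p * PP q = PP q * PP p" if pq: "Suc p < rr" "Suc q < rr" "Suc p < q" for p q
  proof (rule eq_by_se)
    fix i assume i: "i \<in> Sq"
    have len': "Suc p < length i" "Suc q < length i" using pq len[OF i] by auto
    note far = cr_far[OF i pq(3) len'(2)]
    consider "is_solid (i ! p) \<or> is_solid (i ! Suc p)" "is_solid (i ! q) \<or> is_solid (i ! Suc q)"
      | "\<not> is_solid (i ! p)" "\<not> is_solid (i ! Suc p)" "is_solid (i ! q) \<or> is_solid (i ! Suc q)"
      | "is_solid (i ! p) \<or> is_solid (i ! Suc p)" "\<not> is_solid (i ! q)" "\<not> is_solid (i ! Suc q)"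
      | "\<not> is_solid (i ! p)" "\<not> is_solid (i ! Suc p)" "\<not> is_solid (i ! q)" "\<not> is_solid (i ! Suc q)" by blast
    then show "PP p * PP q * se i = PP q * PP p * se i"
    proof cases
      case 1
      then show ?thesis using PP_PP_se[OF i len'(1), of q] PP_PP_se[OF i len'(2), of p] far
          cr_cr_far[OF i pq(3) len'(2)] by simp
    next
      case 2
      then have "PP p * PP q * se i = 0" using PP_PP_se[OF i len'(2), of p] far by (simp add: cr_red)
      moreover have "PP p * se i = 0" using 2 by (simp add: PP_se i cr_red)
      ultimately show ?thesis by (simp add: mult.assoc)
    next
      case 3
      then have "PP q * PP p * se i = 0" using PP_PP_se[OF i len'(1), of q] far by (simp add: cr_red)
      moreover have "PP q * se i = 0" using 3 by (simp add: PP_se i cr_red)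
      ultimately show ?thesis by (simp add: mult.assoc)
    next
      case 4
      then show ?thesis by (simp add: mult.assoc PP_se i cr_red)
    qed
  qed (intro unit_sums_mult unit_sums)+
  show "yy p * PP p * se i = PP p * yy (Suc p) * se i + (if i ! p = i ! Suc p then se i else 0)"
    "PP p * yy p * se i = yy (Suc p) * PP p * se i + (if i ! p = i ! Suc p then se i else 0)"
    if i: "i \<in> Sq" and p: "Suc p < length i" and s: "is_solid (i ! p) \<or> is_solid (i ! Suc p)" for i p
  proof -
    have c: "(if i ! p = i ! Suc p then f else 0) = (if i ! p = i ! Suc p then 1 else 0) * f" for f :: 'r by simp
    note sl = sy_slide[OF i p s, unfolded c[of "ee _"] distrib_right[symmetric]]
    have "yy p * PP p * se i = sy p (swap p i) * cr i p * se i"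
      "yy (Suc p) * PP p * se i = sy (Suc p) (swap p i) * cr i p * se i"
      using yy_cr[OF i p s] by (simp_all add: mult.assoc PP_se i)
    moreover have "PP p * yy p * se i = cr i p * sy p i * se i" "PP p * yy (Suc p) * se i = cr i p * sy (Suc p) i * se i"
      using PP_comm[OF i sy_se[OF i]] p by (simp_all add: mult.assoc yy_se i)
    ultimately show "yy p * PP p * se i = PP p * yy (Suc p) * se i + (if i ! p = i ! Suc p then se i else 0)"
      "PP p * yy p * se i = yy (Suc p) * PP p * se i + (if i ! p = i ! Suc p then se i else 0)"
      using lift_ee[OF i sl(1)] lift_ee[OF i sl(2)] unfolding c[of "se i"] by (simp_all add: distrib_right)
  qed
  have sq: "PP p * PP p * se i = F * se i"
    if i: "i \<in> Sq" and p: "Suc p < length i" and s: "is_solid (i ! p) \<or> is_solid (i ! Suc p)"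
      and eq: "cr (swap p i) p * cr i p * ee (wd i) = f * ee (wd i)" and tr: "transports 1 (se i) f F" for i p f F
    using PP_PP_se[OF i p s, of p] lift_ee[OF i eq] tr_eq[OF tr] by simp
  show "PP p * PP p * se i = Q_poly B a b (yy p) (yy (Suc p)) * se i"
    if "i \<in> Sq" "Suc p < length i" "i ! p = Solid a" "i ! Suc p = Solid b" for i p a b
    by (rule sq[OF that(1,2) _ cr_square(1)[OF that] transports_Q_poly[OF yy_tr yy_tr]]) (use that in auto)
  have aN: "a \<in> {1..N}" if "i \<in> Sq" "p < length i" "i ! p = Solid a" for a i p
    using that Seq_set[OF that(1)] nu_set nth_mem[OF that(2)] by auto
  have kl: "k < length lam" if "i \<in> Sq" "p < length i" "i ! p = Thick k" for k i p
    using thick_pos_eq(2)[OF that] .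
  show "PP p * PP p * se i = gam (\<lambda>d. if d = 0 then 1 else EE k a d) ((lam ! k) a) (yy p) * se i"
    if "i \<in> Sq" "Suc p < length i" "i ! p = Solid a" "i ! Suc p = Thick k" for i p a k
    by (rule sq[OF that(1,2) _ cr_square(2)[OF that] transports_gam[OF gam_tr[OF that(1)
          kl[OF that(1,2,4)] aN[OF that(1) Suc_lessD[OF that(2)] that(3)]] yy_tr]]) (use that in auto)
  show "PP p * PP p * se i = gam (\<lambda>d. if d = 0 then 1 else EE k a d) ((lam ! k) a) (yy (Suc p)) * se i"
    if "i \<in> Sq" "Suc p < length i" "i ! p = Thick k" "i ! Suc p = Solid a" for i p a k
    by (rule sq[OF that(1,2) _ cr_square(3)[OF that] transports_gam[OF gam_tr[OF that(1)
          kl[OF that(1) Suc_lessD[OF that(2)] that(3)] aN[OF that(1,2,4)]] yy_tr]]) (use that in auto)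
  have br: "PP p * PP (Suc p) * PP p * se i = PP (Suc p) * PP p * PP (Suc p) * se i + F * se i"
    if i: "i \<in> Sq" and p: "Suc (Suc p) < length i"
      and s: "is_solid (i ! p) \<or> is_solid (i ! Suc p)" "is_solid (i ! p) \<or> is_solid (i ! Suc (Suc p))"
        "is_solid (i ! Suc p) \<or> is_solid (i ! Suc (Suc p))"
      and eq: "cr (swap (Suc p) (swap p i)) p * cr (swap p i) (Suc p) * cr i p * ee (wd i)
        = cr (swap p (swap (Suc p) i)) (Suc p) * cr (swap (Suc p) i) p * cr i (Suc p) * ee (wd i) + f * ee (wd i)"
      and tr: "transports 1 (se i) f F" for i p f F
    using lift_ee[OF i eq[folded distrib_right]] tr_eq[OF tr] p s
      PP_PP_PP_se[OF i, of p "Suc p" p] PP_PP_PP_se[OF i, of "Suc p" p "Suc p"]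
    by (simp add: distrib_right)
  show "PP p * PP (Suc p) * PP p * se i = PP (Suc p) * PP p * PP (Suc p) * se i + Q_quot B a b (yy p) (yy (Suc (Suc p))) * se i"
    if "i \<in> Sq" "Suc (Suc p) < length i" "i ! p = Solid a" "i ! Suc p = Solid b" "i ! Suc (Suc p) = Solid a" for i p a b
    by (rule br[OF that(1,2) _ _ _ cr_braid(1)[OF that] transports_Q_quot[OF yy_tr yy_tr]]) (use that in auto)
  show "PP p * PP (Suc p) * PP p * se i = PP (Suc p) * PP p * PP (Suc p) * se i
      + dgam (\<lambda>d. if d = 0 then 1 else EE k a d) ((lam ! k) a) (yy p) (yy (Suc (Suc p))) * se i"
    if "i \<in> Sq" "Suc (Suc p) < length i" "i ! p = Solid a" "i ! Suc p = Thick k" "i ! Suc (Suc p) = Solid a" for i p a k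
    by (rule br[OF that(1,2) _ _ _ cr_braid(2)[OF that] transports_dgam[OF gam_tr[OF that(1)
          kl[OF that(1) Suc_lessD[OF that(2)] that(4)] aN[OF that(1,2,5)]] yy_tr yy_tr]]) (use that in auto)
  show "PP p * PP (Suc p) * PP p * se i = PP (Suc p) * PP p * PP (Suc p) * se i"
    if i: "i \<in> Sq" and p: "Suc (Suc p) < length i"
      and c: "card {q \<in> {p, Suc p, Suc (Suc p)}. \<not> is_solid (i ! q)} \<le> 1" and ne: "i ! p \<noteq> i ! Suc (Suc p)" for i p
  proof -
    have two: "is_solid (i ! q) \<or> is_solid (i ! q')"
      if "q \<in> {p, Suc p, Suc (Suc p)}" "q' \<in> {p, Suc p, Suc (Suc p)}" "q \<noteq> q'" for q q'
    proof (rule ccontr)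
      assume "\<not> ?thesis"
      then have "card {q, q'} \<le> card {q \<in> {p, Suc p, Suc (Suc p)}. \<not> is_solid (i ! q)}"
        using that by (intro card_mono) auto
      then show False using c that by simp
    qed
    have s: "is_solid (i ! p) \<or> is_solid (i ! Suc p)" "is_solid (i ! p) \<or> is_solid (i ! Suc (Suc p))"
      "is_solid (i ! Suc p) \<or> is_solid (i ! Suc (Suc p))"
      by (rule two; simp)+
    have "cr (swap (Suc p) (swap p i)) p * cr (swap p i) (Suc p) * cr i p * ee (wd i)
        = cr (swap p (swap (Suc p) i)) (Suc p) * cr (swap (Suc p) i) p * cr i (Suc p) * ee (wd i) + 0 * ee (wd i)"
      using cr_braid(3)[OF i p c ne] by simp
    from br[OF i p s this transports_zero] show ?thesis by simp
  qed
qed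

end

section \<open>Normal forms of words in the crossings\<close>

text \<open>One reduced word for each permutation: the descending run inserts the last strand into
  an arrangement of the others.\<close>

fun normal_words :: "nat => nat list set" where
  "normal_words 0 = {[]}"
| "normal_words (Suc m) = {v @ rev [k..<m] | v k. v \<in> normal_words m \<and> k \<le> m}"

lemma normal_words_letters: "v \<in> normal_words m ==> p \<in> set v ==> Suc p < m"
  by (induction m arbitrary: v p) force+

lemma finite_normal_words: "finite (normal_words m)"
proof (induction m)
  case (Suc m)
  have "normal_words (Suc m) = (\<lambda>(v, k). v @ rev [k..<m]) ` (normal_words m \<times> {..m})" by auto
  then show ?case using Suc by simp
qed simp

text \<open>What rewriting to normal form requires: the symmetric group relations hold up to terms
  with fewer crossings and coefficients in \<open>A\<close>, and coefficients can be brought to the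
  left up to such terms.\<close>

locale crossing_filtration =
  fixes A :: "'r::ring_1 set" and P :: "nat => 'r" and n :: nat
  assumes zero_mem: "0 \<in> A"
    and add: "f \<in> A ==> g \<in> A ==> f + g \<in> A"
    and minus: "f \<in> A ==> - f \<in> A"
    and mult: "f \<in> A ==> g \<in> A ==> f * g \<in> A"
    and slide: "Suc p < n ==> f \<in> A ==> \<exists>g\<in>A. \<exists>h\<in>A. P p * f = g * P p + h"
    and square: "Suc p < n ==> P p * P p \<in> A"
    and far: "Suc q < n ==> Suc p < q ==> P p * P q = P q * P p"
    and braid: "Suc (Suc p) < n ==> \<exists>h\<in>A. P p * P (Suc p) * P p = P (Suc p) * P p * P (Suc p) + h"
begin

abbreviation "Ps v \<equiv> prod_list (map P v)"

inductive_set lspan :: "nat list set => 'r set" for X where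
  zero: "0 \<in> lspan X"
| step: "f \<in> A ==> v \<in> X ==> s \<in> lspan X ==> f * Ps v + s \<in> lspan X"

lemma lspan_single: "f \<in> A ==> v \<in> X ==> f * Ps v \<in> lspan X"
  using lspan.step[OF _ _ lspan.zero] by simp

lemma lspan_add: "s \<in> lspan X ==> s' \<in> lspan X ==> s + s' \<in> lspan X"
  by (induction rule: lspan.induct) (auto simp: add.assoc intro: lspan.step)

lemma lspan_mono: "s \<in> lspan X ==> X \<subseteq> Y ==> s \<in> lspan Y"
  by (induction rule: lspan.induct) (auto intro: lspan.intros)

lemma lspan_right_word: "s \<in> lspan X ==> (\<And>v. v \<in> X ==> v @ w \<in> Y) ==> s * Ps w \<in> lspan Y"
proof (induction rule: lspan.induct)
  case (step f v s)
  then have "f * Ps (v @ w) + s * Ps w \<in> lspan Y" by (intro lspan.step) auto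
  then show ?case by (simp add: distrib_right mult.assoc)
qed (simp add: lspan.zero)

lemma lspan_subst:
  assumes "s \<in> lspan X" "\<And>f v. f \<in> A ==> v \<in> X ==> f * Ps v * h \<in> lspan Y"
  shows "s * h \<in> lspan Y"
  using assms(1) by (induction rule: lspan.induct) (auto simp: distrib_right intro: lspan.zero lspan_add assms(2))

definition "short k = {v. length v < k \<and> (\<forall>p\<in>set v. Suc p < n)}"

lemma short_mono: "s \<in> lspan (short k) ==> k \<le> l ==> s \<in> lspan (short l)"
  by (erule lspan_mono) (auto simp: short_def)

text \<open>Each letter that is passed yields a term with that letter and a term without it, so no
  longer words appear.\<close>

lemma word_slide:
  "f \<in> A ==> g \<in> A ==> (\<forall>p\<in>set v. Suc p < n) ==> f * Ps v * g \<in> lspan (short (Suc (length v)))"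
proof (induction v arbitrary: g rule: rev_induct)
  case Nil
  then show ?case using lspan_single[of "f * g" "[]" "short (Suc 0)"] by (simp add: short_def mult)
next
  case (snoc p v)
  then have p: "Suc p < n" and v: "\<forall>p\<in>set v. Suc p < n" by auto
  obtain g' h where g': "g' \<in> A" "h \<in> A" "P p * g = g' * P p + h" using slide[OF p snoc.prems(2)] by auto
  have "f * Ps (v @ [p]) * g = f * Ps v * g' * Ps [p] + f * Ps v * h"
    using g'(3) by (simp add: mult.assoc distrib_left)
  moreover have "f * Ps v * g' * Ps [p] \<in> lspan (short (Suc (length (v @ [p]))))"
    by (rule lspan_right_word[OF snoc.IH[OF snoc.prems(1) g'(1) v]]) (use p in \<open>auto simp: short_def\<close>)
  moreover have "f * Ps v * h \<in> lspan (short (Suc (length (v @ [p]))))"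
    by (rule short_mono[OF snoc.IH[OF snoc.prems(1) g'(2) v]]) simp
  ultimately show ?case by (simp add: lspan_add)
qed

lemma far_word:
  assumes "Suc p < n" "\<And>q. q \<in> set v ==> Suc q < n \<and> (Suc p < q \<or> Suc q < p)"
  shows "P p * Ps v = Ps v * P p"
proof (rule comm_prod_list)
  fix f assume "f \<in> set (map P v)"
  then obtain q where "q \<in> set v" "f = P q" by auto
  then show "P p * f = f * P p" using far[of q p] far[of p q] assms by fastforce
qed

text \<open>Right multiplication of a coset representative by a generator: either the run itself
  changes, or the letter passes the run and joins \<open>w\<close>, where the induction hypothesis
  applies.\<close>

lemma normal_step:
  assumes IH: "\<And>f v. f \<in> A ==> \<forall>p\<in>set v. Suc p < m ==>
      f * Ps v \<in> lspan ({w \<in> normal_words m. length w = length v} \<union> short (length v))"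
    and f: "f \<in> A" and w: "w \<in> normal_words m" and k: "k \<le> m" and p: "p < m" and m: "Suc m \<le> n"
  defines "v \<equiv> w @ rev [k..<m]"
  shows "f * Ps v * P p \<in> lspan ({w \<in> normal_words (Suc m). length w = Suc (length v)} \<union> short (Suc (length v)))"
    (is "_ \<in> lspan ?X")
proof -
  let ?D = "rev [k..<m]"
  have wl: "\<forall>p\<in>set w. Suc p < m" using normal_words_letters[OF w] by blast
  have lift: "f * Ps (w @ [q]) * Ps ?D \<in> lspan ?X" if q: "Suc q < m" for q
  proof (rule lspan_right_word[OF IH[OF f]])
    show "\<forall>p\<in>set (w @ [q]). Suc p < m" using wl q by auto
    fix x assume "x \<in> {x \<in> normal_words m. length x = length (w @ [q])} \<union> short (length (w @ [q]))"
    then show "x @ ?D \<in> ?X" using k m by (auto simp: v_def short_def)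
  qed
  consider "Suc p = k" | "p = k" | "k < p" | "Suc p < k" by linarith
  then show ?thesis
  proof cases
    case 1
    \<comment> \<open>The letter extends the run downwards, and the word stays normal.\<close>
    have "rev [p..<m] = rev [k..<m] @ [p]" using 1 p by (simp add: upt_conv_Cons)
    then have "w @ rev [p..<m] = v @ [p]" by (simp add: v_def)
    moreover have "w @ rev [p..<m] \<in> normal_words (Suc m)"
      unfolding normal_words.simps using w less_imp_le[OF p] by blast
    ultimately have "v @ [p] \<in> ?X" by (simp del: normal_words.simps)
    from lspan_single[OF f this] show ?thesis by (simp add: mult.assoc)
  next
    case 2
    let ?v' = "w @ rev [Suc k..<m]"
    have v: "v = ?v' @ [k]" using 2 p by (simp add: v_def upt_conv_Cons)
    have "f * Ps ?v' * (P k * P k) \<in> lspan (short (Suc (length ?v')))"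
      by (rule word_slide[OF f square]) (use 2 p m wl in auto)
    then have "f * Ps ?v' * (P k * P k) \<in> lspan ?X"
      by (rule lspan_mono) (auto simp: v short_def)
    then show ?thesis using 2 by (simp add: v mult.assoc)
  next
    case 3
    \<comment> \<open>A letter strictly above the end of the run passes to its left by one braid
      relation, which lowers its index by one; the error has three letters fewer.\<close>
    define q where "q = p - 1"
    have q: "p = Suc q" "k \<le> q" using 3 by (auto simp: q_def)
    let ?up = "rev [Suc p..<m]" and ?lo = "rev [k..<q]"
    have "[k..<m] = [k..<q] @ q # p # [Suc p..<m]"
    proof -
      have "[k..<m] = [k..<q] @ [q..<m]" using q p upt_add_eq_append[of k q "m - q"] by simp
      also have "[q..<m] = q # p # [Suc p..<m]" using q p by (simp add: upt_conv_Cons)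
      finally show ?thesis .
    qed
    then have D: "?D = ?up @ [p, q] @ ?lo" by simp
    have clo: "P p * Ps ?lo = Ps ?lo * P p" using q p m by (intro far_word) auto
    have cup: "P q * Ps ?up = Ps ?up * P q" using q p m by (intro far_word) auto
    obtain h where h: "h \<in> A" "P q * P p * P q = P p * P q * P p + h"
      using braid[of q] q p m by auto
    have br: "P p * P q * P p = P q * P p * P q + (- h)" using h by simp
    have "Ps ?D * P p = Ps ?up * P p * P q * (Ps ?lo * P p)" by (simp add: D mult.assoc)
    also have "\<dots> = Ps ?up * (P p * P q * P p) * Ps ?lo" unfolding clo[symmetric] by (simp only: mult.assoc)
    also have "\<dots> = (Ps ?up * P q) * P p * P q * Ps ?lo + Ps ?up * (- h) * Ps ?lo"
      unfolding br by (simp only: distrib_left distrib_right mult.assoc)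
    also have "\<dots> = P q * Ps ?D + Ps ?up * (- h) * Ps ?lo"
      unfolding cup[symmetric] by (simp add: D mult.assoc)
    finally have eq: "f * Ps v * P p = f * Ps (w @ [q]) * Ps ?D + f * Ps (w @ ?up) * (- h) * Ps ?lo"
      by (simp add: v_def mult.assoc distrib_left right_diff_distrib)
    have err: "f * Ps (w @ ?up) * (- h) * Ps ?lo \<in> lspan ?X"
    proof (rule lspan_right_word)
      show "f * Ps (w @ ?up) * (- h) \<in> lspan (short (Suc (length (w @ ?up))))"
        using wl m by (intro word_slide[OF f minus[OF h(1)]]) auto
      fix x assume "x \<in> short (Suc (length (w @ ?up)))"
      then show "x @ ?lo \<in> ?X" using q p m by (auto simp: short_def v_def D)
    qed
    have "Suc q < m" using q p by simp
    then show ?thesis unfolding eq by (intro lspan_add lift err)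
  next
    case 4
    have "P p * Ps ?D = Ps ?D * P p" using 4 p m by (intro far_word) auto
    then have "f * Ps v * P p = f * Ps (w @ [p]) * Ps ?D" by (simp add: v_def mult.assoc)
    then show ?thesis using lift[of p] 4 k by simp
  qed
qed

text \<open>The length is kept exactly, up to strictly shorter words. This is what allows the
  induction over the length in \<open>normal_words_span\<close>.\<close>

lemma normal_words_span_step:
  "m \<le> n ==> f \<in> A ==> \<forall>p\<in>set v. Suc p < m ==>
    f * Ps v \<in> lspan ({w \<in> normal_words m. length w = length v} \<union> short (length v))"
proof (induction m arbitrary: f v)
  case 0
  then have "v = []" by (cases v) auto
  then show ?case using lspan_single[OF 0(2), of "[]"] by simp
next
  case (Suc m)
  show ?case using Suc.prems(3)
  proof (induction v rule: rev_induct)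
    case Nil
    have "[] \<in> normal_words k" for k
    proof (induction k)
      case (Suc k)
      have "[] = [] @ rev [k..<k]" by simp
      then show ?case using Suc unfolding normal_words.simps by blast
    qed simp
    then show ?case using lspan_single[OF Suc.prems(2), of "[]"] by (simp del: normal_words.simps)
  next
    case (snoc p v)
    let ?X = "{w \<in> normal_words (Suc m). length w = length (v @ [p])} \<union> short (length (v @ [p]))"
    have p: "p < m" using snoc.prems by auto
    have "f * Ps v * P p \<in> lspan ?X"
    proof (rule lspan_subst)
      show "f * Ps v \<in> lspan ({w \<in> normal_words (Suc m). length w = length v} \<union> short (length v))"
        using snoc by simp
      fix g w assume g: "g \<in> A" and w: "w \<in> {w \<in> normal_words (Suc m). length w = length v} \<union> short (length v)"
      show "g * Ps w * P p \<in> lspan ?X"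
      proof (cases "w \<in> short (length v)")
        case True
        have "w @ [p] \<in> short (length (v @ [p]))" using True p Suc.prems(1) by (auto simp: short_def)
        then have "g * Ps (w @ [p]) \<in> lspan ?X" using lspan_single[OF g] by blast
        then show ?thesis by (simp add: mult.assoc)
      next
        case False
        then obtain w' k where w': "w = w' @ rev [k..<m]" "w' \<in> normal_words m" "k \<le> m" "length w = length v"
          using w by auto
        show ?thesis
          using normal_step[OF Suc.IH g w'(2,3) p] Suc.prems(1) w' by (simp del: normal_words.simps)
      qed
    qed
    then show ?case by (simp add: mult.assoc)
  qed
qed

lemma normal_words_span:
  "f \<in> A ==> \<forall>p\<in>set v. Suc p < n ==> f * Ps v \<in> lspan (normal_words n)"
proof (induction "length v" arbitrary: f v rule: less_induct)
  case less
  have "f * Ps v * 1 \<in> lspan (normal_words n)"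
  proof (rule lspan_subst)
    show "f * Ps v \<in> lspan ({w \<in> normal_words n. length w = length v} \<union> short (length v))"
      using normal_words_span_step[OF order.refl less.prems] .
    fix g w assume "g \<in> A" "w \<in> {w \<in> normal_words n. length w = length v} \<union> short (length v)"
    then show "g * Ps w * 1 \<in> lspan (normal_words n)"
      using less.hyps[of w g] lspan_single[of g w] by (auto simp: short_def)
  qed
  then show ?case by simp
qed

lemma lspan_mult:
  assumes "s \<in> lspan (normal_words n)" "s' \<in> lspan (normal_words n)"
  shows "s * s' \<in> lspan (normal_words n)"
proof (rule lspan_subst[OF assms(1)])
  fix f v assume f: "f \<in> A" and v: "v \<in> normal_words n"
  show "f * Ps v * s' \<in> lspan (normal_words n)"
    using assms(2)
  proof (induction rule: lspan.induct)
    case (step g w s)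
    have "f * Ps v * g * Ps w \<in> lspan (short (Suc (length v) + length w))"
      by (rule lspan_right_word[OF word_slide[OF f step(1)]])
        (use normal_words_letters[OF v] normal_words_letters[OF step(2)] in \<open>auto simp: short_def\<close>)
    then have "f * Ps v * g * Ps w * 1 \<in> lspan (normal_words n)"
      by (rule lspan_subst) (auto simp: short_def intro: normal_words_span)
    then show ?case using step by (simp add: distrib_left mult.assoc lspan_add)
  qed (simp add: lspan.zero)
qed

lemma lspan_coefficients:
  assumes "s \<in> lspan X" "finite X"
  shows "\<exists>c. (\<forall>v\<in>X. c v \<in> A) \<and> s = (\<Sum>v\<in>X. c v * Ps v)"
  using assms(1)
proof (induction rule: lspan.induct)
  show "\<exists>c. (\<forall>v\<in>X. c v \<in> A) \<and> 0 = (\<Sum>v\<in>X. c v * Ps v)"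
    by (rule exI[of _ "\<lambda>_. 0"]) (simp add: zero_mem)
next
  fix f v s
  assume f: "f \<in> A" and v: "v \<in> X" and "\<exists>c. (\<forall>v\<in>X. c v \<in> A) \<and> s = (\<Sum>v\<in>X. c v * Ps v)"
  then obtain c where c: "\<forall>v\<in>X. c v \<in> A" "s = (\<Sum>v\<in>X. c v * Ps v)" by blast
  have "(\<Sum>w\<in>X. (c(v := c v + f)) w * Ps w) = (\<Sum>w\<in>X. c w * Ps w + (if w = v then f * Ps v else 0))"
    by (intro sum.cong) (auto simp: distrib_right)
  then have "f * Ps v + s = (\<Sum>w\<in>X. (c(v := c v + f)) w * Ps w)"
    using assms(2) v c by (simp add: sum.distrib)
  moreover have "\<forall>w\<in>X. (c(v := c v + f)) w \<in> A" using c f by (auto intro: add)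
  ultimately show "\<exists>c. (\<forall>v\<in>X. c v \<in> A) \<and> f * Ps v + s = (\<Sum>v\<in>X. c v * Ps v)" by blast
qed

end

section \<open>Normal words as reduced words\<close>

fun act :: "nat list => 'a list => 'a list" where
  "act [] s = s"
| "act (p # v) s = act v (swap p s)"

text \<open>A crossing of equal labels involves the value at a configuration as well as at the
  swapped one. Hence all configurations are collected that arise when each letter may or may not be
  carried out.\<close>

fun reach :: "nat list => 'a list => 'a list set" where
  "reach [] s = {s}"
| "reach (p # v) s = reach v s \<union> reach v (swap p s)"

fun inversions :: "nat list => nat" where
  "inversions [] = 0"
| "inversions (x # l) = length (filter (\<lambda>y. y < x) l) + inversions l"

lemma act_append: "act (v @ w) s = act w (act v s)"
  by (induction v arbitrary: s) auto

lemma length_act [simp]: "length (act v s) = length s"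
  by (induction v arbitrary: s) auto

lemma mset_act: "(\<forall>p\<in>set v. Suc p < length s) ==> mset (act v s) = mset s"
  by (induction v arbitrary: s) auto

lemma swap_append_left: "Suc p < length s ==> swap p (s @ z) = swap p s @ z"
  by (simp add: swap_def list_update_append nth_append)

lemma act_append_left: "(\<forall>p\<in>set v. Suc p < length s) ==> act v (s @ z) = act v s @ z"
  by (induction v arbitrary: s) (auto simp: swap_append_left)

lemma act_descending: "length u + length y = m ==> act (rev [length u..<m]) (u @ y @ [c]) = u @ c # y"
proof (induction y arbitrary: m rule: rev_induct)
  case (snoc d y)
  then have "rev [length u..<m] = (length u + length y) # rev [length u..<length u + length y]"
    by (metis add_Suc_right le_add1 length_append_singleton rev.simps(2) rev_append rev_singleton_conv upt_Suc_append append_Cons append_Nil)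
  moreover have "swap (length u + length y) (u @ y @ d # [c]) = u @ y @ c # [d]"
    using swap_append2[of "u @ y" "length u + length y" d c "[]"] by simp
  moreover have "act (rev [length u..<length u + length y]) ((u @ y @ [c]) @ [d]) = (u @ c # y) @ [d]"
    using snoc.IH[OF refl] by (subst act_append_left) auto
  ultimately show ?case by simp
qed simp

lemma inversions_swap: "Suc p < length l ==> inversions (swap p l) \<le> Suc (inversions l)"
proof (induction l arbitrary: p)
  case (Cons x l)
  show ?case
  proof (cases p)
    case 0
    then obtain y l' where "l = y # l'" using Cons.prems by (cases l) auto
    then show ?thesis using 0 by (auto simp: swap_def)
  next
    case (Suc q)
    then have s: "swap p (x # l) = x # swap q l" by (simp add: swap_def)
    have "length (filter (\<lambda>y. y < x) (swap q l)) = length (filter (\<lambda>y. y < x) l)"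
      using mset_swap[of q l] Cons.prems Suc by (metis Suc_less_eq length_Cons mset_filter size_mset)
    then show ?thesis using Cons.IH[of q] Cons.prems Suc s by simp
  qed
qed simp

lemma inversions_insert_max:
  "(\<And>y. y \<in> set a \<union> set b ==> y < x) ==> inversions (a @ x # b) = inversions (a @ b) + length b"
proof (induction a)
  case Nil
  then have "filter (\<lambda>y. y < x) b = b" by (simp add: filter_id_conv)
  then show ?case by simp
next
  case (Cons c a)
  then have "inversions (a @ x # b) = inversions (a @ b) + length b" "c < x" by auto
  then show ?case by simp
qed

lemma normal_words_act:
  assumes "v \<in> normal_words m" "k \<le> m"
  shows "act (v @ rev [k..<m]) [0..<Suc m] = take k (act v [0..<m]) @ m # drop k (act v [0..<m])"
proof -
  have v: "\<forall>p\<in>set v. Suc p < length [0..<m]" using normal_words_letters[OF assms(1)] by simp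
  have "act v [0..<Suc m] = act v [0..<m] @ [m]" using act_append_left[OF v, of "[m]"] by simp
  also have "\<dots> = take k (act v [0..<m]) @ drop k (act v [0..<m]) @ [m]" by simp
  finally have eq: "act v [0..<Suc m] = take k (act v [0..<m]) @ drop k (act v [0..<m]) @ [m]" .
  have "length (take k (act v [0..<m])) = k" using assms(2) by simp
  then show ?thesis
    using act_descending[of "take k (act v [0..<m])" "drop k (act v [0..<m])" m m] assms(2)
    by (simp only: act_append eq) simp
qed

lemma normal_words_perm: "v \<in> normal_words m ==> set (act v [0..<m]) = {..<m}"
proof -
  assume "v \<in> normal_words m"
  then have "mset (act v [0..<m]) = mset [0..<m]" using normal_words_letters by (intro mset_act) auto
  then show ?thesis by (metis atLeast_upt set_mset_mset)
qed

text \<open>Inserting the largest entry creates as many inversions as the descending run has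
  letters.\<close>

lemma normal_words_reduced: "v \<in> normal_words m ==> inversions (act v [0..<m]) = length v"
proof (induction m arbitrary: v)
  case (Suc m)
  then obtain w k where w: "v = w @ rev [k..<m]" "w \<in> normal_words m" "k \<le> m" by auto
  let ?t = "act w [0..<m]"
  have lt: "\<And>y. y \<in> set (take k ?t) \<union> set (drop k ?t) ==> y < m"
    using normal_words_perm[OF w(2)] by (metis Un_iff in_set_dropD in_set_takeD lessThan_iff)
  from inversions_insert_max[OF lt] show ?case
    using Suc.IH[OF w(2)] w(3) unfolding w(1) normal_words_act[OF w(2,3)] by simp
qed simp

lemma insert_cancel:
  "a @ x # b = a' @ x # b' ==> x \<notin> set a ==> x \<notin> set a' ==> a = a' \<and> b = b'"
  by (induction a arbitrary: a') (auto simp: Cons_eq_append_conv)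

text \<open>The place of the largest entry determines the last run, and removing that entry gives
  the permutation of the remaining word.\<close>

lemma normal_words_inj:
  "v \<in> normal_words m ==> v' \<in> normal_words m ==> act v [0..<m] = act v' [0..<m] ==> v = v'"
proof (induction m arbitrary: v v')
  case (Suc m)
  obtain w k where w: "v = w @ rev [k..<m]" "w \<in> normal_words m" "k \<le> m" using Suc.prems by auto
  obtain w' k' where w': "v' = w' @ rev [k'..<m]" "w' \<in> normal_words m" "k' \<le> m" using Suc.prems by auto
  let ?t = "act w [0..<m]" and ?t' = "act w' [0..<m]"
  have ni: "m \<notin> set (take k ?t)" "m \<notin> set (take k' ?t')"
    using normal_words_perm[OF w(2)] normal_words_perm[OF w'(2)] by (metis in_set_takeD lessThan_iff less_irrefl)+
  have e: "take k ?t @ m # drop k ?t = take k' ?t' @ m # drop k' ?t'"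
    using Suc.prems(3) unfolding w(1) w'(1) normal_words_act[OF w(2,3)] normal_words_act[OF w'(2,3)] .
  have eq: "take k ?t = take k' ?t'" "drop k ?t = drop k' ?t'"
    using insert_cancel[OF e ni] by auto
  then have "?t = ?t'" by (metis append_take_drop_id)
  moreover have "k = k'" using arg_cong[OF eq(1), of length] w(3) w'(3) by simp
  ultimately show ?case using Suc.IH[OF w(2) w'(2)] w(1) w'(1) by simp
qed simp

lemma reach_inversions:
  "t \<in> reach v s ==> (\<forall>p\<in>set v. Suc p < length s) ==> inversions t \<le> inversions s + length v"
proof (induction v arbitrary: s)
  case (Cons p v)
  then consider "t \<in> reach v s" | "t \<in> reach v (swap p s)" by auto
  then show ?case
    using Cons.IH[of s] Cons.IH[of "swap p s"] inversions_swap[of p s] Cons.prems(2) by cases auto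
qed simp

lemma reach_cases:
  "t \<in> reach v s ==> (\<forall>p\<in>set v. Suc p < length s) ==> t = act v s \<or> inversions t < inversions s + length v"
proof (induction v arbitrary: s)
  case (Cons p v)
  then consider "t \<in> reach v s" | "t \<in> reach v (swap p s)" by auto
  then show ?case
    using Cons.IH[of "swap p s"] reach_inversions[of t v s] inversions_swap[of p s] Cons.prems(2) by cases auto
qed simp

lemma inversions_upt [simp]: "inversions [a..<m] = 0"
proof (induction "m - a" arbitrary: a)
  case (Suc d)
  then have "[a..<m] = a # [Suc a..<m]" by (simp add: upt_conv_Cons)
  then show ?case using Suc.hyps(1)[of "Suc a"] Suc.hyps(2) by simp
qed simp

text \<open>Omitting a letter of a reduced word costs inversions. So the permutation of
  \<open>v'\<close> is not reached from any other normal word of at most the same length.\<close>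

lemma normal_words_triangular:
  assumes "v \<in> normal_words m" "v' \<in> normal_words m" "length v \<le> length v'" "act v' [0..<m] \<in> reach v [0..<m]"
  shows "v = v'"
proof -
  have "act v' [0..<m] = act v [0..<m] \<or> inversions (act v' [0..<m]) < length v"
    using reach_cases[OF assms(4)] normal_words_letters[OF assms(1)] by simp
  then show ?thesis
    using normal_words_reduced[OF assms(2)] assms normal_words_inj[of v' m v] by auto
qed

section \<open>Normal forms in the deformed tensor product algebra\<close>

locale tensor_scalars = tensor_relations N B lam nu e y E P
  for N B lam nu and e :: "entry list => 'r::ring_1" and y E P +
  fixes \<kappa> :: "'k::field => 'r"
  assumes kappa_one: "\<kappa> 1 = 1"
    and kappa_add: "\<kappa> (c + d) = \<kappa> c + \<kappa> d"
    and kappa_mult: "\<kappa> (c * d) = \<kappa> c * \<kappa> d"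
    and kappa_e: "i \<in> Seq lam nu ==> \<kappa> c * e i = e i * \<kappa> c"
    and kappa_y: "p < length lam + length nu ==> \<kappa> c * y p = y p * \<kappa> c"
    and kappa_P: "Suc p < length lam + length nu ==> \<kappa> c * P p = P p * \<kappa> c"
begin

abbreviation "Sq \<equiv> Seq lam nu"
abbreviation "rr \<equiv> length lam + length nu"
abbreviation "Eh k a \<equiv> (\<lambda>d. if d = 0 then 1 else E k a d)"

definition "u = (\<Sum>i\<in>Sq. e i)"

text \<open>The coefficients, built up by adding one generator on the left at a time. In the product
  of two rings the same induction runs over matched pairs of coefficients.\<close>

inductive_set diag :: "'r set" where
  zero: "0 \<in> diag"
| unit: "u \<in> diag"
| add: "f \<in> diag ==> g \<in> diag ==> f + g \<in> diag"
| kappa: "f \<in> diag ==> \<kappa> c * f \<in> diag"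
| e: "i \<in> Sq ==> f \<in> diag ==> e i * f \<in> diag"
| y: "p < rr ==> f \<in> diag ==> y p * f \<in> diag"
| E: "k < length lam ==> a \<in> {1..N} ==> d \<in> {1..(lam ! k) a} ==> f \<in> diag ==> E k a d * f \<in> diag"

lemma kappa_minus: "\<kappa> (- 1) * f = - f"
proof -
  have "\<kappa> 0 = 0" using kappa_add[of 0 0] by simp
  then have "\<kappa> (- 1) = - 1" using kappa_add[of "- 1" 1] by (simp add: kappa_one eq_neg_iff_add_eq_0)
  then show ?thesis by simp
qed

lemma diag_minus: "f \<in> diag ==> - f \<in> diag"
  using diag.kappa[of f "- 1"] by (simp add: kappa_minus)

lemma diag_sum: "(\<And>a. a \<in> S ==> g a \<in> diag) ==> sum g S \<in> diag"
  by (induction S rule: infinite_finite_induct) (auto intro: diag.zero diag.add)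

lemma e_u: "i \<in> Sq ==> e i * u = e i" "i \<in> Sq ==> u * e i = e i"
  by (simp_all add: u_def sum_distrib_left sum_distrib_right e_e)

lemma y_u: "p < rr ==> y p * u = y p" "p < rr ==> u * y p = y p"
  using y_sum[of p] by (simp_all add: u_def sum_distrib_left sum_distrib_right y_e[symmetric] Seq_length)

lemma E_u:
  assumes "k < length lam" "a \<in> {1..N}" "d \<in> {1..(lam ! k) a}"
  shows "E k a d * u = E k a d" "u * E k a d = E k a d"
proof -
  show "E k a d * u = E k a d" using E_sum[OF assms] by (simp add: u_def sum_distrib_left)
  have "u * E k a d = (\<Sum>i\<in>Sq. E k a d * e i)"
    unfolding u_def sum_distrib_right by (intro sum.cong refl) (rule E_e[OF _ assms, symmetric])
  then show "u * E k a d = E k a d" using E_sum[OF assms] by simp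
qed

lemma P_u: "Suc p < rr ==> P p * u = P p" "Suc p < rr ==> u * P p = P p"
proof -
  assume p: "Suc p < rr"
  show "P p * u = P p" using P_sum[OF p] by (simp add: u_def sum_distrib_left)
  have "u * (P p * e i) = P p * e i" if i: "i \<in> Sq" for i
  proof (cases "is_solid (i ! p) \<or> is_solid (i ! Suc p)")
    case True
    have "Suc p < length i" using p Seq_length[OF i] by simp
    then show ?thesis
      using True P_e[OF i _ True] e_u(2)[OF Seq_swap[OF i _ True]] by (simp add: mult.assoc[symmetric])
  next
    case False
    then show ?thesis using P_red[OF i] p Seq_length[OF i] by simp
  qed
  then have "u * (\<Sum>i\<in>Sq. P p * e i) = (\<Sum>i\<in>Sq. P p * e i)" by (simp add: sum_distrib_left)
  then show "u * P p = P p" using P_sum[OF p] by simp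
qed

lemma kappa_u: "\<kappa> c * u = u * \<kappa> c"
  by (simp add: u_def sum_distrib_left sum_distrib_right kappa_e)

lemma u_diag: "f \<in> diag ==> u * f = f"
proof (induction rule: diag.induct)
  case unit
  have "u * u = (\<Sum>i\<in>Sq. u * e i)" by (subst (2) u_def) (rule sum_distrib_left)
  also have "\<dots> = (\<Sum>i\<in>Sq. e i)" by (intro sum.cong refl e_u(2))
  finally show ?case by (simp only: u_def[symmetric])
next
  case (kappa f c)
  then show ?case by (simp add: assoc_comm[OF kappa_u[symmetric]])
qed (auto simp: distrib_left mult.assoc[symmetric] e_u y_u E_u)

lemma diag_mult: "f \<in> diag ==> g \<in> diag ==> f * g \<in> diag"
  by (induction rule: diag.induct) (auto simp: u_diag distrib_right mult.assoc intro: diag.intros)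

lemma e_diag: "i \<in> Sq ==> e i \<in> diag"
  using diag.e[OF _ diag.unit] by (simp add: e_u)

text \<open>Polynomials such as \<open>gam\<close> and \<open>Q_poly\<close> contain the unit of the
  ambient ring, which need not lie in \<open>diag\<close>; they only act on it by
  multiplication.\<close>

definition multiplier :: "'r => bool" where "multiplier g \<longleftrightarrow> (\<forall>f\<in>diag. g * f \<in> diag)"

lemma multiplierD: "multiplier g ==> i \<in> Sq ==> g * e i \<in> diag"
  by (simp add: multiplier_def e_diag)

lemma multiplier_intros:
  "multiplier 0" "multiplier 1" "multiplier g ==> multiplier h ==> multiplier (g + h)"
  "multiplier g ==> multiplier h ==> multiplier (g * h)" "multiplier g ==> multiplier (- g)"
  "p < rr ==> multiplier (y p)"
  "k < length lam ==> a \<in> {1..N} ==> d \<in> {1..(lam ! k) a} ==> multiplier (E k a d)"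
  by (auto simp: multiplier_def distrib_right mult.assoc diag_minus intro: diag.intros simp del: atLeastAtMost_iff)

lemma multiplier_power: "multiplier g ==> multiplier (g ^ m)"
  by (induction m) (auto intro: multiplier_intros)

lemma multiplier_sum: "(\<And>a. a \<in> S ==> multiplier (g a)) ==> multiplier (sum g S)"
  by (induction S rule: infinite_finite_induct) (auto intro: multiplier_intros)

lemma multiplier_hsum: "multiplier g ==> multiplier h ==> multiplier (hsum m g h)"
  unfolding hsum_def by (intro multiplier_sum multiplier_intros multiplier_power)

lemma multiplier_Eh:
  "k < length lam ==> a \<in> {1..N} ==> d \<le> (lam ! k) a ==> multiplier (Eh k a d)"
  by (auto intro: multiplier_intros)

lemma multiplier_gam:
  "k < length lam ==> a \<in> {1..N} ==> multiplier g ==> multiplier (gam (Eh k a) ((lam ! k) a) g)"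
  unfolding gam_def
  by (intro multiplier_sum multiplier_intros(4) multiplier_power multiplier_Eh multiplier_intros(2,5)) auto

lemma multiplier_dgam:
  "k < length lam ==> a \<in> {1..N} ==> multiplier g ==> multiplier h ==> multiplier (dgam (Eh k a) ((lam ! k) a) g h)"
  unfolding dgam_def
  by (intro multiplier_sum multiplier_intros(4) multiplier_power multiplier_hsum multiplier_Eh multiplier_intros(2,5)) auto

lemma multiplier_Q_poly: "multiplier g ==> multiplier h ==> multiplier (Q_poly B a b g h)"
  unfolding Q_poly_def by (auto intro: multiplier_intros multiplier_power)

lemma multiplier_Q_quot: "multiplier g ==> multiplier h ==> multiplier (Q_quot B a b g h)"
  unfolding Q_quot_def by (auto intro: multiplier_intros multiplier_hsum)

definition "same p = (\<Sum>i\<in>{i \<in> Sq. is_solid (i ! p) \<and> i ! p = i ! Suc p}. e i)"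

lemma same_diag: "f \<in> diag ==> same p * f \<in> diag"
  unfolding same_def sum_distrib_right by (intro diag_sum) (auto intro: diag.e)

lemma same_sum: "same p = (\<Sum>i\<in>Sq. if is_solid (i ! p) \<and> i ! p = i ! Suc p then e i else 0)"
  unfolding same_def by (intro sum.inter_filter) simp

lemma slides:
  assumes p: "Suc p < rr"
  shows "y p * P p = P p * y (Suc p) + same p" "P p * y p = y (Suc p) * P p + same p"
proof -
  have "y p * P p * e i = P p * y (Suc p) * e i + (if is_solid (i ! p) \<and> i ! p = i ! Suc p then e i else 0) \<and>
      P p * y p * e i = y (Suc p) * P p * e i + (if is_solid (i ! p) \<and> i ! p = i ! Suc p then e i else 0)" if i: "i \<in> Sq" for i
  proof (cases "is_solid (i ! p) \<or> is_solid (i ! Suc p)")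
    case True
    have p': "Suc p < length i" using p Seq_length[OF i] by simp
    have "(i ! p = i ! Suc p) = (is_solid (i ! p) \<and> i ! p = i ! Suc p)" using True by metis
    then show ?thesis using slide_left[OF i p' True] slide_right[OF i p' True] by simp
  next
    case False
    have p': "Suc p < length i" using p Seq_length[OF i] by simp
    then have "P p * e i = 0" using P_red[OF i] False by simp
    then have "P p * y p * e i = 0" "P p * y (Suc p) * e i = 0" "y p * P p * e i = 0" "y (Suc p) * P p * e i = 0"
      using y_e[OF i, of p] y_e[OF i p'] p' by (simp_all add: mult.assoc) (simp_all add: mult.assoc[symmetric])
    then show ?thesis using False by simp
  qed
  then have s: "(\<Sum>i\<in>Sq. y p * P p * e i) = (\<Sum>i\<in>Sq. P p * y (Suc p) * e i) + same p"
    "(\<Sum>i\<in>Sq. P p * y p * e i) = (\<Sum>i\<in>Sq. y (Suc p) * P p * e i) + same p"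
    unfolding same_sum sum.distrib[symmetric] by (simp_all cong: sum.cong)
  have u: "(\<Sum>i\<in>Sq. f * g * e i) = f * g" if "g * u = g" for f g
  proof -
    have "(\<Sum>i\<in>Sq. f * g * e i) = f * (g * u)" by (simp add: u_def sum_distrib_left mult.assoc)
    then show ?thesis by (simp add: that)
  qed
  show "y p * P p = P p * y (Suc p) + same p" "P p * y p = y (Suc p) * P p + same p"
    using s p by (simp_all add: u P_u y_u)
qed

text \<open>Each generator of a coefficient passes the crossing up to a change of its index or
  colours, and the corrections, sums of idempotents, are coefficients again.\<close>

lemma P_slide:
  assumes p: "Suc p < rr" and f: "f \<in> diag"
  shows "\<exists>g\<in>diag. \<exists>h\<in>diag. P p * f = g * P p + h"
  using f
proof (induction rule: diag.induct)
  case zero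
  show ?case by (intro bexI[of _ 0]) (auto intro: diag.zero)
next
  case unit
  show ?case by (intro bexI[of _ u] bexI[of _ 0]) (auto simp: P_u p intro: diag.intros)
next
  case (add f g)
  then obtain f1 f2 g1 g2 where *: "f1 \<in> diag" "f2 \<in> diag" "P p * f = f1 * P p + f2"
    "g1 \<in> diag" "g2 \<in> diag" "P p * g = g1 * P p + g2" by metis
  have "P p * (f + g) = (f1 + g1) * P p + (f2 + g2)" unfolding distrib_left * by (simp add: algebra_simps)
  then show ?case using * by (blast intro: diag.add)
next
  case (kappa f c)
  then obtain g h where *: "g \<in> diag" "h \<in> diag" "P p * f = g * P p + h" by metis
  have "P p * (\<kappa> c * f) = \<kappa> c * (P p * f)" by (rule assoc_comm[OF kappa_P[OF p, symmetric]])
  also have "\<dots> = \<kappa> c * g * P p + \<kappa> c * h" unfolding * by (simp add: distrib_left mult.assoc)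
  finally show ?case using * by (blast intro: diag.kappa)
next
  case (e i f)
  then obtain g h where *: "g \<in> diag" "h \<in> diag" "P p * f = g * P p + h" by metis
  have p': "Suc p < length i" using p Seq_length[OF e(1)] by simp
  show ?case
  proof (cases "is_solid (i ! p) \<or> is_solid (i ! Suc p)")
    case True
    have "P p * (e i * f) = e (swap p i) * (P p * f)"
      using P_e[OF e(1) p' True] by (simp add: mult.assoc[symmetric])
    also have "\<dots> = e (swap p i) * g * P p + e (swap p i) * h" unfolding * by (simp add: distrib_left mult.assoc)
    finally show ?thesis using * Seq_swap[OF e(1) p' True] by (blast intro: diag.e)
  next
    case False
    then have "P p * e i = 0" using P_red[OF e(1) p'] by simp
    then have "P p * (e i * f) = 0 * P p + 0" by (simp add: mult.assoc[symmetric])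
    then show ?thesis using diag.zero by blast
  qed
next
  case (y q f)
  then obtain g h where *: "g \<in> diag" "h \<in> diag" "P p * f = g * P p + h" by metis
  consider "q = p" | "q = Suc p" | "q \<noteq> p" "q \<noteq> Suc p" by blast
  then show ?case
  proof cases
    case 1
    have "P p * (y q * f) = y (Suc p) * (P p * f) + same p * f"
      using slides(2)[OF p] 1 by (simp add: mult.assoc[symmetric] distrib_right)
    also have "\<dots> = (y (Suc p) * g) * P p + (y (Suc p) * h + same p * f)"
      unfolding * by (simp add: distrib_left mult.assoc add.assoc)
    finally show ?thesis using * y p same_diag by (blast intro: diag.y diag.add)
  next
    case 2
    have "P p * y (Suc p) = y p * P p + - same p" using slides(1)[OF p] by simp
    then have "P p * (y q * f) = y p * (P p * f) + - (same p * f)"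
      using 2 by (simp add: mult.assoc[symmetric] left_diff_distrib)
    also have "\<dots> = (y p * g) * P p + (y p * h + - (same p * f))"
      unfolding * by (simp add: distrib_left mult.assoc add.assoc)
    finally have "P p * (y q * f) = (y p * g) * P p + (y p * h + - (same p * f))" .
    moreover have "y p * g \<in> diag" using *(1) p by (intro diag.y) auto
    moreover have "y p * h + - (same p * f) \<in> diag"
      using *(2) p by (intro diag.y diag.add diag_minus same_diag y(2)) auto
    ultimately show ?thesis by blast
  next
    case 3
    have "P p * (y q * f) = y q * (P p * f)" by (rule assoc_comm[OF P_y[OF p y(1) 3]])
    also have "\<dots> = y q * g * P p + y q * h" unfolding * by (simp add: distrib_left mult.assoc)
    finally show ?thesis using * y by (blast intro: diag.y)
  qed
next
  case (E k a d f)
  then obtain g h where *: "g \<in> diag" "h \<in> diag" "P p * f = g * P p + h" by metis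
  have "P p * (E k a d * f) = E k a d * (P p * f)" by (rule assoc_comm[OF E_P[OF E(1-3) p, symmetric]])
  also have "\<dots> = E k a d * g * P p + E k a d * h" unfolding * by (simp add: distrib_left mult.assoc)
  finally show ?case using * E(1-3) by (blast intro: diag.E)
qed

lemma entry_range:
  assumes "i \<in> Sq" "p < length i" "set nu \<subseteq> {1..N}"
  shows "i ! p = Solid a ==> a \<in> {1..N}" "i ! p = Thick k ==> k < length lam"
  using assms Seq_set[OF assms(1)] nth_mem[OF assms(2)] by auto

lemma P_square:
  assumes p: "Suc p < rr" and nu: "set nu \<subseteq> {1..N}"
  shows "P p * P p \<in> diag"
proof -
  have "P p * P p * e i \<in> diag" if i: "i \<in> Sq" for i
  proof -
    have p': "Suc p < length i" "p < length i" using p Seq_length[OF i] by auto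
    note rng = entry_range[OF i p'(2) nu] entry_range[OF i p'(1) nu]
    show ?thesis
    proof (cases "i ! p")
      case (Solid a)
      then show ?thesis using rng p square_black[OF i p'(1)] square_black_red[OF i p'(1)]
        by (cases "i ! Suc p") (auto intro!: multiplierD[OF _ i] multiplier_Q_poly multiplier_gam multiplier_intros(6))
    next
      case (Thick k)
      then show ?thesis using rng p square_red_black[OF i p'(1)] P_red[OF i p'(1)]
        by (cases "i ! Suc p") (auto simp: mult.assoc intro!: multiplierD[OF _ i] multiplier_gam multiplier_intros(6) diag.zero)
    qed
  qed
  then have "(\<Sum>i\<in>Sq. P p * P p * e i) \<in> diag" by (rule diag_sum)
  also have "(\<Sum>i\<in>Sq. P p * P p * e i) = P p * (P p * u)"
    by (simp add: u_def sum_distrib_left mult.assoc)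
  finally show ?thesis using P_u p by simp
qed

lemma P_braid:
  assumes p: "Suc (Suc p) < rr" and nu: "set nu \<subseteq> {1..N}"
  shows "\<exists>h\<in>diag. P p * P (Suc p) * P p = P (Suc p) * P p * P (Suc p) + h"
proof -
  let ?l = "P p * P (Suc p) * P p" and ?r = "P (Suc p) * P p * P (Suc p)"
  have "\<exists>h\<in>diag. ?l * e i = ?r * e i + h" if i: "i \<in> Sq" for i
  proof -
    have p': "Suc (Suc p) < length i" "Suc p < length i" "p < length i" using p Seq_length[OF i] by auto
    note rng = entry_range[OF i p'(3) nu] entry_range[OF i p'(2) nu] entry_range[OF i p'(1) nu]
    have pl: "\<exists>h\<in>diag. ?l * e i = ?r * e i + h" if "?l * e i = ?r * e i"
      using that diag.zero by (metis add.right_neutral)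
    \<comment> \<open>With two thick entries among the three, each side of the braid relation
      contains a crossing that meets a thick pair, so both sides vanish.\<close>
    have zero2: "P b * (P c * e i) = 0"
      if "is_solid (i ! c) \<or> is_solid (i ! Suc c)" "Suc b < length i" "Suc c < length i"
        "\<not> is_solid (swap c i ! b)" "\<not> is_solid (swap c i ! Suc b)" for b c
      using P_e[OF i that(3,1)] P_red[OF Seq_swap[OF i that(3,1)], of b] that
      by (simp add: mult.assoc[symmetric])
    have zero3: "P a * (P b * (P c * e i)) = 0"
      if "is_solid (i ! c) \<or> is_solid (i ! Suc c)" "Suc b < length i" "Suc c < length i" "Suc a < length i"
        "is_solid (swap c i ! b) \<or> is_solid (swap c i ! Suc b)"
        "\<not> is_solid (swap b (swap c i) ! a)" "\<not> is_solid (swap b (swap c i) ! Suc a)" for a b c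
    proof -
      note i' = Seq_swap[OF i that(3,1)]
      have "P b * (P c * e i) = e (swap b (swap c i)) * (P b * P c)"
        using P_e[OF i that(3,1)] P_e[OF i' _ that(5)] that(2) by (simp add: mult.assoc[symmetric])
      moreover have "P a * e (swap b (swap c i)) = 0"
        using P_red[OF Seq_swap[OF i' _ that(5)], of a] that by simp
      ultimately show ?thesis by (simp add: mult.assoc[symmetric])
    qed
    note red = P_red[OF i p'(2)] P_red[OF i p'(1)]
    have plain: "?l * e i = ?r * e i"
      if "is_solid (i ! p) \<and> is_solid (i ! Suc p) \<or> is_solid (i ! p) \<and> is_solid (i ! Suc (Suc p))
        \<or> is_solid (i ! Suc p) \<and> is_solid (i ! Suc (Suc p))" "i ! p \<noteq> i ! Suc (Suc p)"
    proof (rule braid_plain[OF i p'(1) _ that(2)])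
      have "\<exists>q. {q \<in> {p, Suc p, Suc (Suc p)}. \<not> is_solid (i ! q)} \<subseteq> {q}" using that(1) by auto
      then show "card {q \<in> {p, Suc p, Suc (Suc p)}. \<not> is_solid (i ! q)} \<le> 1"
        by (metis (no_types, lifting) card.empty card_insert_disjoint card_mono empty_iff finite.emptyI finite.insertI One_nat_def)
    qed
    consider (aba) a b where "i ! p = Solid a" "i ! Suc p = Solid b" "i ! Suc (Suc p) = Solid a"
      | (aka) a k where "i ! p = Solid a" "i ! Suc p = Thick k" "i ! Suc (Suc p) = Solid a"
      | (flat) "is_solid (i ! p) \<and> is_solid (i ! Suc p) \<or> is_solid (i ! p) \<and> is_solid (i ! Suc (Suc p))
        \<or> is_solid (i ! Suc p) \<and> is_solid (i ! Suc (Suc p))" "i ! p \<noteq> i ! Suc (Suc p)"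
      | (TTX) "\<not> is_solid (i ! p)" "\<not> is_solid (i ! Suc p)"
      | (STT) "is_solid (i ! p)" "\<not> is_solid (i ! Suc p)" "\<not> is_solid (i ! Suc (Suc p))"
      | (TST) "\<not> is_solid (i ! p)" "is_solid (i ! Suc p)" "\<not> is_solid (i ! Suc (Suc p))"
      by (cases "i ! p"; cases "i ! Suc p"; cases "i ! Suc (Suc p)") auto
    then show ?thesis
    proof cases
      case aba
      show ?thesis using braid_black[OF i p'(1) aba] p
        by (auto intro!: bexI[of _ "Q_quot B a b (y p) (y (Suc (Suc p))) * e i"] multiplierD[OF _ i] multiplier_Q_quot multiplier_intros(6))
    next
      case aka
      have "a \<in> {1..N}" "k < length lam" using rng aka by auto
      then show ?thesis using braid_red[OF i p'(1) aka] p
        by (auto intro!: bexI[of _ "dgam (Eh k a) ((lam ! k) a) (y p) (y (Suc (Suc p))) * e i"] multiplierD[OF _ i] multiplier_dgam multiplier_intros(6))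
    next
      case flat
      then show ?thesis using pl plain by blast
    next
      case TTX
      have "?l * e i = 0" using red(1) TTX by (simp add: mult.assoc)
      moreover have "?r * e i = 0"
      proof (cases "is_solid (i ! Suc (Suc p))")
        case True
        then show ?thesis using zero3[of "Suc p" p "Suc p"] TTX p' by (simp add: mult.assoc)
      next
        case False
        then show ?thesis using red(2) TTX by (simp add: mult.assoc)
      qed
      ultimately show ?thesis using pl by simp
    next
      case STT
      have "?r * e i = 0" using red(2) STT by (simp add: mult.assoc)
      moreover have "?l * e i = 0" using zero3[of p "Suc p" p] STT p' by (simp add: mult.assoc)
      ultimately show ?thesis using pl by simp
    next
      case TST
      have "?l * e i = 0" using zero2[of p "Suc p"] TST p' by (simp add: mult.assoc)
      moreover have "?r * e i = 0" using zero2[of "Suc p" p] TST p' by (simp add: mult.assoc)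
      ultimately show ?thesis using pl by simp
    qed
  qed
  then obtain h where h: "\<And>i. i \<in> Sq ==> h i \<in> diag" "\<And>i. i \<in> Sq ==> ?l * e i = ?r * e i + h i" by metis
  have "?l * u = ?r * u + sum h Sq"
    unfolding u_def sum_distrib_left sum.distrib[symmetric] by (intro sum.cong refl) (rule h(2))
  then have "?l = ?r + sum h Sq" using P_u p by (simp add: mult.assoc)
  then show ?thesis by (intro bexI[of _ "sum h Sq"] diag_sum h(1))
qed

lemma crossing_filtration:
  assumes "set nu \<subseteq> {1..N}"
  shows "crossing_filtration diag P rr"
  by standard
    (auto intro: diag.zero diag.add diag_minus diag_mult P_slide P_square[OF _ assms] P_P P_braid[OF _ assms])

end

text \<open>The relations are equations between ring expressions, so they hold in the product. Pairs
  of corresponding elements can then be rewritten with the same words and corresponding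
  coefficients.\<close>

lemma tensor_relations_prod:
  assumes "tensor_relations N B lam nu e y E P" "tensor_relations N B lam nu e' y' E' P'"
  shows "tensor_relations N B lam nu (\<lambda>i. (e i, e' i)) (\<lambda>p. (y p, y' p)) (\<lambda>k a d. (E k a d, E' k a d)) (\<lambda>p. (P p, P' p))"
proof -
  interpret t: tensor_relations N B lam nu e y E P by fact
  interpret t': tensor_relations N B lam nu e' y' E' P' by fact
  have one: "(if d = (0 :: nat) then 1 else (f, g)) = (if d = 0 then 1 else f, if d = 0 then 1 else g)"
    for d and f :: 'a and g :: 'b by (simp add: one_prod_def)
  have power: "(f, g) ^ m = (f ^ m, g ^ m)" for f :: 'a and g :: 'b and m by (simp add: prod_eq_iff)
  have neg: "(- 1 :: 'a \<times> 'b) ^ m = ((- 1) ^ m, (- 1) ^ m)" for m by (simp add: prod_eq_iff)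
  have hsum: "hsum m (f, g) (f', g') = (hsum m f f', hsum m g g')" for f f' :: 'a and g g' :: 'b and m
    by (simp add: hsum_def prod_eq_iff fst_sum snd_sum)
  have gam: "gam (\<lambda>d. (c d, c' d)) m (f, g) = (gam c m f, gam c' m g)" for c c' m and f :: 'a and g :: 'b
    by (simp add: gam_def prod_eq_iff fst_sum snd_sum)
  have dgam: "dgam (\<lambda>d. (c d, c' d)) m (f, g) (f', g') = (dgam c m f f', dgam c' m g g')"
    for c c' m and f f' :: 'a and g g' :: 'b
    by (simp add: dgam_def prod_eq_iff fst_sum snd_sum hsum)
  have Q: "Q_poly B a b (f, g) (f', g') = (Q_poly B a b f f', Q_poly B a b g g')"
    "Q_quot B a b (f, g) (f', g') = (Q_quot B a b f f', Q_quot B a b g g')" for a b and f f' :: 'a and g g' :: 'b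
    by (simp_all add: Q_poly_def Q_quot_def hsum power prod_eq_iff)
  note pair = prod_eq_iff fst_sum snd_sum one gam dgam Q
  show ?thesis
  proof (standard, goal_cases)
    case 1
    then show ?case using t.e_e t'.e_e by (simp add: pair)
  next
    case 2
    then show ?case using t.y_sum t'.y_sum by (simp add: pair)
  next
    case 3
    then show ?case using t.E_sum t'.E_sum by (simp add: pair)
  next
    case 4
    then show ?case using t.P_sum t'.P_sum by (simp add: pair)
  next
    case 5
    then show ?case using t.y_e t'.y_e by (simp add: pair)
  next
    case 6
    then show ?case using t.E_e t'.E_e by (simp add: pair)
  next
    case 7
    then show ?case using t.y_y t'.y_y by (simp add: pair)
  next
    case 8
    then show ?case using t.E_y t'.E_y by (simp add: pair)
  next
    case 9
    then show ?case using t.E_P t'.E_P by (simp add: pair)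
  next
    case 10
    then show ?case using t.y_red t'.y_red by (simp add: pair)
  next
    case 11
    then show ?case using t.P_red t'.P_red by (simp add: pair)
  next
    case 12
    then show ?case using t.P_e t'.P_e by (simp add: pair)
  next
    case 13
    then show ?case using t.P_y t'.P_y by (simp add: pair)
  next
    case (14 p q)
    then show ?case using t.P_P[of p q] t'.P_P[of p q] by (simp add: pair)
  next
    case 15
    then show ?case using t.slide_left t'.slide_left by (simp add: pair)
  next
    case 16
    then show ?case using t.slide_right t'.slide_right by (simp add: pair)
  next
    case 17
    then show ?case using t.square_black t'.square_black by (simp add: pair)
  next
    case 18
    then show ?case using t.square_black_red t'.square_black_red by (simp add: pair)
  next
    case 19
    then show ?case using t.square_red_black t'.square_red_black by (simp add: pair)
  next
    case 20
    then show ?case using t.braid_black t'.braid_black by (simp add: pair)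
  next
    case 21
    then show ?case using t.braid_red t'.braid_red by (simp add: pair)
  next
    case 22
    then show ?case using t.braid_plain t'.braid_plain by (simp add: pair)
  qed
qed

section \<open>The polynomial representation, in terms of labelled configurations\<close>

text \<open>
  Instead of polynomials we use functions on the configurations obtained by putting pairwise
  distinct elements of a field on the strands, on which the symmetric group acts by permuting.
\<close>

fun before :: "lab => lab => bool" where
  "before (Orig a) (Orig b) \<longleftrightarrow> a < b"
| "before (Orig a) (Bar b) \<longleftrightarrow> True"
| "before (Bar a) (Orig b) \<longleftrightarrow> False"
| "before (Bar a) (Bar b) \<longleftrightarrow> a < b"

lemma before_total: "a \<noteq> b ==> before a b = (\<not> before b a)"
  by (cases a; cases b) auto

type_synonym 'f config = "(lab \<times> 'f) list"

locale klr_model =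
  fixes N :: nat and B :: "nat => nat => int" and t :: "lab => lab => 'k::field" and n :: nat
    and \<iota> :: "'k => 'f::field"
  assumes cartan: "cartan_datum N B"
    and scalars: "\<And>i j. i \<in> ext_index N ==> j \<in> ext_index N ==>
      t i j = (if \<exists>k\<in>{1..N}. i = Bar k \<and> j = Orig k then - 1 else 1)"
    and iota: "\<iota> 1 = 1" "\<iota> (c + d) = \<iota> c + \<iota> d" "\<iota> (c * d) = \<iota> c * \<iota> d"
begin

definition valid :: "'f config => bool"
  where "valid s \<longleftrightarrow> length s = n \<and> set (map fst s) \<subseteq> ext_index N \<and> distinct (map snd s)"

definition Qf :: "lab => lab => 'f => 'f => 'f"
  where "Qf a b u v = (if ext_form B a b = 0 then \<iota> (t a b)
    else \<iota> (t a b) * u ^ nat (- cartan_int (ext_form B) a b) + \<iota> (t b a) * v ^ nat (- cartan_int (ext_form B) b a))"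

text \<open>The polynomial \<open>Qf\<close> is put entirely into one of the two directions, chosen
  by the order \<open>before\<close>; in the other direction the crossing only permutes. Together
  they give the square of a crossing.\<close>

definition \<tau> :: "lab \<times> 'f => lab \<times> 'f => 'f"
  where "\<tau> x y = (if before (fst x) (fst y) then 1 else Qf (fst x) (fst y) (snd x) (snd y))"

text \<open>The generators act by zero outside valid configurations, so \<open>uop\<close> can
  represent \<open>1\<close>. On valid ones the values are distinct, and divided differences are
  taken pointwise without any divisibility argument.\<close>

definition "eop w = Endo (\<lambda>\<phi> s. if valid s \<and> map fst s = w then \<phi> s else (0 :: 'f))"
definition "xop p = Endo (\<lambda>\<phi> s. if valid s \<and> p < n then snd (s ! p) * \<phi> s else (0 :: 'f))"
definition "pop p = Endo (\<lambda>\<phi> s. if valid s \<and> Suc p < n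
  then (if fst (s ! p) = fst (s ! Suc p) then (\<phi> s - \<phi> (swap p s)) / (snd (s ! p) - snd (s ! Suc p))
        else \<tau> (s ! p) (s ! Suc p) * \<phi> (swap p s)) else (0 :: 'f))"
definition "uop = Endo (\<lambda>\<phi> s. if valid s then \<phi> s else (0 :: 'f))"
definition "kop c = Endo (\<lambda>\<phi> (s :: 'f config). \<iota> c * \<phi> s)"

lemma app_ops:
  "app (eop w) \<phi> s = (if valid s \<and> map fst s = w then \<phi> s else 0)"
  "app (xop p) \<phi> s = (if valid s \<and> p < n then snd (s ! p) * \<phi> s else 0)"
  "app (pop p) \<phi> s = (if valid s \<and> Suc p < n
    then (if fst (s ! p) = fst (s ! Suc p) then (\<phi> s - \<phi> (swap p s)) / (snd (s ! p) - snd (s ! Suc p))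
          else \<tau> (s ! p) (s ! Suc p) * \<phi> (swap p s)) else 0)"
  "app uop \<phi> s = (if valid s then \<phi> s else 0)"
  "app (kop c) \<phi> s = \<iota> c * \<phi> s"
  unfolding eop_def xop_def pop_def uop_def kop_def
  by (subst Endo_inverse; auto simp: fun_eq_iff algebra_simps add_divide_distrib diff_divide_distrib)+

fun gop :: "lab gens => ('f config => 'f) endo" where
  "gop (Idemp w) = eop w"
| "gop (Dot p) = xop p"
| "gop (Cross p) = pop p"

definition \<rho> :: "(lab gens, 'k) free => ('f config => 'f) endo"
  where "\<rho> = free_eval kop uop gop"

lemma valid_perm: "valid s ==> mset s' = mset s ==> valid s'"
  unfolding valid_def
  by (metis mset_map mset_eq_imp_distinct_iff mset_eq_length mset_eq_setD)

lemma valid_swap: "valid s ==> Suc p < n ==> valid (swap p s)"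
  by (rule valid_perm) (auto simp: valid_def)

lemma op_eqI:
  fixes f g :: "('f config => 'f) endo"
  shows "(\<And>\<phi> s. app f \<phi> s = app g \<phi> s) ==> f = g"
  by (intro endo_eqI ext)

lemma gop_uop: "uop * gop g = gop g" "gop g * uop = gop g"
  by (cases g; intro op_eqI; auto simp: app_ops valid_swap)+

lemma rho_hom: "alg_hom \<rho> kop"
  and rho_gen: "\<rho> (gen g) = gop g" and rho_one: "\<rho> 1 = uop"
proof -
  have k: "kop 1 = 1" "kop (c + d) = kop c + kop d" "kop (c * d) = kop c * kop d" for c d
    by (intro op_eqI, simp add: app_ops iota algebra_simps)+
  have u: "kop c * uop = uop * kop c" "uop * uop = uop" for c
    by (intro op_eqI, simp add: app_ops)+
  have g: "kop c * gop g = gop g * kop c" for c g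
    by (cases g; intro op_eqI) (auto simp: app_ops algebra_simps diff_divide_distrib)
  show "alg_hom \<rho> kop" "\<rho> (gen g) = gop g" "\<rho> 1 = uop"
    unfolding \<rho>_def using free_eval_alg_hom[of kop uop gop, OF k u(1) g u(2) gop_uop] by blast+
qed

end

sublocale klr_model \<subseteq> alg_hom \<rho> kop
  by (rule rho_hom)

context klr_model
begin

lemma iota_simps [simp]: "\<iota> 1 = 1" "\<iota> 0 = 0" "\<iota> (- c) = - \<iota> c"
proof -
  show z: "\<iota> 0 = 0" using iota(2)[of 0 0] by (metis add.right_neutral add_left_cancel)
  show "\<iota> 1 = 1" by (rule iota)
  show "\<iota> (- c) = - \<iota> c" using iota(2)[of "- c" c] z by (simp add: eq_neg_iff_add_eq_0 )
qed

lemma valid_length: "valid s ==> length s = n"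
  by (simp add: valid_def)

lemma valid_words: "valid s ==> map fst s \<in> words (ext_index N) n"
  by (simp add: valid_def words_def)

lemma valid_distinct:
  assumes "valid s" "p < n" "q < n" "p \<noteq> q"
  shows "snd (s ! p) - snd (s ! q) \<noteq> 0"
proof -
  have "map snd s ! p \<noteq> map snd s ! q"
    using assms by (subst nth_eq_iff_index_eq) (auto simp: valid_def)
  then show ?thesis using assms by (simp add: valid_def)
qed

lemma words_fst: "valid s ==> p < n ==> map fst s ! p = fst (s ! p)"
  by (simp add: valid_length)

lemma xop_power: "valid s ==> p < n ==> app (xop p ^ k) \<phi> s = snd (s ! p) ^ k * \<phi> s"
  by (induction k arbitrary: \<phi>) (auto simp: app_ops)

lemma fun_sum_apply: "(\<Sum>a\<in>S. f a) s = (\<Sum>a\<in>S. f a s)" for f :: "'c => 'f config => 'f"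
  by (induction S rule: infinite_finite_induct) auto

lemma hsum_xop: "valid s ==> p < n ==> q < n ==>
    app (hsum k (xop p) (xop q)) \<phi> s = hsum k (snd (s ! p)) (snd (s ! q)) * \<phi> s"
  by (simp add: hsum_def fun_sum_apply xop_power sum_distrib_right mult.assoc)

lemma rho_eq_0I:
  assumes "\<And>\<phi> s. valid s ==> app (\<rho> r) \<phi> s = 0"
  shows "\<rho> r = 0"
proof (rule op_eqI)
  fix \<phi> s
  have "app (\<rho> r) \<phi> s = app uop (app (\<rho> r) \<phi>) s"
    using one_left[of r] by (metis app_simps(6) rho_one)
  then show "app (\<rho> r) \<phi> s = app 0 \<phi> s"
    using assms[of s \<phi>] by (cases "valid s") (simp_all add: app_ops)
qed

lemma finite_words: "finite (words (ext_index N) n)"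
proof -
  have "finite (ext_index N)" by (simp add: ext_index_def)
  then show ?thesis unfolding words_def by (rule finite_lists_length_eq)
qed

lemma app_cases:
  assumes "valid s"
  shows "app (eop w) \<phi> s = (if map fst s = w then \<phi> s else 0)"
    "p < n ==> app (xop p) \<phi> s = snd (s ! p) * \<phi> s"
    "Suc p < n ==> fst (s ! p) = fst (s ! Suc p) ==>
      app (pop p) \<phi> s = (\<phi> s - \<phi> (swap p s)) / (snd (s ! p) - snd (s ! Suc p))"
    "Suc p < n ==> fst (s ! p) \<noteq> fst (s ! Suc p) ==>
      app (pop p) \<phi> s = \<tau> (s ! p) (s ! Suc p) * \<phi> (swap p s)"
  using assms by (simp_all add: app_ops)

lemma swap_fst: "valid s ==> Suc p < n ==> map fst (swap p s) = swap p (map fst s)"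
  by (simp add: map_swap valid_length)

lemma swap_eq_iff: "length i = n ==> length j = n ==> Suc p < n ==> swap p i = j \<longleftrightarrow> i = swap p j"
  using swap_swap by metis

lemma swap_far: "Suc p < q ==> Suc q < length s ==> swap p (swap q s) = swap q (swap p s)"
  by (rule nth_equalityI) (auto simp: swap_def nth_list_update)

lemma rho_gens: "\<rho> (\<e> w) = eop w" "\<rho> (\<x> p) = xop p" "\<rho> (\<psi> p) = pop p"
  by (simp_all add: rho_gen)

lemma rho_cross_far:
  assumes "Suc p < q" "Suc q < n"
  shows "pop p * pop q = pop q * pop p"
proof (rule op_eqI)
  fix \<phi> s
  show "app (pop p * pop q) \<phi> s = app (pop q * pop p) \<phi> s"
  proof (cases "valid s")
    case True
    note v = True valid_swap[OF True, of p] valid_swap[OF True, of q]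
    have l: "length s = n" using valid_length[OF True] .
    have nth: "swap q s ! p = s ! p" "swap q s ! Suc p = s ! Suc p" "swap p s ! q = s ! q" "swap p s ! Suc q = s ! Suc q"
      using assms l by simp_all
    have sw: "swap p (swap q s) = swap q (swap p s)" using assms l by (intro swap_far) auto
    show ?thesis
      using assms v by (cases "fst (s ! p) = fst (s ! Suc p)"; cases "fst (s ! q) = fst (s ! Suc q)")
        (auto simp: app_ops nth sw diff_divide_distrib mult.commute mult.left_commute right_diff_distrib)
  qed (simp add: app_ops)
qed

lemma tau_tau:
  assumes "fst x \<noteq> fst y" "fst x \<in> ext_index N" "fst y \<in> ext_index N"
  shows "\<tau> x y * \<tau> y x = Qf (fst x) (fst y) (snd x) (snd y)"
proof -
  have sym: "ext_form B a b = ext_form B b a" if "a \<in> ext_index N" "b \<in> ext_index N" for a b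
    using cartan that by (cases a; cases b) (auto simp: cartan_datum_def ext_index_def)
  have "Qf (fst y) (fst x) (snd y) (snd x) = Qf (fst x) (fst y) (snd x) (snd y)"
  proof (cases "ext_form B (fst x) (fst y) = 0")
    case True
    have no: "\<not> (\<exists>k\<in>{1..N}. a = Bar k \<and> b = Orig k)" if "ext_form B a b = 0" for a b
    proof
      assume "\<exists>k\<in>{1..N}. a = Bar k \<and> b = Orig k"
      then obtain k where k: "k \<in> {1..N}" "a = Bar k" "b = Orig k" by blast
      have "even (B k k)" "B k k > 0" using cartan k by (auto simp: cartan_datum_def)
      then show False using that k by (auto elim!: evenE)
    qed
    have "t (fst x) (fst y) = 1" "t (fst y) (fst x) = 1"
      unfolding scalars[OF assms(2,3)] scalars[OF assms(3,2)]
      using no[OF True] no[of "fst y" "fst x"] True sym[OF assms(2,3)] by auto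
    then show ?thesis using True sym[OF assms(2,3)] by (simp add: Qf_def)
  next
    case False
    then show ?thesis using sym[OF assms(2,3)] by (simp add: Qf_def add.commute)
  qed
  then show ?thesis using before_total[OF assms(1)] by (simp add: \<tau>_def)
qed

lemma ext_form_neg:
  assumes "a \<in> ext_index N" "b \<in> ext_index N" "a \<noteq> b"
  shows "ext_form B a b \<le> 0"
proof -
  have o: "B i j \<le> 0" if "i \<in> {1..N}" "j \<in> {1..N}" "i \<noteq> j" for i j
  proof -
    have B: "B i i > 0" "B i i dvd 2 * B i j" "(2 * B i j) div B i i \<le> 0"
      using cartan that by (auto simp: cartan_datum_def cartan_int_def)
    then have "2 * B i j \<le> 0" by (metis dvd_div_mult_self mult_nonpos_nonneg order_less_imp_le)
    then show ?thesis by simp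
  qed
  have d: "0 < B i i" if "i \<in> {1..N}" for i using cartan that by (auto simp: cartan_datum_def)
  show ?thesis
    using assms o d by (cases a; cases b) (auto simp: ext_index_def intro: less_imp_le o d)
qed

lemma pop_append:
  "valid (u @ X # Y # v) ==> app (pop (length u)) \<phi> (u @ X # Y # v) =
    (if fst X = fst Y then (\<phi> (u @ X # Y # v) - \<phi> (u @ Y # X # v)) / (snd X - snd Y)
     else \<tau> X Y * \<phi> (u @ Y # X # v))"
  using valid_length[of "u @ X # Y # v"] by (auto simp: app_ops nth_append1)

lemma pop_append_Suc:
  "valid (u @ Z # X # Y # v) ==> app (pop (Suc (length u))) \<phi> (u @ Z # X # Y # v) =
    (if fst X = fst Y then (\<phi> (u @ Z # X # Y # v) - \<phi> (u @ Z # Y # X # v)) / (snd X - snd Y)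
     else \<tau> X Y * \<phi> (u @ Z # Y # X # v))"
  using pop_append[of "u @ [Z]" X Y v \<phi>] by simp

text \<open>Partial fractions: \<open>1/(p q) - 1/(p r) = 1/(q r)\<close> for
  \<open>r = p + q\<close>. In the application these are differences of the values on three strands
  with equal labels.\<close>

lemma nil_braid_half:
  fixes p q r :: 'f
  assumes "p \<noteq> 0" "q \<noteq> 0" "r \<noteq> 0" "r = p + q"
  shows "((a / p - c / r) / q - (a / p - d / q) / r) / p = (a - c + d) / (p * q * r)"
proof -
  have "a / p / q - a / p / r = a / (q * r)"
    using assms(1-3) by (simp add: divide_simps) (simp add: assms(4) algebra_simps)
  then have "(a / p - c / r) / q - (a / p - d / q) / r = (a - c + d) / (q * r)"
    by (simp add: diff_divide_distrib add_divide_distrib mult.commute)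
  then show ?thesis by (simp add: mult.commute mult.left_commute)
qed

lemma flip_fraction: "(b - a) / (y - x) = (a - b) / (x - y)" for a b x y :: 'f
  by (metis minus_diff_eq minus_divide_divide)

text \<open>The two sides disagree only when the outer labels agree and the middle one differs. The
  products \<open>\<tau> X Y * \<tau> Y X\<close> then combine to a divided difference of
  \<open>Qf\<close>, which \<open>rho_kills\<close> turns into the sum of the defining
  relation.\<close>

lemma braid_model:
  assumes s: "valid s" and p: "Suc (Suc p) < n"
  shows "app (pop p * pop (Suc p) * pop p) \<phi> s = app (pop (Suc p) * pop p * pop (Suc p)) \<phi> s
    + (if fst (s ! p) = fst (s ! Suc (Suc p)) \<and> fst (s ! p) \<noteq> fst (s ! Suc p)
       then (Qf (fst (s ! p)) (fst (s ! Suc p)) (snd (s ! p)) (snd (s ! Suc p))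
           - Qf (fst (s ! p)) (fst (s ! Suc p)) (snd (s ! Suc (Suc p))) (snd (s ! Suc p)))
         / (snd (s ! p) - snd (s ! Suc (Suc p))) * \<phi> s else 0)"
proof -
  have "Suc (Suc p) < length s" using p valid_length[OF s] by simp
  then obtain u X Y Z v where s': "s = u @ X # Y # Z # v" "length u = p"
    using split_three[of p s] by metis
  have vs: "valid (u @ X # Y # Z # v)" "valid (u @ Y # X # Z # v)" "valid (u @ X # Z # Y # v)"
    "valid (u @ Y # Z # X # v)" "valid (u @ Z # X # Y # v)" "valid (u @ Z # Y # X # v)"
    by (rule valid_perm[OF s], simp add: s')+
  have d: "snd X - snd Y \<noteq> 0" "snd Y - snd Z \<noteq> 0" "snd X - snd Z \<noteq> 0"
    using vs(1) by (auto simp: valid_def)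
  have d': "snd X \<noteq> snd Y" "snd Y \<noteq> snd Z" "snd X \<noteq> snd Z" "snd Y \<noteq> snd X" "snd Z \<noteq> snd Y" "snd Z \<noteq> snd X"
    using d by auto
  have lab: "fst X \<in> ext_index N" "fst Y \<in> ext_index N" "fst Z \<in> ext_index N"
    using vs(1) by (auto simp: valid_def)
  note ops = pop_append[OF vs(1)] pop_append[OF vs(2)] pop_append[OF vs(3)] pop_append[OF vs(4)]
    pop_append[OF vs(5)] pop_append[OF vs(6)]
    pop_append_Suc[OF vs(1)] pop_append_Suc[OF vs(2)] pop_append_Suc[OF vs(3)] pop_append_Suc[OF vs(4)]
    pop_append_Suc[OF vs(5)] pop_append_Suc[OF vs(6)]
  have nth: "s ! p = X" "s ! Suc p = Y" "s ! Suc (Suc p) = Z"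
    unfolding s' using nth_append1[of u] s'(2) by (auto simp: nth_append)
  consider (all) "fst X = fst Y" "fst Y = fst Z" | (xy) "fst X = fst Y" "fst Y \<noteq> fst Z"
    | (yz) "fst X \<noteq> fst Y" "fst Y = fst Z" | (xz) "fst X = fst Z" "fst X \<noteq> fst Y"
    | (none) "fst X \<noteq> fst Y" "fst Y \<noteq> fst Z" "fst X \<noteq> fst Z" by metis
  then show ?thesis
  proof cases
    case all
    have xyz: "snd X - snd Z = (snd X - snd Y) + (snd Y - snd Z)" "snd X - snd Z = (snd Y - snd Z) + (snd X - snd Y)"
      by simp_all
    show ?thesis
      using all nil_braid_half[OF d(1,2,3) xyz(1)] nil_braid_half[OF d(2,1,3) xyz(2)]
        flip_fraction[of "\<phi> (u @ Y # X # Z # v)" "\<phi> (u @ X # Y # Z # v)" "snd Y" "snd X"]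
        flip_fraction[of "\<phi> (u @ X # Z # Y # v)" "\<phi> (u @ X # Y # Z # v)" "snd Z" "snd Y"]
      unfolding nth unfolding s'(1) s'(2)[symmetric] by (simp add: ops mult.commute mult.left_commute algebra_simps)
  next
    case xy
    then show ?thesis
      unfolding nth unfolding s'(1) s'(2)[symmetric] by (simp add: ops right_diff_distrib mult.commute mult.left_commute)
  next
    case yz
    then show ?thesis
      unfolding nth unfolding s'(1) s'(2)[symmetric] by (simp add: ops right_diff_distrib mult.commute mult.left_commute)
  next
    case xz
    have "Qf (fst Z) (fst Y) (snd X) (snd Y) = \<tau> X Y * \<tau> Y X" "Qf (fst Z) (fst Y) (snd Z) (snd Y) = \<tau> Z Y * \<tau> Y Z"
      using tau_tau[of X Y] tau_tau[of Z Y] xz lab by auto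
    then show ?thesis
      using xz d unfolding nth unfolding s'(1) s'(2)[symmetric]
      by (simp add: ops) (simp add: diff_divide_distrib algebra_simps)
  next
    case none
    then show ?thesis
      unfolding nth unfolding s'(1) s'(2)[symmetric] by (simp add: ops mult.commute mult.left_commute)
  qed
qed

lemma square_model:
  assumes s: "valid s" and p: "Suc p < n"
  shows "app (pop p * pop p) \<phi> s = (if fst (s ! p) = fst (s ! Suc p) then 0
    else Qf (fst (s ! p)) (fst (s ! Suc p)) (snd (s ! p)) (snd (s ! Suc p)) * \<phi> s)"
proof -
  have "Suc p < length s" using p valid_length[OF s] by simp
  then obtain u X Y v where s': "s = u @ X # Y # v" "length u = p"
    using split_two[of p s] by metis
  have vs: "valid (u @ X # Y # v)" "valid (u @ Y # X # v)"
    by (rule valid_perm[OF s], simp add: s')+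
  have lab: "fst X \<in> ext_index N" "fst Y \<in> ext_index N"
    using vs(1) by (auto simp: valid_def)
  have nth: "s ! p = X" "s ! Suc p = Y"
    unfolding s' using nth_append1[of u] s'(2) by (auto simp: nth_append)
  show ?thesis
  proof (cases "fst X = fst Y")
    case True
    then show ?thesis
      unfolding nth unfolding s'(1) s'(2)[symmetric]
      using flip_fraction[of "\<phi> (u @ Y # X # v)" "\<phi> (u @ X # Y # v)" "snd Y" "snd X"]
      by (simp add: pop_append[OF vs(1)] pop_append[OF vs(2)])
  next
    case False
    then show ?thesis
      unfolding nth unfolding s'(1) s'(2)[symmetric] using tau_tau[OF False lab]
      by (simp add: pop_append[OF vs(1)] pop_append[OF vs(2)] mult.assoc[symmetric])
  qed
qed

lemma slide_model:
  assumes s: "valid s" and p: "Suc p < n"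
  shows "app (xop p * pop p) \<phi> s = app (pop p * xop (Suc p)) \<phi> s + (if fst (s ! p) = fst (s ! Suc p) then \<phi> s else 0)"
    and "app (pop p * xop p) \<phi> s = app (xop (Suc p) * pop p) \<phi> s + (if fst (s ! p) = fst (s ! Suc p) then \<phi> s else 0)"
proof -
  have d: "snd (s ! p) - snd (s ! Suc p) \<noteq> 0" using valid_distinct[OF s, of p "Suc p"] p by simp
  note v = s valid_swap[OF s p]
  have l: "length s = n" using valid_length[OF s] .
  have f: "(a * f - a * g) / (a - b) = (b * f - a * g) / (a - b) + f" "(a * f - b * g) / (a - b) = (b * f - b * g) / (a - b) + f"
    if "a - b \<noteq> 0" for a b f g :: 'f
    using that by (simp_all add: divide_simps) (simp_all add: algebra_simps)
  show "app (xop p * pop p) \<phi> s = app (pop p * xop (Suc p)) \<phi> s + (if fst (s ! p) = fst (s ! Suc p) then \<phi> s else 0)"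
    "app (pop p * xop p) \<phi> s = app (xop (Suc p) * pop p) \<phi> s + (if fst (s ! p) = fst (s ! Suc p) then \<phi> s else 0)"
    using p v l f[OF d] by (auto simp: app_ops right_diff_distrib)
qed

theorem rho_kills:
  assumes "r \<in> klr_rels (ext_index N) (ext_form B) t n"
  shows "\<rho> r = 0"
  using assms
proof cases
  case unit
  show ?thesis
  proof (rule rho_eq_0I)
    fix \<phi> s assume s: "valid s"
    have "(\<Sum>i\<in>words (ext_index N) n. app (eop i) \<phi> s) = (\<Sum>i\<in>words (ext_index N) n. if i = map fst s then \<phi> s else 0)"
      by (intro sum.cong) (auto simp: app_cases(1)[OF s])
    also have "\<dots> = \<phi> s" using valid_words[OF s] finite_words by simp
    finally show "app (\<rho> r) \<phi> s = 0"
      using s by (simp add: unit rho_gens rho_one fun_sum_apply app_ops(4))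
  qed
next
  case (idem i j)
  then show ?thesis by (intro rho_eq_0I) (auto simp: mult rho_gens app_cases)
next
  case (dot_idem i p)
  then show ?thesis by (intro rho_eq_0I) (auto simp: mult rho_gens app_cases)
next
  case (cross_idem i p)
  show ?thesis
  proof (rule rho_eq_0I)
    fix \<phi> s assume s: "valid s"
    have l: "length i = n" "length s = n" using cross_idem valid_length[OF s] by (auto simp: words_def)
    have iff: "map fst (swap p s) = i \<longleftrightarrow> map fst s = swap p i"
      using swap_eq_iff[of "map fst s" i p] swap_fst[OF s] l cross_idem by auto
    show "app (\<rho> r) \<phi> s = 0"
    proof (cases "fst (s ! p) = fst (s ! Suc p)")
      case True
      have "swap p (map fst s) = map fst s" using True l cross_idem by (intro swap_same) auto
      then have "map fst s = i \<longleftrightarrow> map fst s = swap p i" using iff swap_fst[OF s] cross_idem by metis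
      then show ?thesis
        using iff cross_idem s valid_swap[OF s] True by (simp add: mult rho_gens app_cases)
    next
      case False
      then show ?thesis
        using iff cross_idem s valid_swap[OF s] by (simp add: mult rho_gens app_cases)
    qed
  qed
next
  case (dot_dot p q)
  then show ?thesis by (intro rho_eq_0I) (auto simp: mult rho_gens app_cases)
next
  case (cross_dot_far p q)
  show ?thesis
  proof (rule rho_eq_0I)
    fix \<phi> s assume s: "valid s"
    then show "app (\<rho> r) \<phi> s = 0"
      using cross_dot_far valid_length[OF s] valid_swap[OF s, of p]
      by (cases "fst (s ! p) = fst (s ! Suc p)") (simp_all add: mult rho_gens app_cases right_diff_distrib)
  qed
next
  case (cross_cross_far p q)
  then show ?thesis using rho_cross_far[of p q] rho_cross_far[of q p] by (auto simp: mult rho_gens)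
next
  case (slide_left i p)
  show ?thesis
  proof (rule rho_eq_0I)
    fix \<phi> s assume s: "valid s"
    show "app (\<rho> r) \<phi> s = 0"
      using slide_model(1)[OF s slide_left(3), of "app (eop i) \<phi>"] slide_left s words_fst[OF s, of p] words_fst[OF s, of "Suc p"]
      by (auto simp: mult rho_gens app_cases(1))
  qed
next
  case (slide_right i p)
  show ?thesis
  proof (rule rho_eq_0I)
    fix \<phi> s assume s: "valid s"
    show "app (\<rho> r) \<phi> s = 0"
      using slide_model(2)[OF s slide_right(3), of "app (eop i) \<phi>"] slide_right s words_fst[OF s, of p] words_fst[OF s, of "Suc p"]
      by (auto simp: mult rho_gens app_cases(1))
  qed
next
  case (square_same i p)
  show ?thesis
  proof (rule rho_eq_0I)
    fix \<phi> s assume s: "valid s"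
    show "app (\<rho> r) \<phi> s = 0"
      using square_model[OF s square_same(3), of "app (eop i) \<phi>"] square_same s words_fst[OF s, of p] words_fst[OF s, of "Suc p"]
      by (auto simp: mult power2_eq_square rho_gens app_cases(1))
  qed
next
  case (square_orth i p a b)
  have r: "\<rho> r = pop p * (pop p * eop i) - kop (t a b) * eop i"
  proof -
    have "\<rho> (\<psi> p ^ 2 * \<e> i) = pop p * (pop p * eop i)" "\<rho> (scal (t a b) * \<e> i) = kop (t a b) * eop i"
      by (simp add: power2_eq_square mult rho_gens mult.assoc, simp add: scal rho_gens)
    then show ?thesis unfolding square_orth(1) by (simp add: diff)
  qed
  show ?thesis
  proof (rule rho_eq_0I)
    fix \<phi> s assume s: "valid s"
    show "app (\<rho> r) \<phi> s = 0"
      using square_model[OF s square_orth(3), of "app (eop i) \<phi>"] square_orth s words_fst[OF s, of p] words_fst[OF s, of "Suc p"]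
      unfolding r by (auto simp: app_cases(1) app_ops(5) Qf_def)
  qed
next
  case (square_adj i p a b)
  have r: "\<rho> r = pop p * (pop p * eop i) - (kop (t a b) * (xop p ^ nat (- cartan_int (ext_form B) a b) * eop i)
      + kop (t b a) * (xop (Suc p) ^ nat (- cartan_int (ext_form B) b a) * eop i))"
  proof -
    have "\<rho> (\<psi> p ^ 2 * \<e> i) = pop p * (pop p * eop i)"
      by (simp add: power2_eq_square mult rho_gens mult.assoc)
    moreover have "\<rho> (scal c * \<x> q ^ d * \<e> i) = kop c * (xop q ^ d * eop i)" for c q d
      by (simp add: mult.assoc scal power_mult rho_gens)
    ultimately show ?thesis unfolding square_adj(1) by (simp only: distrib_right diff add)
  qed
  show ?thesis
  proof (rule rho_eq_0I)
    fix \<phi> s assume s: "valid s"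
    show "app (\<rho> r) \<phi> s = 0"
      using square_model[OF s square_adj(3), of "app (eop i) \<phi>"] square_adj s words_fst[OF s, of p] words_fst[OF s, of "Suc p"]
      unfolding r by (auto simp: xop_power app_cases(1) app_ops(5) Qf_def algebra_simps)
  qed
next
  case (braid i p a b)
  define m where "m = nat (- cartan_int (ext_form B) a b)"
  have r: "\<rho> r = pop p * (pop (Suc p) * (pop p * eop i)) - pop (Suc p) * (pop p * (pop (Suc p) * eop i))
     - (if i ! Suc (Suc p) = a \<and> ext_form B a b < 0
        then kop (t a b) * (hsum m (xop p) (xop (Suc (Suc p))) * eop i) else 0)"
  proof -
    have h: "\<rho> (hsum m (\<x> p) (\<x> (Suc (Suc p))) * \<e> i) = hsum m (xop p) (xop (Suc (Suc p))) * eop i"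
      by (simp add: hsum_def sum_distrib_right mult.assoc power_mult rho_gens)
    have "\<rho> ((\<psi> p * \<psi> (Suc p) * \<psi> p - \<psi> (Suc p) * \<psi> p * \<psi> (Suc p)) * \<e> i)
      = pop p * (pop (Suc p) * (pop p * eop i)) - pop (Suc p) * (pop p * (pop (Suc p) * eop i))"
      by (simp add: left_diff_distrib mult.assoc rho_gens mult)
    then show ?thesis unfolding braid(1) by (simp add: mult.assoc scal h m_def[symmetric])
  qed
  show ?thesis
  proof (rule rho_eq_0I)
    fix \<phi> s assume s: "valid s"
    note w = words_fst[OF s, of p] words_fst[OF s, of "Suc p"] words_fst[OF s, of "Suc (Suc p)"]
    note bm = braid_model[OF s braid(3), of "app (eop i) \<phi>"]
    show "app (\<rho> r) \<phi> s = 0"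
    proof (cases "map fst s = i \<and> i ! Suc (Suc p) = a \<and> a \<noteq> b")
      case False
      moreover have "\<not> ext_form B a a < 0"
      proof -
        have "a \<in> ext_index N" using braid(2,3,4) by (auto simp: words_def)
        moreover have "0 < B k k" if "k \<in> {1..N}" for k using cartan that unfolding cartan_datum_def by blast
        ultimately show ?thesis by (auto simp: ext_index_def not_less intro: less_imp_le simp del: atLeastAtMost_iff)
      qed
      ultimately show ?thesis
        using bm w braid s unfolding r by (auto simp: app_cases(1) app_ops(5) hsum_xop)
    next
      case True
      have lab: "a \<in> ext_index N" "b \<in> ext_index N" using braid by (auto simp: words_def)
      have neg: "ext_form B a b \<le> 0" using ext_form_neg[OF lab] True by blast
      have fst: "fst (s ! p) = a" "fst (s ! Suc p) = b" "fst (s ! Suc (Suc p)) = a"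
        using w braid True by auto
      let ?u = "snd (s ! p)" and ?w = "snd (s ! Suc (Suc p))"
      have d: "?u - ?w \<noteq> 0" using valid_distinct[OF s, of p "Suc (Suc p)"] braid(3) by simp
      have "(?u - ?w) * hsum m ?u ?w = ?u ^ m - ?w ^ m"
        by (simp add: hsum_def power_diff_sumr2 mult.commute)
      then have h: "(?u ^ m - ?w ^ m) / (?u - ?w) = hsum m ?u ?w"
        using d by (simp add: field_simps)
      have "(Qf a b ?u z - Qf a b ?w z) / (?u - ?w) = (if ext_form B a b < 0 then \<iota> (t a b) * hsum m ?u ?w else 0)" for z
        using neg h by (auto simp: Qf_def m_def[symmetric] right_diff_distrib[symmetric] times_divide_eq_right[symmetric] simp del: times_divide_eq_right)
      then show ?thesis
        using bm True fst braid s unfolding r by (auto simp: app_cases(1) app_ops(5) hsum_xop mult.assoc)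
    qed
  qed
qed

end

section \<open>Images of the representatives of the generators\<close>

context klr_seq
begin

lemma rho_S_y: "\<rho> (\<Sum>i\<in>Sq. S_y N lam p i) = yy p"
  by (simp add: yy_def S_y_def sy_def rho_S_e mult sum cong: if_cong)
    (intro sum.cong; simp add: mult rho_S_e)

lemma rho_S_E: "\<rho> (\<Sum>i\<in>Sq. S_E N lam k a d i) = EE k a d"
proof -
  have "\<rho> (elem_sym d P * f) = esym xx d P * \<rho> f" for d P f
    by (simp add: elem_sym_def esym_def sum_distrib_right prod_list_mult o_def)
  then show ?thesis by (simp add: EE_def S_E_def sE_def rho_S_e)
qed

lemma rho_S_Psi: "\<rho> (\<Sum>i\<in>Sq. S_Psi N lam p i) = PP p"
proof -
  have "\<rho> (S_Psi N lam p i) = cr i p * se i" for i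
    by (cases "i ! p"; cases "i ! Suc p")
      (simp_all add: S_Psi_def cr_def Let_def prod_list_mult rho_S_e RR_def LL_def o_def, simp add: mult rho_S_e)
  then show ?thesis by (simp add: PP_def)
qed

lemma tensor_scalars: "tensor_scalars N B lam nu se yy EE PP \<kappa>"
proof (intro tensor_scalars.intro tensor_relations tensor_scalars_axioms.intro)
  show "\<kappa> c * se i = se i * \<kappa> c" for c i
    unfolding rho_S_e[symmetric] by (rule kappa_comm)
  show "\<kappa> c * yy p = yy p * \<kappa> c" for c p
    unfolding rho_S_y[symmetric] by (rule kappa_comm)
  show "\<kappa> c * PP p = PP p * \<kappa> c" for c p
    unfolding rho_S_Psi[symmetric] by (rule kappa_comm)
qed (fact kappa_one kappa_add kappa_mult)+

end

text \<open>Starting from the colours \<open>i\<close>, the word never crosses two thick entries.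
  Other words vanish next to \<open>e i\<close>, so independence cannot be expected of them.\<close>

fun colour_path :: "nat list => entry list => bool" where
  "colour_path [] i \<longleftrightarrow> True"
| "colour_path (p # v) i \<longleftrightarrow> (is_solid (i ! p) \<or> is_solid (i ! Suc p)) \<and> colour_path v (swap p i)"

context tensor_relations
begin

lemma e_P:
  assumes i: "i \<in> Seq lam nu" and p: "Suc p < length i"
  shows "is_solid (i ! p) \<or> is_solid (i ! Suc p) ==> e i * P p = P p * e (swap p i)"
    and "\<not> is_solid (i ! p) ==> \<not> is_solid (i ! Suc p) ==> e i * P p = 0"
proof -
  assume s: "is_solid (i ! p) \<or> is_solid (i ! Suc p)"
  show "e i * P p = P p * e (swap p i)"
    using P_e[OF Seq_swap[OF i p s], of p] p s by auto
next
  assume s: "\<not> is_solid (i ! p)" "\<not> is_solid (i ! Suc p)"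
  have "e i * (P p * e i') = 0" if i': "i' \<in> Seq lam nu" for i'
  proof (cases "is_solid (i' ! p) \<or> is_solid (i' ! Suc p)")
    case True
    have p': "Suc p < length i'" using p i i' by (simp add: Seq_length)
    have "swap p i' \<noteq> i" using True s p' by auto
    then show ?thesis
      using P_e[OF i' p' True] e_e[OF i Seq_swap[OF i' p' True]] by (metis mult.assoc mult_zero_left)
  next
    case False
    then show ?thesis using P_red[OF i', of p] p i i' by (simp add: Seq_length)
  qed
  moreover have "e i * P p = (\<Sum>i'\<in>Seq lam nu. e i * (P p * e i'))"
    using P_sum[of p] p i by (simp add: sum_distrib_left[symmetric] Seq_length)
  ultimately show "e i * P p = 0" by simp
qed

lemma e_word_eq_0:
  "i \<in> Seq lam nu ==> \<forall>p\<in>set v. Suc p < length i ==> \<not> colour_path v i ==> e i * prod_list (map P v) = 0"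
proof (induction v arbitrary: i)
  case (Cons p v)
  show ?case
  proof (cases "is_solid (i ! p) \<or> is_solid (i ! Suc p)")
    case True
    have "e i * prod_list (map P (p # v)) = P p * (e (swap p i) * prod_list (map P v))"
      using e_P(1)[OF Cons.prems(1) _ True] Cons.prems(2) by (simp add: mult.assoc[symmetric])
    also have "e (swap p i) * prod_list (map P v) = 0"
      using Cons.prems True by (intro Cons.IH) (auto intro: Seq_swap)
    finally show ?thesis by simp
  next
    case False
    then show ?thesis
      using e_P(2)[OF Cons.prems(1), of p] Cons.prems(2) by (simp add: mult.assoc[symmetric])
  qed
qed simp

end

section \<open>Thick entries in the configuration model\<close>

locale klr_model_seq = klr_model N B t n \<iota>
  for N B and t :: "lab => lab => 'k::field" and n and \<iota> :: "'k => 'f::field" +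
  fixes lam :: "(nat => nat) list" and nu :: "nat list"
  assumes n_eq: "n = strands N lam nu"
    and nu_set: "set nu \<subseteq> {1..N}"
    and nondegenerate: "nu = [] \<or> (\<forall>k<length lam. \<exists>a\<in>{1..N}. (lam ! k) a \<noteq> 0)"

sublocale klr_model_seq \<subseteq> klr_seq \<rho> kop N B t n lam nu
proof
  show "t i j = (if \<exists>k\<in>{1..N}. i = Bar k \<and> j = Orig k then - 1 else 1)"
    if "i \<in> ext_index N" "j \<in> ext_index N" for i j by (rule scalars[OF that])
qed (fact cartan rho_kills n_eq nu_set nondegenerate)+

sublocale klr_model_seq \<subseteq> ts: tensor_scalars N B lam nu se yy EE PP kop
  by (rule tensor_scalars)

context klr_model_seq
begin

text \<open>The labels of the run differ from the moving one, so no divided difference occurs and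
  the function is evaluated at a single configuration.\<close>

lemma app_RR:
  "valid (u @ bs @ x # z) ==> \<forall>b\<in>set bs. fst b \<noteq> fst x ==>
    app (RR (length u) (length bs)) \<phi> (u @ bs @ x # z) = prod_list (map (\<lambda>b. \<tau> b x) bs) * \<phi> (u @ x # bs @ z)"
proof (induction bs arbitrary: z rule: rev_induct)
  case (snoc b bs)
  have v: "valid (u @ bs @ x # b # z)" by (rule valid_perm[OF snoc.prems(1)]) simp
  have "RR (length u) (length (bs @ [b])) = pop (length (u @ bs)) * RR (length u) (length bs)"
    by (simp add: RR_def rho_gens)
  then show ?case
    using snoc.IH[OF v] snoc.prems pop_append[of "u @ bs" b x z] by (simp add: mult.commute)
qed simp

lemma app_LL:
  "valid (u @ x # bs @ z) ==> \<forall>b\<in>set bs. fst b \<noteq> fst x ==>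
    app (LL (length u) (length bs)) \<phi> (u @ x # bs @ z) = prod_list (map (\<tau> x) bs) * \<phi> (u @ bs @ x # z)"
proof (induction bs arbitrary: u)
  case (Cons b bs)
  have v: "valid ((u @ [b]) @ x # bs @ z)" by (rule valid_perm[OF Cons.prems(1)]) simp
  have "LL (length u) (length (b # bs)) = pop (length u) * LL (length (u @ [b])) (length bs)"
    by (simp add: LL_def rho_gens upt_conv_Cons del: upt_Suc)
  then show ?case
    using Cons.IH[OF v] Cons.prems pop_append[of u x b "bs @ z"] by (auto simp: mult.assoc)
qed simp

text \<open>For two solid strands the factor is 1 or a sum of powers as in \<open>orig\<close>; for
  a solid and a barred strand it is 1 or, up to sign, a difference of values; for two barred strands
  it is 1.\<close>

lemma tau_nonzero:
  assumes "fst x \<in> ext_index N" "fst y \<in> ext_index N" "fst x \<noteq> fst y" "snd x \<noteq> snd y"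
    and orig: "\<And>a b m m'. fst x = Orig a ==> fst y = Orig b ==> 0 < m ==> 0 < m' ==> snd x ^ m + snd y ^ m' \<noteq> 0"
  shows "\<tau> x y \<noteq> 0"
proof -
  have B: "even (B a a) \<and> B a a > 0" if "a \<in> {1..N}" for a
    using cartan that unfolding cartan_datum_def by blast
  note sc = scalars[OF assms(1,2)] scalars[OF assms(2,1)]
  show ?thesis
  proof (cases "fst x"; cases "fst y")
    fix a b assume ab: "fst x = Orig a" "fst y = Orig b"
    then have t: "t (Orig a) (Orig b) = 1" "t (Orig b) (Orig a) = 1" using sc by auto
    have aN: "a \<in> {1..N}" "b \<in> {1..N}" "a \<noteq> b" using assms ab by (auto simp: ext_index_def)
    have pos: "0 < nat (- cartan_int (ext_form B) (Orig c) (Orig d))"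
      if "c \<in> {1..N}" "d \<in> {1..N}" "B c d < 0" for c d
    proof -
      have "(2 * B c d) div B c c < 0"
        using B[OF that(1)] that(3) by (simp add: pos_imp_zdiv_neg_iff)
      then show ?thesis by (simp add: cartan_int_def)
    qed
    show ?thesis
    proof (cases "B a b = 0")
      case False
      have "ext_form B (Orig a) (Orig b) \<le> 0"
        by (rule ext_form_neg) (use assms ab in auto)
      then have "B a b < 0" using False by simp
      moreover have "B b a = B a b" using cartan aN(1,2) unfolding cartan_datum_def by blast
      ultimately show ?thesis
        using orig[OF ab pos[OF aN(1,2)] pos[OF aN(2,1)]] ab t by (simp add: \<tau>_def Qf_def)
    qed (use ab t in \<open>simp add: \<tau>_def Qf_def\<close>)
  next
    fix a b assume ab: "fst x = Bar a" "fst y = Orig b"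
    have aN: "a \<in> {1..N}" using assms ab by (auto simp: ext_index_def)
    show ?thesis
    proof (cases "a = b")
      case True
      obtain c where c: "B a a = 2 * c" "c > 0" using B[OF aN] by auto
      have t: "t (Bar a) (Orig b) = - 1" "t (Orig b) (Bar a) = 1" using sc ab True aN by auto
      have "cartan_int (ext_form B) (Bar a) (Orig b) = - 1" "cartan_int (ext_form B) (Orig b) (Bar a) = - 1"
        using True c nonzero_mult_div_cancel_right[of c "- 1"] by (simp_all add: cartan_int_def)
      then show ?thesis using ab t True c assms(4) by (simp add: \<tau>_def Qf_def)
    next
      case False
      then have "t (Bar a) (Orig b) = 1" using sc ab by auto
      then show ?thesis using ab False by (simp add: \<tau>_def Qf_def)
    qed
  next
    fix a b assume ab: "fst x = Bar a" "fst y = Bar b"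
    then have "t (Bar a) (Bar b) = 1" using sc by auto
    then show ?thesis using ab assms(3) by (simp add: \<tau>_def Qf_def)
  qed (simp add: \<tau>_def)
qed

end

text \<open>
  The states \<open>st l\<close> are the configurations in which the strands of an entry stay together; the
  entries of a fixed sequence \<open>j\<close> appear in the order given by the permutation \<open>l\<close>.
\<close>

locale klr_states = klr_model_seq N B t n \<iota> lam nu
  for N B and t :: "lab => lab => 'k::field" and n and \<iota> :: "'k => 'f::field" and lam nu +
  fixes j :: "entry list" and V :: "nat => nat => 'f"
  assumes j: "j \<in> Seq lam nu"
    and V_inj: "V p c = V q d ==> p = q \<and> c = d"
    and V_nonzero: "V p c \<noteq> 0"
    and V_powers: "p \<noteq> q ==> is_solid (j ! p) ==> is_solid (j ! q) ==> 0 < m ==> 0 < m' ==> V p 0 ^ m + V q 0 ^ m' \<noteq> 0"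
begin

abbreviation "len p \<equiv> length (expand_entry N lam (j ! p))"
definition "item p = map (\<lambda>c. (expand_entry N lam (j ! p) ! c, V p c)) [0..<len p]"
definition "st l = concat (map item l)"
definition "seqn l = map ((!) j) l"
definition "legal l \<longleftrightarrow> mset l = mset [0..<rr] \<and> seqn l \<in> Sq"
definition "unital \<phi> \<longleftrightarrow> app ts.u \<phi> = \<phi>"

lemma st_simps: "st [] = []" "st (p # l) = item p @ st l" "st (l @ l') = st l @ st l'"
  by (simp_all add: st_def)

lemma length_item [simp]: "length (item p) = len p"
  by (simp add: item_def)

lemma fst_item: "map fst (item p) = expand_entry N lam (j ! p)"
  by (simp add: item_def o_def map_nth)

lemma fst_st: "map fst (st l) = wd (seqn l)"
  by (induction l) (simp_all add: st_simps fst_item seqn_def)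

lemma legal_length: "legal l ==> length l = rr" "legal l ==> set l = {..<rr}" "legal l ==> distinct l"
proof -
  assume "legal l"
  then have m: "mset l = mset [0..<rr]" by (simp add: legal_def)
  show "length l = rr" using mset_eq_length[OF m] by simp
  show "set l = {..<rr}" using mset_eq_setD[OF m] by (simp add: atLeast_upt)
  show "distinct l" using mset_eq_imp_distinct_iff[OF m] by simp
qed

lemma seqn_Sq: "legal l ==> seqn l \<in> Sq" and seqn_nth: "legal l ==> p < rr ==> seqn l ! p = j ! (l ! p)"
proof -
  show "legal l ==> seqn l \<in> Sq" by (simp only: legal_def)
  show "seqn l ! p = j ! (l ! p)" if "legal l" "p < rr"
    using legal_length(1)[OF that(1)] that(2) by (simp add: seqn_def)
qed

lemma distinct_st: "distinct l ==> distinct (map snd (st l))"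
proof (induction l)
  case (Cons p l)
  have st: "\<exists>q c. snd x = V q c \<and> q \<in> set l" if "x \<in> set (st l)" for x
    using that unfolding st_def item_def by fastforce
  have "snd x \<noteq> snd y" if xy: "x \<in> set (item p)" "y \<in> set (st l)" for x y
  proof -
    obtain q c where q: "snd y = V q c" "q \<in> set l" using st[OF xy(2)] by blast
    obtain d where "snd x = V p d" using xy(1) by (auto simp: item_def)
    then show ?thesis using q V_inj[of p d q c] Cons.prems by auto
  qed
  then have "snd ` set (item p) \<inter> snd ` set (st l) = {}" by fastforce
  moreover have "distinct (map snd (item p))"
    by (auto simp: item_def o_def distinct_map inj_on_def dest: V_inj)
  ultimately show ?case using Cons by (simp add: st_simps)
qed (simp add: st_simps)

lemma valid_st: "legal l ==> valid (st l)"
proof -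
  assume l: "legal l"
  have w: "map fst (st l) \<in> W" unfolding fst_st by (rule wd_W[OF seqn_Sq[OF l]])
  then have "length (map fst (st l)) = n" by (simp add: words_def)
  then show ?thesis using w distinct_st[OF legal_length(3)[OF l]] by (simp add: valid_def words_def)
qed

lemma base: "legal [0..<rr]" "seqn [0..<rr] = j"
proof -
  show "seqn [0..<rr] = j" unfolding seqn_def using Seq_length[OF j] map_nth[of j] by simp
  then show "legal [0..<rr]" by (simp add: legal_def j)
qed

lemma legal_swap:
  assumes "legal l" "Suc p < rr" "is_solid (seqn l ! p) \<or> is_solid (seqn l ! Suc p)"
  shows "legal (swap p l)" "seqn (swap p l) = swap p (seqn l)"
proof -
  show s: "seqn (swap p l) = swap p (seqn l)"
    unfolding seqn_def using assms legal_length(1)[OF assms(1)] by (intro map_swap) simp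
  show "legal (swap p l)"
    using assms legal_length(1)[OF assms(1)] Seq_swap[OF seqn_Sq[OF assms(1)], of p]
    by (simp add: legal_def s) (simp add: seqn_def)
qed

lemma app_se_other: "legal l ==> i \<in> Sq ==> i \<noteq> seqn l ==> app (se i) \<phi> (st l) = 0"
proof -
  assume l: "legal l" and i: "i \<in> Sq" "i \<noteq> seqn l"
  have "app (se i) \<phi> (st l) = app (ee (wd i)) (app (se i) \<phi>) (st l)"
    using se_ee(2)[OF i(1)] by (metis app_simps(6))
  then show ?thesis
    using i wd_inj[OF i(1) seqn_Sq[OF l]] by (simp add: rho_gens app_ops fst_st)
qed

text \<open>At a state, a unital function does not notice the nilHecke idempotents: the unit is the
  sum of the \<open>se i\<close>, and all but one of these vanish there because of the
  colours.\<close>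

lemma app_se:
  assumes "unital \<phi>" "legal l" "i \<in> Sq"
  shows "app (se i) \<phi> (st l) = (if i = seqn l then \<phi> (st l) else 0)"
proof -
  have "\<phi> (st l) = app ts.u \<phi> (st l)" using assms(1) by (simp only: unital_def)
  also have "\<dots> = (\<Sum>i'\<in>Sq. app (se i') \<phi> (st l))" by (simp add: ts.u_def fun_sum_apply)
  also have "\<dots> = (\<Sum>i'\<in>Sq. if i' = seqn l then app (se i') \<phi> (st l) else 0)"
    by (intro sum.cong) (auto simp: app_se_other assms)
  also have "\<dots> = app (se (seqn l)) \<phi> (st l)" using seqn_Sq[OF assms(2)] by simp
  finally show ?thesis using app_se_other assms by auto
qed

lemma unital_app: "ts.u * f = f ==> unital (app f \<phi>)"
  by (metis unital_def app_simps(6))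

lemma app_through_se:
  assumes "legal l" "ts.u * f = f"
  shows "app f \<phi> (st l) = app (se (seqn l) * f) \<phi> (st l)"
  using app_se[OF unital_app[OF assms(2)] assms(1) seqn_Sq[OF assms(1)]] by simp

lemma first_strand_st:
  assumes "legal l" "l = u @ v"
  shows "fs (seqn l) (length u) = length (st u)"
proof -
  have "fs (seqn l) (length u) = length (map fst (st u))"
    unfolding fst_st first_strand_def assms(2) by (simp add: seqn_def)
  then show ?thesis by simp
qed

lemma split_legal:
  assumes "legal l" "Suc p < rr"
  obtains u v where "l = u @ l ! p # l ! Suc p # v" "length u = p"
    "st l = st u @ item (l ! p) @ item (l ! Suc p) @ st v"
    "st (swap p l) = st u @ item (l ! Suc p) @ item (l ! p) @ st v"
    "length (st u) = fs (seqn l) p"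
proof -
  obtain u v where l: "l = u @ l ! p # l ! Suc p # v" "length u = p"
    using split_two[of p l] assms legal_length(1) by auto
  have s: "swap p l = u @ l ! Suc p # l ! p # v" using l by (metis swap_append2)
  show thesis
  proof (rule that[OF l])
    show "st l = st u @ item (l ! p) @ item (l ! Suc p) @ st v"
      by (subst l(1)) (simp add: st_simps)
    show "st (swap p l) = st u @ item (l ! Suc p) @ item (l ! p) @ st v"
      by (simp add: s st_simps)
    show "length (st u) = fs (seqn l) p"
      using first_strand_st[OF assms(1) l(1)] l(2) by simp
  qed
qed

lemma item_solid: "j ! p = Solid a ==> item p = [(Orig a, V p 0)]"
  by (simp add: item_def)

lemma item_thick: "j ! p = Thick k ==> b \<in> set (item p) ==> (\<exists>c. fst b = Bar c) \<and> (\<exists>c. snd b = V p c)"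
proof -
  assume p: "j ! p = Thick k" and b: "b \<in> set (item p)"
  have "fst b \<in> set (expand_entry N lam (Thick k))"
    using b fst_item[of p] p by (metis image_eqI list.set_map)
  then show ?thesis using thick_Bar b by (auto simp: item_def)
qed

lemma st_solid:
  assumes l: "legal l" and p: "p < rr" and a: "j ! (l ! p) = Solid a"
  shows "st l ! fs (seqn l) p = (Orig a, V (l ! p) 0)"
proof -
  have sp: "l = take p l @ l ! p # drop (Suc p) l" "length (take p l) = p"
    using p legal_length(1)[OF l] by (simp_all add: id_take_nth_drop)
  have "st l = st (take p l) @ item (l ! p) @ st (drop (Suc p) l)"
    by (subst sp(1)) (simp add: st_simps)
  then have "st l ! length (st (take p l)) = (Orig a, V (l ! p) 0)"
    using item_solid[OF a] by simp
  then show ?thesis using first_strand_st[OF l sp(1)] sp(2) by simp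
qed

lemma app_yy:
  assumes \<phi>: "unital \<phi>" and l: "legal l" and p: "p < rr"
  shows "app (yy p) \<phi> (st l) = (if is_solid (j ! (l ! p)) then V (l ! p) 0 * \<phi> (st l) else 0)"
proof -
  let ?i = "seqn l"
  have i: "?i \<in> Sq" "p < length ?i" using seqn_Sq[OF l] p by (simp_all add: Seq_length)
  have "app (yy p) \<phi> (st l) = app (se ?i * yy p) \<phi> (st l)"
    by (rule app_through_se[OF l ts.y_u(2)[OF p]])
  also have "se ?i * yy p = sy p ?i * se ?i"
    using ts.y_e[OF i] yy_se[OF i(1)] by simp
  also have "app \<dots> \<phi> (st l) = (if is_solid (j ! (l ! p)) then V (l ! p) 0 * \<phi> (st l) else 0)"
  proof (cases "is_solid (?i ! p)")
    case True
    then obtain a where a: "j ! (l ! p) = Solid a" using seqn_nth[OF l p] by (auto simp: is_solid_iff)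
    have "snd (st l ! fs ?i p) = V (l ! p) 0" using st_solid[OF l p a] by simp
    then show ?thesis
      using True solid_strand(1)[OF i True] app_se[OF \<phi> l i(1)] valid_st[OF l] a
      by (simp add: sy_def rho_gens app_ops)
  qed (use seqn_nth[OF l p] in \<open>simp add: sy_def\<close>)
  finally show ?thesis .
qed

text \<open>The coefficient \<open>\<beta>\<close> is a product of factors \<open>\<tau>\<close> or,
  for two solid strands with equal labels, up to sign the reciprocal of a difference of values;
  genericity makes it nonzero. Only for equal labels is \<open>\<alpha>\<close> different from
  0.\<close>

lemma app_PP:
  assumes l: "legal l" and p: "Suc p < rr" and s: "is_solid (seqn l ! p) \<or> is_solid (seqn l ! Suc p)"
  obtains \<alpha> \<beta> where "\<beta> \<noteq> 0"
    "\<And>\<phi>. unital \<phi> ==> app (PP p) \<phi> (st l) = \<alpha> * \<phi> (st l) + \<beta> * \<phi> (st (swap p l))"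
proof -
  let ?i = "seqn l" and ?a = "l ! p" and ?b = "l ! Suc p"
  define i' where "i' = swap p ?i"
  note l' = legal_swap[OF l p s]
  have p': "Suc p < length ?i" "Suc p < length l"
    using p seqn_Sq[OF l] by (simp_all add: Seq_length legal_length(1)[OF l])
  have i: "?i \<in> Sq" "i' \<in> Sq" "Suc p < length i'" "is_solid (i' ! p) \<or> is_solid (i' ! Suc p)"
    using seqn_Sq[OF l] seqn_Sq[OF l'(1)] p' s by (auto simp: i'_def l'(2))
  have i'_nth: "i' ! p = j ! ?b" "i' ! Suc p = j ! ?a"
    using p' seqn_nth[OF l] p by (simp_all add: i'_def)
  obtain u v where uv: "st l = st u @ item ?a @ item ?b @ st v"
    "st (swap p l) = st u @ item ?b @ item ?a @ st v" "length (st u) = fs ?i p"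
    using split_legal[OF l p] by metis
  have fsi: "fs i' p = length (st u)" using uv(3) first_strand_swap[OF p'(1), of p] by (simp add: i'_def)
  have ne: "?a \<noteq> ?b" using legal_length(3)[OF l] p' by (simp add: nth_eq_iff_index_eq)
  have "se ?i * PP p = PP p * se i'"
    using ts.e_P(1)[OF i(1) p'(1) s] by (simp add: i'_def)
  then have red: "app (PP p) \<phi> (st l) = app (cr i' p) (app (se i') \<phi>) (st l)" for \<phi>
    using app_through_se[OF l ts.P_u(2)[OF p], of \<phi>] PP_se[OF i(2), of p] by simp
  have sel: "app (se i') \<phi> (st (swap p l)) = \<phi> (st (swap p l))" if "unital \<phi>" for \<phi>
    using app_se[OF that l'(1) i(2)] by (simp add: l'(2) i'_def)
  have labs: "fst x \<in> ext_index N" if "x \<in> set (st l)" for x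
    using valid_st[OF l] that by (auto simp: valid_def)
  note vst = valid_st[OF l, unfolded uv(1)]
  have mem: "x \<in> set (item ?a) ==> x \<in> set (st l)" "x \<in> set (item ?b) ==> x \<in> set (st l)" for x
    by (simp_all add: uv(1))
  have nz: "\<tau> x y \<noteq> 0"
    if "(\<exists>c. fst x = Bar c) \<noteq> (\<exists>c. fst y = Bar c)" "x \<in> set (st l)" "y \<in> set (st l)"
      "snd x = V q c" "snd y = V q' c'" "q \<noteq> q'" for x y q q' c c'
  proof (rule tau_nonzero)
    show "snd x \<noteq> snd y" using that V_inj by auto
    show "fst x \<noteq> fst y" using that(1) by metis
  qed (use that(1-3) labs in auto)
  from i(3,4) show thesis
  proof (cases rule: cr_cases)
    case (SS c d)
    have it: "item ?b = [(Orig c, V ?b 0)]" "item ?a = [(Orig d, V ?a 0)]"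
      using SS(1,2) item_solid i'_nth by auto
    note v1 = vst[unfolded it append.simps]
    show thesis
    proof (cases "c = d")
      case True
      then have "i' = ?i" using SS(1,2) p' unfolding i'_def by (simp add: swap_same)
      then have se1: "app (se i') \<phi> (st l) = \<phi> (st l)" if "unital \<phi>" for \<phi> using app_se[OF that l i(1)] by simp
      have "V ?a 0 - V ?b 0 \<noteq> 0" using V_inj[of ?a 0 ?b 0] ne by auto
      then have nzd: "- 1 / (V ?a 0 - V ?b 0) \<noteq> 0" by simp
      show thesis
      proof (rule that[OF nzd])
        fix \<phi> assume \<phi>: "unital \<phi>"
        have "app (PP p) \<phi> (st l) = (app (se i') \<phi> (st l) - app (se i') \<phi> (st (swap p l))) / (V ?a 0 - V ?b 0)"
          using pop_append[OF v1, of "app (se i') \<phi>"] True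
          unfolding red SS(3) fsi rho_gens unfolding uv(1,2) it by simp
        also have "\<dots> = 1 / (V ?a 0 - V ?b 0) * \<phi> (st l) + - 1 / (V ?a 0 - V ?b 0) * \<phi> (st (swap p l))"
          using sel[OF \<phi>] se1[OF \<phi>] by (simp add: diff_divide_distrib)
        finally show "app (PP p) \<phi> (st l) = \<dots>" .
      qed
    next
      case False
      have "\<tau> (Orig d, V ?a 0) (Orig c, V ?b 0) \<noteq> 0"
      proof (rule tau_nonzero)
        have "V ?a 0 ^ m + V ?b 0 ^ m' \<noteq> 0" if "0 < m" "0 < m'" for m m'
          using V_powers[OF ne _ _ that] SS(1,2) i'_nth by simp
        then show "snd (Orig d, V ?a 0) ^ m + snd (Orig c, V ?b 0) ^ m' \<noteq> 0" if "0 < m" "0 < m'" for m m'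
          using that by simp
      qed (use False labs[OF mem(1)] labs[OF mem(2)] it V_inj[of ?a 0 ?b 0] ne in auto)
      then show thesis
      proof (rule that[where \<alpha>=0])
        fix \<phi> assume \<phi>: "unital \<phi>"
        show "app (PP p) \<phi> (st l) = 0 * \<phi> (st l) + \<tau> (Orig d, V ?a 0) (Orig c, V ?b 0) * \<phi> (st (swap p l))"
          using pop_append[OF v1, of "app (se i') \<phi>"] False sel[OF \<phi>]
          unfolding red SS(3) fsi rho_gens unfolding uv(1,2) it by simp
      qed
    qed
  next
    case (ST c k)
    have jt: "j ! ?a = Thick k" using ST i'_nth by simp
    have it: "item ?b = [(Orig c, V ?b 0)]" using ST item_solid i'_nth by auto
    have w: "length (item ?a) = weight_size N (lam ! k)" using jt by simp
    note th = item_thick[OF jt]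
    have nz0: "0 \<notin> set (map (\<lambda>b. \<tau> b (Orig c, V ?b 0)) (item ?a))"
      using nz[OF _ mem(1) mem(2), of _ "(Orig c, V ?b 0)" ?a _ ?b 0] th it ne by fastforce
    show thesis
    proof (rule that[where \<alpha>=0])
      show "prod_list (map (\<lambda>b. \<tau> b (Orig c, V ?b 0)) (item ?a)) \<noteq> 0"
        using nz0 by (simp only: prod_list_zero_iff not_False_eq_True)
      fix \<phi> assume \<phi>: "unital \<phi>"
      have "valid (st u @ item ?a @ (Orig c, V ?b 0) # st v)" using vst it by simp
      from app_RR[OF this, of "app (se i') \<phi>"]
      show "app (PP p) \<phi> (st l) = 0 * \<phi> (st l) + prod_list (map (\<lambda>b. \<tau> b (Orig c, V ?b 0)) (item ?a)) * \<phi> (st (swap p l))"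
        using th sel[OF \<phi>] unfolding red ST(3) fsi w[symmetric] unfolding uv(1,2) it by fastforce
    qed
  next
    case (TS c k)
    have jt: "j ! ?b = Thick k" using TS i'_nth by simp
    have it: "item ?a = [(Orig c, V ?a 0)]" using TS item_solid i'_nth by auto
    have w: "length (item ?b) = weight_size N (lam ! k)" using jt by simp
    note th = item_thick[OF jt]
    have nz0: "0 \<notin> set (map (\<tau> (Orig c, V ?a 0)) (item ?b))"
      using nz[OF _ mem(1) mem(2), of "(Orig c, V ?a 0)" _ ?a 0 ?b] th it ne by fastforce
    show thesis
    proof (rule that[where \<alpha>=0])
      show "prod_list (map (\<tau> (Orig c, V ?a 0)) (item ?b)) \<noteq> 0"
        using nz0 by (simp only: prod_list_zero_iff not_False_eq_True)
      fix \<phi> assume \<phi>: "unital \<phi>"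
      have "valid (st u @ (Orig c, V ?a 0) # item ?b @ st v)" using vst it by simp
      from app_LL[OF this, of "app (se i') \<phi>"]
      show "app (PP p) \<phi> (st l) = 0 * \<phi> (st l) + prod_list (map (\<tau> (Orig c, V ?a 0)) (item ?b)) * \<phi> (st (swap p l))"
        using th sel[OF \<phi>] unfolding red TS(3) fsi w[symmetric] unfolding uv(1,2) it by fastforce
    qed
  qed
qed

end

section \<open>Leading terms of words in the crossings\<close>

context klr_states
begin

abbreviation "PPs v \<equiv> prod_list (map PP v)"

lemma u_PPs: "\<forall>p\<in>set v. Suc p < rr ==> unital \<phi> ==> unital (app (PPs v) \<phi>)"
proof (induction v)
  case (Cons p v)
  then have "ts.u * PP p = PP p" by (intro ts.P_u) simp
  then have "unital (app (PP p) (app (PPs v) \<phi>))" by (rule unital_app)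
  then show ?case by simp
qed simp

lemma app_word_zero:
  "legal l ==> \<forall>p\<in>set v. Suc p < rr ==> unital \<phi> ==>
    (\<And>l'. l' \<in> reach v l ==> legal l' ==> \<phi> (st l') = 0) ==> app (PPs v) \<phi> (st l) = 0"
proof (induction v arbitrary: l)
  case (Cons p v)
  have p: "Suc p < rr" "\<forall>p\<in>set v. Suc p < rr" using Cons.prems(2) by auto
  have up: "ts.u * PP p = PP p" by (rule ts.P_u(2)[OF p(1)])
  show ?case
  proof (cases "is_solid (seqn l ! p) \<or> is_solid (seqn l ! Suc p)")
    case True
    obtain \<alpha> \<beta> where ab: "\<And>\<phi>. unital \<phi> ==> app (PP p) \<phi> (st l) = \<alpha> * \<phi> (st l) + \<beta> * \<phi> (st (swap p l))"
      using app_PP[OF Cons.prems(1) p(1) True] by metis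
    have "app (PPs v) \<phi> (st l) = 0"
      by (rule Cons.IH[OF Cons.prems(1) p(2) Cons.prems(3)]) (simp add: Cons.prems(4))
    moreover have "app (PPs v) \<phi> (st (swap p l)) = 0"
      by (rule Cons.IH[OF legal_swap(1)[OF Cons.prems(1) p(1) True] p(2) Cons.prems(3)]) (simp add: Cons.prems(4))
    ultimately show ?thesis using ab[OF u_PPs[OF p(2) Cons.prems(3)]] by simp
  next
    case False
    then have "se (seqn l) * PP p = 0"
      using ts.e_P(2)[OF seqn_Sq[OF Cons.prems(1)], of p] p(1) seqn_Sq[OF Cons.prems(1)]
      by (simp add: Seq_length)
    then show ?thesis
      using app_through_se[OF Cons.prems(1) up, of "app (PPs v) \<phi>"] by simp
  qed
qed simp

lemma act_reach: "act v l \<in> reach v l"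
  by (induction v arbitrary: l) auto

text \<open>An omitted swap loses an inversion, so the state of the full permutation is reached in
  one way only, with the product of the nonzero \<open>\<beta>\<close> as coefficient.\<close>

lemma app_word_lead:
  "legal l ==> \<forall>p\<in>set v. Suc p < rr ==> unital \<phi> ==> colour_path v (seqn l) ==>
    inversions (act v l) = inversions l + length v ==>
    (\<And>l'. legal l' ==> l' \<noteq> act v l ==> \<phi> (st l') = 0) ==> \<phi> (st (act v l)) \<noteq> 0 ==>
    app (PPs v) \<phi> (st l) \<noteq> 0"
proof (induction v arbitrary: l)
  case (Cons p v)
  note l = Cons.prems(1) and \<phi> = Cons.prems(3) and inv = Cons.prems(5)
  have p: "Suc p < rr" "\<forall>p\<in>set v. Suc p < rr" using Cons.prems(2) by auto
  have s: "is_solid (seqn l ! p) \<or> is_solid (seqn l ! Suc p)" using Cons.prems(4) by simp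
  note l' = legal_swap[OF l p(1) s]
  obtain \<alpha> \<beta> where ab: "\<beta> \<noteq> 0"
      "\<And>\<phi>. unital \<phi> ==> app (PP p) \<phi> (st l) = \<alpha> * \<phi> (st l) + \<beta> * \<phi> (st (swap p l))"
    using app_PP[OF l p(1) s] by metis
  have len: "length l = rr" "length (swap p l) = rr" using legal_length(1) l l'(1) by auto
  have "app (PPs v) \<phi> (st l) = 0"
  proof (rule app_word_zero[OF l p(2) \<phi>])
    fix l'' assume r: "l'' \<in> reach v l" "legal l''"
    have "inversions l'' \<le> inversions l + length v"
      using reach_inversions[OF r(1)] p(2) len by simp
    then have "l'' \<noteq> act (p # v) l" using inv by auto
    then show "\<phi> (st l'') = 0" using Cons.prems(6) r(2) by blast
  qed
  moreover have "app (PPs v) \<phi> (st (swap p l)) \<noteq> 0"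
  proof (rule Cons.IH[OF l'(1) p(2) \<phi>])
    have "inversions (act v (swap p l)) \<le> inversions (swap p l) + length v"
      using reach_inversions[OF act_reach] p(2) len by simp
    moreover have "inversions (swap p l) \<le> Suc (inversions l)"
      using inversions_swap p(1) len by simp
    ultimately show "inversions (act v (swap p l)) = inversions (swap p l) + length v"
      using inv by simp
  qed (use Cons.prems l' in auto)
  ultimately show ?case using ab(1) ab(2)[OF u_PPs[OF p(2) \<phi>]] by simp
qed simp

lemma nonzero_multiplier_prod_list:
  fixes gs :: "('f config => 'f) endo list"
  assumes "\<And>f. f \<in> set gs ==> \<exists>c. c \<noteq> 0 \<and> (\<forall>\<phi>. app f \<phi> s = c * \<phi> s)"
  shows "\<exists>c. c \<noteq> 0 \<and> (\<forall>\<phi>. app (prod_list gs) \<phi> s = c * \<phi> s)"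
  using assms
proof (induction gs)
  case Nil
  show ?case by (intro exI[of _ 1]) simp
next
  case (Cons f gs)
  obtain c where c: "c \<noteq> 0" "\<And>\<phi>. app (prod_list gs) \<phi> s = c * \<phi> s" using Cons by auto
  obtain d where d: "d \<noteq> 0" "\<And>\<phi>. app f \<phi> s = d * \<phi> s" using Cons.prems[of f] by auto
  show ?case by (intro exI[of _ "d * c"]) (simp add: c d mult.assoc)
qed

lemma st_values: "x \<in> set (st l) ==> \<exists>p c. x \<in> set (item p) \<and> snd x = V p c"
proof -
  assume "x \<in> set (st l)"
  then obtain p where p: "x \<in> set (item p)" by (auto simp: st_def)
  then have "\<exists>c. snd x = V p c" by (auto simp: item_def)
  then show ?thesis using p by blast
qed

lemma nilxs_multiplier:
  assumes "legal l" "i \<in> Sq"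
  shows "\<exists>c. c \<noteq> 0 \<and> (\<forall>\<phi>. app (nilxs (block_list N lam i)) \<phi> (st l) = c * \<phi> (st l))"
proof (intro nonzero_multiplier_prod_list)
  fix f assume "f \<in> set (map (\<lambda>(b, m). nilx b m) (block_list N lam i))"
  then obtain b m where bm: "(b, m) \<in> set (block_list N lam i)" "f = nilx b m" by auto
  then have bn: "b + m \<le> n" using run_list_block_list[OF assms(2)] by (auto simp: run_list_def same_run_def)
  show "\<exists>c. c \<noteq> 0 \<and> (\<forall>\<phi>. app f \<phi> (st l) = c * \<phi> (st l))"
    unfolding bm(2) nilx_def
  proof (intro nonzero_multiplier_prod_list)
    fix g assume "g \<in> set (map (\<lambda>q. xx (b + q) ^ (m - Suc q)) [0..<m])"
    then obtain q where q: "q < m" "g = xx (b + q) ^ (m - Suc q)" by auto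
    have qn: "b + q < n" using q bn by simp
    have "st l ! (b + q) \<in> set (st l)" using qn valid_length[OF valid_st[OF assms(1)]] by simp
    then have "snd (st l ! (b + q)) \<noteq> 0" using st_values V_nonzero by metis
    then show "\<exists>c. c \<noteq> 0 \<and> (\<forall>\<phi>. app g \<phi> (st l) = c * \<phi> (st l))"
      using xop_power[OF valid_st[OF assms(1)] qn] q(2)
      by (intro exI[of _ "snd (st l ! (b + q)) ^ (m - Suc q)"]) (simp add: rho_gens)
  qed
qed

text \<open>Thick entries are determined by the sequence; solid entries with equal labels are told
  apart by their values.\<close>

lemma legal_eqI:
  assumes l: "legal l" "legal l'" and s: "seqn l = seqn l'"
    and v: "\<And>p. p < rr ==> is_solid (j ! (l ! p)) ==> V (l ! p) 0 = V (l' ! p) 0"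
  shows "l = l'"
proof (rule nth_equalityI)
  show "length l = length l'" using legal_length(1) l by simp
  fix p assume "p < length l"
  then have p: "p < rr" using legal_length(1) l by simp
  have e: "j ! (l ! p) = j ! (l' ! p)" using seqn_nth[OF l(1) p] seqn_nth[OF l(2) p] s by simp
  show "l ! p = l' ! p"
  proof (cases "j ! (l ! p)")
    case (Solid a)
    then show ?thesis using v[OF p] V_inj by auto
  next
    case (Thick k)
    have "l ! p < rr" "l' ! p < rr"
      using legal_length(1,2)[OF l(1)] legal_length(1,2)[OF l(2)] p by (metis lessThan_iff nth_mem)+
    then show ?thesis
      using thick_pos_eq(1)[OF j] Thick e Seq_length[OF j] by metis
  qed
qed

text \<open>A point mass is in general not fixed by the nilHecke idempotents. The indicator
  \<open>H\<close> prescribes the values on solid strands only and is symmetric in the barred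
  strands of a block, hence killed by the crossings inside blocks; after multiplication by the
  staircase monomials it is unital. Among states, the colours and solid values already determine the
  permutation.\<close>

lemma delta:
  assumes l0: "legal l0"
  obtains \<phi> where "unital \<phi>" "\<phi> (st l0) \<noteq> 0" "\<And>l. legal l ==> l \<noteq> l0 ==> \<phi> (st l) = 0"
proof -
  define i where "i = seqn l0"
  let ?w = "wd i" and ?bl = "block_list N lam i"
  have i: "i \<in> Sq" unfolding i_def by (rule seqn_Sq[OF l0])
  define G where "G s \<longleftrightarrow> valid s \<and> map fst s = ?w \<and> (\<forall>q<n. \<forall>a. fst (s ! q) = Orig a \<longrightarrow> s ! q = st l0 ! q)" for s
  define H where "H s = (if G s then 1 else 0 :: 'f)" for s
  \<comment> \<open>\<open>nus_nilxs\<close> speaks of ring elements, so the function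
    \<open>H\<close> is replaced by a rank one operator whose image it spans.\<close>
  define Y where "Y = Endo (\<lambda>\<psi> s. \<psi> (st l0) * H s)"
  have Y: "app Y \<psi> s = \<psi> (st l0) * H s" for \<psi> s
    unfolding Y_def by (subst Endo_inverse) (auto simp: algebra_simps)
  have wn: "length ?w = n" using wd_W[OF i] by (simp add: words_def)
  have eY: "ee ?w * Y = Y"
    by (rule op_eqI) (simp add: rho_gens app_ops Y H_def G_def)
  have pY: "ps (b + c) * Y = 0" if bm: "(b, m) \<in> set ?bl" "Suc c < m" for b m c
  proof (rule op_eqI)
    fix \<psi> s
    let ?q = "b + c"
    obtain k a where ka: "k < length lam" "a \<in> {1..N}" "b = block_start N lam i k a" "m = (lam ! k) a"
      using bm(1) by (auto simp: block_list_def less_Suc_eq_le simp del: upt_Suc)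
    have w: "?w ! ?q = Bar a" "?w ! Suc ?q = Bar a" "Suc ?q < n"
      using block_bounds(3)[OF i ka(1,2), of c] block_bounds(3)[OF i ka(1,2), of "Suc c"]
        block_le_n[OF i ka(1,2)] bm(2) ka(3,4) by auto
    have sw: "swap ?q ?w = ?w" using w wn by (intro swap_same) auto
    have GG: "G (swap ?q s) = G s" if s: "valid s"
    proof -
      have ls: "length s = n" using valid_length[OF s] .
      have m: "map fst (swap ?q s) = ?w \<longleftrightarrow> map fst s = ?w"
        using swap_eq_iff[of "map fst s" ?w ?q] swap_fst[OF s w(3)] sw ls wn w(3) by simp
      have "s ! q' = swap ?q s ! q' \<or> ((\<exists>a. fst (s ! q') = Bar a) \<and> (\<exists>a. fst (swap ?q s ! q') = Bar a))"
        if "map fst s = ?w" "q' < n" for q'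
      proof -
        have "fst (s ! ?q) = Bar a" "fst (s ! Suc ?q) = Bar a"
          using words_fst[OF s, of ?q] words_fst[OF s, of "Suc ?q"] w that by auto
        then show ?thesis using ls w(3) by (cases "q' = ?q"; cases "q' = Suc ?q") auto
      qed
      then have "map fst s = ?w ==> (\<forall>q'<n. \<forall>a. fst (swap ?q s ! q') = Orig a \<longrightarrow> swap ?q s ! q' = st l0 ! q')
          \<longleftrightarrow> (\<forall>q'<n. \<forall>a. fst (s ! q') = Orig a \<longrightarrow> s ! q' = st l0 ! q')"
        by (metis lab.distinct(1))
      then show ?thesis unfolding G_def using m s valid_swap[OF s w(3)] by blast
    qed
    show "app (ps ?q * Y) \<psi> s = app 0 \<psi> s"
    proof (cases "valid s \<and> fst (s ! ?q) \<noteq> fst (s ! Suc ?q)")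
      case True
      then have "map fst s \<noteq> ?w" using words_fst[of s ?q] words_fst[of s "Suc ?q"] w by auto
      then have "\<not> G s" by (simp add: G_def)
      then show ?thesis using GG True by (simp add: rho_gens app_ops Y H_def)
    qed (use GG in \<open>auto simp: rho_gens app_ops Y H_def\<close>)
  qed
  let ?Z = "nilxs ?bl * Y"
  have "ee ?w * ?Z = ?Z"
    using assoc_comm[OF nilxs_ee[OF wd_W[OF i] run_list_block_list[OF i]], of Y, symmetric] eY by simp
  then have "se i * ?Z = nus ?bl * ?Z" by (simp add: se_def mult.assoc)
  also have "\<dots> = ?Z"
    by (rule nus_nilxs[OF wd_W[OF i] run_list_block_list[OF i] eY pY])
  finally have "ts.u * ?Z = ?Z" using assoc_eq[OF ts.e_u(2)[OF i], of ?Z] by simp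
  then have un: "unital (app ?Z (\<lambda>_. 1))" by (rule unital_app)
  have val: "\<exists>c. c \<noteq> 0 \<and> app ?Z (\<lambda>_. 1) (st l) = c * H (st l)" if l: "legal l" for l
  proof -
    obtain c where "c \<noteq> 0" "\<And>\<phi>. app (nilxs ?bl) \<phi> (st l) = c * \<phi> (st l)"
      using nilxs_multiplier[OF l i] by blast
    then show ?thesis by (intro exI[of _ c]) (simp add: Y)
  qed
  have "G (st l0)" using valid_st[OF l0] by (simp add: G_def fst_st i_def)
  then have nz: "app ?Z (\<lambda>_. 1) (st l0) \<noteq> 0" using val[OF l0] by (auto simp: H_def)
  have z: "app ?Z (\<lambda>_. 1) (st l) = 0" if l: "legal l" "l \<noteq> l0" for l
  proof -
    have "\<not> G (st l)"
    proof
      assume G: "G (st l)"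
      then have sl: "seqn l = i" using wd_inj[OF seqn_Sq[OF l(1)] i] by (simp add: G_def fst_st)
      have "l = l0"
      proof (rule legal_eqI[OF l(1) l0])
        show "seqn l = seqn l0" using sl i_def by simp
        fix p assume p: "p < rr" and so: "is_solid (j ! (l ! p))"
        obtain a where a: "j ! (l ! p) = Solid a" using so by (auto simp: is_solid_iff)
        then have a0: "j ! (l0 ! p) = Solid a" using sl seqn_nth[OF l(1) p] seqn_nth[OF l0 p] i_def by simp
        have "fs i p < n"
          using solid_strand(1)[OF i, of p] p so seqn_nth[OF l(1) p] sl i by (simp add: Seq_length)
        then show "V (l ! p) 0 = V (l0 ! p) 0"
          using G st_solid[OF l(1) p a] st_solid[OF l0 p a0] sl i_def by (simp add: G_def)
      qed
      then show False using l(2) by simp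
    qed
    then show ?thesis using val[OF l(1)] by (auto simp: H_def)
  qed
  show thesis by (rule that[OF un nz z])
qed

text \<open>The relation is tested on a function concentrated at the state of a longest admissible
  word \<open>v0\<close> with nonzero coefficient. Other admissible words with nonzero coefficient
  do not reach this state, and words crossing two thick entries vanish at the base state.\<close>

lemma independence:
  assumes fin: "finite X" "X \<subseteq> normal_words rr"
    and g: "\<And>v \<phi>. v \<in> X ==> unital \<phi> ==> app (g v) \<phi> (st [0..<rr]) = m v * \<phi> (st [0..<rr])"
    and z: "(\<Sum>v\<in>X. g v * PPs v) = 0" and v: "v \<in> X" "colour_path v j"
  shows "m v = 0"
proof (rule ccontr)
  assume "m v \<noteq> 0"
  define Z where "Z = {v \<in> X. colour_path v j \<and> m v \<noteq> 0}"
  have "finite (length ` Z)" "length ` Z \<noteq> {}" using fin v \<open>m v \<noteq> 0\<close> by (auto simp: Z_def)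
  then obtain v0 where v0: "v0 \<in> Z" "length v0 = Max (length ` Z)" by (metis Max_in imageE)
  have max: "length v' \<le> length v0" if "v' \<in> Z" for v'
    unfolding v0(2) using that \<open>finite (length ` Z)\<close> by (intro Max_ge) auto
  let ?b = "[0..<rr]"
  have lett: "\<forall>p\<in>set v. Suc p < rr" if "v \<in> X" for v using that fin(2) normal_words_letters by blast
  have leg: "legal (act v l)" if "\<forall>p\<in>set v. Suc p < rr" "colour_path v (seqn l)" "legal l" for v l
    using that
  proof (induction v arbitrary: l)
    case (Cons p v)
    then show ?case using legal_swap[OF Cons.prems(3), of p] by simp
  qed simp
  have v0': "v0 \<in> X" "colour_path v0 (seqn ?b)" using v0(1) by (auto simp: Z_def base)
  obtain \<phi> where \<phi>: "unital \<phi>" "\<phi> (st (act v0 ?b)) \<noteq> 0" "\<And>l. legal l ==> l \<noteq> act v0 ?b ==> \<phi> (st l) = 0"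
    using delta[OF leg[OF lett[OF v0'(1)] v0'(2) base(1)]] by metis
  have "0 = (\<Sum>v\<in>X. app (g v) (app (PPs v) \<phi>) (st ?b))"
    using arg_cong[OF z, of "\<lambda>f. app f \<phi> (st ?b)"] by (simp add: fun_sum_apply)
  also have "\<dots> = (\<Sum>v\<in>X. m v * app (PPs v) \<phi> (st ?b))"
    by (intro sum.cong refl g u_PPs[OF lett \<phi>(1)])
  also have "\<dots> = (\<Sum>v\<in>X. if v = v0 then m v0 * app (PPs v0) \<phi> (st ?b) else 0)"
  proof (rule sum.cong[OF refl])
    fix v assume v: "v \<in> X"
    show "m v * app (PPs v) \<phi> (st ?b) = (if v = v0 then m v0 * app (PPs v0) \<phi> (st ?b) else 0)"
    proof (cases "v = v0")
      case False
      have "app (PPs v) \<phi> (st ?b) = 0" if "m v \<noteq> 0"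
      proof (cases "colour_path v j")
        case True
        then have "length v \<le> length v0" using max that v by (simp add: Z_def)
        then have "act v0 ?b \<notin> reach v ?b"
          using normal_words_triangular[of v rr v0] False v v0'(1) fin(2) by blast
        then show ?thesis using \<phi> by (intro app_word_zero base lett[OF v]) auto
      next
        case not_path: False
        have "v \<noteq> []" using not_path by auto
        then obtain p w where pw: "v = p # w" by (cases v) auto
        have "ts.u * PPs v = PPs v"
          using ts.P_u(2)[of p] lett[OF v] unfolding pw by (simp add: mult.assoc[symmetric])
        then have "app (PPs v) \<phi> (st ?b) = app (se j * PPs v) \<phi> (st ?b)"
          using app_through_se[OF base(1), of "PPs v" \<phi>] by (simp only: base(2))
        also have "se j * PPs v = 0"
          using ts.e_word_eq_0[OF j _ not_path] lett[OF v] Seq_length[OF j] by simp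
        finally show ?thesis by simp
      qed
      then show ?thesis using False by auto
    qed simp
  qed
  also have "\<dots> = m v0 * app (PPs v0) \<phi> (st ?b)" using fin v0'(1) by simp
  also have "\<dots> \<noteq> 0"
  proof -
    have "app (PPs v0) \<phi> (st ?b) \<noteq> 0"
    proof (rule app_word_lead[OF base(1) lett[OF v0'(1)] \<phi>(1) v0'(2) _ \<phi>(3) \<phi>(2)])
      show "inversions (act v0 ?b) = inversions ?b + length v0"
        using normal_words_reduced[of v0 rr] fin(2) v0'(1) by auto
    qed
    then show ?thesis using v0(1) by (simp add: Z_def)
  qed
  finally show False by simp
qed

end

section \<open>Independence of the normal words\<close>

text \<open>
  Solid strands carry variables, thick strands carry variables times an indeterminate
  \<open>\<epsilon>\<close>. Setting \<open>\<epsilon> = 0\<close> kills the elementary symmetric polynomials of the thick strands.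
\<close>

type_synonym 'k mpoly = "(nat \<Rightarrow>\<^sub>0 nat) \<Rightarrow>\<^sub>0 'k"

definition emb :: "'k::field mpoly poly => 'k mpoly poly fract"
  where "emb d = Fraction_Field.Fract d 1"

lemma emb_hom: "emb (a + b) = emb a + emb b" "emb (a * b) = emb a * emb b" "emb 0 = 0" "emb 1 = 1"
  by (simp_all add: emb_def Zero_fract_def One_fract_def)

lemma emb_sum: "emb (sum f A) = (\<Sum>a\<in>A. emb (f a))"
  by (induction A rule: infinite_finite_induct) (simp_all add: emb_hom)

lemma emb_prod_list: "emb (prod_list l) = prod_list (map emb l)"
  by (induction l) (simp_all add: emb_hom)

lemma emb_power: "emb (a ^ m) = emb a ^ m"
  by (induction m) (simp_all add: emb_hom)

lemma emb_eq_iff [simp]: "emb a = emb b \<longleftrightarrow> a = b"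
  by (simp add: emb_def eq_fract)

definition mvar :: "nat => 'k::field mpoly"
  where "mvar p = Poly_Mapping.single (Poly_Mapping.single p 1) 1"

definition mconst :: "'k => 'k::field mpoly"
  where "mconst c = Poly_Mapping.single 0 c"

lemma mvar_power: "mvar p ^ m = Poly_Mapping.single (Poly_Mapping.single p m) 1"
  by (induction m) (simp_all add: mvar_def mult_single single_add[symmetric])

lemma mvar_inj: "mvar p = (mvar q :: 'k::field mpoly) \<longleftrightarrow> p = q"
proof
  assume "mvar p = (mvar q :: 'k mpoly)"
  then have "Poly_Mapping.lookup (mvar q :: 'k mpoly) (Poly_Mapping.single p 1) = 1"
    by (metis lookup_single_eq mvar_def)
  then have "Poly_Mapping.single p 1 = (Poly_Mapping.single q 1 :: nat \<Rightarrow>\<^sub>0 nat)"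
    by (auto simp: mvar_def lookup_single when_def split: if_splits)
  then show "p = q" by (metis lookup_single_eq lookup_single_not_eq zero_neq_one)
qed simp

lemma mvar_nonzero: "mvar p \<noteq> (0 :: 'k::field mpoly)"
proof
  assume "mvar p = (0 :: 'k mpoly)"
  then have "Poly_Mapping.lookup (mvar p :: 'k mpoly) (Poly_Mapping.single p 1) = 0" by simp
  then show False by (simp add: mvar_def)
qed

lemma mvar_power_sum:
  assumes "p \<noteq> q" "0 < m"
  shows "mvar p ^ m + mvar q ^ m' \<noteq> (0 :: 'k::field mpoly)"
proof
  assume "mvar p ^ m + mvar q ^ m' = (0 :: 'k mpoly)"
  then have "Poly_Mapping.lookup (mvar p ^ m + mvar q ^ m' :: 'k mpoly) (Poly_Mapping.single p m) = 0" by simp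
  moreover have "Poly_Mapping.single q m' \<noteq> (Poly_Mapping.single p m :: nat \<Rightarrow>\<^sub>0 nat)"
    using assms by (metis lookup_single_eq lookup_single_not_eq not_less_zero)
  ultimately show False by (simp add: mvar_power lookup_add lookup_single when_def)
qed

text \<open>The degree in \<epsilon> separates thick from solid values, so coinciding variables of
  the two kinds do no harm; \<open>prod_encode\<close> gives each strand of a thick entry a variable
  of its own.\<close>

definition generic_value :: "entry list => nat => nat => 'k::field mpoly poly fract"
  where "generic_value j p c = emb (if is_solid (j ! p) \<and> c = 0 then [:mvar p:] else monom (mvar (prod_encode (p, c))) 1)"

lemma generic_value_inj:
  assumes "generic_value j p c = (generic_value j q d :: 'k::field mpoly poly fract)"
  shows "p = q \<and> c = d"
proof -
  have ne: "[:a:] \<noteq> monom b 1" "monom b 1 \<noteq> [:a:]" if "b \<noteq> 0" for a b :: "'k mpoly"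
    using that by (metis degree_monom_eq degree_pCons_0 zero_neq_one)+
  have m: "monom (mvar x) 1 = (monom (mvar y) 1 :: 'k mpoly poly) \<longleftrightarrow> x = y" for x y
    by (simp add: monom_eq_iff mvar_inj)
  show ?thesis
    using assms ne[OF mvar_nonzero] unfolding generic_value_def emb_eq_iff
    by (auto simp: m mvar_inj split: if_splits)
qed

lemma generic_value_nonzero: "generic_value j p c \<noteq> (0 :: 'k::field mpoly poly fract)"
  unfolding generic_value_def emb_hom(3)[symmetric] emb_eq_iff
  by (simp add: mvar_nonzero monom_eq_0_iff)

lemma generic_value_powers:
  assumes "p \<noteq> q" "is_solid (j ! p)" "is_solid (j ! q)" "0 < m" "0 < m'"
  shows "generic_value j p 0 ^ m + generic_value j q 0 ^ m' \<noteq> (0 :: 'k::field mpoly poly fract)"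
proof -
  have c: "[:a:] ^ r = [:a ^ r:]" for a :: "'k mpoly" and r
    by (induction r) (simp_all add: one_pCons)
  show ?thesis
    using mvar_power_sum[OF assms(1,4), of m'] assms(2,3)
    unfolding generic_value_def emb_power[symmetric] emb_hom(1)[symmetric] emb_hom(3)[symmetric] emb_eq_iff
    by (simp add: c)
qed

definition const_emb :: "'k::field => 'k mpoly poly fract"
  where "const_emb c = emb [:mconst c:]"

lemma const_emb_hom:
  "const_emb 1 = 1" "const_emb (c + d) = const_emb c + const_emb d" "const_emb (c * d) = const_emb c * const_emb d"
proof -
  show "const_emb 1 = 1" by (simp add: const_emb_def mconst_def emb_hom(4)[symmetric] one_pCons)
  show "const_emb (c + d) = const_emb c + const_emb d"
    by (simp add: const_emb_def mconst_def emb_hom[symmetric] single_add)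
  show "const_emb (c * d) = const_emb c * const_emb d"
    by (simp add: const_emb_def mconst_def emb_hom[symmetric] mult_single mult.commute)
qed

section \<open>Coefficients of matched elements\<close>

context tensor_scalars
begin

definition ymono :: "(nat \<Rightarrow>\<^sub>0 nat) => 'r"
  where "ymono \<beta> = prod_list (map (\<lambda>q. y q ^ Poly_Mapping.lookup \<beta> q) [0..<rr])"

text \<open>Evaluation at the dots, with the scalars on the left. The product laws below have a
  constant or a variable as left factor, in accordance with the one-generator steps in
  \<open>diag\<close>.\<close>

definition yeval :: "'k mpoly => 'r"
  where "yeval = pm_extend (\<lambda>\<beta> c. \<kappa> c * ymono \<beta>)"

lemma kappa_0: "\<kappa> 0 = 0"
  using kappa_add[of 0 0] by simp

lemma yeval_add: "yeval (f + g) = yeval f + yeval g"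
  unfolding yeval_def by (rule pm_extend_add) (simp_all add: kappa_0 kappa_add distrib_right)

lemma yeval_single: "yeval (Poly_Mapping.single \<beta> c) = \<kappa> c * ymono \<beta>"
  unfolding yeval_def by (rule pm_extend_single) (simp add: kappa_0)

lemma yeval_zero [simp]: "yeval 0 = 0"
  by (simp add: yeval_def)

lemma yeval_one [simp]: "yeval 1 = 1"
  using yeval_single[of 0 1] by (simp add: kappa_one ymono_def map_replicate_const)

lemma yeval_const: "yeval (mconst c * f) = \<kappa> c * yeval f"
proof (induction f rule: poly_mapping_additive_induct)
  case (single_add \<beta> d f)
  then show ?case
    by (simp add: distrib_left yeval_add mconst_def mult_single yeval_single kappa_mult mult.assoc)
qed simp

lemma y_ymono:
  assumes p: "p < rr"
  shows "y p * ymono \<beta> = ymono (Poly_Mapping.single p 1 + \<beta>)"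
proof -
  have c: "y p * y q ^ m = y q ^ m * y p" if "q < rr" for q m
    using comm_power[OF y_y[OF p that]] .
  \<comment> \<open>Induction over prefixes: until position \<open>p\<close> is reached,
    \<open>y p\<close> travels to the right end, and the second conjunct says that the new exponent
    has not yet changed the prefix.\<close>
  have "y p * prod_list (map (\<lambda>q. y q ^ Poly_Mapping.lookup \<beta> q) [0..<r])
      = (if p < r then prod_list (map (\<lambda>q. y q ^ Poly_Mapping.lookup (Poly_Mapping.single p 1 + \<beta>) q) [0..<r])
        else prod_list (map (\<lambda>q. y q ^ Poly_Mapping.lookup \<beta> q) [0..<r]) * y p)
    \<and> (p \<ge> r \<longrightarrow> map (\<lambda>q. y q ^ Poly_Mapping.lookup (Poly_Mapping.single p 1 + \<beta>) q) [0..<r]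
        = map (\<lambda>q. y q ^ Poly_Mapping.lookup \<beta> q) [0..<r])" if "r \<le> rr" for r
    using that
  proof (induction r)
    case (Suc r)
    let ?f = "\<lambda>q. y q ^ Poly_Mapping.lookup \<beta> q" and ?g = "\<lambda>q. y q ^ Poly_Mapping.lookup (Poly_Mapping.single p 1 + \<beta>) q"
    have r: "r < rr" using Suc.prems by simp
    have g: "?g r = (if p = r then y p * ?f r else ?f r)"
      by (simp add: lookup_add lookup_single when_def)
    consider "p < r" | "p = r" | "p > r" by linarith
    then show ?case
    proof cases
      case 1
      then show ?thesis using Suc g by (simp add: mult.assoc[symmetric])
    next
      case 2
      have c': "y p * prod_list (map ?f [0..<r]) = prod_list (map ?f [0..<r]) * y p" and m: "map ?g [0..<r] = map ?f [0..<r]"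
        using Suc.IH Suc.prems 2 by simp_all
      have "y p * (prod_list (map ?f [0..<r]) * ?f r) = prod_list (map ?g [0..<r]) * ?g r"
        unfolding m g using 2 c' by (simp add: mult.assoc[symmetric])
      then show ?thesis using 2 by simp
    next
      case 3
      then show ?thesis using Suc g c[OF r] by (simp add: mult.assoc[symmetric]) (simp add: mult.assoc)
    qed
  qed simp
  from this[of rr] p show ?thesis unfolding ymono_def by simp
qed

lemma yeval_mvar:
  assumes p: "p < rr"
  shows "yeval (mvar p * f) = y p * yeval f"
proof (induction f rule: poly_mapping_additive_induct)
  case (single_add \<beta> d f)
  have "y p * (\<kappa> d * ymono \<beta>) = \<kappa> d * (y p * ymono \<beta>)"
    by (rule assoc_comm[symmetric]) (use p in \<open>simp add: kappa_y\<close>)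
  with single_add show ?case
    by (simp add: distrib_left yeval_add mvar_def mult_single yeval_single y_ymono[OF p])
qed simp

end

text \<open>\<open>T\<close> stands for any ring with the undeformed relations, in particular for
  one in which the violating idempotents vanish too.\<close>

locale klr_generic =
  klr_model_seq N B t n "const_emb :: 'k::field => 'k mpoly poly fract" lam nu +
  T: tensor_scalars N B lam nu eT yT "\<lambda>k a d. 0" PT \<kappa>T
  for N B and t :: "lab => lab => 'k::field" and n lam nu
    and eT :: "entry list => 'r::ring_1" and yT PT and \<kappa>T :: "'k::field => 'r"
begin

sublocale pr: tensor_scalars N B lam nu "\<lambda>i. (se i, eT i)" "\<lambda>p. (yy p, yT p)" "\<lambda>k a d. (EE k a d, 0)"
  "\<lambda>p. (PP p, PT p)" "\<lambda>c. (kop c, \<kappa>T c)"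
proof (intro tensor_scalars.intro tensor_scalars_axioms.intro)
  show "tensor_relations N B lam nu (\<lambda>i. (se i, eT i)) (\<lambda>p. (yy p, yT p)) (\<lambda>k a d. (EE k a d, 0)) (\<lambda>p. (PP p, PT p))"
    by (rule tensor_relations_prod[OF tensor_relations T.tensor_relations_axioms])
qed (simp_all add: prod_eq_iff kappa_one kappa_add kappa_mult T.kappa_one T.kappa_add T.kappa_mult
  ts.kappa_e ts.kappa_y ts.kappa_P T.kappa_e T.kappa_y T.kappa_P)

lemma pr_u: "pr.u = (ts.u, T.u)"
  by (simp add: pr.u_def ts.u_def T.u_def prod_eq_iff fst_sum snd_sum)

lemma esym_emb: "esym (\<lambda>q. emb (g q)) d Q = emb (esym g d Q)"
  by (simp add: esym_def emb_sum emb_prod_list o_def)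

lemma poly_esym_0:
  assumes "\<And>q. q \<in> Q ==> poly (g q) 0 = (0 :: 'k mpoly)" "d > 0" "finite Q"
  shows "poly (esym g d Q) 0 = 0"
proof -
  have "poly (prod_list (map g (sorted_list_of_set A))) 0 = 0" if "A \<subseteq> Q" "card A = d" for A
  proof -
    have f: "finite A" "A \<noteq> {}" using that assms(2,3) by (auto intro: finite_subset)
    then have "set (sorted_list_of_set A) \<noteq> {}" by simp
    then obtain q l where l: "sorted_list_of_set A = q # l" by (cases "sorted_list_of_set A") auto
    then have "q \<in> set (sorted_list_of_set A)" by simp
    then have "q \<in> Q" using f that(1) by auto
    then show ?thesis using assms(1) by (simp add: l)
  qed
  then show ?thesis by (auto simp: esym_def poly_sum intro!: sum.neutral)
qed

lemma app_esym_xx: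
  assumes "valid s" "\<And>q. q \<in> Q ==> q < n" "finite Q"
  shows "app (esym xx d Q) \<phi> s = esym (\<lambda>q. snd (s ! q)) d Q * \<phi> s"
proof -
  have l: "app (prod_list (map xx l)) \<phi> s = prod_list (map (\<lambda>q. snd (s ! q)) l) * \<phi> s" if "set l \<subseteq> {..<n}" for l \<phi>
    using that by (induction l) (simp_all add: rho_gens app_ops assms(1))
  have "app (prod_list (map xx (sorted_list_of_set A))) \<phi> s
      = prod_list (map (\<lambda>q. snd (s ! q)) (sorted_list_of_set A)) * \<phi> s" if "A \<subseteq> Q" for A
    using that assms(2,3) finite_subset[OF that] by (intro l) auto
  then show ?thesis
    by (simp add: esym_def fun_sum_apply sum_distrib_right)
qed

text \<open>The bridge between the algebras: a coefficient acts at the base state by a polynomial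
  \<open>m\<close>, and its counterpart in \<open>T\<close> is \<open>m\<close> at \<epsilon> = 0,
  evaluated at the dots. For \<open>E k a d\<close> this is consistent because an elementary
  symmetric polynomial of positive degree in multiples of \<epsilon> vanishes at \<epsilon> = 0. So
  if the first coefficient is zero, the second is as well.\<close>

lemma diag_value:
  assumes j: "j \<in> Sq" and f: "f \<in> pr.diag"
  shows "\<exists>m. (\<forall>\<phi>. klr_states.unital N B t n const_emb lam nu \<phi> \<longrightarrow>
      app (fst f) \<phi> (klr_states.st N lam j (generic_value j) [0..<rr])
        = emb m * \<phi> (klr_states.st N lam j (generic_value j) [0..<rr]))
    \<and> eT j * snd f = T.yeval (poly m 0) * eT j"
proof -
  interpret s: klr_states N B t n const_emb lam nu j "generic_value j"
    by standard (auto simp: j generic_value_nonzero dest: generic_value_inj generic_value_powers)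
  let ?b = "[0..<rr]"
  have lenj: "length j = rr" using Seq_length[OF j] .
  have un: "s.unital (app (fst g) \<phi>)" if "g \<in> pr.diag" for g \<phi>
    using pr.u_diag[OF that] by (intro s.unital_app) (auto simp: pr_u prod_eq_iff)
  from f show ?thesis
  proof (induction rule: pr.diag.induct)
    case zero
    show ?case by (intro exI[of _ 0]) (simp add: emb_hom)
  next
    case unit
    show ?case by (intro exI[of _ 1]) (simp add: emb_hom pr_u s.unital_def T.e_u(1)[OF j])
  next
    case (add f g)
    then obtain m m' where "\<forall>\<phi>. s.unital \<phi> \<longrightarrow> app (fst f) \<phi> (s.st ?b) = emb m * \<phi> (s.st ?b)"
      "\<forall>\<phi>. s.unital \<phi> \<longrightarrow> app (fst g) \<phi> (s.st ?b) = emb m' * \<phi> (s.st ?b)"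
      "eT j * snd f = T.yeval (poly m 0) * eT j" "eT j * snd g = T.yeval (poly m' 0) * eT j" by blast
    then show ?case by (intro exI[of _ "m + m'"]) (simp add: emb_hom T.yeval_add distrib_left distrib_right)
  next
    case (kappa f c)
    then obtain m where m: "\<forall>\<phi>. s.unital \<phi> \<longrightarrow> app (fst f) \<phi> (s.st ?b) = emb m * \<phi> (s.st ?b)"
      "eT j * snd f = T.yeval (poly m 0) * eT j" by blast
    have "eT j * (\<kappa>T c * snd f) = \<kappa>T c * (eT j * snd f)"
      by (rule assoc_comm) (simp add: T.kappa_e[OF j])
    then show ?case
      using m by (intro exI[of _ "[:mconst c:] * m"])
        (simp add: emb_hom app_ops const_emb_def[of c] T.yeval_const mult.assoc poly_mult del: mult_pCons_left)
  next
    case (e i f)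
    then obtain m where m: "\<forall>\<phi>. s.unital \<phi> \<longrightarrow> app (fst f) \<phi> (s.st ?b) = emb m * \<phi> (s.st ?b)"
      "eT j * snd f = T.yeval (poly m 0) * eT j" by blast
    have "app (se i) (app (fst f) \<phi>) (s.st ?b) = (if i = j then app (fst f) \<phi> (s.st ?b) else 0)" for \<phi>
      using s.app_se[OF un[OF e(2)] s.base(1) e(1)] s.base(2) by simp
    moreover have "eT j * (eT i * snd f) = (if i = j then eT j * snd f else 0)"
      using T.e_e[OF j e(1)] by (auto simp: mult.assoc[symmetric])
    ultimately show ?case
      using m by (intro exI[of _ "if i = j then m else 0"]) (simp add: emb_hom)
  next
    case (y p f)
    then obtain m where m: "\<forall>\<phi>. s.unital \<phi> \<longrightarrow> app (fst f) \<phi> (s.st ?b) = emb m * \<phi> (s.st ?b)"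
      "eT j * snd f = T.yeval (poly m 0) * eT j" by blast
    have p: "p < length j" using y(1) lenj by simp
    have yp: "app (yy p) (app (fst f) \<phi>) (s.st ?b)
        = (if is_solid (j ! p) then generic_value j p 0 * app (fst f) \<phi> (s.st ?b) else 0)" for \<phi>
      using s.app_yy[OF un[OF y(2)] s.base(1) y(1)] y(1) by simp
    show ?case
    proof (cases "is_solid (j ! p)")
      case True
      have "eT j * (yT p * snd f) = yT p * (eT j * snd f)"
        by (rule assoc_comm) (simp add: T.y_e[OF j p])
      then show ?thesis
        using m yp True by (intro exI[of _ "[:mvar p:] * m"])
          (simp add: emb_hom generic_value_def[of j p 0] T.yeval_mvar[OF y(1)] mult.assoc poly_mult del: mult_pCons_left)
    next
      case False
      have "eT j * (yT p * snd f) = 0"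
        using T.y_e[OF j p] T.y_red[OF j p False] by (simp add: mult.assoc[symmetric])
      then show ?thesis using yp False by (intro exI[of _ 0]) (simp add: emb_hom)
    qed
  next
    case (E k a d f)
    then obtain m where m: "\<forall>\<phi>. s.unital \<phi> \<longrightarrow> app (fst f) \<phi> (s.st ?b) = emb m * \<phi> (s.st ?b)" by blast
    let ?bs = "block_start N lam j k a"
    define Q where "Q = {?bs..<?bs + (lam ! k) a}"
    have Qn: "q < n" if "q \<in> Q" for q using that block_le_n[OF j E(1,2)] by (simp add: Q_def)
    note v = s.valid_st[OF s.base(1)]
    have "\<exists>g. snd (s.st ?b ! q) = emb g \<and> poly g 0 = 0" if q: "q \<in> Q" for q
    proof -
      have "map fst (s.st ?b) = wd j" using s.fst_st[of ?b] s.base(2) by simp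
      moreover have "wd j ! q = Bar a"
        using block_bounds(3)[OF j E(1,2), of "q - ?bs"] q by (auto simp: Q_def)
      ultimately have fq: "fst (s.st ?b ! q) = Bar a" using words_fst[OF v Qn[OF q]] by simp
      have "s.st ?b ! q \<in> set (s.st ?b)" using Qn[OF q] valid_length[OF v] by simp
      then obtain p c where pc: "s.st ?b ! q \<in> set (s.item p)" "snd (s.st ?b ! q) = generic_value j p c"
        using s.st_values by blast
      have "\<not> is_solid (j ! p)"
        using pc(1) fq s.item_solid by (auto simp: is_solid_iff)
      then show ?thesis using pc(2) by (intro exI[of _ "monom (mvar (prod_encode (p, c))) 1"])
          (simp add: generic_value_def[of j p c] poly_monom)
    qed
    then obtain g where g: "\<And>q. q \<in> Q ==> snd (s.st ?b ! q) = emb (g q)" "\<And>q. q \<in> Q ==> poly (g q) 0 = 0"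
      by metis
    have es: "esym (\<lambda>q. snd (s.st ?b ! q)) d Q = esym (\<lambda>q. emb (g q)) d Q"
      unfolding esym_def
    proof (intro sum.cong refl arg_cong[where f = prod_list] map_cong)
      fix A q assume A: "A \<in> {A. A \<subseteq> Q \<and> card A = d}" and q: "q \<in> set (sorted_list_of_set A)"
      have "finite A" using A by (auto simp: Q_def intro: finite_subset)
      then show "snd (s.st ?b ! q) = emb (g q)" using q A g by auto
    qed
    have "app (EE k a d) (app (fst f) \<phi>) (s.st ?b) = emb (esym g d Q) * app (fst f) \<phi> (s.st ?b)" for \<phi>
    proof -
      have "app (EE k a d) (app (fst f) \<phi>) (s.st ?b) = app (se j * EE k a d) (app (fst f) \<phi>) (s.st ?b)"
        using s.app_through_se[OF s.base(1) ts.E_u(2)[OF E(1-3)]] unfolding s.base(2) .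
      also have "se j * EE k a d = esym xx d Q * se j"
        using ts.E_e[OF j E(1-3)] EE_se[OF j, of k a d] by (simp add: sE_def Q_def)
      also have "app \<dots> (app (fst f) \<phi>) (s.st ?b) = emb (esym g d Q) * app (fst f) \<phi> (s.st ?b)"
        using app_esym_xx[OF v Qn, of Q d] s.app_se[OF un[OF E(4)] s.base(1) j] s.base(2) es
        by (simp add: Q_def esym_emb)
      finally show ?thesis .
    qed
    moreover have "poly (esym g d Q) 0 = 0"
      by (rule poly_esym_0) (use g(2) E(3) in \<open>auto simp: Q_def\<close>)
    ultimately show ?case using m by (intro exI[of _ "esym g d Q * m"]) (simp add: emb_hom)
  qed
qed

theorem kernel_transfer:
  assumes q: "q \<in> crossing_filtration.lspan pr.diag (\<lambda>p. (PP p, PT p)) (normal_words rr)"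
    and z: "fst q = 0"
  shows "T.u * snd q = 0"
proof -
  interpret cf: crossing_filtration pr.diag "\<lambda>p. (PP p, PT p)" rr
    by (rule pr.crossing_filtration[OF nu_set])
  obtain g where g: "\<And>v. v \<in> normal_words rr ==> g v \<in> pr.diag" "q = (\<Sum>v\<in>normal_words rr. g v * cf.Ps v)"
    using cf.lspan_coefficients[OF q finite_normal_words] by blast
  have fP: "fst (cf.Ps v) = prod_list (map PP v)" "snd (cf.Ps v) = prod_list (map PT v)" for v
    by (induction v) auto
  have "eT j * snd q = 0" if j: "j \<in> Sq" for j
  proof -
    interpret s: klr_states N B t n const_emb lam nu j "generic_value j"
      by standard (auto simp: j generic_value_nonzero dest: generic_value_inj generic_value_powers)
    have "\<forall>v\<in>normal_words rr. \<exists>m. (\<forall>\<phi>. s.unital \<phi> \<longrightarrow> app (fst (g v)) \<phi> (s.st [0..<rr]) = emb m * \<phi> (s.st [0..<rr]))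
        \<and> eT j * snd (g v) = T.yeval (poly m 0) * eT j"
      using diag_value[OF j g(1)] by (intro ballI)
    from bchoice[OF this] obtain m where m': "\<forall>v\<in>normal_words rr. (\<forall>\<phi>. s.unital \<phi> \<longrightarrow>
        app (fst (g v)) \<phi> (s.st [0..<rr]) = emb (m v) * \<phi> (s.st [0..<rr]))
        \<and> eT j * snd (g v) = T.yeval (poly (m v) 0) * eT j" ..
    then have m: "\<And>v \<phi>. v \<in> normal_words rr ==> s.unital \<phi> ==>
        app (fst (g v)) \<phi> (s.st [0..<rr]) = emb (m v) * \<phi> (s.st [0..<rr])"
      "\<And>v. v \<in> normal_words rr ==> eT j * snd (g v) = T.yeval (poly (m v) 0) * eT j"
      by simp_all
    have z': "(\<Sum>v\<in>normal_words rr. fst (g v) * prod_list (map PP v)) = 0"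
      using z unfolding g(2) by (simp add: fst_sum fP)
    have "eT j * (snd (g v) * prod_list (map PT v)) = 0" if v: "v \<in> normal_words rr" for v
    proof (cases "colour_path v j")
      case True
      have "emb (m v) = 0"
        by (rule s.independence[OF finite_normal_words subset_refl m(1) z' v True])
      then have "m v = 0" by (metis emb_hom(3) emb_eq_iff)
      then show ?thesis using m(2)[OF v] by (simp add: mult.assoc[symmetric])
    next
      case False
      have "eT j * prod_list (map PT v) = 0"
        using T.e_word_eq_0[OF j _ False] normal_words_letters[OF v] Seq_length[OF j] by auto
      then show ?thesis using m(2)[OF v] by (simp add: mult.assoc[symmetric]) (simp add: mult.assoc)
    qed
    then show ?thesis unfolding g(2) by (simp add: snd_sum fP sum_distrib_left)
  qed
  then show ?thesis by (simp add: T.u_def sum_distrib_right)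
qed

end

section \<open>Algebras as records\<close>

text \<open>The unit \<open>u\<close> need only act as the identity on classes: it is
  \<open>1\<close> for a presented algebra and a sum of idempotents for \<open>S\<close>.\<close>

lemma ring_of_representatives:
  fixes A (structure) and C :: "'f::ring_1 => 'a"
  assumes carrier: "carrier A = C ` D" and ops: "\<zero> = C 0" "\<one> = C u"
    "\<And>f g. f \<in> D ==> g \<in> D ==> C f \<oplus> C g = C (f + g)" "\<And>f g. f \<in> D ==> g \<in> D ==> C f \<otimes> C g = C (f * g)"
    and D: "0 \<in> D" "u \<in> D" "\<And>f g. f \<in> D ==> g \<in> D ==> f + g \<in> D" "\<And>f g. f \<in> D ==> g \<in> D ==> f * g \<in> D"
      "\<And>f. f \<in> D ==> - f \<in> D"
    and unit: "\<And>f. f \<in> D ==> C (u * f) = C f" "\<And>f. f \<in> D ==> C (f * u) = C f"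
  shows "ring A"
proof (rule ringI)
  show "abelian_group A"
  proof (rule abelian_groupI)
    fix a assume "a \<in> carrier A"
    then obtain f where f: "f \<in> D" "a = C f" unfolding carrier by blast
    have "C (- f) \<in> carrier A" using D(5) f unfolding carrier by blast
    moreover have "C (- f) \<oplus> a = \<zero>" using f ops D(5) by simp
    ultimately show "\<exists>b\<in>carrier A. b \<oplus> a = \<zero>" by blast
  qed (auto simp: carrier ops D algebra_simps)
  show "Group.monoid A"
    by (rule monoidI) (auto simp: carrier ops D unit mult.assoc)
qed (auto simp: carrier ops D algebra_simps)

text \<open>The first isomorphism theorem gives the ring isomorphism. For scalars, the
  multiplication of \<open>alg_Quot\<close> is a union over all representatives, which
  \<open>h\<close> maps to a single element.\<close>

lemma alg_isomorphicI:
  fixes h :: "'a => 'b" and S :: "('k, 'a) module" and T :: "('k, 'b) module"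
  assumes S: "ring S" and T: "ring T" and h: "h \<in> ring_hom S T" "h ` carrier S = carrier T"
    and J: "J = {a \<in> carrier S. h a = \<zero>\<^bsub>T\<^esub>}"
    and smult: "\<And>c a. a \<in> carrier S ==> c \<odot>\<^bsub>S\<^esub> a \<in> carrier S \<and> h (c \<odot>\<^bsub>S\<^esub> a) = c \<odot>\<^bsub>T\<^esub> h a"
  shows "alg_isomorphic (alg_Quot S J) T"
proof -
  interpret ring_hom_ring S T h by (rule ring_hom_ringI2[OF S T h(1)])
  have ker: "a_kernel S T h = J" unfolding a_kernel_def' J ..
  have "(\<lambda>X. the_elem (h ` X)) \<in> ring_iso (S Quot J) T"
    using FactRing_iso_set[OF h(2)] unfolding ker .
  then have iso: "(\<lambda>X. the_elem (h ` X)) \<in> ring_iso (alg_Quot S J) T"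
    by (simp add: ring_iso_def ring_hom_def alg_Quot_def)
  have im: "h ` (J +>\<^bsub>S\<^esub> a) = {h a}" if a: "a \<in> carrier S" for a
  proof -
    have "h ` (J +>\<^bsub>S\<^esub> a) \<subseteq> {h a}"
      using a unfolding a_r_coset_def' J by auto
    moreover have "\<zero>\<^bsub>S\<^esub> \<in> J" by (simp add: J)
    then have "J +>\<^bsub>S\<^esub> a \<noteq> {}" unfolding a_r_coset_def' by auto
    ultimately show ?thesis using subset_singletonD by fastforce
  qed
  have "the_elem (h ` (c \<odot>\<^bsub>alg_Quot S J\<^esub> X)) = c \<odot>\<^bsub>T\<^esub> the_elem (h ` X)"
    if X: "X \<in> carrier (alg_Quot S J)" for c X
  proof -
    obtain a where a: "a \<in> carrier S" "X = J +>\<^bsub>S\<^esub> a"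
      using X by (auto simp: alg_Quot_def FactRing_def A_RCOSETS_def')
    have "\<zero>\<^bsub>S\<^esub> \<in> J" by (simp add: J)
    then have ne: "X \<noteq> {}" unfolding a(2) a_r_coset_def' by auto
    have x: "x \<in> carrier S" "h x = h a" if "x \<in> X" for x
    proof -
      show "h x = h a" using im[OF a(1)] that unfolding a(2) by blast
      show "x \<in> carrier S" using that a unfolding a(2) a_r_coset_def' J by auto
    qed
    have "h ` (c \<odot>\<^bsub>alg_Quot S J\<^esub> X) = (\<Union>x\<in>X. h ` (J +>\<^bsub>S\<^esub> (c \<odot>\<^bsub>S\<^esub> x)))"
      by (simp add: alg_Quot_def image_UN)
    also have "\<dots> = (\<Union>x\<in>X. {c \<odot>\<^bsub>T\<^esub> h a})"
      using x smult im by (intro SUP_cong refl) simp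
    also have "\<dots> = {c \<odot>\<^bsub>T\<^esub> h a}" using ne by simp
    finally show ?thesis using im[OF a(1)] by (simp add: a(2))
  qed
  then have "(\<lambda>X. the_elem (h ` X)) \<in> alg_iso (alg_Quot S J) T"
    using iso by (simp add: alg_iso_def)
  then show ?thesis unfolding alg_isomorphic_def by blast
qed

lemma presented_class:
  fixes G :: "'g set" and Rel :: "('g, 'k::field) free set"
  assumes Rel: "Rel \<subseteq> carrier (free_alg G)"
  defines "A \<equiv> presented_alg G Rel" and "C \<equiv> presented_class G Rel" and "D \<equiv> carrier (free_alg G :: ('k, ('g, 'k) free) module)"
  shows "carrier A = C ` D" "zero A = C 0" "one A = C 1"
    "f \<in> D ==> g \<in> D ==> add A (C f) (C g) = C (f + g)"
    "f \<in> D ==> g \<in> D ==> mult A (C f) (C g) = C (f * g)"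
    "f \<in> D ==> module.smult A c (C f) = C (scal c * f)"
    "C f = C g \<longleftrightarrow> f - g \<in> Rideal G Rel"
proof -
  note Z = Rideal_closed[OF Rel]
  interpret F: ring "free_alg G :: ('k, ('g, 'k) free) module" by (rule free_alg_ring)
  interpret I: ideal "Rideal G Rel" "free_alg G :: ('k, ('g, 'k) free) module"
    by (rule F.genideal_ideal[OF Rel])
  have C: "C f = (\<lambda>z. z + f) ` Rideal G Rel" for f
    unfolding C_def presented_class_def a_r_coset_def' by auto
  show "carrier A = C ` D"
    unfolding A_def D_def C_def presented_alg_def alg_Quot_def FactRing_def A_RCOSETS_def' presented_class_def by auto
  show "zero A = C 0"
    unfolding C by (simp add: A_def presented_alg_def alg_Quot_def FactRing_def)
  show "one A = C 1"
    by (simp add: A_def presented_alg_def alg_Quot_def FactRing_def C_def presented_class_def)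
  show "add A (C f) (C g) = C (f + g)" if "f \<in> D" "g \<in> D"
    using I.a_rcos_sum[of f g] that
    by (simp add: A_def presented_alg_def alg_Quot_def FactRing_def C_def presented_class_def D_def del: free_alg_simps(1))
  show "mult A (C f) (C g) = C (f * g)" if "f \<in> D" "g \<in> D"
    using I.rcoset_mult_add[of f g] that
    by (simp add: A_def presented_alg_def alg_Quot_def FactRing_def C_def presented_class_def D_def del: free_alg_simps(1))
  show eq: "C f = C g \<longleftrightarrow> f - g \<in> Rideal G Rel" for f g
  proof
    assume "C f = C g"
    moreover have "f \<in> C f" unfolding C using Z(2) by (intro image_eqI[of _ _ 0]) auto
    ultimately have "f \<in> C g" by simp
    then show "f - g \<in> Rideal G Rel" unfolding C by auto
  next
    assume fg: "f - g \<in> Rideal G Rel"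
    have "C f \<subseteq> C g" if "f - g \<in> Rideal G Rel" for f g
      unfolding C
    proof (rule image_subsetI)
      fix z assume "z \<in> Rideal G Rel"
      then show "z + f \<in> (\<lambda>z. z + g) ` Rideal G Rel"
        using Z(3)[OF _ that] by (intro image_eqI[of _ _ "z + (f - g)"]) auto
    qed
    from this[OF fg] this[of g f] Z(6)[OF fg] show "C f = C g" by simp
  qed
  show "module.smult A c (C f) = C (scal c * f)" if f: "f \<in> D"
  proof -
    have "C (scal c * x) = C (scal c * f)" if "x \<in> C f" for x
    proof -
      obtain z where z: "x = z + f" "z \<in> Rideal G Rel" using \<open>x \<in> C f\<close> unfolding C by blast
      then show ?thesis unfolding eq using Z(5)[OF z(2) scal_carrier, of c] by (simp add: algebra_simps)
    qed
    moreover have "C f \<noteq> {}" unfolding C using Z(2) by auto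
    ultimately have "(\<Union>x\<in>C f. C (scal c * x)) = C (scal c * f)" by auto
    then show ?thesis
      by (simp add: A_def presented_alg_def alg_Quot_def C_def presented_class_def)
  qed
qed

lemma presented_alg_is_ring:
  assumes "Rel \<subseteq> carrier (free_alg G)"
  shows "ring (presented_alg G Rel)"
proof (rule ring_of_representatives)
  note p = presented_class[OF assms]
  show "carrier (presented_alg G Rel) = presented_class G Rel ` carrier (free_alg G)" by (rule p)
  show "one (presented_alg G Rel) = presented_class G Rel 1" by (rule p)
qed (simp_all only: presented_class(1-6)[OF assms] carrier_closed mult_1_left mult_1_right)

text \<open>Induction over a generated ideal, in which the closure conditions may assume that the
  elements involve only the given generators.\<close>

lemma Rideal_minimal:
  fixes Rel :: "('g, 'k::field) free set"
  assumes f: "f \<in> Rideal G Rel" and Rel: "Rel \<subseteq> carrier (free_alg G)" and P: "\<And>r. r \<in> Rel ==> P r"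
    and cl: "P 0" "\<And>f g. f \<in> carrier (free_alg G) ==> g \<in> carrier (free_alg G) ==> P f ==> P g ==> P (f - g)"
    "\<And>f g. f \<in> carrier (free_alg G) ==> g \<in> carrier (free_alg G) ==> P f ==> P (f * g) \<and> P (g * f)"
  shows "P f"
proof -
  let ?F = "free_alg G :: ('k, ('g, 'k) free) module"
  interpret ring ?F by (rule free_alg_ring)
  note c = carrier_closed[where G = G]
  let ?I = "{f \<in> carrier ?F. P f}"
  have neg: "P (- f)" if "f \<in> ?I" for f
    using cl(2)[of 0 f] that c(1) cl(1) by simp
  have add: "P (f + g)" if "f \<in> ?I" "g \<in> ?I" for f g
    using cl(2)[of f "- g"] that neg[OF that(2)] c(5) by simp
  have "ideal ?I ?F"
  proof (rule idealI[OF ring_axioms])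
    show "subgroup ?I (add_monoid ?F)"
    proof (rule add.subgroupI)
      show "?I \<noteq> {}" using c(1) cl(1) by blast
      show "\<ominus>\<^bsub>?F\<^esub> f \<in> ?I" if "f \<in> ?I" for f
        using that neg[OF that] c(5)[of f] by (simp add: free_alg_uminus del: free_alg_simps(1))
      show "f \<oplus>\<^bsub>?F\<^esub> g \<in> ?I" if "f \<in> ?I" "g \<in> ?I" for f g
        using that add[OF that] c(3)[of f g] by (simp del: free_alg_simps(1))
    qed auto
    show "g \<otimes>\<^bsub>?F\<^esub> f \<in> ?I" "f \<otimes>\<^bsub>?F\<^esub> g \<in> ?I" if "f \<in> ?I" "g \<in> carrier ?F" for f g
      using that cl(3)[of f g] by (auto intro: carrier_closed simp del: free_alg_simps(1))
  qed
  then have "Rideal G Rel \<subseteq> ?I"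
    by (rule genideal_minimal) (use Rel P in auto)
  then show ?thesis using f by blast
qed

lemma (in alg_hom) kills_Rideal:
  assumes "f \<in> Rideal G Rel" "Rel \<subseteq> carrier (free_alg G)" "\<And>r. r \<in> Rel ==> \<rho> r = 0"
  shows "\<rho> f = 0"
  using assms(1,2) by (rule Rideal_minimal) (simp_all add: assms(3) mult)

section \<open>Webster's algebra\<close>

locale gens_hom = alg_hom \<rho> \<kappa> for \<rho> :: "('l gens, 'k::field) free => 'r::ring_1" and \<kappa>
begin

lemma rho_hsum: "\<rho> (hsum m (\<x> p) (\<x> q) * f) = hsum m (\<rho> (\<x> p)) (\<rho> (\<x> q)) * \<rho> f"
  by (simp add: hsum_def sum_distrib_right mult.assoc power_mult)

lemma rho_square: "\<rho> (\<psi> p ^ 2 * f) = \<rho> (\<psi> p) * \<rho> (\<psi> p) * \<rho> f"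
  by (simp add: power2_eq_square mult.assoc) (simp add: mult)

lemma rho_braid: "\<rho> ((\<psi> p * \<psi> q * \<psi> p - \<psi> q * \<psi> p * \<psi> q) * f)
    = \<rho> (\<psi> p) * \<rho> (\<psi> q) * \<rho> (\<psi> p) * \<rho> f - \<rho> (\<psi> q) * \<rho> (\<psi> p) * \<rho> (\<psi> q) * \<rho> f"
  by (simp add: mult left_diff_distrib)

lemma rho_slide: "\<rho> ((\<x> p * \<psi> q - \<psi> q * \<x> r) * f) = \<rho> (\<x> p) * \<rho> (\<psi> q) * \<rho> f - \<rho> (\<psi> q) * \<rho> (\<x> r) * \<rho> f"
    "\<rho> ((\<psi> q * \<x> r - \<x> p * \<psi> q) * f) = \<rho> (\<psi> q) * \<rho> (\<x> r) * \<rho> f - \<rho> (\<x> p) * \<rho> (\<psi> q) * \<rho> f"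
  by (simp_all add: mult left_diff_distrib)

lemma rho_Q_poly: "\<rho> (Q_poly B a b (\<x> p) (\<x> q) * f) = Q_poly B a b (\<rho> (\<x> p)) (\<rho> (\<x> q)) * \<rho> f"
  by (simp add: Q_poly_def distrib_right add power_mult)

lemma rho_Q_quot: "\<rho> (Q_quot B a b (\<x> p) (\<x> q) * f) = Q_quot B a b (\<rho> (\<x> p)) (\<rho> (\<x> q)) * \<rho> f"
  by (simp add: Q_quot_def rho_hsum)

end

locale webster = gens_hom \<rho> \<kappa> for \<rho> :: "(entry gens, 'k::field) free => 'r::ring_1" and \<kappa> +
  fixes B :: "nat => nat => int" and lam :: "(nat => nat) list" and nu :: "nat list"
  assumes kills: "r \<in> T_rels B lam nu ==> \<rho> r = 0"
begin

text \<open>With all \<open>E k a d\<close> equal to 0 only the leading term survives, and the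
  deformed relations become Webster's.\<close>

lemma gam_undeformed: "gam (\<lambda>d. if d = 0 then 1 else 0) m y = (y :: 'r) ^ m"
proof -
  have "gam (\<lambda>d. if d = 0 then 1 else 0) m y = (\<Sum>d\<le>m. if d = 0 then y ^ m else 0)"
    unfolding gam_def by (intro sum.cong) auto
  then show ?thesis by simp
qed

lemma dgam_undeformed: "dgam (\<lambda>d. if d = 0 then 1 else 0) m y z = hsum m (y :: 'r) z"
proof -
  have "dgam (\<lambda>d. if d = 0 then 1 else 0) m y z = (\<Sum>d\<le>m. if d = 0 then hsum m y z else 0)"
    unfolding dgam_def by (intro sum.cong) auto
  then show ?thesis by simp
qed

lemma sum_e: "(\<Sum>i\<in>Seq lam nu. \<rho> (\<e> i)) = \<rho> 1"
  using kills[OF T_rels.unit] by simp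

lemma right_unit: "(\<Sum>i\<in>Seq lam nu. \<rho> f * \<rho> (\<e> i)) = \<rho> f"
  by (simp add: sum_distrib_left[symmetric] sum_e)

theorem tensor_relations:
  "tensor_relations N B lam nu (\<lambda>i. \<rho> (\<e> i)) (\<lambda>p. \<rho> (\<x> p)) (\<lambda>k a d. 0) (\<lambda>p. \<rho> (\<psi> p))"
proof (standard, goal_cases)
  case (1 i j)
  then show ?case using kills[OF T_rels.idem, of i j] by (auto simp: mult split: if_splits)
next
  case (5 i p)
  then show ?case using kills[OF T_rels.dot_idem, of i p] by (simp add: mult)
next
  case (7 p q)
  then show ?case using kills[OF T_rels.dot_dot, of p q] by (simp add: mult)
next
  case (10 i p)
  then show ?case using kills[OF T_rels.dot_red, of i p] by (simp add: mult)
next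
  case (11 i p)
  then show ?case using kills[OF T_rels.cross_red, of i p] by (simp add: mult)
next
  case (12 i p)
  then show ?case using kills[OF T_rels.cross_idem, of i p] by (simp add: mult)
next
  case (13 p q)
  then show ?case using kills[OF T_rels.cross_dot_far, of p q] by (simp add: mult)
next
  case (14 p q)
  then show ?case using kills[OF T_rels.cross_cross_far, of p q] by (simp add: mult)
next
  case (15 i p)
  then show ?case
    using kills[OF T_rels.slide_left, of i p] by (simp add: rho_slide diff_eq_eq add.commute split: if_splits)
next
  case (16 i p)
  then show ?case
    using kills[OF T_rels.slide_right, of i p] by (simp add: rho_slide diff_eq_eq add.commute split: if_splits)
next
  case (17 i p a b)
  then show ?case using kills[OF T_rels.square_black, of i p a b] by (simp add: rho_square rho_Q_poly)
next
  case (18 i p a k)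
  then show ?case
    using kills[OF T_rels.square_black_red, of i p a k] by (simp add: power2_eq_square[symmetric] power_mult gam_undeformed)
next
  case (19 i p k a)
  then show ?case
    using kills[OF T_rels.square_red_black, of i p k a] by (simp add: power2_eq_square[symmetric] power_mult gam_undeformed)
next
  case (20 i p a b)
  then show ?case
    using kills[OF T_rels.braid_black, of i p a b] by (simp add: rho_braid rho_Q_quot diff_eq_eq add.commute)
next
  case (21 i p a k)
  then show ?case
    using kills[OF T_rels.braid_red, of i p a k] by (simp add: rho_braid rho_hsum dgam_undeformed diff_eq_eq add.commute)
next
  case (22 i p)
  then show ?case using kills[OF T_rels.braid_plain, of i p] by (simp add: rho_braid)
qed (simp_all add: right_unit)

lemma tensor_scalars:
  "tensor_scalars N B lam nu (\<lambda>i. \<rho> (\<e> i)) (\<lambda>p. \<rho> (\<x> p)) (\<lambda>k a d. 0) (\<lambda>p. \<rho> (\<psi> p)) \<kappa>"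
  by (intro tensor_scalars.intro tensor_relations tensor_scalars_axioms.intro)
    (auto simp: kappa_one kappa_add kappa_mult kappa_comm)

end

section \<open>Representatives and relations lie in the free algebras on the generators\<close>

lemma gens_over_simps [simp]:
  "Idemp i \<in> gens_over I n \<longleftrightarrow> i \<in> I" "Dot p \<in> gens_over I n \<longleftrightarrow> p < n" "Cross p \<in> gens_over I n \<longleftrightarrow> Suc p < n"
  by (auto simp: gens_over_def)

lemmas free_carrier = carrier_closed carrier_sum carrier_prod_list carrier_power

lemma klr_rels_carrier: "klr_rels L B t n \<subseteq> carrier (free_alg (gens_over (words L n) n))"
proof
  fix r assume "r \<in> klr_rels L B t n"
  then show "r \<in> carrier (free_alg (gens_over (words L n) n))"
    by cases (auto simp: hsum_def simp del: free_alg_simps(1) intro!: free_carrier swap_words)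
qed

lemma T_rels_carrier: "T_rels B lam nu \<subseteq> carrier (free_alg (gens_over (Seq lam nu) (length lam + length nu)))"
proof
  fix r assume "r \<in> T_rels B lam nu"
  then show "r \<in> carrier (free_alg (gens_over (Seq lam nu) (length lam + length nu)))"
    by cases (auto simp: hsum_def Q_poly_def Q_quot_def Seq_length simp del: free_alg_simps(1)
        intro!: free_carrier Seq_swap)
qed

lemma free_word:
  fixes c :: "'k::field" and l :: "'g list"
  shows "Poly_Mapping.single (Word l) c = scal c * prod_list (map gen l)"
proof -
  have "prod_list (map gen l) = (Poly_Mapping.single (Word l) 1 :: ('g, 'k::field) free)" for l
    by (induction l) (simp_all add: gen_def mult_single plus_freemon_def zero_freemon_def[symmetric])
  then show ?thesis by (simp add: scal_def mult_single)
qed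

lemma free_decompose:
  fixes f :: "('g, 'k::field) free"
  shows "f = (\<Sum>w\<in>Poly_Mapping.keys f. scal (Poly_Mapping.lookup f w) * prod_list (map gen (letters w)))"
proof -
  have "f = (\<Sum>w\<in>Poly_Mapping.keys f. Poly_Mapping.single w (Poly_Mapping.lookup f w))"
    by (rule poly_mapping_eqI) (simp add: lookup_sum lookup_single when_def in_keys_iff)
  also have "\<dots> = (\<Sum>w\<in>Poly_Mapping.keys f. scal (Poly_Mapping.lookup f w) * prod_list (map gen (letters w)))"
    by (intro sum.cong refl) (metis free_word freemon.exhaust_sel)
  finally show ?thesis .
qed

context klr_seq
begin

lemma nil_idem_carrier: "b + m \<le> n ==> nil_idem b m \<in> carrier (free_alg (gens_over I n))"
  unfolding nil_idem_def psi_longest_def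
  by (intro carrier_closed(4) carrier_prod_list) (auto simp del: free_alg_simps(1) intro!: free_carrier)

lemma S_e_carrier: "i \<in> Sq ==> S_e N lam i \<in> carrier (free_alg (gens_over W n))"
  unfolding S_e_def
  by (intro carrier_closed(4) carrier_prod_list)
    (auto simp del: free_alg_simps(1) upt_Suc simp: wd_W intro!: carrier_prod_list nil_idem_carrier block_le_n)

lemma S_y_carrier: "p < rr ==> (\<Sum>i\<in>Sq. S_y N lam p i) \<in> carrier (free_alg (gens_over W n))"
  by (intro carrier_sum)
    (auto simp: S_y_def Seq_length simp del: free_alg_simps(1) intro!: free_carrier S_e_carrier solid_strand(1))

lemma S_E_carrier:
  assumes "k < length lam" "a \<in> {1..N}"
  shows "(\<Sum>i\<in>Sq. S_E N lam k a d i :: (lab gens, 'k) free) \<in> carrier (free_alg (gens_over W n))"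
proof (rule carrier_sum)
  fix i assume i: "i \<in> Sq"
  let ?Q = "{block_start N lam i k a..<block_start N lam i k a + (lam ! k) a}"
  have "(prod_list (map \<x> (sorted_list_of_set A)) :: (lab gens, 'k) free) \<in> carrier (free_alg (gens_over W n))" if "A \<subseteq> ?Q" for A
  proof (rule carrier_prod_list)
    fix f :: "(lab gens, 'k) free" assume "f \<in> set (map \<x> (sorted_list_of_set A))"
    moreover have "finite A" using that by (auto intro: finite_subset)
    ultimately obtain q where "q \<in> A" "f = \<x> q" by auto
    then show "f \<in> carrier (free_alg (gens_over W n))"
      using that block_le_n[OF i assms] by (auto simp del: free_alg_simps(1))
  qed
  then show "(S_E N lam k a d i :: (lab gens, 'k) free) \<in> carrier (free_alg (gens_over W n))"
    unfolding S_E_def elem_sym_def by (intro carrier_closed(4) carrier_sum S_e_carrier i) (simp del: free_alg_simps(1))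
qed

lemma S_Psi_carrier:
  assumes "Suc p < rr"
  shows "(\<Sum>i\<in>Sq. S_Psi N lam p i) \<in> carrier (free_alg (gens_over W n))"
proof (rule carrier_sum)
  fix i assume i: "i \<in> Sq"
  have p: "p < length i" "Suc p < length i" using assms i by (simp_all add: Seq_length)
  have le: "fs i p + length (expand_entry N lam (i ! p)) + length (expand_entry N lam (i ! Suc p)) \<le> n"
    using fs_le[OF i, of "Suc (Suc p)"] first_strand_Suc[OF p(1), of N lam] first_strand_Suc[OF p(2), of N lam] by simp
  show "S_Psi N lam p i \<in> carrier (free_alg (gens_over W n))"
    using le by (cases "i ! p"; cases "i ! Suc p")
      (auto simp: S_Psi_def Let_def simp del: free_alg_simps(1)
        intro!: carrier_closed(1) carrier_closed(4) carrier_prod_list S_e_carrier i)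
qed

end

section \<open>The isomorphism\<close>

locale comparison = klr_seq \<rho> \<kappa> N B t n lam nu + T: webster \<rho>T \<kappa>T B lam nu
  for \<rho> :: "(lab gens, 'k::field) free => 'r::ring_1" and \<kappa> N B t n lam nu
    and \<rho>T :: "(entry gens, 'k::field) free => 's::ring_1" and \<kappa>T +
  assumes ker: "f \<in> carrier (free_alg (gens_over W n)) ==>
      \<rho> f = 0 \<longleftrightarrow> f \<in> Rideal (gens_over W n) (klr_rels (ext_index N) (ext_form B) t n)"
    and kerT: "g \<in> carrier (free_alg (gens_over (Seq lam nu) (length lam + length nu))) ==>
      \<rho>T g = 0 \<longleftrightarrow> g \<in> Rideal (gens_over (Seq lam nu) (length lam + length nu)) (T_rels B lam nu)"

sublocale comparison \<subseteq> ts: tensor_scalars N B lam nu se yy EE PP \<kappa>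
  by (rule tensor_scalars)

context comparison
begin

abbreviation "GR \<equiv> gens_over W n"
abbreviation "GT \<equiv> gens_over Sq rr"
abbreviation "DR \<equiv> carrier (free_alg GR :: ('k, (lab gens, 'k) free) module)"
abbreviation "DT \<equiv> carrier (free_alg GT :: ('k, (entry gens, 'k) free) module)"
abbreviation "cls \<equiv> R_class N B t n"
abbreviation "clT \<equiv> presented_class GT (T_rels B lam nu)"
abbreviation "SA \<equiv> S_alg N B t lam nu"
abbreviation "TA \<equiv> T_alg B lam nu :: ('k, (entry gens, 'k) free set) module"
abbreviation "JJ \<equiv> S_ideal N B t lam nu"
abbreviation "U \<equiv> \<Sum>i\<in>Sq. S_e N lam i"

lemmas rho_zero = zero and rho_add = add and rho_mult = mult and rho_scal = scal

text \<open>
  Pairs of representatives of elements of \<open>S\<close> and \<open>T\<close> that correspond to each other under the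
  isomorphism.
\<close>

inductive \<theta> :: "(lab gens, 'k) free => (entry gens, 'k) free => bool" where
  zero: "\<theta> 0 0"
| one: "\<theta> (\<Sum>i\<in>Sq. S_e N lam i) 1"
| e: "i \<in> Sq ==> \<theta> (S_e N lam i) (\<e> i)"
| y: "p < rr ==> \<theta> (\<Sum>i\<in>Sq. S_y N lam p i) (\<x> p)"
| E: "k < length lam ==> a \<in> {1..N} ==> d \<in> {1..(lam ! k) a} ==> \<theta> (\<Sum>i\<in>Sq. S_E N lam k a d i) 0"
| Psi: "Suc p < rr ==> \<theta> (\<Sum>i\<in>Sq. S_Psi N lam p i) (\<psi> p)"
| add: "\<theta> f g ==> \<theta> f' g' ==> \<theta> (f + f') (g + g')"
| mult: "\<theta> f g ==> \<theta> f' g' ==> \<theta> (f * f') (g * g')"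
| scal: "\<theta> f g ==> \<theta> (scal c * f) (scal c * g)"

lemma theta_carrier: "\<theta> f g ==> f \<in> DR \<and> g \<in> DT"
proof (induction rule: \<theta>.induct)
  case one
  then show ?case by (auto simp del: free_alg_simps(1) intro!: free_carrier S_e_carrier)
next
  case (y p)
  then show ?case using S_y_carrier[OF y] by (simp del: free_alg_simps(1))
next
  case (E k a d)
  then show ?case using S_E_carrier[OF E(1,2), of d] carrier_closed(1) by blast
next
  case (Psi p)
  then show ?case using S_Psi_carrier[OF Psi] by (simp del: free_alg_simps(1))
qed (auto simp del: free_alg_simps(1) intro!: free_carrier S_e_carrier)

lemma theta_minus: "\<theta> f g ==> \<theta> (- f) (- g)"
  using \<theta>.scal[of f g "- 1"] by simp

lemma theta_diff: "\<theta> f g ==> \<theta> f' g' ==> \<theta> (f - f') (g - g')"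
  using \<theta>.add[OF _ theta_minus, of f g f' g'] by simp

lemma theta_sum: "(\<And>a. a \<in> A ==> \<theta> (F a) (G a)) ==> \<theta> (sum F A) (sum G A)"
  by (induction A rule: infinite_finite_induct) (auto intro: \<theta>.zero \<theta>.add)

text \<open>Surjectivity of the map from \<open>S\<close>: each generator of \<open>T\<close> has a
  counterpart, and the constructors of \<open>\<theta>\<close> follow sums, products and
  scalars.\<close>

lemma theta_total:
  assumes "g \<in> DT"
  shows "\<exists>f. \<theta> f g"
proof -
  have gen: "\<exists>f. \<theta> f (gen x)" if "x \<in> GT" for x
    using that by (auto simp: gens_over_def intro: \<theta>.e \<theta>.y \<theta>.Psi)
  have word: "\<exists>f. \<theta> f (prod_list (map gen l))" if "set l \<subseteq> GT" for l
    using that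
  proof (induction l)
    case Nil
    show ?case using \<theta>.one by auto
  next
    case (Cons x l)
    then obtain f f' where "\<theta> f (gen x)" "\<theta> f' (prod_list (map gen l))" using gen[of x] by auto
    then show ?case using \<theta>.mult by fastforce
  qed
  have "\<forall>w\<in>Poly_Mapping.keys g. \<exists>f. \<theta> f (scal (Poly_Mapping.lookup g w) * prod_list (map gen (letters w)))"
    using assms word \<theta>.scal by fastforce
  then obtain F where "\<And>w. w \<in> Poly_Mapping.keys g ==> \<theta> (F w) (scal (Poly_Mapping.lookup g w) * prod_list (map gen (letters w)))"
    by metis
  from theta_sum[of "Poly_Mapping.keys g" F "\<lambda>w. scal (Poly_Mapping.lookup g w) * prod_list (map gen (letters w))", OF this] have "\<theta> (sum F (Poly_Mapping.keys g)) g"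
    using free_decompose[of g] by simp
  then show ?thesis by blast
qed

lemma rho_U: "\<rho> U = ts.u"
  by (simp add: ts.u_def rho_S_e)

lemma theta_unit: "\<theta> f g ==> ts.u * \<rho> f = \<rho> f \<and> \<rho> f * ts.u = \<rho> f"
proof (induction rule: \<theta>.induct)
  case one
  show ?case using ts.u_diag[OF ts.diag.unit] unfolding rho_U by simp
next
  case (mult f g f' g')
  have "ts.u * \<rho> (f * f') = (ts.u * \<rho> f) * \<rho> f'" "\<rho> (f * f') * ts.u = \<rho> f * (\<rho> f' * ts.u)"
    by (simp_all only: rho_mult mult.assoc)
  then show ?case using mult.IH by (simp add: rho_mult)
next
  case (scal f g c)
  have "ts.u * (\<kappa> c * \<rho> f) = \<kappa> c * (ts.u * \<rho> f)" by (rule assoc_comm) (simp add: ts.kappa_u)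
  then show ?case using scal.IH by (simp add: rho_scal mult.assoc)
qed (simp_all add: rho_S_e rho_S_y rho_S_E rho_S_Psi ts.e_u ts.y_u ts.E_u ts.P_u
    rho_add distrib_left distrib_right del: atLeastAtMost_iff sum)

text \<open>Makes the passage from \<open>S\<close> to \<open>T\<close> well defined. Vanishing in
  the faithful model means lying in the ideal of relations, hence vanishing in the configuration
  model \<open>G\<close>. The pair has a normal form there, as combinations of normal words contain
  the matched generators and are closed under the constructors of \<open>\<theta>\<close>.\<close>

lemma kernel_T:
  assumes "\<theta> f g" "\<rho> f = 0"
  shows "\<rho>T g = 0"
proof -
  interpret G: klr_generic N B t n lam nu "\<lambda>i. \<rho>T (\<e> i)" "\<lambda>p. \<rho>T (\<x> p)" "\<lambda>p. \<rho>T (\<psi> p)" \<kappa>T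
  proof (intro klr_generic.intro klr_model_seq.intro klr_model_seq_axioms.intro T.tensor_scalars klr_model.intro)
    show "t i j = (if \<exists>k\<in>{1..N}. i = Bar k \<and> j = Orig k then - 1 else 1)"
      if "i \<in> ext_index N" "j \<in> ext_index N" for i j by (rule scalars[OF that])
  qed (fact cartan n_eq nu_set nondegenerate const_emb_hom)+
  interpret cf: crossing_filtration G.pr.diag "\<lambda>p. (G.PP p, \<rho>T (\<psi> p))" rr
    by (rule G.pr.crossing_filtration[OF nu_set])
  let ?L = "cf.lspan (normal_words rr)"
  have d: "x \<in> ?L" if "x \<in> G.pr.diag" for x
    using cf.normal_words_span[OF that, of "[]"] by simp
  have k: "(G.kop c, \<kappa>T c) * s \<in> ?L" if "s \<in> ?L" for c s
    using that
  proof (induction rule: cf.lspan.induct)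
    case (step f v s)
    then show ?case
      using cf.lspan.step[OF G.pr.diag.kappa[OF step(1), of c] step(2)]
      by (simp add: distrib_left mult.assoc)
  qed (simp add: cf.lspan.zero)
  have Tu: "G.T.u = \<rho>T 1" by (simp add: G.T.u_def T.sum_e)
  have "(G.\<rho> f, \<rho>T g) \<in> ?L"
    using assms(1)
  proof (induction rule: \<theta>.induct)
    case zero
    show ?case using cf.lspan.zero by (simp add: zero_prod_def)
  next
    case one
    have "(G.\<rho> U, \<rho>T 1) = G.pr.u"
      by (simp add: G.pr_u G.ts.u_def Tu G.rho_S_e)
    then show ?case using d[OF G.pr.diag.unit] by simp
  next
    case (e i)
    then show ?case using d[OF G.pr.e_diag[OF e]] by (simp add: G.rho_S_e)
  next
    case (y p)
    then show ?case using d[OF G.pr.diag.y[OF y G.pr.diag.unit]]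
      unfolding G.pr.y_u(1)[OF y] G.rho_S_y by simp
  next
    case (E k a d')
    then show ?case using d[OF G.pr.diag.E[OF E G.pr.diag.unit]]
      unfolding G.pr.E_u(1)[OF E] G.rho_S_E by simp
  next
    case (Psi p)
    have "(G.PP p, \<rho>T (\<psi> p)) \<in> ?L"
      using cf.normal_words_span[OF G.pr.diag.unit, of "[p]"] Psi G.pr.P_u(2)[OF Psi] by simp
    then show ?case unfolding G.rho_S_Psi .
  next
    case (add f g f' g')
    from cf.lspan_add[OF add.IH] show ?case by (simp add: G.add T.add)
  next
    case (mult f g f' g')
    from cf.lspan_mult[OF mult.IH] show ?case by (simp add: G.mult T.mult times_prod_def)
  next
    case (scal f g c)
    from k[OF scal.IH, of c] show ?case by (simp add: G.scal T.scal times_prod_def)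
  qed
  moreover have "G.\<rho> f = 0"
    using ker[of f] theta_carrier[OF assms(1)] assms(2)
    by (intro alg_hom.kills_Rideal[OF G.rho_hom _ klr_rels_carrier G.rho_kills]) auto
  ultimately have "G.T.u * \<rho>T g = 0" using G.kernel_transfer[of "(G.\<rho> f, \<rho>T g)"] by simp
  then show ?thesis unfolding Tu by simp
qed

lemma cls_facts:
  "f \<in> DR ==> f' \<in> DR ==> cls f = cls f' \<longleftrightarrow> \<rho> f = \<rho> f'"
  "zero SA = cls 0" "one SA = cls U"
  "f \<in> DR ==> f' \<in> DR ==> add SA (cls f) (cls f') = cls (f + f')"
  "f \<in> DR ==> f' \<in> DR ==> mult SA (cls f) (cls f') = cls (f * f')"
  "f \<in> DR ==> c \<odot>\<^bsub>SA\<^esub> cls f = cls (scal c * f)"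
proof -
  note p = presented_class[OF klr_rels_carrier[of "ext_index N" "ext_form B" t n]]
  note defs = S_alg_def Let_def generated_alg_def tilde_R_def klr_alg_def R_class_def klr_class_def n_eq[symmetric]
  show "cls f = cls f' \<longleftrightarrow> \<rho> f = \<rho> f'" if "f \<in> DR" "f' \<in> DR"
    using p(7)[of f f'] ker[of "f - f'"] carrier_closed(6)[OF that] by (simp add: defs del: free_alg_simps(1))
  show "zero SA = cls 0" "one SA = cls U" using p(2) by (simp_all add: defs)
  show "add SA (cls f) (cls f') = cls (f + f')" "mult SA (cls f) (cls f') = cls (f * f')" if "f \<in> DR" "f' \<in> DR"
    using p(4,5)[OF that] by (simp_all add: defs)
  show "c \<odot>\<^bsub>SA\<^esub> cls f = cls (scal c * f)" if "f \<in> DR"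
    using p(6)[OF that] by (simp add: defs)
qed

lemma carrier_S: "carrier SA = cls ` {f. \<exists>g. \<theta> f g}"
proof -
  define X where "X = {cls (S_e N lam i) | i. i \<in> Sq}
        \<union> {cls (\<Sum>i\<in>Sq. S_y N lam p i) | p. p < rr}
        \<union> {cls (\<Sum>i\<in>Sq. S_E N lam k a d i) | k a d. k < length lam \<and> a \<in> {1..N} \<and> d \<in> {1..(lam ! k) a}}
        \<union> {cls (\<Sum>i\<in>Sq. S_Psi N lam p i) | p. Suc p < rr}"
  let ?R = "tilde_R N B t n"
  have S: "carrier SA = subalg_span ?R X" "zero SA = zero ?R" "add SA = add ?R" "mult SA = mult ?R"
      "(\<odot>\<^bsub>SA\<^esub>) = (\<odot>\<^bsub>?R\<^esub>)"
    by (simp_all add: S_alg_def Let_def generated_alg_def X_def n_eq[symmetric])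
  note ops = cls_facts(2,4,5,6)[unfolded S(2-5)]
  have DR: "f \<in> DR" if "\<theta> f g" for f g using theta_carrier[OF that] by simp
  have "a \<in> cls ` {f. \<exists>g. \<theta> f g}" if "a \<in> subalg_span ?R X" for a
    using that
  proof (induction rule: subalg_span.induct)
    case zero
    show ?case unfolding ops(1) using \<theta>.zero by blast
  next
    case (incl x)
    then show ?case unfolding X_def
      by (elim UnE CollectE exE conjE; hypsubst; intro imageI CollectI; blast intro: \<theta>.e \<theta>.y \<theta>.E \<theta>.Psi)
  next
    case (add x y)
    then obtain f g f' g' where f: "\<theta> f g" "x = cls f" "\<theta> f' g'" "y = cls f'" by blast
    then show ?case using \<theta>.add[OF f(1,3)] ops(2)[OF DR[OF f(1)] DR[OF f(3)]] by blast
  next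
    case (mult x y)
    then obtain f g f' g' where f: "\<theta> f g" "x = cls f" "\<theta> f' g'" "y = cls f'" by blast
    then show ?case using \<theta>.mult[OF f(1,3)] ops(3)[OF DR[OF f(1)] DR[OF f(3)]] by blast
  next
    case (smult x c)
    then obtain f g where f: "\<theta> f g" "x = cls f" by blast
    then show ?case using \<theta>.scal[OF f(1)] ops(4)[OF DR[OF f(1)]] by blast
  qed
  moreover have "cls f \<in> subalg_span ?R X" if "\<theta> f g" for f g
    using that
  proof (induction rule: \<theta>.induct)
    case zero
    show ?case unfolding ops(1)[symmetric] by (rule subalg_span.zero)
  next
    case one
    \<comment> \<open>The unit is not among the listed generators; it is obtained by adding up the
      idempotents.\<close>
    have "cls (\<Sum>i\<in>A. S_e N lam i) \<in> subalg_span ?R X" if "A \<subseteq> Sq" for A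
      using finite_subset[OF that finite_Seq] that
    proof (induction A rule: finite_induct)
      case empty
      show ?case unfolding sum.empty ops(1)[symmetric] by (rule subalg_span.zero)
    next
      case (insert i A)
      have c: "S_e N lam i \<in> DR" "(\<Sum>i\<in>A. S_e N lam i) \<in> DR"
        using insert.prems by (auto intro!: carrier_sum S_e_carrier simp del: free_alg_simps(1))
      have "cls (S_e N lam i) \<in> subalg_span ?R X"
        using insert.prems by (intro subalg_span.incl) (auto simp: X_def)
      from subalg_span.add[OF this insert.IH] insert.prems show ?case
        unfolding sum.insert[OF insert.hyps] ops(2)[OF c, symmetric] by blast
    qed
    then show ?case by blast
  next
    case (add f g f' g')
    from subalg_span.add[OF add.IH] show ?case unfolding ops(2)[OF DR[OF add.hyps(1)] DR[OF add.hyps(2)]] .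
  next
    case (mult f g f' g')
    from subalg_span.mult[OF mult.IH] show ?case unfolding ops(3)[OF DR[OF mult.hyps(1)] DR[OF mult.hyps(2)]] .
  next
    case (scal f g c)
    from subalg_span.smult[OF scal.IH, of c] show ?case unfolding ops(4)[OF DR[OF scal.hyps]] .
  next
    case (e i)
    then show ?case by (intro subalg_span.incl) (unfold X_def, blast)
  next
    case (y p)
    then show ?case by (intro subalg_span.incl) (unfold X_def, blast)
  next
    case (E k a d)
    then show ?case by (intro subalg_span.incl) (unfold X_def, blast)
  next
    case (Psi p)
    then show ?case by (intro subalg_span.incl) (unfold X_def, blast)
  qed
  ultimately show ?thesis unfolding S(1) by blast
qed

lemma ring_S: "ring SA"
proof (rule ring_of_representatives[OF carrier_S cls_facts(2,3)])
  show "cls (U * f) = cls f" "cls (f * U) = cls f" if m: "f \<in> {f. \<exists>g. \<theta> f g}" for f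
  proof -
    obtain g where f: "\<theta> f g" using m by blast
    have c: "U * f \<in> DR" "f * U \<in> DR" "f \<in> DR"
      using theta_carrier[OF \<theta>.mult[OF \<theta>.one f]] theta_carrier[OF \<theta>.mult[OF f \<theta>.one]] theta_carrier[OF f] by blast+
    show "cls (U * f) = cls f" "cls (f * U) = cls f"
      unfolding cls_facts(1)[OF c(1,3)] cls_facts(1)[OF c(2,3)]
      using theta_unit[OF f] unfolding rho_mult rho_U by blast+
  qed
  have D: "f \<in> DR" if "f \<in> {f. \<exists>g. \<theta> f g}" for f
    using that theta_carrier by blast
  show "cls f \<oplus>\<^bsub>SA\<^esub> cls g = cls (f + g)" "cls f \<otimes>\<^bsub>SA\<^esub> cls g = cls (f * g)"
    if "f \<in> {f. \<exists>g. \<theta> f g}" "g \<in> {f. \<exists>g. \<theta> f g}" for f g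
    by (rule cls_facts(4)[OF D[OF that(1)] D[OF that(2)]], rule cls_facts(5)[OF D[OF that(1)] D[OF that(2)]])
  show "f + g \<in> {f. \<exists>g. \<theta> f g}" if "f \<in> {f. \<exists>g. \<theta> f g}" "g \<in> {f. \<exists>g. \<theta> f g}" for f g
  proof -
    obtain f' g' where "\<theta> f f'" "\<theta> g g'" using \<open>f \<in> _\<close> \<open>g \<in> _\<close> by blast
    from \<theta>.add[OF this] show ?thesis by (intro CollectI exI)
  qed
  show "f * g \<in> {f. \<exists>g. \<theta> f g}" if "f \<in> {f. \<exists>g. \<theta> f g}" "g \<in> {f. \<exists>g. \<theta> f g}" for f g
  proof -
    obtain f' g' where "\<theta> f f'" "\<theta> g g'" using \<open>f \<in> _\<close> \<open>g \<in> _\<close> by blast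
    from \<theta>.mult[OF this] show ?thesis by (intro CollectI exI)
  qed
  show "- f \<in> {f. \<exists>g. \<theta> f g}" if "f \<in> {f. \<exists>g. \<theta> f g}" for f
  proof -
    obtain f' where "\<theta> f f'" using \<open>f \<in> _\<close> by blast
    from theta_minus[OF this] show ?thesis by (intro CollectI exI)
  qed
  show "0 \<in> {f. \<exists>g. \<theta> f g}" by (intro CollectI exI, rule \<theta>.zero)
  show "U \<in> {f. \<exists>g. \<theta> f g}" by (intro CollectI exI, rule \<theta>.one)
qed

abbreviation "JG \<equiv> {cls (\<Sum>i\<in>Sq. S_E N lam k a d i) | k a d. k < length lam \<and> a \<in> {1..N} \<and> d \<in> {1..(lam ! k) a}}
        \<union> {cls (S_e N lam i) | i. i \<in> Sq \<and> i \<noteq> [] \<and> is_solid (i ! 0)}"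

lemma JJ_def: "JJ = Idl\<^bsub>SA\<^esub> JG"
  by (simp add: S_ideal_def Let_def n_eq[symmetric])

lemma JG_carrier: "JG \<subseteq> carrier SA"
  unfolding carrier_S
  by (intro subsetI; elim UnE CollectE exE conjE; hypsubst; intro imageI CollectI; blast intro: \<theta>.E \<theta>.e)

lemma ideal_J: "ideal JJ SA"
  unfolding JJ_def by (rule ring.genideal_ideal[OF ring_S JG_carrier])

lemma JG_J: "JG \<subseteq> JJ"
  unfolding JJ_def by (rule ring.genideal_self[OF ring_S JG_carrier])

text \<open>The ideal as a predicate on the ring of the model, where calculations with classes
  become calculations with ring operations.\<close>

definition "inJ x \<longleftrightarrow> (\<exists>f g. \<theta> f g \<and> x = \<rho> f \<and> cls f \<in> JJ)"

lemma inJI: "\<theta> f g ==> cls f \<in> JJ ==> inJ (\<rho> f)"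
  unfolding inJ_def by blast

lemma inJ_cls: "\<theta> f g ==> inJ (\<rho> f) ==> cls f \<in> JJ"
  unfolding inJ_def using cls_facts(1) theta_carrier by metis

lemma inJ_0: "inJ 0"
proof -
  interpret ideal JJ SA by (rule ideal_J)
  have "cls 0 \<in> JJ" using additive_subgroup.zero_closed[OF is_additive_subgroup] by (simp add: cls_facts(2))
  then show ?thesis unfolding inJ_def using \<theta>.zero rho_zero by metis
qed

lemma inJ_add:
  assumes "inJ x" "inJ y"
  shows "inJ (x + y)"
proof -
  interpret ideal JJ SA by (rule ideal_J)
  obtain f g f' g' where f: "\<theta> f g" "x = \<rho> f" "cls f \<in> JJ" "\<theta> f' g'" "y = \<rho> f'" "cls f' \<in> JJ"
    using assms unfolding inJ_def by blast
  have D: "f \<in> DR" "f' \<in> DR" using theta_carrier[OF f(1)] theta_carrier[OF f(4)] by blast+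
  have "cls (f + f') \<in> JJ"
    unfolding cls_facts(4)[OF D, symmetric] by (rule additive_subgroup.a_closed[OF is_additive_subgroup f(3,6)])
  from inJI[OF \<theta>.add[OF f(1,4)] this] show ?thesis unfolding f(2,5) rho_add .
qed

lemma inJ_mult:
  assumes "inJ x" "\<theta> h g"
  shows "inJ (\<rho> h * x)" "inJ (x * \<rho> h)"
proof -
  interpret ideal JJ SA by (rule ideal_J)
  obtain f g' where f: "\<theta> f g'" "x = \<rho> f" "cls f \<in> JJ" using assms(1) unfolding inJ_def by blast
  have h: "cls h \<in> carrier SA" unfolding carrier_S using assms(2) by blast
  have D: "f \<in> DR" "h \<in> DR" using theta_carrier[OF f(1)] theta_carrier[OF assms(2)] by blast+
  have "cls (h * f) \<in> JJ"
    unfolding cls_facts(5)[OF D(2,1), symmetric] by (rule I_l_closed[OF f(3) h])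
  from inJI[OF \<theta>.mult[OF assms(2) f(1)] this] show "inJ (\<rho> h * x)" unfolding f(2) rho_mult .
  have "cls (f * h) \<in> JJ"
    unfolding cls_facts(5)[OF D, symmetric] by (rule I_r_closed[OF f(3) h])
  from inJI[OF \<theta>.mult[OF f(1) assms(2)] this] show "inJ (x * \<rho> h)" unfolding f(2) rho_mult .
qed

lemma inJ_kappa: "inJ x ==> inJ (\<kappa> c * x)"
proof -
  assume x: "inJ x"
  then obtain f g where f: "\<theta> f g" "x = \<rho> f" unfolding inJ_def by blast
  \<comment> \<open>An ideal of the ring is closed under scalars because a scalar acts as
    multiplication by that multiple of the unit of \<open>S\<close>.\<close>
  have "\<rho> (scal c * U) * x = \<kappa> c * (ts.u * x)" by (simp only: rho_scal rho_U mult.assoc)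
  also have "\<dots> = \<kappa> c * x" using theta_unit[OF f(1)] f(2) by simp
  finally have eq: "\<rho> (scal c * U) * x = \<kappa> c * x" .
  from inJ_mult(1)[OF x \<theta>.scal[OF \<theta>.one, of c]] show ?thesis unfolding eq .
qed

lemma inJ_minus: "inJ x ==> inJ (- x)"
  using inJ_kappa[of x "- 1"] by (simp add: kappa_uminus kappa_one)

lemma inJ_diff: "inJ x ==> inJ y ==> inJ (x - y)"
  using inJ_add[OF _ inJ_minus, of x y] by simp

lemma inJ_sum: "(\<And>a. a \<in> A ==> inJ (F a)) ==> inJ (sum F A)"
  by (induction A rule: infinite_finite_induct) (auto intro: inJ_0 inJ_add)

lemma inJ_sign: "inJ x ==> inJ ((- 1) ^ d * x)"
  by (induction d) (auto simp: mult.assoc intro: inJ_minus)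

lemma inJ_EE: "k < length lam ==> a \<in> {1..N} ==> d \<in> {1..(lam ! k) a} ==> inJ (EE k a d)"
  unfolding rho_S_E[symmetric] by (rule inJI[OF \<theta>.E]) (use JG_J in blast)+

lemma inJ_se: "i \<in> Sq ==> i \<noteq> [] ==> is_solid (i ! 0) ==> inJ (se i)"
  unfolding rho_S_e[symmetric] by (rule inJI[OF \<theta>.e]) (use JG_J in blast)+

fun \<gamma> :: "entry gens => 'r" where
  "\<gamma> (Idemp i) = (if i \<in> Sq then se i else 0)"
| "\<gamma> (Dot p) = (if p < rr then yy p else 0)"
| "\<gamma> (Cross p) = (if Suc p < rr then PP p else 0)"

text \<open>The inverse up to \<open>J\<close>: generators of \<open>T\<close> go to their
  counterparts in \<open>S\<close>, which satisfy Webster's relations modulo \<open>J\<close>.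
  Generators outside the presentation go to 0, which keeps the unit laws of
  \<open>free_eval\<close>.\<close>

definition "\<eta> = free_eval \<kappa> ts.u \<gamma>"

lemma eta_hom: "gens_hom \<eta> \<kappa>" and eta_gen: "\<eta> (gen x) = \<gamma> x" and eta_one: "\<eta> 1 = ts.u"
proof -
  have kg: "\<kappa> c * \<gamma> g = \<gamma> g * \<kappa> c" for c g
    by (cases g) (simp_all add: ts.kappa_e ts.kappa_y ts.kappa_P)
  have ug: "ts.u * \<gamma> g = \<gamma> g" "\<gamma> g * ts.u = \<gamma> g" for g
    by (cases g; simp add: ts.e_u ts.y_u ts.P_u)+
  note e = free_eval_alg_hom[of \<kappa> ts.u \<gamma>, OF kappa_one kappa_add kappa_mult ts.kappa_u kg
      ts.u_diag[OF ts.diag.unit] ug, folded \<eta>_def]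
  show "gens_hom \<eta> \<kappa>" by (rule gens_hom.intro[OF e(1)])
  show "\<eta> (gen x) = \<gamma> x" by (rule e(2))
  show "\<eta> 1 = ts.u" by (rule e(3))
qed

end

section \<open>The inverse map modulo the ideal\<close>

sublocale comparison \<subseteq> H: gens_hom \<eta> \<kappa>
  by (rule eta_hom)

context comparison
begin

text \<open>A discrepancy arises only where some \<open>E k a d\<close>, matched with 0, has been
  used, and this lies in \<open>J\<close>. The second claim, that \<open>\<eta> g\<close> comes from
  \<open>S\<close>, serves the product step, where one factor is replaced at a time.\<close>

lemma theta_eta: "\<theta> f g ==> inJ (\<rho> f - \<eta> g) \<and> (\<exists>h k. \<theta> h k \<and> \<rho> h = \<eta> g)"
proof (induction rule: \<theta>.induct)
  case zero
  show ?case using inJ_0 \<theta>.zero by (auto intro!: exI[of _ 0])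
next
  case one
  show ?case using inJ_0 \<theta>.one rho_U eta_one by (metis diff_self)
next
  case (e i)
  then have "\<eta> (\<e> i) = \<rho> (S_e N lam i)" by (simp add: eta_gen rho_S_e)
  then show ?case using inJ_0 \<theta>.e[OF e] by (metis diff_self)
next
  case (y p)
  then have "\<eta> (\<x> p) = \<rho> (\<Sum>i\<in>Sq. S_y N lam p i)" by (simp only: eta_gen rho_S_y \<gamma>.simps if_True)
  then show ?case using inJ_0 \<theta>.y[OF y] by (metis diff_self)
next
  case (E k a d)
  then show ?case using inJ_EE[OF E] \<theta>.zero unfolding rho_S_E by (auto intro!: exI[of _ 0])
next
  case (Psi p)
  then have "\<eta> (\<psi> p) = \<rho> (\<Sum>i\<in>Sq. S_Psi N lam p i)" by (simp only: eta_gen rho_S_Psi \<gamma>.simps if_True)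
  then show ?case using inJ_0 \<theta>.Psi[OF Psi] by (metis diff_self)
next
  case (add f g f' g')
  obtain h k h' k' where h: "\<theta> h k" "\<rho> h = \<eta> g" "\<theta> h' k'" "\<rho> h' = \<eta> g'" using add.IH by blast
  have "\<rho> (f + f') - \<eta> (g + g') = (\<rho> f - \<eta> g) + (\<rho> f' - \<eta> g')"
    by (simp add: rho_add H.add)
  moreover have "\<rho> (h + h') = \<eta> (g + g')" by (simp add: rho_add H.add h)
  ultimately show ?case using inJ_add add.IH \<theta>.add[OF h(1,3)] by metis
next
  case (mult f g f' g')
  obtain h k h' k' where h: "\<theta> h k" "\<rho> h = \<eta> g" "\<theta> h' k'" "\<rho> h' = \<eta> g'" using mult.IH by blast
  have "\<rho> (f * f') - \<eta> (g * g') = (\<rho> f - \<eta> g) * \<rho> f' + \<rho> h * (\<rho> f' - \<eta> g')"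
    by (simp add: rho_mult H.mult h left_diff_distrib right_diff_distrib)
  moreover have "inJ ((\<rho> f - \<eta> g) * \<rho> f' + \<rho> h * (\<rho> f' - \<eta> g'))"
    using mult.IH by (intro inJ_add inJ_mult(2)[OF _ mult.hyps(2)] inJ_mult(1)[OF _ h(1)]) simp_all
  moreover have "\<rho> (h * h') = \<eta> (g * g')" by (simp add: rho_mult H.mult h)
  ultimately show ?case using \<theta>.mult[OF h(1,3)] by metis
next
  case (scal f g c)
  obtain h k where h: "\<theta> h k" "\<rho> h = \<eta> g" using scal.IH by blast
  have "\<rho> (scal c * f) - \<eta> (scal c * g) = \<kappa> c * (\<rho> f - \<eta> g)"
    by (simp add: rho_scal H.scal right_diff_distrib)
  moreover have "\<rho> (scal c * h) = \<eta> (scal c * g)" by (simp add: rho_scal H.scal h)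
  ultimately show ?case using inJ_kappa scal.IH \<theta>.scal[OF h(1)] by metis
qed

lemma eta_image: "g \<in> DT ==> \<exists>h k. \<theta> h k \<and> \<rho> h = \<eta> g"
  using theta_total theta_eta by blast

lemma inJ_EE_eta:
  assumes "k < length lam" "a \<in> {1..N}" "d \<in> {1..(lam ! k) a}" "g \<in> DT"
  shows "inJ ((- 1) ^ d * EE k a d * \<eta> g)"
proof -
  obtain h k' where h: "\<theta> h k'" "\<rho> h = \<eta> g" using eta_image[OF assms(4)] by blast
  show ?thesis using inJ_sign[OF inJ_mult(2)[OF inJ_EE[OF assms(1-3)] h(1)], of d] by (simp add: h(2) mult.assoc)
qed

lemma eta_gens: "i \<in> Sq ==> \<eta> (\<e> i) = se i" "p < rr ==> \<eta> (\<x> p) = yy p" "Suc p < rr ==> \<eta> (\<psi> p) = PP p"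
  by (simp_all add: eta_gen)

text \<open>All terms of the deformed power except the leading one contain some
  \<open>E k a d\<close>, and \<open>J\<close> absorbs the remaining factors because they come from
  \<open>S\<close>.\<close>

lemma inJ_gam:
  assumes "k < length lam" "a \<in> {1..N}" "i \<in> Sq" "p < rr"
  shows "inJ (gam (\<lambda>d. if d = 0 then 1 else EE k a d) ((lam ! k) a) (yy p) * se i - yy p ^ (lam ! k) a * se i)"
proof -
  let ?m = "(lam ! k) a"
  have "\<eta> (\<x> p ^ c * \<e> i) = yy p ^ c * se i" for c by (simp add: H.power_mult eta_gens assms)
  moreover have "\<x> p ^ c * \<e> i \<in> DT" for c
    using assms by (auto intro!: free_carrier simp del: free_alg_simps(1))
  ultimately have J: "inJ ((- 1) ^ d * EE k a d * (yy p ^ c * se i))" if "d \<in> {1..?m}" for c d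
    using inJ_EE_eta[OF assms(1,2) that] by metis
  have "gam (\<lambda>d. if d = 0 then 1 else EE k a d) ?m (yy p) * se i - yy p ^ ?m * se i
      = (\<Sum>d<?m. (- 1) ^ Suc d * EE k a (Suc d) * (yy p ^ (?m - Suc d) * se i))"
    unfolding gam_def sum.atMost_shift by (simp add: distrib_right sum_distrib_right mult.assoc)
  also have "inJ \<dots>" by (intro inJ_sum J) auto
  finally show ?thesis .
qed

lemma inJ_dgam:
  assumes "k < length lam" "a \<in> {1..N}" "i \<in> Sq" "p < rr" "q < rr"
  shows "inJ (dgam (\<lambda>d. if d = 0 then 1 else EE k a d) ((lam ! k) a) (yy p) (yy q) * se i - hsum ((lam ! k) a) (yy p) (yy q) * se i)"
proof -
  let ?m = "(lam ! k) a"
  have "\<eta> (hsum c (\<x> p) (\<x> q) * \<e> i) = hsum c (yy p) (yy q) * se i" for c by (simp add: H.rho_hsum eta_gens assms)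
  moreover have "hsum c (\<x> p) (\<x> q) * \<e> i \<in> DT" for c
    using assms by (auto simp: hsum_def intro!: free_carrier simp del: free_alg_simps(1))
  ultimately have J: "inJ ((- 1) ^ d * EE k a d * (hsum c (yy p) (yy q) * se i))" if "d \<in> {1..?m}" for c d
    using inJ_EE_eta[OF assms(1,2) that] by metis
  have "dgam (\<lambda>d. if d = 0 then 1 else EE k a d) ?m (yy p) (yy q) * se i - hsum ?m (yy p) (yy q) * se i
      = (\<Sum>d<?m. (- 1) ^ Suc d * EE k a (Suc d) * (hsum (?m - Suc d) (yy p) (yy q) * se i))"
    unfolding dgam_def sum.atMost_shift by (simp add: distrib_right sum_distrib_right mult.assoc)
  also have "inJ \<dots>" by (intro inJ_sum J) auto
  finally show ?thesis .
qed

text \<open>Most relations hold exactly in \<open>S\<close>. Those with a deformed power or its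
  divided difference use the elementary symmetric functions in \<open>J\<close>, and the violating
  relation uses the idempotents in \<open>J\<close>.\<close>

lemma inJ_rels:
  assumes "r \<in> T_rels B lam nu"
  shows "inJ (\<eta> r)"
  using assms
proof cases
  case unit
  then have "\<eta> r = 0" by (simp add: eta_one eta_gens ts.u_def)
  then show ?thesis using inJ_0 by simp
next
  case (idem i j)
  then have "\<eta> r = 0" using ts.e_e[of i j] by (auto simp: H.mult eta_gens)
  then show ?thesis using inJ_0 by simp
next
  case (dot_idem i p)
  then have "\<eta> r = 0" using ts.y_e[of i p] by (simp add: H.mult eta_gens Seq_length)
  then show ?thesis using inJ_0 by simp
next
  case (dot_dot p q)
  then have "\<eta> r = 0" using ts.y_y[of p q] by (simp add: H.mult eta_gens)
  then show ?thesis using inJ_0 by simp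
next
  case (dot_red i p)
  then have "\<eta> r = 0" using ts.y_red[of i p] by (simp add: H.mult eta_gens Seq_length)
  then show ?thesis using inJ_0 by simp
next
  case (cross_red i p)
  then have "\<eta> r = 0" using ts.P_red[of i p] by (simp add: H.mult eta_gens Seq_length)
  then show ?thesis using inJ_0 by simp
next
  case (cross_idem i p)
  then have "\<eta> r = 0" using ts.P_e[of i p] Seq_swap[of i lam nu p] by (simp add: H.mult eta_gens Seq_length)
  then show ?thesis using inJ_0 by simp
next
  case (cross_dot_far p q)
  then have "\<eta> r = 0" using ts.P_y[of p q] by (simp add: H.mult eta_gens)
  then show ?thesis using inJ_0 by simp
next
  case (cross_cross_far p q)
  then have "\<eta> r = 0" using ts.P_P[of p q] ts.P_P[of q p] by (auto simp: H.mult eta_gens)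
  then show ?thesis using inJ_0 by simp
next
  case (slide_left i p)
  then have "\<eta> r = 0" using ts.slide_left[of i p] by (simp add: H.rho_slide eta_gens Seq_length)
  then show ?thesis using inJ_0 by simp
next
  case (slide_right i p)
  then have "\<eta> r = 0" using ts.slide_right[of i p] by (simp add: H.rho_slide eta_gens Seq_length)
  then show ?thesis using inJ_0 by simp
next
  case (square_black i p a b)
  then have "\<eta> r = 0" using ts.square_black[of i p a b]
    unfolding square_black(1) H.diff H.rho_square H.rho_Q_poly by (simp add: eta_gens Seq_length)
  then show ?thesis using inJ_0 by simp
next
  case (square_black_red i p a k)
  have p: "p < rr" "Suc p < rr" "p < length i" using square_black_red Seq_length by auto
  have eta: "\<eta> r = gam (\<lambda>d. if d = 0 then 1 else EE k a d) ((lam ! k) a) (yy p) * se i - yy p ^ (lam ! k) a * se i"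
    using ts.square_black_red[of i p a k] square_black_red(2-) p
    unfolding square_black_red(1) H.diff H.power_mult by (simp add: eta_gens power2_eq_square)
  have l: "p < length i" "Suc p < length i" using square_black_red(3) by auto
  have r1: "a \<in> {1..N}" by (rule ts.entry_range(1)[OF square_black_red(2) l(1) nu_set square_black_red(4)])
  have r2: "k < length lam" by (rule ts.entry_range(2)[OF square_black_red(2) l(2) nu_set square_black_red(5)])
  show ?thesis unfolding eta by (rule inJ_gam[OF r2 r1 square_black_red(2) p(1)])
next
  case (square_red_black i p k a)
  have p: "p < rr" "Suc p < rr" "p < length i" using square_red_black Seq_length by auto
  have eta: "\<eta> r = gam (\<lambda>d. if d = 0 then 1 else EE k a d) ((lam ! k) a) (yy (Suc p)) * se i - yy (Suc p) ^ (lam ! k) a * se i"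
    using ts.square_red_black[of i p k a] square_red_black(2-) p
    unfolding square_red_black(1) H.diff H.power_mult by (simp add: eta_gens power2_eq_square)
  have l: "p < length i" "Suc p < length i" using square_red_black(3) by auto
  have r1: "a \<in> {1..N}" by (rule ts.entry_range(1)[OF square_red_black(2) l(2) nu_set square_red_black(5)])
  have r2: "k < length lam" by (rule ts.entry_range(2)[OF square_red_black(2) l(1) nu_set square_red_black(4)])
  show ?thesis unfolding eta by (rule inJ_gam[OF r2 r1 square_red_black(2) p(2)])
next
  case (braid_black i p a b)
  then have "\<eta> r = 0" using ts.braid_black[of i p a b]
    unfolding braid_black(1) H.diff H.rho_braid H.rho_Q_quot by (simp add: eta_gens Seq_length)
  then show ?thesis using inJ_0 by simp
next
  case (braid_red i p a k)
  have p: "p < rr" "Suc p < rr" "Suc (Suc p) < rr" "p < length i" "Suc p < length i" using braid_red Seq_length by auto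
  have eta: "\<eta> r = dgam (\<lambda>d. if d = 0 then 1 else EE k a d) ((lam ! k) a) (yy p) (yy (Suc (Suc p))) * se i
      - hsum ((lam ! k) a) (yy p) (yy (Suc (Suc p))) * se i"
    using ts.braid_red[of i p a k] braid_red(2-) p
    unfolding braid_red(1) H.diff H.rho_braid H.rho_hsum by (simp add: eta_gens)
  have l: "p < length i" "Suc p < length i" using braid_red(3) by auto
  have r1: "a \<in> {1..N}" by (rule ts.entry_range(1)[OF braid_red(2) l(1) nu_set braid_red(4)])
  have r2: "k < length lam" by (rule ts.entry_range(2)[OF braid_red(2) l(2) nu_set braid_red(5)])
  show ?thesis unfolding eta by (rule inJ_dgam[OF r2 r1 braid_red(2) p(1,3)])
next
  case (braid_plain i p)
  then have "\<eta> r = 0" using ts.braid_plain[of i p]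
    unfolding braid_plain(1) H.rho_braid by (simp add: eta_gens Seq_length)
  then show ?thesis using inJ_0 by simp
next
  case (cyclotomic i)
  then show ?thesis using inJ_se[of i] by (simp add: eta_gens)
qed

lemma inJ_eta:
  assumes "g \<in> Rideal GT (T_rels B lam nu)"
  shows "inJ (\<eta> g)"
  using assms T_rels_carrier inJ_rels
proof (rule Rideal_minimal[where P = "\<lambda>g. inJ (\<eta> g)"])
  show "inJ (\<eta> (f * g)) \<and> inJ (\<eta> (g * f))" if "f \<in> DT" "g \<in> DT" "inJ (\<eta> f)" for f g
  proof -
    obtain h k where h: "\<theta> h k" "\<rho> h = \<eta> g" using eta_image[OF \<open>g \<in> DT\<close>] by blast
    show ?thesis using inJ_mult[OF that(3) h(1)] by (simp add: H.mult h(2))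
  qed
qed (simp_all add: inJ_0 inJ_diff del: free_alg_simps(1))

lemma clT_facts:
  "g \<in> DT ==> g' \<in> DT ==> clT g = clT g' \<longleftrightarrow> \<rho>T (g - g') = 0"
  "carrier TA = clT ` DT" "zero TA = clT 0" "one TA = clT 1"
  "g \<in> DT ==> g' \<in> DT ==> add TA (clT g) (clT g') = clT (g + g')"
  "g \<in> DT ==> g' \<in> DT ==> mult TA (clT g) (clT g') = clT (g * g')"
  "g \<in> DT ==> c \<odot>\<^bsub>TA\<^esub> clT g = clT (scal c * g)"
proof -
  note p = presented_class[OF T_rels_carrier[of B lam nu], folded T_alg_def]
  show "clT g = clT g' \<longleftrightarrow> \<rho>T (g - g') = 0" if "g \<in> DT" "g' \<in> DT"
    using p(7)[of g g'] kerT[OF carrier_closed(6)[OF that]] by blast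
  show "carrier TA = clT ` DT" "zero TA = clT 0" "one TA = clT 1" by (rule p(1), rule p(2), rule p(3))
  show "g \<in> DT ==> g' \<in> DT ==> add TA (clT g) (clT g') = clT (g + g')" by (rule p(4))
  show "g \<in> DT ==> g' \<in> DT ==> mult TA (clT g) (clT g') = clT (g * g')" by (rule p(5))
  show "g \<in> DT ==> c \<odot>\<^bsub>TA\<^esub> clT g = clT (scal c * g)" by (rule p(6))
qed

text \<open>\<open>h\<close> sends the class of \<open>f\<close> to the class of a matched
  \<open>g\<close>, and \<open>kernel_T\<close> makes the choice irrelevant. Its kernel contains the
  generators of \<open>J\<close>. Conversely, if \<open>g\<close> vanishes in \<open>T\<close>, then
  \<open>\<eta> g\<close> lies in \<open>J\<close>, and \<open>f\<close> differs from it by an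
  element of \<open>J\<close>.\<close>

theorem isomorphic: "alg_isomorphic (S_bar N B t lam nu) TA"
proof -
  define h where "h x = clT (SOME g. \<exists>f. \<theta> f g \<and> x = cls f)" for x
  have h: "h (cls f) = clT g" if fg: "\<theta> f g" for f g
  proof -
    have "\<exists>f'. \<theta> f' (SOME g. \<exists>f'. \<theta> f' g \<and> cls f = cls f') \<and> cls f = cls f'"
      by (rule someI_ex[of "\<lambda>g. \<exists>f'. \<theta> f' g \<and> cls f = cls f'"]) (use fg in blast)
    then obtain f' g' where f': "\<theta> f' g'" "cls f = cls f'" "h (cls f) = clT g'" unfolding h_def by blast
    have "\<rho> (f' - f) = 0"
      using cls_facts(1)[of f f'] f'(2) theta_carrier[OF f'(1)] theta_carrier[OF fg] by simp
    from kernel_T[OF theta_diff[OF f'(1) fg] this]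
    show ?thesis using clT_facts(1)[of g' g] theta_carrier[OF f'(1)] theta_carrier[OF fg] f'(3) by blast
  qed
  have DR: "f \<in> DR" "g \<in> DT" if "\<theta> f g" for f g using theta_carrier[OF that] by blast+
  have hom: "h \<in> ring_hom SA TA"
  proof (rule ring_hom_memI)
    show "h x \<in> carrier TA" if "x \<in> carrier SA" for x
      using that h DR(2) unfolding carrier_S clT_facts(2) by blast
    fix x y assume "x \<in> carrier SA" "y \<in> carrier SA"
    then obtain f g f' g' where f: "\<theta> f g" "x = cls f" "\<theta> f' g'" "y = cls f'" unfolding carrier_S by blast
    note D = DR[OF f(1)] DR[OF f(3)]
    show "h (x \<otimes>\<^bsub>SA\<^esub> y) = h x \<otimes>\<^bsub>TA\<^esub> h y"
      unfolding f(2,4) cls_facts(5)[OF D(1,3)] h[OF f(1)] h[OF f(3)] h[OF \<theta>.mult[OF f(1,3)]] clT_facts(6)[OF D(2,4)] ..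
    show "h (x \<oplus>\<^bsub>SA\<^esub> y) = h x \<oplus>\<^bsub>TA\<^esub> h y"
      unfolding f(2,4) cls_facts(4)[OF D(1,3)] h[OF f(1)] h[OF f(3)] h[OF \<theta>.add[OF f(1,3)]] clT_facts(5)[OF D(2,4)] ..
  next
    show "h (one SA) = one TA" unfolding cls_facts(3) clT_facts(4) by (rule h[OF \<theta>.one])
  qed
  have ringT: "ring TA" unfolding T_alg_def by (rule presented_alg_is_ring[OF T_rels_carrier])
  interpret hr: ring_hom_ring SA TA h by (rule ring_hom_ringI2[OF ring_S ringT hom])
  let ?K = "{x \<in> carrier SA. h x = zero TA}"
  have "JJ \<subseteq> ?K"
    unfolding JJ_def
  proof (rule ring.genideal_minimal[OF ring_S])
    show "ideal ?K SA" using hr.kernel_is_ideal unfolding a_kernel_def' .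
    have V: "h (cls (S_e N lam i)) = zero TA" if i: "i \<in> Sq" "i \<noteq> []" "is_solid (i ! 0)" for i
    proof -
      have D: "\<e> i \<in> DT" "0 \<in> DT" using DR(2)[OF \<theta>.e[OF i(1)]] DR(2)[OF \<theta>.zero] .
      show ?thesis unfolding h[OF \<theta>.e[OF i(1)]] clT_facts(3) clT_facts(1)[OF D]
        using T.kills[OF T_rels.cyclotomic[OF i]] by simp
    qed
    have E: "h (cls (\<Sum>i\<in>Sq. S_E N lam k a d i)) = zero TA"
      if "k < length lam" "a \<in> {1..N}" "d \<in> {1..(lam ! k) a}" for k a d
      unfolding clT_facts(3) by (rule h[OF \<theta>.E[OF that]])
    show "JG \<subseteq> ?K"
    proof (rule subsetI)
      fix x assume x: "x \<in> JG"
      from x have "h x = zero TA"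
        apply -
        apply (elim UnE CollectE exE conjE)
         apply (hypsubst, rule E, assumption+)
        apply (hypsubst, rule V, assumption+)
        done
      then show "x \<in> ?K" using subsetD[OF JG_carrier x] by (intro CollectI conjI)
    qed
  qed
  moreover have "?K \<subseteq> JJ"
  proof
    fix x assume x: "x \<in> ?K"
    then obtain f g where f: "\<theta> f g" "x = cls f" unfolding carrier_S by blast
    have "clT g = clT 0" using x h[OF f(1)] f(2) clT_facts(3) by simp
    then have "\<rho>T g = 0" using clT_facts(1)[OF DR(2)[OF f(1)] DR(2)[OF \<theta>.zero]] by simp
    then have "inJ (\<eta> g)" using kerT DR(2)[OF f(1)] by (intro inJ_eta) blast
    from inJ_add[OF conjunct1[OF theta_eta[OF f(1)]] this] have "inJ (\<rho> f)" by simp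
    then show "x \<in> JJ" unfolding f(2) by (rule inJ_cls[OF f(1)])
  qed
  ultimately have J: "JJ = ?K" by (rule subset_antisym)
  have surj: "h ` carrier SA = carrier TA"
  proof
    show "h ` carrier SA \<subseteq> carrier TA" using hom unfolding ring_hom_def by blast
    show "carrier TA \<subseteq> h ` carrier SA"
      unfolding clT_facts(2) carrier_S
    proof (rule image_subsetI)
      fix g assume "g \<in> DT"
      then obtain f where "\<theta> f g" using theta_total by blast
      then show "clT g \<in> h ` cls ` {f. \<exists>g. \<theta> f g}" using h[of f g] by (metis imageI mem_Collect_eq)
    qed
  qed
  show ?thesis
    unfolding S_bar_def
  proof (rule alg_isomorphicI[OF ring_S ringT hom surj J])
    fix c x assume "x \<in> carrier SA"
    then obtain f g where f: "\<theta> f g" "x = cls f" unfolding carrier_S by blast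
    have s: "c \<odot>\<^bsub>SA\<^esub> cls f = cls (scal c * f)" by (rule cls_facts(6)[OF DR(1)[OF f(1)]])
    show "c \<odot>\<^bsub>SA\<^esub> x \<in> carrier SA \<and> h (c \<odot>\<^bsub>SA\<^esub> x) = c \<odot>\<^bsub>TA\<^esub> h x"
      unfolding f(2) s h[OF f(1)] h[OF \<theta>.scal[OF f(1)]] clT_facts(7)[OF DR(2)[OF f(1)]] carrier_S
      by (intro conjI imageI CollectI exI refl, rule \<theta>.scal[OF f(1)])
  qed
qed

end

theorem theorem4p5:
  fixes N :: nat and B :: "nat \<Rightarrow> nat \<Rightarrow> int"
    and lam :: "(nat \<Rightarrow> nat) list" and nu :: "nat list"
    and t :: "lab \<Rightarrow> lab \<Rightarrow> 'k::field"
  assumes cartan: "cartan_datum N B"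
    and nu: "set nu \<subseteq> {1..N}"
    and nondegenerate: "nu = [] \<or> (\<forall>k<length lam. \<exists>a\<in>{1..N}. (lam ! k) a \<noteq> 0)"
    and scalars: "\<And>i j. i \<in> ext_index N \<Longrightarrow> j \<in> ext_index N \<Longrightarrow>
      t i j = (if \<exists>k\<in>{1..N}. i = Bar k \<and> j = Orig k then - 1 else 1)"
  shows "alg_isomorphic (S_bar N B t lam nu) (T_alg B lam nu :: ('k, _) module)"
proof -
  define n where "n = strands N lam nu"
  define GR where "GR = gens_over (words (ext_index N) n) n"
  define GT where "GT = gens_over (Seq lam nu) (length lam + length nu)"
  have c: "klr_rels (ext_index N) (ext_form B) t n \<subseteq> carrier (free_alg GR)"
    "(T_rels B lam nu :: (entry gens, 'k) free set) \<subseteq> carrier (free_alg GT)"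
    unfolding GR_def GT_def by (rule klr_rels_carrier T_rels_carrier)+
  \<comment> \<open>Faithful models of both presented algebras; faithfulness turns equations in the
    models into equations between classes.\<close>
  obtain \<rho> :: "(lab gens, 'k) free \<Rightarrow> (lab gens, 'k) free endo" and \<kappa> where R: "alg_hom \<rho> \<kappa>"
    "\<And>f. f \<in> carrier (free_alg GR) \<Longrightarrow> \<rho> f = 0 \<longleftrightarrow> f \<in> Rideal GR (klr_rels (ext_index N) (ext_form B) t n)"
  proof (rule presented_alg_model[OF c(1)])
    fix r :: "(lab gens, 'k) free \<Rightarrow> (lab gens, 'k) free endo" and \<kappa>
    assume m: "alg_hom r \<kappa>" "\<And>f. f \<in> carrier (free_alg GR) \<Longrightarrow> r f = 0 \<longleftrightarrow> f \<in> Rideal GR (klr_rels (ext_index N) (ext_form B) t n)"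
    show thesis by (rule that[OF m])
  qed
  obtain \<rho>T :: "(entry gens, 'k) free \<Rightarrow> (entry gens, 'k) free endo" and \<kappa>T where T: "alg_hom \<rho>T \<kappa>T"
    "\<And>f. f \<in> carrier (free_alg GT) \<Longrightarrow> \<rho>T f = 0 \<longleftrightarrow> f \<in> Rideal GT (T_rels B lam nu)"
  proof (rule presented_alg_model[OF c(2)])
    fix r :: "(entry gens, 'k) free \<Rightarrow> (entry gens, 'k) free endo" and \<kappa>
    assume m: "alg_hom r \<kappa>" "\<And>f. f \<in> carrier (free_alg GT) \<Longrightarrow> r f = 0 \<longleftrightarrow> f \<in> Rideal GT (T_rels B lam nu)"
    show thesis by (rule that[OF m])
  qed
  interpret comparison \<rho> \<kappa> N B t n lam nu \<rho>T \<kappa>T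
  proof (intro comparison.intro klr_seq.intro klr.intro klr_axioms.intro klr_seq_axioms.intro
      webster.intro gens_hom.intro webster_axioms.intro comparison_axioms.intro R(1) T(1))
    show "t i j = (if \<exists>k\<in>{1..N}. i = Bar k \<and> j = Orig k then - 1 else 1)"
      if "i \<in> ext_index N" "j \<in> ext_index N" for i j by (rule scalars[OF that])
    show "\<rho> r = 0" if "r \<in> klr_rels (ext_index N) (ext_form B) t n" for r
      using R(2)[OF subsetD[OF c(1) that]] subsetD[OF Rideal_closed(8)[OF c(1)] that] by blast
    show "\<rho>T r = 0" if "r \<in> T_rels B lam nu" for r
      using T(2)[OF subsetD[OF c(2) that]] subsetD[OF Rideal_closed(8)[OF c(2)] that] by blast
  qed (fact cartan n_def nu nondegenerate R(2)[unfolded GR_def] T(2)[unfolded GT_def])+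
  show ?thesis by (rule isomorphic)
qed

end
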